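(* Let $k$ be a field, $B$ a finite-dimensional Hopf algebra over $k$ whose antipode satisfies $S=S^{-1}$, and $H$ a braided Hopf algebra in the Yetter–Drinfeld category $({}^B_B\mathcal{YD},C)$ with $C_{H,H}=C_{H,H}^{-1}$. Then $$H^{*rat}\cong\int^l_{H^*}\otimes H\qquad\text{as }H\text{-Hopf modules in }({}^B_B\mathcal{YD},C),$$ where $H^{*rat}$ is the maximal rational $H^*$-submodule (in ${}^B_B\mathcal{YD}$) of the regular left $H^*$-module $H^*$.
   Context: An object of ${}^B_B\mathcal{YD}$ is a left $B$-module and left $B$-comodule $M$, with coaction $m\mapsto\sum m_{(-1)}\otimes m_{(0)}$, such that $\sum(b\cdot m)_{(-1)}\otimes(b\cdot m)_{(0)}=\sum b_1m_{(-1)}S(b_3)\otimes b_2\cdot m_{(0)}$; the braiding is $C(u\otimes v)=\sum u_{(-1)}\cdot v\otimes u_{(0)}$. A braided Hopf algebra is a Hopf algebra object $(H,m,\eta,\Delta,\epsilon,S)$ in this braided category. An object's name also denotes its identity morphism. For $M\in{}^B_B\mathcal{YD}$ the full dual $M^*=\mathrm{Hom}_k(M,k)$ is an object of ${}^B_B\mathcal{YD}$ via $(b\cdot x^* )(x)=x^*(S(b)\cdot x)$ and the coaction determined by $\sum x^*_{(-1)}\langle x^*_{(0)},x\rangle=\sum S^{-1}(x_{(-1)})\langle x^*,x_{(0)}\rangle$; $\langle\,,\rangle$ is evaluation. $H^*$ is an algebra with unit $\epsilon$ and product $m_{H^*}$ determined by $\langle\,,\rangle(m_{H^*}\otimes H)=(\langle\,,\rangle\otimes\langle\,,\rangle)(H^*\otimes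 C_{H^*,H}\otimes H)(H^*\otimes H^*\otimes\Delta)$. The map $\rightharpoonup:H\otimes H^*\to H^*$ is determined by $\langle\,,\rangle(\rightharpoonup\otimes H)=\langle\,,\rangle(H^*\otimes m)(H^*\otimes C_{H,H})(C_{H,H^*}\otimes H)$. A left $H^*$-module $(M,\alpha)$ in ${}^B_B\mathcal{YD}$ is rational if there is a morphism $\rho:M\to M\otimes H$ in ${}^B_B\mathcal{YD}$ with $(M\otimes\langle\,,\rangle)(C_{H^*,M}\otimes H)(H^*\otimes\rho)=\alpha$. $\int^l_{H^*}=\{f\in H^*\mid gf=g(1)f\text{ for all }g\in H^*\}$ (product of $H^*$). A (right) $H$-Hopf module is an object $M$ with a right $H$-module structure $\alpha:M\otimes H\to M$ and a right $H$-comodule structure $\rho:M\to M\otimes H$ in the category such that $\rho\,\alpha=(\alpha\otimes m)(M\otimes C_{H,H}\otimes H)(\rho\otimes\Delta)$. On $H^{*rat}$ the action is $\leftharpoondown\;=\;\rightharpoonup(S\otimes H^{*rat})\,C_{H^{*rat},H}$ and the coaction is the $\rho$ from rationality; on $V\otimes H$ the structures are $V\otimes m$ and $V\otimes\Delta$. *)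

theory Defs
  imports HOL.Vector_Spaces "HOL-Library.Function_Algebras"
begin

section \<open>Vector spaces and their tensor products\<close>

text \<open>
  The field is a type \<open>'k :: field\<close>.  A vector space is a subspace \<open>carrier V\<close> of an ambient
  vector space, which is a whole type together with the scalar multiplication \<open>scale V\<close>.
\<close>

record ('k, 'a) vspace =
  carrier :: "'a set"
  scale :: "'k \<Rightarrow> 'a \<Rightarrow> 'a"

definition is_space :: "('k::field, 'a::ab_group_add, 'z) vspace_scheme \<Rightarrow> bool" where
  "is_space V \<longleftrightarrow> vector_space (scale V) \<and> module.subspace (scale V) (carrier V)"

definition linear_on ::
  "('k::field, 'a::ab_group_add, 'y) vspace_scheme \<Rightarrow> ('k, 'c::ab_group_add, 'z) vspace_scheme
    \<Rightarrow> ('a \<Rightarrow> 'c) \<Rightarrow> bool" where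
  "linear_on V W f \<longleftrightarrow>
     (\<forall>x\<in>carrier V. f x \<in> carrier W) \<and>
     (\<forall>x\<in>carrier V. \<forall>y\<in>carrier V. f (x + y) = f x + f y) \<and>
     (\<forall>c. \<forall>x\<in>carrier V. f (scale V c x) = scale W c (f x))"

definition bilinear_on ::
  "('k::field, 'a::ab_group_add, 'x) vspace_scheme \<Rightarrow> ('k, 'c::ab_group_add, 'y) vspace_scheme
    \<Rightarrow> ('k, 'd::ab_group_add, 'z) vspace_scheme \<Rightarrow> ('a \<Rightarrow> 'c \<Rightarrow> 'd) \<Rightarrow> bool" where
  "bilinear_on V W U \<beta> \<longleftrightarrow>
     (\<forall>x\<in>carrier V. linear_on W U (\<beta> x)) \<and> (\<forall>y\<in>carrier W. linear_on V U (\<lambda>x. \<beta> x y))"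

definition ground :: "('k::field, 'k) vspace" where
  "ground = \<lparr>carrier = UNIV, scale = (*)\<rparr>"

definition fscale :: "'k::field \<Rightarrow> ('x \<Rightarrow> 'k) \<Rightarrow> 'x \<Rightarrow> 'k" where
  "fscale c f = (\<lambda>x. c * f x)"

text \<open>
  The tensor product.  In the free vector space on pairs, two formal sums are identified modulo the
  bilinearity relations iff every bilinear form takes the same value on them (we are over a field).
  So the class of a formal sum is represented by its evaluation functional on bilinear forms.
  The forms are those of the ambient spaces, so that the tensor product of subspaces is a subset of
  the tensor product of the ambient spaces.  The lemmas \<open>bilinear_on_tens\<close>,
  \<open>tensor_lift_tens\<close>, \<open>linear_on_tensor_lift\<close> and \<open>tensor_lift_unique\<close> below are the universal
  property.
\<close>

type_synonym ('a, 'c, 'k) tensor = "('a \<Rightarrow> 'c \<Rightarrow> 'k) \<Rightarrow> 'k"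

definition bilinear_form ::
  "('k::field \<Rightarrow> 'a::ab_group_add \<Rightarrow> 'a) \<Rightarrow> ('k \<Rightarrow> 'c::ab_group_add \<Rightarrow> 'c) \<Rightarrow> ('a \<Rightarrow> 'c \<Rightarrow> 'k) \<Rightarrow> bool"
  where
  "bilinear_form s t \<beta> \<longleftrightarrow>
     (\<forall>x. Vector_Spaces.linear t (*) (\<beta> x)) \<and> (\<forall>y. Vector_Spaces.linear s (*) (\<lambda>x. \<beta> x y))"

definition tens ::
  "('k::field, 'a::ab_group_add, 'y) vspace_scheme \<Rightarrow> ('k, 'c::ab_group_add, 'z) vspace_scheme
    \<Rightarrow> 'a \<Rightarrow> 'c \<Rightarrow> ('a, 'c, 'k) tensor" where
  "tens V W x y = (\<lambda>\<beta>. if bilinear_form (scale V) (scale W) \<beta> then \<beta> x y else 0)"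

definition tensor_space ::
  "('k::field, 'a::ab_group_add, 'y) vspace_scheme \<Rightarrow> ('k, 'c::ab_group_add, 'z) vspace_scheme
    \<Rightarrow> ('k, ('a, 'c, 'k) tensor) vspace" where
  "tensor_space V W =
     \<lparr>carrier = module.span fscale {tens V W x y | x y. x \<in> carrier V \<and> y \<in> carrier W},
      scale = fscale\<rparr>"

text \<open>
  The linear map on \<open>V \<otimes> W\<close> induced by a bilinear map \<open>\<beta>\<close>, in the style of Sweedler's notation:
  \<open>tensor_lift V W (\<lambda>x y. \<beta> x y) t\<close> is \<open>\<Sum> \<beta> x y\<close> over any expression \<open>t = \<Sum> x \<otimes> y\<close> with
  \<open>x \<in> V\<close> and \<open>y \<in> W\<close>.
\<close>

definition tensor_lift ::
  "('k::field, 'a::ab_group_add, 'y) vspace_scheme \<Rightarrow> ('k, 'c::ab_group_add, 'z) vspace_scheme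
    \<Rightarrow> ('a \<Rightarrow> 'c \<Rightarrow> 'd::ab_group_add) \<Rightarrow> ('a, 'c, 'k) tensor \<Rightarrow> 'd" where
  "tensor_lift V W \<beta> t =
     (\<Sum>(x, y) \<leftarrow> (SOME xs. set xs \<subseteq> carrier V \<times> carrier W \<and> t = (\<Sum>(x, y) \<leftarrow> xs. tens V W x y)).
        \<beta> x y)"


subsection \<open>The universal property\<close>

lemma vector_space_fscale: "vector_space (fscale :: 'k::field \<Rightarrow> ('x \<Rightarrow> 'k) \<Rightarrow> _)"
  by unfold_locales (auto simp: fscale_def algebra_simps)

lemma vector_space_times: "vector_space ((*) :: 'k::field \<Rightarrow> 'k \<Rightarrow> 'k)"
  by unfold_locales (auto simp: algebra_simps)

lemma is_space_tensor_space:
  fixes V :: "('k::field, 'a::ab_group_add, 'x) vspace_scheme"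
    and W :: "('k, 'c::ab_group_add, 'y) vspace_scheme"
  shows "is_space (tensor_space V W)"
proof -
  interpret F: vector_space "fscale :: 'k \<Rightarrow> (('a \<Rightarrow> 'c \<Rightarrow> 'k) \<Rightarrow> 'k) \<Rightarrow> _" by (rule vector_space_fscale)
  show ?thesis unfolding is_space_def tensor_space_def
    using F.subspace_span F.vector_space_axioms by auto
qed

lemma bilinear_formD:
  assumes "bilinear_form s t \<beta>"
  shows "\<beta> (x + x') y = \<beta> x y + \<beta> x' y" "\<beta> x (y + y') = \<beta> x y + \<beta> x y'"
    "\<beta> (s c x) y = c * \<beta> x y" "\<beta> x (t c y) = c * \<beta> x y"
  using assms by (simp_all add: bilinear_form_def linear_iff)

lemma tens_in:
  fixes V :: "('k::field, 'a::ab_group_add, 'x) vspace_scheme"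
    and W :: "('k, 'c::ab_group_add, 'y) vspace_scheme"
  assumes "x \<in> carrier V" "y \<in> carrier W"
  shows "tens V W x y \<in> carrier (tensor_space V W)"
proof -
  interpret F: vector_space "fscale :: 'k \<Rightarrow> (('a \<Rightarrow> 'c \<Rightarrow> 'k) \<Rightarrow> 'k) \<Rightarrow> _" by (rule vector_space_fscale)
  show ?thesis using assms unfolding tensor_space_def by (auto intro: F.span_base)
qed

lemma tens_add_left: "tens V W (x + x') y = tens V W x y + tens V W x' y"
  and tens_add_right: "tens V W x (y + y') = tens V W x y + tens V W x y'"
  and tens_scale_left: "tens V W (scale V c x) y = fscale c (tens V W x y)"
  and tens_scale_right: "tens V W x (scale W c y) = fscale c (tens V W x y)"
  by (auto simp: tens_def fscale_def fun_eq_iff bilinear_formD)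

lemma bilinear_on_tens: "bilinear_on V W (tensor_space V W) (tens V W)"
  by (auto simp: bilinear_on_def linear_on_def tens_in tens_add_left tens_add_right
      tens_scale_left tens_scale_right) (simp_all add: tensor_space_def)

lemma tensor_rep:
  fixes V :: "('k::field, 'a::ab_group_add, 'x) vspace_scheme"
    and W :: "('k, 'c::ab_group_add, 'y) vspace_scheme"
  assumes V: "is_space V" and t: "t \<in> carrier (tensor_space V W)"
  shows "\<exists>xs. set xs \<subseteq> carrier V \<times> carrier W \<and> t = (\<Sum>(x, y) \<leftarrow> xs. tens V W x y)"
proof -
  interpret F: vector_space "fscale :: 'k \<Rightarrow> (('a \<Rightarrow> 'c \<Rightarrow> 'k) \<Rightarrow> 'k) \<Rightarrow> _" by (rule vector_space_fscale)
  interpret V: vector_space "scale V" using V by (simp add: is_space_def)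
  have sV: "V.subspace (carrier V)" using V by (simp add: is_space_def)
  have "t \<in> F.span {tens V W x y | x y. x \<in> carrier V \<and> y \<in> carrier W}"
    using t by (simp add: tensor_space_def)
  then show ?thesis
  proof (induction rule: F.span_induct_alt)
    case base
    show ?case by (rule exI[of _ "[]"]) simp
  next
    case (step c u t)
    then obtain x y xs where u: "u = tens V W x y" "x \<in> carrier V" "y \<in> carrier W"
      and xs: "set xs \<subseteq> carrier V \<times> carrier W" "t = (\<Sum>(x, y) \<leftarrow> xs. tens V W x y)" by auto
    show ?case
      by (rule exI[of _ "(scale V c x, y) # xs"])
        (use u xs V.subspace_scale[OF sV] in \<open>auto simp: tens_scale_left\<close>)
  qed
qed

lemma sum_list_zero_of_tens_zero:
  fixes V :: "('k::field, 'a::ab_group_add, 'x) vspace_scheme"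
    and W :: "('k, 'c::ab_group_add, 'y) vspace_scheme"
    and U :: "('k, 'd::ab_group_add, 'z) vspace_scheme"
  assumes V: "is_space V" and W: "is_space W" and U: "is_space U" and \<beta>: "bilinear_on V W U \<beta>"
    and xs: "set xs \<subseteq> carrier V \<times> carrier W" and 0: "(\<Sum>(x, y) \<leftarrow> xs. tens V W x y) = 0"
  shows "(\<Sum>(x, y) \<leftarrow> xs. \<beta> x y) = 0"
proof (rule ccontr)
  let ?u = "\<Sum>(x, y) \<leftarrow> xs. \<beta> x y"
  assume u: "?u \<noteq> 0"
  have vV: "vector_space (scale V)" and vW: "vector_space (scale W)" and vU: "vector_space (scale U)"
    and sV: "module.subspace (scale V) (carrier V)" and sW: "module.subspace (scale W) (carrier W)"
    using V W U by (auto simp: is_space_def)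
  note vk = vector_space_times[where 'k='k]
  interpret V: vector_space "scale V" by (rule vV)
  interpret W: vector_space "scale W" by (rule vW)
  interpret U: vector_space "scale U" by (rule vU)
  interpret VV: vector_space_pair "scale V" "scale V" by (intro vector_space_pair.intro vV)
  interpret WW: vector_space_pair "scale W" "scale W" by (intro vector_space_pair.intro vW)
  interpret Uk: vector_space_pair "scale U" "(*) :: 'k \<Rightarrow> 'k \<Rightarrow> 'k"
    by (intro vector_space_pair.intro vU vk)
  obtain p where p: "range p \<subseteq> carrier V" "Vector_Spaces.linear (scale V) (scale V) p"
      "\<And>x. x \<in> carrier V \<Longrightarrow> p x = x"
    using VV.linear_exists_left_inverse_on[OF V.linear_ident sV] by auto
  obtain q where q: "range q \<subseteq> carrier W" "Vector_Spaces.linear (scale W) (scale W) q"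
      "\<And>x. x \<in> carrier W \<Longrightarrow> q x = x"
    using WW.linear_exists_left_inverse_on[OF W.linear_ident sW] by auto
  have "U.independent {?u}" using u by simp
  then obtain \<phi> where \<phi>: "Vector_Spaces.linear (scale U) (*) \<phi>" "\<phi> ?u = 1"
    using Uk.linear_independent_extend[of "{?u}" "\<lambda>_. 1"] by auto
  note pl = VV.linear_add[OF p(2)] VV.linear_scale[OF p(2)]
  note ql = WW.linear_add[OF q(2)] WW.linear_scale[OF q(2)]
  note fl = Uk.linear_add[OF \<phi>(1)] Uk.linear_scale[OF \<phi>(1)] Uk.linear_0[OF \<phi>(1)]
  let ?\<gamma> = "\<lambda>x y. \<phi> (\<beta> (p x) (q y))"
  have pin: "p x \<in> carrier V" and qin: "q y \<in> carrier W" for x y using p q by auto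
  have \<gamma>: "bilinear_form (scale V) (scale W) ?\<gamma>"
    using \<beta> unfolding bilinear_form_def bilinear_on_def linear_on_def
    by (auto simp: linear_iff vV vW vk pl ql fl pin qin)
  have "(\<Sum>(x, y) \<leftarrow> ys. tens V W x y) ?\<gamma> = \<phi> (\<Sum>(x, y) \<leftarrow> ys. \<beta> x y)"
    if "set ys \<subseteq> carrier V \<times> carrier W" for ys
    using that by (induction ys) (auto simp: fl p q tens_def \<gamma>)
  from this[OF xs] 0 \<phi> show False by simp
qed

lemma tensor_lift_sum_list:
  fixes V :: "('k::field, 'a::ab_group_add, 'x) vspace_scheme"
    and W :: "('k, 'c::ab_group_add, 'y) vspace_scheme"
    and U :: "('k, 'd::ab_group_add, 'z) vspace_scheme"
  assumes "is_space V" "is_space W" "is_space U" "bilinear_on V W U \<beta>"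
    and xs: "set xs \<subseteq> carrier V \<times> carrier W"
  shows "tensor_lift V W \<beta> (\<Sum>(x, y) \<leftarrow> xs. tens V W x y) = (\<Sum>(x, y) \<leftarrow> xs. \<beta> x y)"
proof -
  interpret V: vector_space "scale V" using assms by (simp add: is_space_def)
  have sV: "V.subspace (carrier V)" using assms by (simp add: is_space_def)
  let ?P = "\<lambda>ys. set ys \<subseteq> carrier V \<times> carrier W \<and>
    (\<Sum>(x, y) \<leftarrow> xs. tens V W x y) = (\<Sum>(x, y) \<leftarrow> ys. tens V W x y)"
  define ys where "ys = (SOME ys. ?P ys)"
  have "?P ys" unfolding ys_def by (rule someI[of ?P xs]) (use xs in auto)
  then have ys: "set ys \<subseteq> carrier V \<times> carrier W"
    "(\<Sum>(x, y) \<leftarrow> xs. tens V W x y) = (\<Sum>(x, y) \<leftarrow> ys. tens V W x y)" by auto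
  define zs where "zs = map (\<lambda>(x, y). (scale V (-1) x, y)) ys"
  have zs: "set zs \<subseteq> carrier V \<times> carrier W"
    using ys(1) V.subspace_neg[OF sV] unfolding zs_def by auto
  have 1: "(\<Sum>(x, y) \<leftarrow> zs. tens V W x y) = - (\<Sum>(x, y) \<leftarrow> ys. tens V W x y)"
    unfolding zs_def
  proof (induction ys)
    case (Cons a ys)
    then show ?case
      by (cases a) (auto simp only: list.map sum_list.Cons prod.case tens_scale_left,
          auto simp: fscale_def fun_eq_iff)
  qed simp
  have \<beta>1: "\<beta> (scale V (-1) x) y = - \<beta> x y" if "x \<in> carrier V" "y \<in> carrier W" for x y
  proof -
    interpret U: vector_space "scale U" using assms by (simp add: is_space_def)
    have "\<beta> (scale V (-1) x) y = scale U (-1) (\<beta> x y)"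
      using assms(4) that unfolding bilinear_on_def linear_on_def by blast
    then show ?thesis by simp
  qed
  have 2: "(\<Sum>(x, y) \<leftarrow> zs. \<beta> x y) = - (\<Sum>(x, y) \<leftarrow> ys. \<beta> x y)"
    unfolding zs_def using ys(1)
  proof (induction ys)
    case (Cons a ys)
    then show ?case by (cases a) (auto simp del: V.scale_minus_left simp: \<beta>1)
  qed simp
  have "(\<Sum>(x, y) \<leftarrow> xs @ zs. \<beta> x y) = 0"
    by (rule sum_list_zero_of_tens_zero[OF assms(1-4)]) (use xs zs ys 1 in auto)
  then have "(\<Sum>(x, y) \<leftarrow> xs. \<beta> x y) = (\<Sum>(x, y) \<leftarrow> ys. \<beta> x y)" using 2 by simp
  then show ?thesis unfolding tensor_lift_def ys_def by simp
qed

lemma tensor_lift_tens: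
  assumes "is_space V" "is_space W" "is_space U" "bilinear_on V W U \<beta>"
    and "x \<in> carrier V" "y \<in> carrier W"
  shows "tensor_lift V W \<beta> (tens V W x y) = \<beta> x y"
  using tensor_lift_sum_list[OF assms(1-4), of "[(x, y)]"] assms(5-6) by simp

lemma linear_on_tensor_lift:
  fixes V :: "('k::field, 'a::ab_group_add, 'x) vspace_scheme"
    and W :: "('k, 'c::ab_group_add, 'y) vspace_scheme"
    and U :: "('k, 'd::ab_group_add, 'z) vspace_scheme"
  assumes "is_space V" "is_space W" "is_space U" "bilinear_on V W U \<beta>"
  shows "linear_on (tensor_space V W) U (tensor_lift V W \<beta>)"
proof -
  interpret V: vector_space "scale V" using assms by (simp add: is_space_def)
  interpret U: vector_space "scale U" using assms by (simp add: is_space_def)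
  have sV: "V.subspace (carrier V)" and sU: "U.subspace (carrier U)"
    using assms by (simp_all add: is_space_def)
  note L = tensor_lift_sum_list[OF assms]
  have B: "\<beta> x y \<in> carrier U" "\<beta> (scale V c x) y = scale U c (\<beta> x y)"
    if "x \<in> carrier V" "y \<in> carrier W" for x y c
    using assms(4) that unfolding bilinear_on_def linear_on_def by blast+
  show ?thesis unfolding linear_on_def
  proof (intro conjI ballI allI)
    fix t assume t: "t \<in> carrier (tensor_space V W)"
    then obtain xs where xs: "set xs \<subseteq> carrier V \<times> carrier W" "t = (\<Sum>(x, y) \<leftarrow> xs. tens V W x y)"
      using tensor_rep[OF assms(1)] by blast
    have "(\<Sum>(x, y) \<leftarrow> xs. \<beta> x y) \<in> carrier U" using xs(1)
      by (induction xs) (auto simp: B U.subspace_0[OF sU] U.subspace_add[OF sU])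
    then show "tensor_lift V W \<beta> t \<in> carrier U" using L xs by simp
    { fix s assume "s \<in> carrier (tensor_space V W)"
      then obtain ys where ys: "set ys \<subseteq> carrier V \<times> carrier W"
          "s = (\<Sum>(x, y) \<leftarrow> ys. tens V W x y)"
        using tensor_rep[OF assms(1)] by blast
      show "tensor_lift V W \<beta> (t + s) = tensor_lift V W \<beta> t + tensor_lift V W \<beta> s"
        using L[of "xs @ ys"] L[of xs] L[of ys] xs ys by simp }
    fix c
    let ?zs = "map (\<lambda>(x, y). (scale V c x, y)) xs"
    have z: "set ?zs \<subseteq> carrier V \<times> carrier W"
      using xs(1) V.subspace_scale[OF sV] by auto
    have "fscale c t = (\<Sum>(x, y) \<leftarrow> ?zs. tens V W x y)" unfolding xs(2)
    proof (induction xs)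
      case (Cons a xs)
      then show ?case
        by (cases a) (simp add: tens_scale_left, simp add: fscale_def fun_eq_iff distrib_left)
    qed (auto simp: fscale_def fun_eq_iff)
    moreover have "(\<Sum>(x, y) \<leftarrow> ?zs. \<beta> x y) = scale U c (\<Sum>(x, y) \<leftarrow> xs. \<beta> x y)" using xs(1)
      by (induction xs) (auto simp: B U.scale_right_distrib)
    ultimately show "tensor_lift V W \<beta> (scale (tensor_space V W) c t) = scale U c (tensor_lift V W \<beta> t)"
      using L[OF z] L[OF xs(1)] xs(2) by (simp add: tensor_space_def)
  qed
qed

lemma tensor_lift_unique:
  fixes V :: "('k::field, 'a::ab_group_add, 'x) vspace_scheme"
    and W :: "('k, 'c::ab_group_add, 'y) vspace_scheme"
    and U :: "('k, 'd::ab_group_add, 'z) vspace_scheme"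
  assumes "is_space V" "is_space W" "is_space U" "bilinear_on V W U \<beta>"
    and f: "linear_on (tensor_space V W) U f"
      "\<And>x y. x \<in> carrier V \<Longrightarrow> y \<in> carrier W \<Longrightarrow> f (tens V W x y) = \<beta> x y"
    and t: "t \<in> carrier (tensor_space V W)"
  shows "f t = tensor_lift V W \<beta> t"
proof -
  interpret F: vector_space "fscale :: 'k \<Rightarrow> (('a \<Rightarrow> 'c \<Rightarrow> 'k) \<Rightarrow> 'k) \<Rightarrow> _" by (rule vector_space_fscale)
  interpret U: vector_space "scale U" using assms by (simp add: is_space_def)
  note T = is_space_tensor_space[of V W, unfolded is_space_def]
  obtain xs where xs: "set xs \<subseteq> carrier V \<times> carrier W" "t = (\<Sum>(x, y) \<leftarrow> xs. tens V W x y)"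
    using tensor_rep[OF assms(1) t] by blast
  have sub: "F.subspace (carrier (tensor_space V W))" using T by (simp add: tensor_space_def)
  have 0: "0 \<in> carrier (tensor_space V W)" using F.subspace_0[OF sub] .
  have add: "f (x + y) = f x + f y"
    if "x \<in> carrier (tensor_space V W)" "y \<in> carrier (tensor_space V W)" for x y
    using f(1) that by (auto simp: linear_on_def)
  have f0: "f 0 = 0" using add[OF 0 0] by simp
  have "(\<Sum>(x, y) \<leftarrow> xs. tens V W x y) \<in> carrier (tensor_space V W) \<and>
      f (\<Sum>(x, y) \<leftarrow> xs. tens V W x y) = (\<Sum>(x, y) \<leftarrow> xs. \<beta> x y)" using xs(1)
    by (induction xs) (auto simp: 0 f0 f add tens_in F.subspace_add[OF sub])
  then show ?thesis using tensor_lift_sum_list[OF assms(1-4) xs(1)] xs(2) by simp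
qed


section \<open>Hopf algebras over a field\<close>

text \<open>
  Multiplication and unit are those of the type class \<open>ring_1\<close>; its axiom \<open>0 \<noteq> 1\<close> is no
  restriction, because the counit maps \<open>1\<close> to \<open>1\<close>.
\<close>

record ('k, 'b) hopf = "('k, 'b) vspace" +
  comult :: "'b \<Rightarrow> ('b, 'b, 'k) tensor"
  counit :: "'b \<Rightarrow> 'k"
  antipode :: "'b \<Rightarrow> 'b"

definition coassociative_counital ::
  "('k::field, 'b::ab_group_add, 'z) vspace_scheme \<Rightarrow> ('b \<Rightarrow> ('b, 'b, 'k) tensor) \<Rightarrow> ('b \<Rightarrow> 'k)
    \<Rightarrow> bool" where
  "coassociative_counital V \<Delta> \<epsilon> \<longleftrightarrow>
     (\<forall>x\<in>carrier V.
        tensor_lift V V (\<lambda>x1 x2.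
            tensor_lift V V (\<lambda>y1 y2. tens V (tensor_space V V) y1 (tens V V y2 x2)) (\<Delta> x1)) (\<Delta> x)
          = tensor_lift V V (\<lambda>x1 x2. tens V (tensor_space V V) x1 (\<Delta> x2)) (\<Delta> x) \<and>
        tensor_lift V V (\<lambda>x1 x2. scale V (\<epsilon> x1) x2) (\<Delta> x) = x \<and>
        tensor_lift V V (\<lambda>x1 x2. scale V (\<epsilon> x2) x1) (\<Delta> x) = x)"

definition hopf_algebra :: "('k::field, 'b::ring_1, 'z) hopf_scheme \<Rightarrow> bool" where
  "hopf_algebra B \<longleftrightarrow>
     is_space B \<and> carrier B = UNIV \<and>
     bilinear_on B B B (*) \<and>
     linear_on B (tensor_space B B) (comult B) \<and>
     linear_on B ground (counit B) \<and>
     coassociative_counital B (comult B) (counit B) \<and>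
     (\<forall>x y. comult B (x * y) =
        tensor_lift B B (\<lambda>x1 x2.
          tensor_lift B B (\<lambda>y1 y2. tens B B (x1 * y1) (x2 * y2)) (comult B y)) (comult B x)) \<and>
     comult B 1 = tens B B 1 1 \<and>
     (\<forall>x y. counit B (x * y) = counit B x * counit B y) \<and>
     counit B 1 = 1 \<and>
     linear_on B B (antipode B) \<and>
     (\<forall>x. tensor_lift B B (\<lambda>x1 x2. antipode B x1 * x2) (comult B x) = scale B (counit B x) 1 \<and>
          tensor_lift B B (\<lambda>x1 x2. x1 * antipode B x2) (comult B x) = scale B (counit B x) 1)"


section \<open>Yetter--Drinfeld modules\<close>

record ('k, 'b, 'a) ydm = "('k, 'a) vspace" +
  act :: "'b \<Rightarrow> 'a \<Rightarrow> 'a"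
  coact :: "'a \<Rightarrow> ('b, 'a, 'k) tensor"

definition yd_module ::
  "('k::field, 'b::ring_1, 'y) hopf_scheme \<Rightarrow> ('k, 'b, 'a::ab_group_add, 'z) ydm_scheme \<Rightarrow> bool" where
  "yd_module B M \<longleftrightarrow>
     is_space M \<and>
     bilinear_on B M M (act M) \<and>
     (\<forall>m\<in>carrier M. act M 1 m = m) \<and>
     (\<forall>b c. \<forall>m\<in>carrier M. act M (b * c) m = act M b (act M c m)) \<and>
     linear_on M (tensor_space B M) (coact M) \<and>
     (\<forall>m\<in>carrier M.
        tensor_lift B M (\<lambda>b m0.
            tensor_lift B B (\<lambda>b1 b2. tens B (tensor_space B M) b1 (tens B M b2 m0)) (comult B b))
          (coact M m)
          = tensor_lift B M (\<lambda>b m0. tens B (tensor_space B M) b (coact M m0)) (coact M m)) \<and>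
     (\<forall>m\<in>carrier M. tensor_lift B M (\<lambda>b m0. scale M (counit B b) m0) (coact M m) = m) \<and>
     (\<forall>b. \<forall>m\<in>carrier M. coact M (act M b m) =
        tensor_lift B B (\<lambda>b1 b'.
          tensor_lift B B (\<lambda>b2 b3.
            tensor_lift B M (\<lambda>c m0. tens B M (b1 * c * antipode B b3) (act M b2 m0)) (coact M m))
          (comult B b')) (comult B b))"

definition yd_hom ::
  "('k::field, 'b::ring_1, 'x) hopf_scheme \<Rightarrow> ('k, 'b, 'a::ab_group_add, 'y) ydm_scheme
    \<Rightarrow> ('k, 'b, 'c::ab_group_add, 'z) ydm_scheme \<Rightarrow> ('a \<Rightarrow> 'c) \<Rightarrow> bool" where
  "yd_hom B M N f \<longleftrightarrow>
     linear_on M N f \<and>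
     (\<forall>b. \<forall>m\<in>carrier M. f (act M b m) = act N b (f m)) \<and>
     (\<forall>m\<in>carrier M. coact N (f m) = tensor_lift B M (\<lambda>b m0. tens B N b (f m0)) (coact M m))"

definition yd_unit :: "('k::field, 'b::ring_1, 'z) hopf_scheme \<Rightarrow> ('k, 'b, 'k) ydm" where
  "yd_unit B =
     \<lparr>carrier = UNIV, scale = (*), act = (\<lambda>b c. counit B b * c), coact = (\<lambda>c. tens B ground 1 c)\<rparr>"

definition yd_tensor ::
  "('k::field, 'b::ring_1, 'x) hopf_scheme \<Rightarrow> ('k, 'b, 'a::ab_group_add, 'y) ydm_scheme
    \<Rightarrow> ('k, 'b, 'c::ab_group_add, 'z) ydm_scheme \<Rightarrow> ('k, 'b, ('a, 'c, 'k) tensor) ydm" where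
  "yd_tensor B M N =
     \<lparr>carrier = carrier (tensor_space M N),
      scale = scale (tensor_space M N),
      act = (\<lambda>b. tensor_lift M N (\<lambda>m n.
               tensor_lift B B (\<lambda>b1 b2. tens M N (act M b1 m) (act N b2 n)) (comult B b))),
      coact = tensor_lift M N (\<lambda>m n.
               tensor_lift B M (\<lambda>b m0.
                 tensor_lift B N (\<lambda>c n0. tens B (tensor_space M N) (b * c) (tens M N m0 n0))
                 (coact N n)) (coact M m))\<rparr>"

definition braid ::
  "('k::field, 'b::ring_1, 'x) hopf_scheme \<Rightarrow> ('k, 'b, 'a::ab_group_add, 'y) ydm_scheme
    \<Rightarrow> ('k, 'b, 'c::ab_group_add, 'z) ydm_scheme \<Rightarrow> ('a, 'c, 'k) tensor \<Rightarrow> ('c, 'a, 'k) tensor"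
  where
  "braid B M N =
     tensor_lift M N (\<lambda>m n. tensor_lift B M (\<lambda>b m0. tens N M (act N b n) m0) (coact M m))"

definition sub_object :: "('k, 'b, 'a, 'z) ydm_scheme \<Rightarrow> 'a set \<Rightarrow> ('k, 'b, 'a, 'z) ydm_scheme" where
  "sub_object M N = M\<lparr>carrier := N\<rparr>"


section \<open>Braided Hopf algebras\<close>

text \<open>The fields prefixed with \<open>b\<close> belong to \<open>H\<close>, those of \<^type>\<open>hopf\<close> to \<open>B\<close>.\<close>

record ('k, 'b, 'h) braided_hopf = "('k, 'b, 'h) ydm" +
  bcomult :: "'h \<Rightarrow> ('h, 'h, 'k) tensor"
  bcounit :: "'h \<Rightarrow> 'k"
  bantipode :: "'h \<Rightarrow> 'h"

definition braided_hopf_algebra ::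
  "('k::field, 'b::ring_1, 'y) hopf_scheme \<Rightarrow> ('k, 'b, 'h::ring_1, 'z) braided_hopf_scheme \<Rightarrow> bool"
  where
  "braided_hopf_algebra B H \<longleftrightarrow>
     yd_module B H \<and> carrier H = UNIV \<and>
     bilinear_on H H H (*) \<and>
     yd_hom B (yd_tensor B H H) H (tensor_lift H H (*)) \<and>
     yd_hom B (yd_unit B) H (\<lambda>c. scale H c 1) \<and>
     yd_hom B H (yd_tensor B H H) (bcomult H) \<and>
     yd_hom B H (yd_unit B) (bcounit H) \<and>
     coassociative_counital H (bcomult H) (bcounit H) \<and>
     (\<forall>x y. bcomult H (x * y) =
        tensor_lift H H (\<lambda>x1 x2.
          tensor_lift H H (\<lambda>y1 y2.
            tensor_lift H H (\<lambda>u v. tens H H (x1 * u) (v * y2)) (braid B H H (tens H H x2 y1)))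
          (bcomult H y)) (bcomult H x)) \<and>
     bcomult H 1 = tens H H 1 1 \<and>
     (\<forall>x y. bcounit H (x * y) = bcounit H x * bcounit H y) \<and>
     bcounit H 1 = 1 \<and>
     yd_hom B H H (bantipode H) \<and>
     (\<forall>x. tensor_lift H H (\<lambda>x1 x2. bantipode H x1 * x2) (bcomult H x) = scale H (bcounit H x) 1 \<and>
          tensor_lift H H (\<lambda>x1 x2. x1 * bantipode H x2) (bcomult H x) = scale H (bcounit H x) 1)"


section \<open>The dual\<close>

text \<open>
  \<open>dual B H\<close> is meant for \<open>H\<close> with \<open>carrier H = UNIV\<close>.  The sum and the zero of \<open>'h \<Rightarrow> 'k\<close> are
  pointwise; the (also pointwise) product of that type is never used: \<open>dual_mult\<close> is the product
  of \<open>H*\<close>, whose unit is \<open>bcounit H\<close>.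
\<close>

definition dual_carrier :: "('k::field, 'h::ab_group_add, 'z) vspace_scheme \<Rightarrow> ('h \<Rightarrow> 'k) set" where
  "dual_carrier H = {f. Vector_Spaces.linear (scale H) (*) f}"

definition dual_space :: "('k::field, 'h::ab_group_add, 'z) vspace_scheme \<Rightarrow> ('k, 'h \<Rightarrow> 'k) vspace"
  where
  "dual_space H = \<lparr>carrier = dual_carrier H, scale = fscale\<rparr>"

definition dual_coact ::
  "('k::field, 'b::ring_1, 'y) hopf_scheme \<Rightarrow> ('k, 'b, 'h::ab_group_add, 'z) ydm_scheme
    \<Rightarrow> ('h \<Rightarrow> 'k) \<Rightarrow> ('b, 'h \<Rightarrow> 'k, 'k) tensor" where
  "dual_coact B H f =
     (THE t. t \<in> carrier (tensor_space B (dual_space H)) \<and>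
        (\<forall>x. tensor_lift B (dual_space H) (\<lambda>b g. scale B (g x) b) t
           = tensor_lift B H (\<lambda>b x0. scale B (f x0) (inv (antipode B) b)) (coact H x)))"

definition dual ::
  "('k::field, 'b::ring_1, 'y) hopf_scheme \<Rightarrow> ('k, 'b, 'h::ab_group_add, 'z) ydm_scheme
    \<Rightarrow> ('k, 'b, 'h \<Rightarrow> 'k) ydm" where
  "dual B H =
     \<lparr>carrier = dual_carrier H, scale = fscale,
      act = (\<lambda>b f x. f (act H (antipode B b) x)),
      coact = dual_coact B H\<rparr>"

definition dual_mult ::
  "('k::field, 'b::ring_1, 'y) hopf_scheme \<Rightarrow> ('k, 'b, 'h::ring_1, 'z) braided_hopf_scheme
    \<Rightarrow> ('h \<Rightarrow> 'k) \<Rightarrow> ('h \<Rightarrow> 'k) \<Rightarrow> 'h \<Rightarrow> 'k" where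
  "dual_mult B H f g = (\<lambda>h.
     tensor_lift H H (\<lambda>h1 h2.
       tensor_lift H (dual B H) (\<lambda>u v. f u * v h2) (braid B (dual B H) H (tens (dual B H) H g h1)))
     (bcomult H h))"

definition dual_hit ::
  "('k::field, 'b::ring_1, 'y) hopf_scheme \<Rightarrow> ('k, 'b, 'h::ring_1, 'z) braided_hopf_scheme
    \<Rightarrow> 'h \<Rightarrow> ('h \<Rightarrow> 'k) \<Rightarrow> 'h \<Rightarrow> 'k" where
  "dual_hit B H h f = (\<lambda>x.
     tensor_lift (dual B H) H (\<lambda>f' h'.
       tensor_lift H H (\<lambda>u v. f' (u * v)) (braid B H H (tens H H h' x)))
     (braid B H (dual B H) (tens H (dual B H) h f)))"


section \<open>Rational modules and integrals\<close>

definition dual_module ::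
  "('k::field, 'b::ring_1, 'x) hopf_scheme \<Rightarrow> ('k, 'b, 'h::ring_1, 'y) braided_hopf_scheme
    \<Rightarrow> ('k, 'b, 'a::ab_group_add, 'z) ydm_scheme \<Rightarrow> (('h \<Rightarrow> 'k) \<Rightarrow> 'a \<Rightarrow> 'a) \<Rightarrow> bool" where
  "dual_module B H M \<alpha> \<longleftrightarrow>
     yd_module B M \<and>
     bilinear_on (dual B H) M M \<alpha> \<and>
     yd_hom B (yd_tensor B (dual B H) M) M (tensor_lift (dual B H) M \<alpha>) \<and>
     (\<forall>m\<in>carrier M. \<alpha> (bcounit H) m = m) \<and>
     (\<forall>f\<in>carrier (dual B H). \<forall>g\<in>carrier (dual B H). \<forall>m\<in>carrier M.
        \<alpha> (dual_mult B H f g) m = \<alpha> f (\<alpha> g m))"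

definition rational_coaction ::
  "('k::field, 'b::ring_1, 'x) hopf_scheme \<Rightarrow> ('k, 'b, 'h::ring_1, 'y) braided_hopf_scheme
    \<Rightarrow> ('k, 'b, 'a::ab_group_add, 'z) ydm_scheme \<Rightarrow> (('h \<Rightarrow> 'k) \<Rightarrow> 'a \<Rightarrow> 'a)
    \<Rightarrow> ('a \<Rightarrow> ('a, 'h, 'k) tensor) \<Rightarrow> bool" where
  "rational_coaction B H M \<alpha> \<rho> \<longleftrightarrow>
     yd_hom B M (yd_tensor B M H) \<rho> \<and>
     (\<forall>f\<in>carrier (dual B H). \<forall>m\<in>carrier M.
        tensor_lift M H (\<lambda>m0 m1.
          tensor_lift M (dual B H) (\<lambda>u v. scale M (v m1) u)
            (braid B (dual B H) M (tens (dual B H) M f m0))) (\<rho> m)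
        = \<alpha> f m)"

definition rational_module ::
  "('k::field, 'b::ring_1, 'x) hopf_scheme \<Rightarrow> ('k, 'b, 'h::ring_1, 'y) braided_hopf_scheme
    \<Rightarrow> ('k, 'b, 'a::ab_group_add, 'z) ydm_scheme \<Rightarrow> (('h \<Rightarrow> 'k) \<Rightarrow> 'a \<Rightarrow> 'a) \<Rightarrow> bool" where
  "rational_module B H M \<alpha> \<longleftrightarrow> dual_module B H M \<alpha> \<and> (\<exists>\<rho>. rational_coaction B H M \<alpha> \<rho>)"

definition rational_submodule ::
  "('k::field, 'b::ring_1, 'y) hopf_scheme \<Rightarrow> ('k, 'b, 'h::ring_1, 'z) braided_hopf_scheme
    \<Rightarrow> ('h \<Rightarrow> 'k) set \<Rightarrow> bool" where
  "rational_submodule B H N \<longleftrightarrow>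
     N \<subseteq> carrier (dual B H) \<and> rational_module B H (sub_object (dual B H) N) (dual_mult B H)"

text \<open>\<^const>\<open>Greatest\<close> with respect to inclusion of sets.\<close>

definition dual_rat_carrier ::
  "('k::field, 'b::ring_1, 'y) hopf_scheme \<Rightarrow> ('k, 'b, 'h::ring_1, 'z) braided_hopf_scheme
    \<Rightarrow> ('h \<Rightarrow> 'k) set" where
  "dual_rat_carrier B H = (GREATEST N. rational_submodule B H N)"

definition dual_rat ::
  "('k::field, 'b::ring_1, 'y) hopf_scheme \<Rightarrow> ('k, 'b, 'h::ring_1, 'z) braided_hopf_scheme
    \<Rightarrow> ('k, 'b, 'h \<Rightarrow> 'k) ydm" where
  "dual_rat B H = sub_object (dual B H) (dual_rat_carrier B H)"

definition left_integrals ::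
  "('k::field, 'b::ring_1, 'y) hopf_scheme \<Rightarrow> ('k, 'b, 'h::ring_1, 'z) braided_hopf_scheme
    \<Rightarrow> ('k, 'b, 'h \<Rightarrow> 'k) ydm" where
  "left_integrals B H = sub_object (dual B H)
     {f \<in> carrier (dual B H). \<forall>g\<in>carrier (dual B H). dual_mult B H g f = fscale (g 1) f}"


section \<open>Hopf modules\<close>

definition hopf_module ::
  "('k::field, 'b::ring_1, 'x) hopf_scheme \<Rightarrow> ('k, 'b, 'h::ring_1, 'y) braided_hopf_scheme
    \<Rightarrow> ('k, 'b, 'a::ab_group_add, 'z) ydm_scheme \<Rightarrow> ('a \<Rightarrow> 'h \<Rightarrow> 'a)
    \<Rightarrow> ('a \<Rightarrow> ('a, 'h, 'k) tensor) \<Rightarrow> bool" where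
  "hopf_module B H M \<alpha> \<rho> \<longleftrightarrow>
     yd_module B M \<and>
     bilinear_on M H M \<alpha> \<and>
     yd_hom B (yd_tensor B M H) M (tensor_lift M H \<alpha>) \<and>
     (\<forall>m\<in>carrier M. \<alpha> m 1 = m) \<and>
     (\<forall>m\<in>carrier M. \<forall>x y. \<alpha> m (x * y) = \<alpha> (\<alpha> m x) y) \<and>
     yd_hom B M (yd_tensor B M H) \<rho> \<and>
     (\<forall>m\<in>carrier M.
        tensor_lift M H (\<lambda>m0 m1. tens (tensor_space M H) H (\<rho> m0) m1) (\<rho> m)
        = tensor_lift M H (\<lambda>m0 m1.
            tensor_lift H H (\<lambda>x1 x2. tens (tensor_space M H) H (tens M H m0 x1) x2) (bcomult H m1))
          (\<rho> m)) \<and>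
     (\<forall>m\<in>carrier M. tensor_lift M H (\<lambda>m0 m1. scale M (bcounit H m1) m0) (\<rho> m) = m) \<and>
     (\<forall>m\<in>carrier M. \<forall>h. \<rho> (\<alpha> m h) =
        tensor_lift M H (\<lambda>m0 m1.
          tensor_lift H H (\<lambda>h1 h2.
            tensor_lift H H (\<lambda>u v. tens M H (\<alpha> m0 u) (v * h2)) (braid B H H (tens H H m1 h1)))
          (bcomult H h)) (\<rho> m))"

definition hopf_module_isomorphic ::
  "('k::field, 'b::ring_1, 'w) hopf_scheme \<Rightarrow> ('k, 'b, 'h::ring_1, 'x) braided_hopf_scheme
    \<Rightarrow> ('k, 'b, 'a::ab_group_add, 'y) ydm_scheme \<Rightarrow> ('a \<Rightarrow> 'h \<Rightarrow> 'a)
    \<Rightarrow> ('a \<Rightarrow> ('a, 'h, 'k) tensor)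
    \<Rightarrow> ('k, 'b, 'c::ab_group_add, 'z) ydm_scheme \<Rightarrow> ('c \<Rightarrow> 'h \<Rightarrow> 'c)
    \<Rightarrow> ('c \<Rightarrow> ('c, 'h, 'k) tensor) \<Rightarrow> bool" where
  "hopf_module_isomorphic B H M \<alpha> \<rho> M' \<alpha>' \<rho>' \<longleftrightarrow>
     hopf_module B H M \<alpha> \<rho> \<and> hopf_module B H M' \<alpha>' \<rho>' \<and>
     (\<exists>\<phi>. yd_hom B M M' \<phi> \<and> bij_betw \<phi> (carrier M) (carrier M') \<and>
        (\<forall>m\<in>carrier M. \<forall>h. \<phi> (\<alpha> m h) = \<alpha>' (\<phi> m) h) \<and>
        (\<forall>m\<in>carrier M. \<rho>' (\<phi> m) = tensor_lift M H (\<lambda>m0 m1. tens M' H (\<phi> m0) m1) (\<rho> m)))"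

definition dual_rat_act ::
  "('k::field, 'b::ring_1, 'y) hopf_scheme \<Rightarrow> ('k, 'b, 'h::ring_1, 'z) braided_hopf_scheme
    \<Rightarrow> ('h \<Rightarrow> 'k) \<Rightarrow> 'h \<Rightarrow> 'h \<Rightarrow> 'k" where
  "dual_rat_act B H f h =
     tensor_lift H (dual_rat B H) (\<lambda>u v. dual_hit B H (bantipode H u) v)
       (braid B (dual_rat B H) H (tens (dual_rat B H) H f h))"

definition free_act ::
  "('k::field, 'a::ab_group_add, 'y) vspace_scheme \<Rightarrow> ('k, 'b, 'h::ring_1, 'z) braided_hopf_scheme
    \<Rightarrow> ('a, 'h, 'k) tensor \<Rightarrow> 'h \<Rightarrow> ('a, 'h, 'k) tensor" where
  "free_act V H t h = tensor_lift V H (\<lambda>v x. tens V H v (x * h)) t"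

definition free_coact ::
  "('k::field, 'a::ab_group_add, 'y) vspace_scheme \<Rightarrow> ('k, 'b, 'h::ring_1, 'z) braided_hopf_scheme
    \<Rightarrow> ('a, 'h, 'k) tensor \<Rightarrow> (('a, 'h, 'k) tensor, 'h, 'k) tensor" where
  "free_coact V H =
     tensor_lift V H (\<lambda>v x.
       tensor_lift H H (\<lambda>x1 x2. tens (tensor_space V H) H (tens V H v x1) x2) (bcomult H x))"

end

theory Submission
  imports Defs
begin

text \<open>
  Tested against linear functionals, every identity becomes one between multilinear forms on \<open>H\<close>.
  With \<open>C\<^sup>2 = 1\<close> and \<open>S\<^sup>2 = 1\<close> on \<open>B\<close>, the operations of \<open>H*\<close> are explicit:
  \<open>(f g)(x) = (g \<otimes> f)(C \<Delta>(x))\<close> and \<open>f \<leftharpoonup> h = f(m C(S h \<otimes> -))\<close>, and \<open>\<Sigma> f\<^sub>0 \<otimes> f\<^sub>1\<close> is the coaction of \<open>f\<close>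
  iff \<open>\<Sigma> (f\<^sub>0 \<otimes> id) C(f\<^sub>1 \<otimes> x) = (f \<otimes> id) C \<Delta>(x)\<close> for all \<open>x\<close>. So the coaction is unique and
  automatically a morphism, it satisfies \<open>\<rho>(v) = v \<otimes> 1\<close> exactly for integrals \<open>v\<close>, and its
  compatibility with \<open>\<leftharpoonup>\<close> is the identity \<open>\<Delta>(x) (1 \<otimes> S h) = \<Sigma> \<Delta>(x S(h\<^sub>1)) (h\<^sub>2 \<otimes> 1)\<close>, which holds
  because \<open>\<Delta>\<close> is multiplicative. As for ordinary Hopf modules, \<open>m \<mapsto> \<Sigma> m\<^sub>0 \<leftharpoonup> S(m\<^sub>1)\<close> then projects
  the rational part onto the integrals and \<open>m \<mapsto> \<Sigma> m\<^sub>0 \<leftharpoonup> S(m\<^sub>1) \<otimes> m\<^sub>2\<close> inverts \<open>v \<otimes> h \<mapsto> v \<leftharpoonup> h\<close>.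
  The Hopf module axioms for \<open>\<integral> \<otimes> H\<close> are transported along this bijection.
\<close>



subsection \<open>Finite sums over lists of pairs\<close>

text \<open>The obstacle is Sweedler notation. The terms of a tensor are picked by
  \<open>SOME\<close>, so the list chosen for a coproduct or a coaction is not a linear function of
  its argument, and only its sums against multilinear maps carry meaning. Structure maps are
  therefore handled as lists, axioms as identities between forms, and equality of tensors through
  families of functionals with trivial common kernel. The abstract setting of forms is instantiated
  twice, for \<open>H\<close> with C and for \<open>B\<close> with the flip; the second instance
  supplies the facts on the antipode of \<open>B\<close>. Finite dimension of \<open>B\<close>
  ensures that the coaction of the full dual is a tensor at all. The pairing of H* \<otimes> H that
  rationality prescribes contains a braiding; undoing it shows that these pairings separate
  elements, and this is the source of uniqueness. Closure of the rational part under
  \<leftharpoonup> comes from maximality: the span of all f \<leftharpoonup> h is again a rational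
  submodule.\<close>

definition sw :: "('a \<times> 'c) list \<Rightarrow> ('a \<Rightarrow> 'c \<Rightarrow> 'd::comm_monoid_add) \<Rightarrow> 'd" where
  "sw xs \<beta> = (\<Sum>(x, y) \<leftarrow> xs. \<beta> x y)"

lemma sw_Nil [simp]: "sw [] \<beta> = 0"
  and sw_Cons [simp]: "sw ((x, y) # xs) \<beta> = \<beta> x y + sw xs \<beta>"
  by (simp_all add: sw_def)

lemma sw_cong: "(\<And>x y. (x, y) \<in> set xs \<Longrightarrow> \<beta> x y = \<gamma> x y) \<Longrightarrow> sw xs \<beta> = sw xs \<gamma>"
  unfolding sw_def by (rule arg_cong[where f = sum_list], rule map_cong) auto

lemma sw_add: "sw xs (\<lambda>a b. F a b + G a b) = sw xs F + sw xs G"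
  by (induction xs) (auto simp: ac_simps)

lemma sw_zero [simp]: "sw xs (\<lambda>a b. 0) = 0"
  by (induction xs) auto

lemma sw_swap: "sw xs (\<lambda>a b. sw ys (\<lambda>c d. F a b c d)) = sw ys (\<lambda>c d. sw xs (\<lambda>a b. F a b c d))"
  by (induction xs) (auto simp: sw_add)

text \<open>The inner lists may depend on the outer variables; only the list that moves must be
  constant. This is the shape met when the terms of a fixed coproduct or coaction are pulled through
  nested braidings.\<close>

lemma sw_swap3: "sw xs (\<lambda>a b. sw (ys a b) (\<lambda>c d. sw zs (\<lambda>p q. F a b c d p q))) =
    sw zs (\<lambda>p q. sw xs (\<lambda>a b. sw (ys a b) (\<lambda>c d. F a b c d p q)))"
  by (subst sw_swap[of zs xs], intro sw_cong, rule sw_swap)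

lemma sw_swap4: "sw xs (\<lambda>a b. sw (ys a b) (\<lambda>c d. sw (zs a b c d) (\<lambda>m n. sw ws (\<lambda>p q. F a b c d m n p q)))) =
    sw ws (\<lambda>p q. sw xs (\<lambda>a b. sw (ys a b) (\<lambda>c d. sw (zs a b c d) (\<lambda>m n. F a b c d m n p q))))"
  by (subst sw_swap[of ws xs], intro sw_cong, rule sw_swap3)

lemma sw_mult_left: "sw xs (\<lambda>a b. c * F a b) = (c :: 'k::semiring_0) * sw xs F"
  by (induction xs) (auto simp: distrib_left)

lemma sw_mult_right: "sw xs (\<lambda>a b. F a b * c) = sw xs F * (c :: 'k::semiring_0)"
  by (induction xs) (auto simp: distrib_right)

lemma sw_apply: "sw xs F x = sw xs (\<lambda>a b. F a b x)"
  by (induction xs) auto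

lemma sw_map: "sw (map (\<lambda>(a, b). (f a b, g a b)) xs) \<beta> = sw xs (\<lambda>a b. \<beta> (f a b) (g a b))"
  by (induction xs) auto

lemma sw_hom:
  assumes "\<And>x y. \<phi> (x + y) = \<phi> x + \<phi> y" "\<phi> 0 = 0"
  shows "\<phi> (sw xs F) = sw xs (\<lambda>a b. \<phi> (F a b))"
  by (induction xs) (auto simp: assms)


subsection \<open>Linear maps, forms and bilinear forms on whole types\<close>

text \<open>In contrast to \<open>Vector_Spaces.linear\<close> there is no vector space premise on
  \<open>s\<close> and \<open>t\<close>. Linearity of a long nested sum can then be proved by
  resolution with the rules in \<open>lin\<close> alone.\<close>

definition lmap :: "('k \<Rightarrow> 'a::plus \<Rightarrow> 'a) \<Rightarrow> ('k \<Rightarrow> 'c::plus \<Rightarrow> 'c) \<Rightarrow> ('a \<Rightarrow> 'c) \<Rightarrow> bool" where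
  "lmap s t f \<longleftrightarrow> (\<forall>x y. f (x + y) = f x + f y) \<and> (\<forall>c x. f (s c x) = t c (f x))"

abbreviation lform :: "('k::field \<Rightarrow> 'a::plus \<Rightarrow> 'a) \<Rightarrow> ('a \<Rightarrow> 'k) \<Rightarrow> bool" where
  "lform s \<equiv> lmap s (*)"

definition bform ::
  "('k::field \<Rightarrow> 'a::plus \<Rightarrow> 'a) \<Rightarrow> ('k \<Rightarrow> 'c::plus \<Rightarrow> 'c) \<Rightarrow> ('a \<Rightarrow> 'c \<Rightarrow> 'k) \<Rightarrow> bool" where
  "bform s t \<beta> \<longleftrightarrow> (\<forall>y. lform s (\<lambda>x. \<beta> x y)) \<and> (\<forall>x. lform t (\<lambda>y. \<beta> x y))"

definition tform ::
  "('k::field \<Rightarrow> 'a::plus \<Rightarrow> 'a) \<Rightarrow> ('k \<Rightarrow> 'c::plus \<Rightarrow> 'c) \<Rightarrow> ('k \<Rightarrow> 'd::plus \<Rightarrow> 'd)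
    \<Rightarrow> ('a \<Rightarrow> 'c \<Rightarrow> 'd \<Rightarrow> 'k) \<Rightarrow> bool" where
  "tform s t u \<gamma> \<longleftrightarrow> (\<forall>y z. lform s (\<lambda>x. \<gamma> x y z)) \<and> (\<forall>x z. lform t (\<lambda>y. \<gamma> x y z)) \<and>
     (\<forall>x y. lform u (\<lambda>z. \<gamma> x y z))"

named_theorems lin

lemma lmapD: "lmap s t f \<Longrightarrow> f (x + y) = f x + f y" "lmap s t f \<Longrightarrow> f (s c x) = t c (f x)"
  by (auto simp: lmap_def)

lemma lmap_0: "lmap s t f \<Longrightarrow> f (0 :: 'a::monoid_add) = (0 :: 'c::cancel_comm_monoid_add)"
  using lmapD(1)[of s t f 0 0] by simp

lemma lmap_sw: "lmap s t f \<Longrightarrow> f (sw xs F) = sw xs (\<lambda>a b. f (F a b))"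
  for f :: "'a::comm_monoid_add \<Rightarrow> 'c::cancel_comm_monoid_add"
  by (rule sw_hom) (auto simp: lmapD lmap_0)

lemma bformI [lin]: "(\<And>y. lform s (\<lambda>x. \<beta> x y)) \<Longrightarrow> (\<And>x. lform t (\<lambda>y. \<beta> x y)) \<Longrightarrow> bform s t \<beta>"
  by (auto simp: bform_def)

lemma tformI [lin]:
  "(\<And>y z. lform s (\<lambda>x. \<gamma> x y z)) \<Longrightarrow> (\<And>x z. lform t (\<lambda>y. \<gamma> x y z)) \<Longrightarrow> (\<And>x y. lform u (\<lambda>z. \<gamma> x y z))
    \<Longrightarrow> tform s t u \<gamma>"
  by (auto simp: tform_def)

text \<open>The argument is a composite \<open>g x\<close> on purpose. Instantiated at one
  particular form these become introduction rules for \<open>lin\<close> that peel linear maps off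
  layer by layer.\<close>

lemma bform_left: "bform s t \<beta> \<Longrightarrow> lmap r s g \<Longrightarrow> lform r (\<lambda>x. \<beta> (g x) y)"
  and bform_right: "bform s t \<beta> \<Longrightarrow> lmap r t h \<Longrightarrow> lform r (\<lambda>y. \<beta> x (h y))"
  by (auto simp: bform_def lmap_def)

lemma tform_1: "tform s t u \<gamma> \<Longrightarrow> lmap r s f \<Longrightarrow> lform r (\<lambda>x. \<gamma> (f x) b c)"
  and tform_2: "tform s t u \<gamma> \<Longrightarrow> lmap r t g \<Longrightarrow> lform r (\<lambda>x. \<gamma> a (g x) c)"
  and tform_3: "tform s t u \<gamma> \<Longrightarrow> lmap r u h \<Longrightarrow> lform r (\<lambda>x. \<gamma> a b (h x))"
  by (auto simp: tform_def lmap_def)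

lemma lform_comp: "lform s \<phi> \<Longrightarrow> lmap r s g \<Longrightarrow> lform r (\<lambda>x. \<phi> (g x))"
  and lmap_comp: "lmap s t f \<Longrightarrow> lmap r s g \<Longrightarrow> lmap r t (\<lambda>x. f (g x))"
  by (auto simp: lmap_def)

lemma lmap_id [lin]: "lmap s s (\<lambda>x. x)"
  by (simp add: lmap_def)

lemma lform_mult_left [lin]: "lform s f \<Longrightarrow> lform s (\<lambda>x. c * f x)"
  and lform_mult_right [lin]: "lform s f \<Longrightarrow> lform s (\<lambda>x. f x * c)"
  by (auto simp: lmap_def algebra_simps)

lemma lform_sw [lin]: "(\<And>a b. lform s (\<lambda>x. F x a b)) \<Longrightarrow> lform s (\<lambda>x. sw xs (\<lambda>a b. F x a b))"
  by (simp add: lmap_def sw_def sum_list_addf[symmetric] sum_list_const_mult[symmetric] split_def)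

lemma lform_eval [lin]: "lform fscale (\<lambda>g. g x)"
  by (simp add: lmap_def fscale_def)


subsection \<open>Sums over a chosen representation of a tensor\<close>

text \<open>The list hidden inside \<open>tensor_lift\<close>, named so that nested lifts become
  nested list sums which can be exchanged and regrouped.\<close>

definition rep ::
  "('k::field, 'a::ab_group_add, 'y) vspace_scheme \<Rightarrow> ('k, 'c::ab_group_add, 'z) vspace_scheme
    \<Rightarrow> ('a, 'c, 'k) tensor \<Rightarrow> ('a \<times> 'c) list" where
  "rep V W t = (SOME xs. set xs \<subseteq> carrier V \<times> carrier W \<and> t = (\<Sum>(x, y) \<leftarrow> xs. tens V W x y))"

lemma tensor_lift_sw: "tensor_lift V W \<beta> t = sw (rep V W t) \<beta>"
  by (simp add: tensor_lift_def rep_def sw_def)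

lemma
  assumes "is_space V" "t \<in> carrier (tensor_space V W)"
  shows rep_set: "set (rep V W t) \<subseteq> carrier V \<times> carrier W"
    and sw_rep_tens: "sw (rep V W t) (tens V W) = t"
  using someI_ex[OF tensor_rep[OF assms]] unfolding rep_def sw_def by auto

lemma scale_tensor_space [simp]: "scale (tensor_space V W) = fscale"
  by (simp add: tensor_space_def)

lemma ground_simps [simp]: "carrier ground = UNIV" "scale ground = (*)"
  by (simp_all add: ground_def)

lemma is_space_ground [simp]: "is_space (ground :: ('k::field, 'k) vspace)"
  using vector_space_times[where 'k = 'k]
  by (simp add: is_space_def module.subspace_UNIV vector_space_def module_def)

lemma linear_onD:
  assumes "linear_on V W f"
  shows "x \<in> carrier V \<Longrightarrow> f x \<in> carrier W"
    "x \<in> carrier V \<Longrightarrow> y \<in> carrier V \<Longrightarrow> f (x + y) = f x + f y"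
    "x \<in> carrier V \<Longrightarrow> f (scale V c x) = scale W c (f x)"
  using assms by (auto simp: linear_on_def)

lemma is_spaceD:
  fixes V :: "('k::field, 'a::ab_group_add, 'z) vspace_scheme"
  assumes "is_space V"
  shows "0 \<in> carrier V" "x \<in> carrier V \<Longrightarrow> y \<in> carrier V \<Longrightarrow> x + y \<in> carrier V"
    "x \<in> carrier V \<Longrightarrow> y \<in> carrier V \<Longrightarrow> x - y \<in> carrier V"
    "x \<in> carrier V \<Longrightarrow> scale V c x \<in> carrier V"
    "scale V 1 x = x" "scale V c (x + y) = scale V c x + scale V c y" "scale V c 0 = 0"
    "scale V (c * d) x = scale V c (scale V d x)" "scale V (c + d) x = scale V c x + scale V d x"
    "scale V 0 x = 0"
proof -
  interpret V: vector_space "scale V" using assms by (simp add: is_space_def)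
  have s: "V.subspace (carrier V)" using assms by (simp add: is_space_def)
  show "0 \<in> carrier V" "x \<in> carrier V \<Longrightarrow> y \<in> carrier V \<Longrightarrow> x + y \<in> carrier V"
    "x \<in> carrier V \<Longrightarrow> y \<in> carrier V \<Longrightarrow> x - y \<in> carrier V"
    "x \<in> carrier V \<Longrightarrow> scale V c x \<in> carrier V"
    using s V.subspace_0 V.subspace_add V.subspace_diff V.subspace_scale by auto
  show "scale V 1 x = x" "scale V c (x + y) = scale V c x + scale V c y" "scale V c 0 = 0"
    "scale V (c * d) x = scale V c (scale V d x)" "scale V (c + d) x = scale V c x + scale V d x"
    "scale V 0 x = 0"
    by (simp_all add: V.scale_right_distrib V.scale_left_distrib)
qed

lemma sw_in:
  assumes "is_space V" "\<And>a b. (a, b) \<in> set xs \<Longrightarrow> F a b \<in> carrier V"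
  shows "sw xs F \<in> carrier V"
  using assms(2) by (induction xs) (auto simp: is_spaceD[OF assms(1)])

lemma linear_on_0:
  assumes "linear_on V W f" "is_space V" shows "f 0 = 0"
  using linear_onD(2)[OF assms(1), of 0 0] is_spaceD(1)[OF assms(2)] by simp

lemma linear_on_sw:
  assumes f: "linear_on V W f" and V: "is_space V"
    and "\<And>a b. (a, b) \<in> set xs \<Longrightarrow> F a b \<in> carrier V"
  shows "f (sw xs F) = sw xs (\<lambda>a b. f (F a b))"
  using assms(3)
proof (induction xs)
  case (Cons p xs)
  then show ?case using sw_in[OF V, of xs F]
    by (cases p) (auto simp: linear_onD[OF f])
qed (simp add: linear_on_0[OF f V])

lemma linear_on_rep:
  assumes "is_space V" "linear_on (tensor_space V W) U f" "t \<in> carrier (tensor_space V W)"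
  shows "f t = sw (rep V W t) (\<lambda>x y. f (tens V W x y))"
proof -
  have "f t = f (sw (rep V W t) (tens V W))" using sw_rep_tens[OF assms(1,3)] by simp
  also have "\<dots> = sw (rep V W t) (\<lambda>x y. f (tens V W x y))"
    by (rule linear_on_sw[OF assms(2) is_space_tensor_space])
      (use rep_set[OF assms(1,3)] in \<open>auto intro: tens_in\<close>)
  finally show ?thesis .
qed

lemma linear_on_tensor_eqI:
  assumes "is_space V" "linear_on (tensor_space V W) U f" "linear_on (tensor_space V W) U g"
    "t \<in> carrier (tensor_space V W)"
    "\<And>x y. x \<in> carrier V \<Longrightarrow> y \<in> carrier W \<Longrightarrow> f (tens V W x y) = g (tens V W x y)"
  shows "f t = g t"
  unfolding linear_on_rep[OF assms(1,2,4)] linear_on_rep[OF assms(1,3,4)]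
  by (rule sw_cong) (use rep_set[OF assms(1,4)] assms(5) in auto)

text \<open>Independence of the choice: the chosen list may differ from \<open>xs\<close>, but both
  represent the same tensor, and a bilinear map cannot tell them apart.\<close>

lemma sw_rep:
  assumes "is_space V" "is_space W" "is_space U" "bilinear_on V W U \<beta>"
    and "set xs \<subseteq> carrier V \<times> carrier W"
  shows "sw (rep V W (sw xs (tens V W))) \<beta> = sw xs \<beta>"
  using tensor_lift_sum_list[OF assms] by (simp add: tensor_lift_sw sw_def)

lemma sw_tens_in: 
  assumes "set xs \<subseteq> carrier V \<times> carrier W"
  shows "sw xs (tens V W) \<in> carrier (tensor_space V W)"
  by (rule sw_in[OF is_space_tensor_space]) (use assms in \<open>auto intro: tens_in\<close>)

lemma sw_rep_tens1:
  assumes "is_space V" "is_space W" "is_space U" "bilinear_on V W U \<beta>"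
    and "x \<in> carrier V" "y \<in> carrier W"
  shows "sw (rep V W (tens V W x y)) \<beta> = \<beta> x y"
  using tensor_lift_tens[OF assms] by (simp add: tensor_lift_sw)

lemma tens_cong: "scale V = scale V' \<Longrightarrow> scale W = scale W' \<Longrightarrow> tens V W = tens V' W'"
  by (intro ext) (simp add: tens_def)

lemma tens_0: "tens V W 0 y = 0" "tens V W x 0 = 0"
  using tens_add_left[of V W 0 0 y] tens_add_right[of V W x 0 0] by simp_all

lemma tensor_space_mono:
  fixes V V' :: "('k::field, 'a::ab_group_add, 'x) vspace_scheme"
    and W W' :: "('k, 'c::ab_group_add, 'y) vspace_scheme"
  assumes "carrier V \<subseteq> carrier V'" "carrier W \<subseteq> carrier W'" "scale V = scale V'" "scale W = scale W'"
  shows "carrier (tensor_space V W) \<subseteq> carrier (tensor_space V' W')"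
proof -
  interpret F: vector_space "fscale :: 'k \<Rightarrow> (('a \<Rightarrow> 'c \<Rightarrow> 'k) \<Rightarrow> 'k) \<Rightarrow> _" by (rule vector_space_fscale)
  have "{tens V W x y | x y. x \<in> carrier V \<and> y \<in> carrier W}
      \<subseteq> {tens V' W' x y | x y. x \<in> carrier V' \<and> y \<in> carrier W'}"
    unfolding tens_cong[OF assms(3,4)] using assms(1,2) by blast
  then show ?thesis unfolding tensor_space_def by (simp add: F.span_mono)
qed

text \<open>A tensor over subspaces is the same functional as over the larger spaces, but
  \<open>rep\<close> may choose another list there. The list chosen in the smaller space is also
  admissible in the larger one, so bilinear sums agree.\<close>

lemma sw_rep_mono:
  fixes V V' :: "('k::field, 'a::ab_group_add, 'x) vspace_scheme"
    and W W' :: "('k, 'c::ab_group_add, 'y) vspace_scheme"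
  assumes "carrier V \<subseteq> carrier V'" "carrier W \<subseteq> carrier W'" "scale V = scale V'" "scale W = scale W'"
    and "is_space V" "is_space V'" "is_space W'" "is_space U" "bilinear_on V' W' U \<beta>"
    and "t \<in> carrier (tensor_space V W)"
  shows "sw (rep V W t) \<beta> = sw (rep V' W' t) \<beta>"
proof -
  have s: "set (rep V W t) \<subseteq> carrier V' \<times> carrier W'" using rep_set[OF assms(5,10)] assms(1,2) by auto
  have "sw (rep V W t) (tens V' W') = t"
    using sw_rep_tens[OF assms(5,10)] tens_cong[OF assms(3,4)] by simp
  then show ?thesis using sw_rep[OF assms(6-9) s] by simp
qed


subsection \<open>Separating families of functionals\<close>

text \<open>The full space of functionals is too large a test set here: on H* one evaluates at
  points of \<open>H\<close>, and on H* \<otimes> H one uses the braided pairing. Trivial common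
  kernel is what suffices to conclude equality.\<close>

definition separating :: "('k::field, 'a::ab_group_add, 'z) vspace_scheme \<Rightarrow> ('a \<Rightarrow> 'k) set \<Rightarrow> bool" where
  "separating V P \<longleftrightarrow> (\<forall>\<phi>\<in>P. linear_on V ground \<phi>) \<and> (\<forall>v\<in>carrier V. (\<forall>\<phi>\<in>P. \<phi> v = 0) \<longrightarrow> v = 0)"

lemma separating_eqI:
  assumes "separating V P" "is_space V" "v \<in> carrier V" "v' \<in> carrier V" "\<And>\<phi>. \<phi> \<in> P \<Longrightarrow> \<phi> v = \<phi> v'"
  shows "v = v'"
proof -
  have "\<phi> (v - v') = 0" if "\<phi> \<in> P" for \<phi>
  proof -
    have "\<phi> ((v - v') + v') = \<phi> (v - v') + \<phi> v'"
      using assms(1) that is_spaceD(3)[OF assms(2-4)] assms(4)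
      by (intro linear_onD(2)[of V ground]) (auto simp: separating_def)
    then show ?thesis using assms(5)[OF that] by simp
  qed
  then have "v - v' = 0" using assms is_spaceD(3)[OF assms(2-4)] by (auto simp: separating_def)
  then show ?thesis by simp
qed

lemma linear_on_lform: "lform (scale V) \<phi> \<Longrightarrow> linear_on V ground \<phi>"
  by (auto simp: linear_on_def lmap_def)

lemma separating_lforms:
  fixes V :: "('k::field, 'a::ab_group_add, 'z) vspace_scheme"
  assumes "is_space V" shows "separating V {\<phi>. lform (scale V) \<phi>}"
  unfolding separating_def
proof (intro conjI ballI impI)
  fix v assume v: "\<forall>\<phi>\<in>{\<phi>. lform (scale V) \<phi>}. \<phi> v = 0"
  show "v = 0"
  proof (rule ccontr)
    assume "v \<noteq> 0"
    interpret V: vector_space "scale V" using assms by (simp add: is_space_def)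
    interpret Vk: vector_space_pair "scale V" "(*) :: 'k \<Rightarrow> 'k \<Rightarrow> 'k"
      by (intro vector_space_pair.intro vector_space_times) unfold_locales
    have "V.independent {v}" using \<open>v \<noteq> 0\<close> by simp
    then obtain \<phi> where \<phi>: "Vector_Spaces.linear (scale V) (*) \<phi>" "\<phi> v = 1"
      using Vk.linear_independent_extend[of "{v}" "\<lambda>_. 1"] by auto
    then have "lform (scale V) \<phi>" by (simp add: lmap_def linear_iff)
    then show False using v \<phi> by auto
  qed
qed (auto intro: linear_on_lform)

lemma bilinear_on_mult:
  assumes "linear_on V ground \<phi>" "linear_on W ground \<psi>"
  shows "bilinear_on V W ground (\<lambda>v w. \<phi> v * \<psi> w)"
  using assms by (auto simp: bilinear_on_def linear_on_def algebra_simps)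

lemma linear_on_sw_rep:
  assumes "is_space V" "is_space W" "is_space U" "bilinear_on V W U \<beta>"
  shows "linear_on (tensor_space V W) U (\<lambda>t. sw (rep V W t) \<beta>)"
  using linear_on_tensor_lift[OF assms] by (simp add: tensor_lift_sw[abs_def])

text \<open>Rewriting the left factors in a basis of their span reduces the vanishing of a tensor to that
  of its right coefficients.\<close>

lemma tensor_eq_0:
  fixes V :: "('k::field, 'a::ab_group_add, 'x) vspace_scheme"
    and W :: "('k, 'c::ab_group_add, 'y) vspace_scheme"
  assumes V: "is_space V" and W: "is_space W" and P: "separating V P" and Q: "separating W Q"
    and t: "t \<in> carrier (tensor_space V W)"
    and 0: "\<And>\<phi> \<psi>. \<phi> \<in> P \<Longrightarrow> \<psi> \<in> Q \<Longrightarrow> sw (rep V W t) (\<lambda>v w. \<phi> v * \<psi> w) = 0"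
  shows "t = 0"
proof -
  interpret V: vector_space "scale V" using V by (simp add: is_space_def)
  interpret W: vector_space "scale W" using W by (simp add: is_space_def)
  interpret F: vector_space "fscale :: 'k \<Rightarrow> (('a \<Rightarrow> 'c \<Rightarrow> 'k) \<Rightarrow> 'k) \<Rightarrow> _" by (rule vector_space_fscale)
  define xs where "xs = rep V W t"
  have xs: "set xs \<subseteq> carrier V \<times> carrier W" "t = sw xs (tens V W)"
    using rep_set[OF V t] sw_rep_tens[OF V t] by (auto simp: xs_def)
  obtain b where b: "b \<subseteq> fst ` set xs" "V.independent b" "V.span b = V.span (fst ` set xs)"
  proof -
    obtain b where b: "b \<subseteq> fst ` set xs" "V.independent b" "fst ` set xs \<subseteq> V.span b"
      using V.basis_exists by metis
    moreover have "V.span b = V.span (fst ` set xs)"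
      unfolding V.span_eq using b(1,3) V.span_superset by blast
    ultimately show ?thesis using that by blast
  qed
  have fb: "finite b" using b(1) finite_subset by blast
  have sW: "W.subspace (carrier W)" and sV: "V.subspace (carrier V)"
    using V W by (simp_all add: is_space_def)
  \<comment> \<open>The right coefficient of \<open>e\<close>: once all left factors are expanded in
    the basis \<open>b\<close>, the tensor is the sum of e \<otimes> \<open>w e\<close>.\<close>
  define w where "w e = sw xs (\<lambda>x y. scale W (V.representation b x e) y)" for e
  have ex: "(\<Sum>e\<in>b. scale V (V.representation b x e) e) = x" if "(x, y) \<in> set xs" for x y
  proof -
    have "x \<in> V.span b" using that b(3) V.span_base[of x "fst ` set xs"] by force
    then show ?thesis using V.sum_representation_eq[OF b(2) _ fb] by simp
  qed
  have wW: "w e \<in> carrier W" for e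
    unfolding w_def by (rule sw_in[OF W]) (use xs W.subspace_scale[OF sW] in auto)
  have tl: "tens V W (\<Sum>e\<in>c. f e) y = (\<Sum>e\<in>c. tens V W (f e) y)" if "finite c" for c f y
    using that by (induction c rule: finite_induct) (simp_all add: tens_add_left tens_0)
  have tr: "tens V W e (sw zs f) = sw zs (\<lambda>x y. tens V W e (f x y))" for e zs and f :: "'a \<Rightarrow> 'c \<Rightarrow> 'c"
    by (rule sw_hom) (rule tens_add_right tens_0)+
  have sws: "sw zs (\<lambda>x y. \<Sum>e\<in>b. f x y e) = (\<Sum>e\<in>b. sw zs (\<lambda>x y. f x y e))"
    for zs :: "('a \<times> 'c) list" and f :: "'a \<Rightarrow> 'c \<Rightarrow> 'a \<Rightarrow> 'd::comm_monoid_add"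
    by (induction zs) (auto simp: sum.distrib)
  have "t = sw xs (\<lambda>x y. tens V W (\<Sum>e\<in>b. scale V (V.representation b x e) e) y)"
    unfolding xs(2) by (rule sw_cong) (simp add: ex)
  also have "\<dots> = sw xs (\<lambda>x y. \<Sum>e\<in>b. tens V W e (scale W (V.representation b x e) y))"
    by (simp add: tl[OF fb] tens_scale_left tens_scale_right)
  also have "\<dots> = (\<Sum>e\<in>b. tens V W e (w e))"
    by (simp add: sws w_def tr)
  finally have tb: "t = (\<Sum>e\<in>b. tens V W e (w e))" .
  have "w e = 0" if "e \<in> b" for e
  proof -
    have "\<psi> (w e) = 0" if \<psi>: "\<psi> \<in> Q" for \<psi>
    proof -
      have l\<psi>: "linear_on W ground \<psi>" using Q \<psi> by (simp add: separating_def)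
      \<comment> \<open>Contracting the right factors with \<psi> gives a vector of \<open>V\<close>
        that every functional in \<open>P\<close> kills. So it is 0, and independence of
        \<open>b\<close> makes its coordinates \<psi> (\<open>w e\<close>) vanish.\<close>
      let ?v = "sw xs (\<lambda>x y. scale V (\<psi> y) x)"
      have vV: "?v \<in> carrier V" by (rule sw_in[OF V]) (use xs V.subspace_scale[OF sV] in auto)
      have "\<phi> ?v = 0" if \<phi>: "\<phi> \<in> P" for \<phi>
      proof -
        have l\<phi>: "linear_on V ground \<phi>" using P \<phi> by (simp add: separating_def)
        have "\<phi> ?v = sw xs (\<lambda>x y. \<phi> (scale V (\<psi> y) x))"
          by (rule linear_on_sw[OF l\<phi> V]) (use xs V.subspace_scale[OF sV] in auto)
        also have "\<dots> = sw xs (\<lambda>x y. \<phi> x * \<psi> y)"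
          by (rule sw_cong) (use xs linear_onD(3)[OF l\<phi>] in auto)
        also have "\<dots> = 0" using 0[OF \<phi> \<psi>] by (simp add: xs_def)
        finally show ?thesis .
      qed
      then have "?v = 0" using P vV by (auto simp: separating_def)
      moreover have "?v = sw xs (\<lambda>x y. \<Sum>e\<in>b. scale V (\<psi> y * V.representation b x e) e)"
      proof (rule sw_cong)
        fix x y assume "(x, y) \<in> set xs"
        then have "scale V (\<psi> y) x = scale V (\<psi> y) (\<Sum>e\<in>b. scale V (V.representation b x e) e)"
          by (simp add: ex)
        then show "scale V (\<psi> y) x = (\<Sum>e\<in>b. scale V (\<psi> y * V.representation b x e) e)"
          by (simp add: V.scale_sum_right)
      qed
      moreover have "sw zs (\<lambda>x y. scale V (f x y) e) = scale V (sw zs f) e"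
        for zs :: "('a \<times> 'c) list" and f e by (induction zs) (auto simp: V.scale_left_distrib)
      ultimately have z: "(\<Sum>e\<in>b. scale V (sw xs (\<lambda>x y. \<psi> y * V.representation b x e)) e) = 0"
        by (simp add: sws)
      have "sw xs (\<lambda>x y. \<psi> y * V.representation b x e) = 0"
        using V.independentD[OF b(2) fb subset_refl z \<open>e \<in> b\<close>] .
      moreover have "\<psi> (w e) = sw xs (\<lambda>x y. \<psi> (scale W (V.representation b x e) y))"
        unfolding w_def
        by (rule linear_on_sw[OF l\<psi> W]) (use xs W.subspace_scale[OF sW] in auto)
      moreover have "\<dots> = sw xs (\<lambda>x y. \<psi> y * V.representation b x e)"
        by (rule sw_cong) (use xs linear_onD(3)[OF l\<psi>] in auto)
      ultimately show ?thesis by simp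
    qed
    then show ?thesis using Q wW by (auto simp: separating_def)
  qed
  then show ?thesis unfolding tb by (simp add: tens_0)
qed

definition tensor_forms ::
  "('k::field, 'a::ab_group_add, 'x) vspace_scheme \<Rightarrow> ('k, 'c::ab_group_add, 'y) vspace_scheme
    \<Rightarrow> ('a \<Rightarrow> 'k) set \<Rightarrow> ('c \<Rightarrow> 'k) set \<Rightarrow> (('a, 'c, 'k) tensor \<Rightarrow> 'k) set" where
  "tensor_forms V W P Q = (\<lambda>(\<phi>, \<psi>) t. sw (rep V W t) (\<lambda>v w. \<phi> v * \<psi> w)) ` (P \<times> Q)"

lemma separating_tensor:
  fixes V :: "('k::field, 'a::ab_group_add, 'x) vspace_scheme"
    and W :: "('k, 'c::ab_group_add, 'y) vspace_scheme"
  assumes V: "is_space V" and W: "is_space W" and P: "separating V P" and Q: "separating W Q"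
  shows "separating (tensor_space V W) (tensor_forms V W P Q)"
  unfolding separating_def
proof (intro conjI ballI impI)
  fix F assume "F \<in> tensor_forms V W P Q"
  then obtain \<phi> \<psi> where "F = (\<lambda>t. sw (rep V W t) (\<lambda>v w. \<phi> v * \<psi> w))" "\<phi> \<in> P" "\<psi> \<in> Q"
    by (auto simp: tensor_forms_def)
  then show "linear_on (tensor_space V W) ground F"
    using P Q by (auto simp: separating_def intro!: linear_on_sw_rep V W bilinear_on_mult)
next
  fix t assume t: "t \<in> carrier (tensor_space V W)" "\<forall>F\<in>tensor_forms V W P Q. F t = 0"
  show "t = 0"
  proof (rule tensor_eq_0[OF V W P Q t(1)])
    fix \<phi> \<psi> assume "\<phi> \<in> P" "\<psi> \<in> Q"
    then have "(\<lambda>t. sw (rep V W t) (\<lambda>v w. \<phi> v * \<psi> w)) \<in> tensor_forms V W P Q"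
      by (force simp: tensor_forms_def)
    from t(2)[rule_format, OF this] show "sw (rep V W t) (\<lambda>v w. \<phi> v * \<psi> w) = 0" .
  qed
qed

lemma tensor_eqI:
  fixes V :: "('k::field, 'a::ab_group_add, 'x) vspace_scheme"
    and W :: "('k, 'c::ab_group_add, 'y) vspace_scheme"
  assumes "is_space V" "is_space W" "separating V P" "separating W Q"
    and "t \<in> carrier (tensor_space V W)" "t' \<in> carrier (tensor_space V W)"
    and "\<And>\<phi> \<psi>. \<phi> \<in> P \<Longrightarrow> \<psi> \<in> Q \<Longrightarrow>
      sw (rep V W t) (\<lambda>v w. \<phi> v * \<psi> w) = sw (rep V W t') (\<lambda>v w. \<phi> v * \<psi> w)"
  shows "t = t'"
proof (rule separating_eqI[OF separating_tensor[OF assms(1-4)] is_space_tensor_space assms(5,6)])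
  fix F assume "F \<in> tensor_forms V W P Q"
  then show "F t = F t'" using assms(7) by (auto simp: tensor_forms_def)
qed



subsection \<open>Braided bialgebras with antipode in terms of multilinear forms\<close>

text \<open>\<open>D x\<close> lists the terms of the coproduct of \<open>x\<close>, and \<open>C x y\<close> those of the braiding applied to
  \<open>x \<otimes> y\<close>, whose first components are the images of \<open>y\<close>.\<close>

locale braided_forms =
  fixes s :: "'k::field \<Rightarrow> 'a::ring_1 \<Rightarrow> 'a"
    and D :: "'a \<Rightarrow> ('a \<times> 'a) list" and C :: "'a \<Rightarrow> 'a \<Rightarrow> ('a \<times> 'a) list"
    and e :: "'a \<Rightarrow> 'k" and S :: "'a \<Rightarrow> 'a"
  assumes mult_left: "lmap s s (\<lambda>x. x * y)" and mult_right: "lmap s s (\<lambda>y. x * y)"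
    and e: "lform s e" and S: "lmap s s S"
    and D: "bform s s \<beta> \<Longrightarrow> lform s (\<lambda>x. sw (D x) \<beta>)"
    and C_left: "bform s s \<beta> \<Longrightarrow> lform s (\<lambda>x. sw (C x y) \<beta>)"
    and C_right: "bform s s \<beta> \<Longrightarrow> lform s (\<lambda>y. sw (C x y) \<beta>)"
    and coassoc: "tform s s s \<gamma> \<Longrightarrow>
      sw (D x) (\<lambda>a b. sw (D a) (\<lambda>c d. \<gamma> c d b)) = sw (D x) (\<lambda>a b. sw (D b) (\<lambda>c d. \<gamma> a c d))"
    and counit_left: "lform s \<phi> \<Longrightarrow> sw (D x) (\<lambda>a b. e a * \<phi> b) = \<phi> x"
    and counit_right: "lform s \<phi> \<Longrightarrow> sw (D x) (\<lambda>a b. e b * \<phi> a) = \<phi> x"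
    and D_mult: "bform s s \<beta> \<Longrightarrow> sw (D (x * y)) \<beta> =
      sw (D x) (\<lambda>x1 x2. sw (D y) (\<lambda>y1 y2. sw (C x2 y1) (\<lambda>u v. \<beta> (x1 * u) (v * y2))))"
    and D_one: "bform s s \<beta> \<Longrightarrow> sw (D 1) \<beta> = \<beta> 1 1"
    and e_mult: "e (x * y) = e x * e y" and e_one: "e 1 = 1"
    and antipode_left: "lform s \<phi> \<Longrightarrow> sw (D x) (\<lambda>a b. \<phi> (S a * b)) = e x * \<phi> 1"
    and antipode_right: "lform s \<phi> \<Longrightarrow> sw (D x) (\<lambda>a b. \<phi> (a * S b)) = e x * \<phi> 1"
    and C_mult_left: "bform s s \<beta> \<Longrightarrow> sw (C (x * x') y) \<beta> =
      sw (C x' y) (\<lambda>y' z'. sw (C x y') (\<lambda>y'' z. \<beta> y'' (z * z')))"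
    and C_mult_right: "bform s s \<beta> \<Longrightarrow> sw (C x (y * y')) \<beta> =
      sw (C x y) (\<lambda>z x1. sw (C x1 y') (\<lambda>z' x2. \<beta> (z * z') x2))"
    and C_D_left: "tform s s s \<gamma> \<Longrightarrow> sw (C x y) (\<lambda>u v. sw (D u) (\<lambda>u1 u2. \<gamma> u1 u2 v)) =
      sw (D y) (\<lambda>y1 y2. sw (C x y1) (\<lambda>u1 x1. sw (C x1 y2) (\<lambda>u2 v. \<gamma> u1 u2 v)))"
    and C_D_right: "tform s s s \<gamma> \<Longrightarrow> sw (C x y) (\<lambda>u v. sw (D v) (\<lambda>v1 v2. \<gamma> u v1 v2)) =
      sw (D x) (\<lambda>x1 x2. sw (C x2 y) (\<lambda>y' v2. sw (C x1 y') (\<lambda>u v1. \<gamma> u v1 v2)))"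
    and C_e_left: "lform s \<phi> \<Longrightarrow> sw (C x y) (\<lambda>u v. e u * \<phi> v) = e y * \<phi> x"
    and C_e_right: "lform s \<phi> \<Longrightarrow> sw (C x y) (\<lambda>u v. e v * \<phi> u) = e x * \<phi> y"
    and C_one_left: "bform s s \<beta> \<Longrightarrow> sw (C 1 y) \<beta> = \<beta> y 1"
    and C_one_right: "bform s s \<beta> \<Longrightarrow> sw (C x 1) \<beta> = \<beta> 1 x"
    and C_S_left: "bform s s \<beta> \<Longrightarrow> sw (C (S x) y) \<beta> = sw (C x y) (\<lambda>u v. \<beta> u (S v))"
    and C_S_right: "bform s s \<beta> \<Longrightarrow> sw (C x (S y)) \<beta> = sw (C x y) (\<lambda>u v. \<beta> (S u) v)"
    and C_braid: "tform s s s \<gamma> \<Longrightarrow>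
      sw (C x y) (\<lambda>y1 x1. sw (C x1 z) (\<lambda>z1 x2. sw (C y1 z1) (\<lambda>z2 y2. \<gamma> z2 y2 x2))) =
      sw (C y z) (\<lambda>z1 y1. sw (C x z1) (\<lambda>z2 x1. sw (C x1 y1) (\<lambda>y2 x2. \<gamma> z2 y2 x2)))"
begin

lemmas lmap_mult_left [lin] = lmap_comp[OF mult_left]
lemmas lmap_mult_right [lin] = lmap_comp[OF mult_right]
lemmas lmap_S [lin] = lmap_comp[OF S]
lemmas lform_e [lin] = lform_comp[OF e]

lemma lform_D [lin]: "bform s s \<beta> \<Longrightarrow> lmap r s g \<Longrightarrow> lform r (\<lambda>x. sw (D (g x)) \<beta>)"
  and lform_C_left [lin]: "bform s s \<beta> \<Longrightarrow> lmap r s g \<Longrightarrow> lform r (\<lambda>x. sw (C (g x) y) \<beta>)"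
  and lform_C_right [lin]: "bform s s \<beta> \<Longrightarrow> lmap r s g \<Longrightarrow> lform r (\<lambda>x. sw (C y (g x)) \<beta>)"
  by (rule lform_comp[OF D] lform_comp[OF C_left] lform_comp[OF C_right]; assumption)+

text \<open>In the braided tensor product algebra this reads \<open>\<Sigma> \<Delta>(S h\<^sub>1) (h\<^sub>2 \<otimes> 1) = 1 \<otimes> S h\<close>: both sides
  become \<open>h \<otimes> 1\<close> when multiplied from the left, in the sense of convolution, by \<open>\<Delta>\<close>.\<close>

lemma comult_antipode_right:
  assumes \<xi>: "bform s s \<xi>"
  shows "sw (D h) (\<lambda>h1 h2. sw (D (S h1)) (\<lambda>s1 s2. sw (C s2 h2) (\<lambda>k u. \<xi> (s1 * k) u))) = \<xi> 1 (S h)"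
proof -
  note [lin] = bform_left[OF \<xi>] bform_right[OF \<xi>]
  \<comment> \<open>\<open>w\<close> is a slot for a right factor 1 \<otimes> w. Filling it with
    \<open>b1 * S b2\<close>, which sums to a counit, supplies the second leg \<open>b1\<close> that
    completes \<open>a\<close> to a full coproduct; multiplicativity of \<Delta> then
    applies.\<close>
  let ?Q = "\<lambda>y z w. sw (D y) (\<lambda>s1 s2. sw (C s2 z) (\<lambda>k u. \<xi> (s1 * k) (u * w)))"
  let ?G = "\<lambda>t b. sw (D t) (\<lambda>p q. \<xi> p (q * S b))"
  have 1: "?Q y a 1 * e b = sw (D b) (\<lambda>b1 b2. ?Q y a (b1 * S b2))" for y a b
    by (subst antipode_right) (intro lin, simp)
  have 2: "?Q y z 1 = sw (D z) (\<lambda>a b. sw (D b) (\<lambda>b1 b2. ?Q y a (b1 * S b2)))" for y z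
    unfolding 1[symmetric] by (subst mult.commute, subst counit_right) (intro lin, simp)
  have 3: "sw (D z) (\<lambda>a b. sw (D b) (\<lambda>b1 b2. ?Q y a (b1 * S b2))) =
      sw (D z) (\<lambda>z' b2. sw (D z') (\<lambda>a b1. ?Q y a (b1 * S b2)))" for y z
    by (rule coassoc[symmetric]) (intro lin)
  have 4: "sw (D z) (\<lambda>a b1. ?Q y a (b1 * w)) = sw (D (y * z)) (\<lambda>p q. \<xi> p (q * w))" for y z w
    by (subst D_mult, intro lin) (subst sw_swap, simp add: mult.assoc)
  have "sw (D h) (\<lambda>h1 h2. sw (D (S h1)) (\<lambda>s1 s2. sw (C s2 h2) (\<lambda>k u. \<xi> (s1 * k) u))) =
      sw (D h) (\<lambda>h1 h2. ?Q (S h1) h2 1)" by simp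
  also have "\<dots> = sw (D h) (\<lambda>h1 h'. sw (D h') (\<lambda>z b2. ?G (S h1 * z) b2))"
    unfolding 2 3 4 ..
  also have "\<dots> = sw (D h) (\<lambda>c b2. sw (D c) (\<lambda>h1 z. ?G (S h1 * z) b2))"
    by (rule coassoc[symmetric]) (intro lin)
  also have "\<dots> = sw (D h) (\<lambda>c b2. e c * ?G 1 b2)"
    by (subst antipode_left) (intro lin, simp)
  also have "\<dots> = ?G 1 h"
    by (rule counit_left) (intro lin)
  also have "\<dots> = \<xi> 1 (S h)"
    by (subst D_one) (intro lin, simp)
  finally show ?thesis .
qed

text \<open>Similarly \<open>\<Sigma> (1 \<otimes> h\<^sub>1) \<Delta>(S h\<^sub>2) = S h \<otimes> 1\<close>.\<close>

lemma comult_antipode_left: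
  assumes \<zeta>: "bform s s \<zeta>"
  shows "sw (D h) (\<lambda>q m. sw (D (S m)) (\<lambda>s1 s2. sw (C q s1) (\<lambda>u v. \<zeta> u (v * s2)))) = \<zeta> (S h) 1"
proof -
  note [lin] = bform_left[OF \<zeta>] bform_right[OF \<zeta>]
  let ?Q = "\<lambda>w z y. sw (D y) (\<lambda>s1 s2. sw (C z s1) (\<lambda>u v. \<zeta> (w * u) (v * s2)))"
  let ?G = "\<lambda>a t. sw (D t) (\<lambda>p q. \<zeta> (S a * p) q)"
  have 1: "e a * ?Q 1 b t = sw (D a) (\<lambda>a1 a2. ?Q (S a1 * a2) b t)" for a b t
    by (subst antipode_left) (intro lin, simp)
  have 2: "?Q 1 q t = sw (D q) (\<lambda>a b. sw (D a) (\<lambda>a1 a2. ?Q (S a1 * a2) b t))" for q t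
    unfolding 1[symmetric] by (subst counit_left) (intro lin, simp)
  have 3: "sw (D q) (\<lambda>a b. sw (D a) (\<lambda>a1 a2. ?Q (S a1 * a2) b t)) =
      sw (D q) (\<lambda>a1 b. sw (D b) (\<lambda>a2 b2. ?Q (S a1 * a2) b2 t))" for q t
    by (rule coassoc) (intro lin)
  have 4: "sw (D b) (\<lambda>a2 b2. ?Q (w * a2) b2 t) = sw (D (b * t)) (\<lambda>p q. \<zeta> (w * p) q)" for b w t
    by (subst D_mult, intro lin) (simp add: mult.assoc)
  have "sw (D h) (\<lambda>q m. sw (D (S m)) (\<lambda>s1 s2. sw (C q s1) (\<lambda>u v. \<zeta> u (v * s2)))) =
      sw (D h) (\<lambda>q m. ?Q 1 q (S m))" by simp
  also have "\<dots> = sw (D h) (\<lambda>q m. sw (D q) (\<lambda>a1 b. ?G a1 (b * S m)))"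
    unfolding 2 3 4 ..
  also have "\<dots> = sw (D h) (\<lambda>a1 q. sw (D q) (\<lambda>b m. ?G a1 (b * S m)))"
    by (rule coassoc) (intro lin)
  also have "\<dots> = sw (D h) (\<lambda>a1 q. e q * ?G a1 1)"
    by (subst antipode_right) (intro lin, simp)
  also have "\<dots> = ?G h 1"
    by (rule counit_right) (intro lin)
  also have "\<dots> = \<zeta> (S h) 1"
    by (subst D_one) (intro lin, simp)
  finally show ?thesis .
qed

text \<open>Both sides are convolution inverse to the multiplication.\<close>

lemma antipode_mult:
  assumes \<phi>: "lform s \<phi>"
  shows "\<phi> (S (x * y)) = sw (C x y) (\<lambda>u v. \<phi> (S u * S v))"
proof -
  note [lin] = lform_comp[OF \<phi>]
  \<comment> \<open>The multiplication convolved on the right with the claimed value,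
    \<open>S u * S v\<close> after a braiding, is the counit. The prefix \<open>w\<close> allows
    this to be inserted behind another factor.\<close>
  have P: "sw (D x) (\<lambda>p q. sw (D y) (\<lambda>c d. sw (C q c) (\<lambda>b k. sw (C k d) (\<lambda>i j. \<phi> (w * (p * b) * (S i * S j))))))
      = e x * (e y * \<phi> w)" (is "?lhs = _") for w x y
  proof -
    have "?lhs = sw (D x) (\<lambda>p q. sw (C q y) (\<lambda>u j. sw (D u) (\<lambda>b i. \<phi> (w * (p * b) * (S i * S j)))))"
      by (subst C_D_left) (intro lin, simp)
    also have "\<dots> = sw (D x) (\<lambda>p q. sw (C q y) (\<lambda>u j. e u * \<phi> (w * p * S j)))"
    proof -
      have "sw (D u) (\<lambda>b i. \<phi> (w * (p * b) * (S i * S j))) = e u * \<phi> (w * p * S j)" for p u j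
        using antipode_right[of "\<lambda>t. \<phi> (w * p * t * S j)" u]
        by (simp add: mult.assoc) (rule meta_mp, assumption, intro lin)
      then show ?thesis by simp
    qed
    also have "\<dots> = sw (D x) (\<lambda>p q. e y * \<phi> (w * p * S q))"
      by (subst C_e_left) (intro lin, simp)
    also have "\<dots> = e y * sw (D x) (\<lambda>p q. \<phi> (w * (p * S q)))"
      by (simp add: sw_mult_left mult.assoc)
    also have "\<dots> = e x * (e y * \<phi> w)"
      by (subst antipode_right) (intro lin, simp)
    finally show ?thesis .
  qed
  have "\<phi> (S (x * y)) = sw (D x) (\<lambda>a b. e b * \<phi> (S (a * y)))"
    by (subst counit_right) (intro lin, simp)
  also have "\<dots> = sw (D x) (\<lambda>a b. sw (D y) (\<lambda>c d. e d * (e b * \<phi> (S (a * c)))))"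
    by (subst counit_right) (intro lin, simp)
  also have "\<dots> = sw (D x) (\<lambda>a b. sw (D y) (\<lambda>c d. e d * sw (C b c) (\<lambda>u v. e v * \<phi> (S (a * u)))))"
    by (subst C_e_right) (intro lin, simp)
  also have "\<dots> = sw (D x) (\<lambda>a b. sw (D y) (\<lambda>c d. sw (C b c) (\<lambda>u v. e v * (e d * \<phi> (S (a * u))))))"
    by (simp add: sw_mult_left[symmetric] mult.left_commute)
  \<comment> \<open>The counits of \<open>v\<close> and \<open>d\<close> are expanded backwards by
    \<open>P\<close> with prefix \<open>S (a * u)\<close>. The remaining steps regroup the terms so
    that this antipode cancels against the multiplication instead.\<close>
  also have "\<dots> = sw (D x) (\<lambda>a b. sw (D y) (\<lambda>c d. sw (C b c) (\<lambda>u v. sw (D v) (\<lambda>p q. sw (D d) (\<lambda>m n.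
      sw (C q m) (\<lambda>b k. sw (C k n) (\<lambda>i j. \<phi> (S (a * u) * (p * b) * (S i * S j)))))))))"
    unfolding P ..
  also have "\<dots> = sw (D x) (\<lambda>a b. sw (D y) (\<lambda>c d. sw (D b) (\<lambda>x1 x2. sw (C x2 c) (\<lambda>y' v2. sw (C x1 y') (\<lambda>u v1.
      sw (D d) (\<lambda>m n. sw (C v2 m) (\<lambda>b k. sw (C k n) (\<lambda>i j. \<phi> (S (a * u) * (v1 * b) * (S i * S j))))))))))"
    by (subst C_D_right) (intro lin, simp)
  also have "\<dots> = sw (D x) (\<lambda>a b. sw (D b) (\<lambda>x1 x2. sw (D y) (\<lambda>c d. sw (D d) (\<lambda>m n. sw (C x2 c) (\<lambda>y' v2.
      sw (C v2 m) (\<lambda>b k. sw (C x1 y') (\<lambda>u v1. sw (C k n) (\<lambda>i j. \<phi> (S (a * u) * (v1 * b) * (S i * S j))))))))))"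
    by (intro sw_cong, subst sw_swap, intro sw_cong, subst sw_swap3, intro sw_cong, rule sw_swap)
  also have "\<dots> = sw (D x) (\<lambda>z x2. sw (D z) (\<lambda>a x1. sw (D y) (\<lambda>w n. sw (D w) (\<lambda>c m. sw (C x2 c) (\<lambda>y' v2.
      sw (C v2 m) (\<lambda>b k. sw (C x1 y') (\<lambda>u v1. sw (C k n) (\<lambda>i j. \<phi> (S (a * u) * (v1 * b) * (S i * S j))))))))))"
    by (subst (2) coassoc[symmetric], intro lin) (rule coassoc[symmetric], intro lin)
  also have "\<dots> = sw (D x) (\<lambda>z x2. sw (D z) (\<lambda>a x1. sw (D y) (\<lambda>w n. sw (C x2 w) (\<lambda>t k. sw (D t) (\<lambda>y' b.
      sw (C x1 y') (\<lambda>u v1. sw (C k n) (\<lambda>i j. \<phi> (S (a * u) * (v1 * b) * (S i * S j)))))))))"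
    by (subst C_D_left) (intro lin, simp)
  also have "\<dots> = sw (D x) (\<lambda>z x2. sw (D y) (\<lambda>w n. sw (C x2 w) (\<lambda>t k. sw (C k n) (\<lambda>i j. sw (D z) (\<lambda>a x1.
      sw (D t) (\<lambda>y' b. sw (C x1 y') (\<lambda>u v1. \<phi> (S (a * u) * (v1 * b) * (S i * S j)))))))))"
    by (intro sw_cong, subst sw_swap, intro sw_cong, subst sw_swap, intro sw_cong, rule sw_swap4)
  \<comment> \<open>By now \<open>a * u\<close> and \<open>v1 * b\<close> are the two legs of the
    coproduct of \<open>z * t\<close>, so the antipode axiom can be applied to that product as a
    whole.\<close>
  also have "\<dots> = sw (D x) (\<lambda>z x2. sw (D y) (\<lambda>w n. sw (C x2 w) (\<lambda>t k. sw (C k n) (\<lambda>i j.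
      sw (D (z * t)) (\<lambda>p q. \<phi> (S p * q * (S i * S j)))))))"
    by (subst D_mult) (intro lin, simp)
  also have "\<dots> = sw (D x) (\<lambda>z x2. sw (D y) (\<lambda>w n. sw (C x2 w) (\<lambda>t k. e t * (e z * sw (C k n) (\<lambda>i j. \<phi> (S i * S j))))))"
  proof -
    have "sw (D (z * t)) (\<lambda>p q. \<phi> (S p * q * (S i * S j))) = e t * (e z * \<phi> (S i * S j))" for z t i j
      by (subst antipode_left[of "\<lambda>u. \<phi> (u * (S i * S j))"], intro lin) (simp add: e_mult mult_ac)
    then show ?thesis by (simp add: sw_mult_left)
  qed
  also have "\<dots> = sw (D x) (\<lambda>z x2. e z * sw (D y) (\<lambda>w n. e w * sw (C x2 n) (\<lambda>i j. \<phi> (S i * S j))))"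
    by (subst C_e_left, intro lin) (simp add: sw_mult_left mult.left_commute)
  also have "\<dots> = sw (D x) (\<lambda>z x2. e z * sw (C x2 y) (\<lambda>i j. \<phi> (S i * S j)))"
    by (subst (2) counit_left, intro lin) simp
  also have "\<dots> = sw (C x y) (\<lambda>i j. \<phi> (S i * S j))"
    by (subst counit_left, intro lin) simp
  finally show ?thesis .
qed

text \<open>For f \<leftharpoonup> h = f(m C(S h \<otimes> -)) this is f \<leftharpoonup> hk = (f
  \<leftharpoonup> h) \<leftharpoonup> k. The antipode reverses a product up to one braiding, and
  the braid relation carries \<open>x\<close> past both factors in the order required.\<close>

lemma antipode_mult_braided:
  assumes f: "lform s f"
  shows "sw (C (S (h * k)) x) (\<lambda>a b. f (a * b)) =
    sw (C (S k) x) (\<lambda>a b. sw (C (S h) (a * b)) (\<lambda>c d. f (c * d)))"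
proof -
  note [lin] = lform_comp[OF f]
  have "sw (C (S (h * k)) x) (\<lambda>a b. f (a * b)) =
      sw (C h k) (\<lambda>u v. sw (C (S u * S v) x) (\<lambda>a b. f (a * b)))"
    by (rule antipode_mult[of "\<lambda>t. sw (C t x) (\<lambda>a b. f (a * b))"]) (intro lin)
  also have "\<dots> = sw (C (S h) (S k)) (\<lambda>u v. sw (C (u * v) x) (\<lambda>a b. f (a * b)))"
    by (subst C_S_left, intro lin, subst C_S_right, intro lin) simp
  also have "\<dots> = sw (C (S h) (S k)) (\<lambda>u v. sw (C v x) (\<lambda>y' z'. sw (C u y') (\<lambda>y'' z. f (y'' * (z * z')))))"
    by (subst C_mult_left) (intro lin, simp)
  also have "\<dots> = sw (C (S k) x) (\<lambda>a b. sw (C (S h) a) (\<lambda>z x1. sw (C x1 b) (\<lambda>z' x2. f (z * (z' * x2)))))"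
    by (rule C_braid) (intro lin)
  also have "\<dots> = sw (C (S k) x) (\<lambda>a b. sw (C (S h) (a * b)) (\<lambda>c d. f (c * d)))"
    by (subst C_mult_right, intro lin) (simp add: mult.assoc)
  finally show ?thesis .
qed

end

section \<open>Consequences of C^2 = 1\<close>

locale symmetric_forms = braided_forms +
  assumes C_inv: "bform s s \<beta> \<Longrightarrow> sw (C x y) (\<lambda>u v. sw (C u v) \<beta>) = \<beta> x y"
begin

text \<open>With \<Delta>' = C \<Delta> this reads (id \<otimes> \<Delta>) \<Delta>' = (id \<otimes>
  C) (\<Delta>' \<otimes> id) \<Delta>'. Naturality and the braid relation bring two braidings of
  the same pair together; they cancel, and ordinary coassociativity remains. It later yields
  coassociativity of the rational coaction.\<close>

lemma braided_copy:
  assumes \<gamma>: "tform s s s \<gamma>"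
  shows "sw (D x) (\<lambda>x1 x2. sw (C x1 x2) (\<lambda>a c. sw (D c) (\<lambda>c1 c2. \<gamma> a c1 c2))) =
    sw (D x) (\<lambda>x1 x2. sw (C x1 x2) (\<lambda>p q. sw (D p) (\<lambda>p1 p2. sw (C p1 p2) (\<lambda>a c.
      sw (C c q) (\<lambda>b v. \<gamma> a b v)))))"
proof -
  note [lin] = tform_1[OF \<gamma>] tform_2[OF \<gamma>] tform_3[OF \<gamma>]
  have "sw (D x) (\<lambda>x1 x2. sw (C x1 x2) (\<lambda>p q. sw (D p) (\<lambda>p1 p2. sw (C p1 p2) (\<lambda>a c. sw (C c q) (\<lambda>b v. \<gamma> a b v)))))
    = sw (D x) (\<lambda>x1 x2. sw (D x2) (\<lambda>y1 y2. sw (C x1 y1) (\<lambda>u1 w. sw (C w y2) (\<lambda>u2 v.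
        sw (C u1 u2) (\<lambda>a c. sw (C c v) (\<lambda>b v'. \<gamma> a b v'))))))"
    by (subst C_D_left) (intro lin, simp)
  also have "\<dots> = sw (D x) (\<lambda>x1 x2. sw (D x2) (\<lambda>y1 y2. sw (C y1 y2) (\<lambda>z1 t. sw (C x1 z1) (\<lambda>a x'. \<gamma> a x' t))))"
    by (subst C_braid, intro lin, subst C_inv) (intro lin, simp)
  also have "\<dots> = sw (D x) (\<lambda>z y2. sw (D z) (\<lambda>x1 y1. sw (C y1 y2) (\<lambda>z1 t. sw (C x1 z1) (\<lambda>a x'. \<gamma> a x' t))))"
    by (rule coassoc[symmetric]) (intro lin)
  also have "\<dots> = sw (D x) (\<lambda>x1 x2. sw (C x1 x2) (\<lambda>a c. sw (D c) (\<lambda>c1 c2. \<gamma> a c1 c2)))"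
    by (subst C_D_right) (intro lin, simp)
  finally show ?thesis ..
qed

text \<open>Coassociativity of C \<Delta>, the dual of associativity of H*: one further braiding
  applied to \<open>braided_copy\<close> cancels the extra one there.\<close>

lemma braided_coassoc:
  assumes \<gamma>: "tform s s s \<gamma>"
  shows "sw (D x) (\<lambda>x1 x2. sw (C x1 x2) (\<lambda>a c. sw (D c) (\<lambda>c1 c2. sw (C c1 c2) (\<lambda>b v. \<gamma> a b v)))) =
    sw (D x) (\<lambda>x1 x2. sw (C x1 x2) (\<lambda>p q. sw (D p) (\<lambda>p1 p2. sw (C p1 p2) (\<lambda>a c. \<gamma> a c q))))"
proof -
  note [lin] = tform_1[OF \<gamma>] tform_2[OF \<gamma>] tform_3[OF \<gamma>]
  show ?thesis by (subst braided_copy, intro lin, subst C_inv) (intro lin, simp)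
qed

text \<open>This is \<open>comult_antipode_right\<close> multiplied from the left by \<Delta>(x) in
  the braided tensor product algebra. The fact \<open>1\<close> in the proof is associativity of
  that algebra, for the case at hand.\<close>

lemma antipode_shift:
  assumes \<chi>: "bform s s \<chi>"
  shows "sw (D x) (\<lambda>x1 x2. \<chi> x1 (x2 * S h)) =
    sw (D h) (\<lambda>h1 h2. sw (D (x * S h1)) (\<lambda>y1 y2. sw (C y2 h2) (\<lambda>k u. \<chi> (y1 * k) u)))"
proof -
  note [lin] = bform_left[OF \<chi>] bform_right[OF \<chi>]
  let ?X = "\<lambda>x1 x2 w z'. sw (C x2 w) (\<lambda>w' z. \<chi> (x1 * w') (z * z'))"
  have 1: "sw (C x2 s1) (\<lambda>u v. sw (C (v * s2) h2) (\<lambda>k w. \<chi> (x1 * u * k) w)) =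
      sw (C s2 h2) (\<lambda>k z'. ?X x1 x2 (s1 * k) z')" for x1 x2 s1 s2 h2
  proof -
    have "sw (C x2 s1) (\<lambda>u v. sw (C (v * s2) h2) (\<lambda>k w. \<chi> (x1 * u * k) w)) =
        sw (C x2 s1) (\<lambda>u v. sw (C s2 h2) (\<lambda>k z'. sw (C v k) (\<lambda>k' z. \<chi> (x1 * u * k') (z * z'))))"
      by (subst C_mult_left) (intro lin, simp)
    also have "\<dots> = sw (C s2 h2) (\<lambda>k z'. sw (C x2 s1) (\<lambda>u v. sw (C v k) (\<lambda>k' z. \<chi> (x1 * (u * k')) (z * z'))))"
      by (subst sw_swap) (simp add: mult.assoc)
    also have "\<dots> = sw (C s2 h2) (\<lambda>k z'. ?X x1 x2 (s1 * k) z')"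
      by (subst C_mult_right) (intro lin, simp)
    finally show ?thesis .
  qed
  have "sw (D h) (\<lambda>h1 h2. sw (D (x * S h1)) (\<lambda>y1 y2. sw (C y2 h2) (\<lambda>k u. \<chi> (y1 * k) u))) =
      sw (D h) (\<lambda>h1 h2. sw (D x) (\<lambda>x1 x2. sw (D (S h1)) (\<lambda>s1 s2. sw (C s2 h2) (\<lambda>k z'. ?X x1 x2 (s1 * k) z'))))"
    by (subst D_mult, intro lin) (simp only: 1)
  also have "\<dots> = sw (D x) (\<lambda>x1 x2. sw (D h) (\<lambda>h1 h2. sw (D (S h1)) (\<lambda>s1 s2. sw (C s2 h2) (\<lambda>k z'. ?X x1 x2 (s1 * k) z'))))"
    by (rule sw_swap)
  also have "\<dots> = sw (D x) (\<lambda>x1 x2. ?X x1 x2 1 (S h))"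
    by (subst comult_antipode_right) (intro lin, simp)
  also have "\<dots> = sw (D x) (\<lambda>x1 x2. \<chi> x1 (x2 * S h))"
    by (subst C_one_right) (intro lin, simp)
  finally show ?thesis ..
qed

text \<open>For \<open>f \<leftharpoonup> h = f (m C (S h \<otimes> -))\<close> this is the compatibility of \<open>\<leftharpoonup>\<close> with the coaction of \<open>H\<close>
  on the rational part of \<open>H*\<close>. Moving the braidings to the outside turns it into the identity
  \<open>\<Delta>(x) (1 \<otimes> S h) = \<Sigma> \<Delta>(x S(h\<^sub>1)) (h\<^sub>2 \<otimes> 1)\<close>.\<close>

lemma braided_antipode_shift:
  assumes \<psi>: "bform s s \<psi>"
  shows "sw (D x) (\<lambda>x1 x2. sw (C x1 x2) (\<lambda>u v. sw (C (S h) u) (\<lambda>a b. \<psi> (a * b) v))) =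
    sw (D h) (\<lambda>h1 h2. sw (C h2 x) (\<lambda>x' h2'. sw (C (S h1) x') (\<lambda>a b. sw (D (a * b)) (\<lambda>y1 y2.
      sw (C y1 y2) (\<lambda>u v. \<psi> u (v * h2'))))))" (is "?F h x = ?G h x")
proof -
  note [lin] = bform_left[OF \<psi>] bform_right[OF \<psi>]
  let ?T = "\<lambda>t h2. sw (D t) (\<lambda>y1 y2. sw (C y1 y2) (\<lambda>u v. \<psi> u (v * h2)))"
  have SC: "sw (C p k) (\<lambda>z y. sw (C (S z) y) (\<lambda>a b. \<beta> a b)) = \<beta> p (S k)" if \<beta>: "bform s s \<beta>" for p k \<beta>
  proof -
    note [lin] = bform_left[OF \<beta>] bform_right[OF \<beta>]
    show ?thesis by (subst C_S_left, intro lin, subst C_inv) (intro lin, simp)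
  qed
  \<comment> \<open>Both sides are compared after precomposition with the braiding of
    \<open>x\<close> and \<open>h\<close>, which lets the inner braidings cancel or move outward.
    Nothing is lost, since a second braiding undoes it at the end.\<close>
  have F: "sw (C x h) (\<lambda>k x'. ?F k x') = sw (D x) (\<lambda>x1 x2. sw (C x1 (x2 * S h)) \<psi>)" for x h
  proof -
    have "sw (C x h) (\<lambda>k x'. ?F k x') = sw (D x) (\<lambda>x1 x2. sw (C x2 h) (\<lambda>k x2'. sw (C x1 k) (\<lambda>h' x1'.
        sw (C x1' x2') (\<lambda>u v. sw (C (S h') u) (\<lambda>a b. \<psi> (a * b) v)))))"
      by (subst C_D_right) (intro lin, simp)
    also have "\<dots> = sw (D x) (\<lambda>x1 x2. sw (C x1 x2) (\<lambda>p q. sw (C q h) (\<lambda>k v. sw (C p k) (\<lambda>z y.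
        sw (C (S z) y) (\<lambda>a b. \<psi> (a * b) v)))))"
      by (subst C_braid[symmetric]) (intro lin, simp)
    also have "\<dots> = sw (D x) (\<lambda>x1 x2. sw (C x1 x2) (\<lambda>p q. sw (C q h) (\<lambda>k v. \<psi> (p * S k) v)))"
      by (subst SC) (intro lin, simp)
    also have "\<dots> = sw (D x) (\<lambda>x1 x2. sw (C x1 (x2 * S h)) \<psi>)"
      by (subst C_mult_right, rule \<psi>, subst C_S_right) (intro lin, simp)
    finally show ?thesis .
  qed
  have G: "sw (C x h) (\<lambda>k x'. ?G k x') = sw (D h) (\<lambda>h1 h2. ?T (x * S h1) h2)" for x h
  proof -
    have "sw (C x h) (\<lambda>k x'. ?G k x') = sw (D h) (\<lambda>h1 h2. sw (C x h1) (\<lambda>u1 x1. sw (C x1 h2) (\<lambda>u2 v.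
        sw (C u2 v) (\<lambda>x' h2'. sw (C (S u1) x') (\<lambda>a b. ?T (a * b) h2')))))"
      by (subst C_D_left) (intro lin, simp)
    also have "\<dots> = sw (D h) (\<lambda>h1 h2. sw (C x h1) (\<lambda>u1 x1. sw (C (S u1) x1) (\<lambda>a b. ?T (a * b) h2)))"
      by (subst C_inv) (intro lin, simp)
    also have "\<dots> = sw (D h) (\<lambda>h1 h2. ?T (x * S h1) h2)"
      by (subst SC) (intro lin, simp)
    finally show ?thesis .
  qed
  have FG: "sw (C x h) (\<lambda>k x'. ?F k x') = sw (C x h) (\<lambda>k x'. ?G k x')" for x h
  proof -
    have "sw (C y2 h2) (\<lambda>k u. sw (C (y1 * k) u) \<psi>) = sw (C y1 y2) (\<lambda>u v. \<psi> u (v * h2))" for y1 y2 h2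
      by (subst C_mult_left, rule \<psi>, subst C_inv) (intro lin, simp)
    then show ?thesis unfolding F G
      by (subst antipode_shift, intro lin) simp
  qed
  have "?F h x = sw (C h x) (\<lambda>x' h'. sw (C x' h') (\<lambda>k x''. ?F k x''))"
    by (rule C_inv[symmetric]) (intro lin)
  also have "\<dots> = sw (C h x) (\<lambda>x' h'. sw (C x' h') (\<lambda>k x''. ?G k x''))"
    by (simp only: FG)
  also have "\<dots> = ?G h x"
    by (rule C_inv) (intro lin)
  finally show ?thesis .
qed

end



subsection \<open>Linear maps on carriers\<close>

named_theorems lon

lemma linear_onI [intro?]:
  "(\<And>x. x \<in> carrier V \<Longrightarrow> f x \<in> carrier W) \<Longrightarrow>
   (\<And>x y. x \<in> carrier V \<Longrightarrow> y \<in> carrier V \<Longrightarrow> f (x + y) = f x + f y) \<Longrightarrow>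
   (\<And>c x. x \<in> carrier V \<Longrightarrow> f (scale V c x) = scale W c (f x)) \<Longrightarrow> linear_on V W f"
  by (auto simp: linear_on_def)

lemma bilinear_onI [lon]:
  "(\<And>x. x \<in> carrier V \<Longrightarrow> linear_on W U (\<lambda>y. \<beta> x y)) \<Longrightarrow> (\<And>y. y \<in> carrier W \<Longrightarrow> linear_on V U (\<lambda>x. \<beta> x y))
    \<Longrightarrow> bilinear_on V W U \<beta>"
  by (auto simp: bilinear_on_def)

lemma bilinear_onD1: "bilinear_on V W U \<beta> \<Longrightarrow> x \<in> carrier V \<Longrightarrow> linear_on W U (\<lambda>y. \<beta> x y)"
  by (auto simp: bilinear_on_def)

lemma bilinear_on_in: "bilinear_on V W U \<beta> \<Longrightarrow> x \<in> carrier V \<Longrightarrow> y \<in> carrier W \<Longrightarrow> \<beta> x y \<in> carrier U"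
  by (auto simp: bilinear_on_def linear_on_def)

lemma linear_on_comp: "linear_on W U f \<Longrightarrow> linear_on V W g \<Longrightarrow> linear_on V U (\<lambda>x. f (g x))"
  by (auto simp: linear_on_def)

lemma bilinear_on_comp1: "bilinear_on V W U \<beta> \<Longrightarrow> linear_on X V g \<Longrightarrow> y \<in> carrier W \<Longrightarrow> linear_on X U (\<lambda>x. \<beta> (g x) y)"
  by (auto simp: bilinear_on_def linear_on_def)

lemma bilinear_on_comp2: "bilinear_on V W U \<beta> \<Longrightarrow> linear_on X W g \<Longrightarrow> y \<in> carrier V \<Longrightarrow> linear_on X U (\<lambda>x. \<beta> y (g x))"
  by (auto simp: bilinear_on_def linear_on_def)

lemma linear_on_ident [lon]: "linear_on V V (\<lambda>x. x)"
  by (auto simp: linear_on_def)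

lemmas linear_on_tens_left [lon] = bilinear_on_comp1[OF bilinear_on_tens]
lemmas linear_on_tens_right [lon] = bilinear_on_comp2[OF bilinear_on_tens]

lemma sw_scale:
  "is_space U \<Longrightarrow> sw xs (\<lambda>a b. scale U c (F a b)) = scale U c (sw xs F)"
  by (induction xs) (auto simp: is_spaceD)

lemma linear_on_sum:
  assumes "is_space U" "\<And>a b. (a, b) \<in> set xs \<Longrightarrow> linear_on V U (\<lambda>x. F x a b)"
  shows "linear_on V U (\<lambda>x. sw xs (\<lambda>a b. F x a b))"
proof
  fix x y c assume x: "x \<in> carrier V"
  show "sw xs (\<lambda>a b. F x a b) \<in> carrier U"
    by (rule sw_in[OF assms(1)]) (use linear_onD(1)[OF assms(2) x] in blast)
  { assume y: "y \<in> carrier V"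
    show "sw xs (\<lambda>a b. F (x + y) a b) = sw xs (\<lambda>a b. F x a b) + sw xs (\<lambda>a b. F y a b)"
      unfolding sw_add[symmetric] by (rule sw_cong) (rule linear_onD(2)[OF assms(2) x y]) }
  show "sw xs (\<lambda>a b. F (scale V c x) a b) = scale U c (sw xs (\<lambda>a b. F x a b))"
    unfolding sw_scale[OF assms(1), symmetric] by (rule sw_cong) (rule linear_onD(3)[OF assms(2) x])
qed

lemma linear_on_sw_rep_comp:
  "is_space V \<Longrightarrow> is_space W \<Longrightarrow> is_space U \<Longrightarrow> bilinear_on V W U \<beta> \<Longrightarrow> linear_on X (tensor_space V W) g
    \<Longrightarrow> linear_on X U (\<lambda>x. sw (rep V W (g x)) (\<lambda>a b. \<beta> a b))"
  using linear_on_comp[OF linear_on_sw_rep] by blast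

text \<open>Here the parameter enters through the summand, in \<open>linear_on_sw_rep_comp\<close>
  through the tensor. Alternating the two proves linearity of nested sums by resolution.\<close>

lemma linear_on_sw_rep_body:
  assumes "is_space V" "is_space U" "t \<in> carrier (tensor_space V W)"
    "\<And>a b. a \<in> carrier V \<Longrightarrow> b \<in> carrier W \<Longrightarrow> linear_on X U (\<lambda>x. F x a b)"
  shows "linear_on X U (\<lambda>x. sw (rep V W t) (\<lambda>a b. F x a b))"
  by (rule linear_on_sum[OF assms(2)], rule assms(4)) (use rep_set[OF assms(1,3)] in auto)

lemma sw_rep_in:
  assumes "is_space V" "is_space U" "t \<in> carrier (tensor_space V W)"
    "\<And>a b. a \<in> carrier V \<Longrightarrow> b \<in> carrier W \<Longrightarrow> F a b \<in> carrier U"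
  shows "sw (rep V W t) F \<in> carrier U"
  by (rule sw_in[OF assms(2)], rule assms(4)) (use rep_set[OF assms(1,3)] in auto)

lemma sw_rep_cong:
  assumes "is_space V" "t \<in> carrier (tensor_space V W)"
    "\<And>a b. a \<in> carrier V \<Longrightarrow> b \<in> carrier W \<Longrightarrow> F a b = G a b"
  shows "sw (rep V W t) F = sw (rep V W t) G"
  by (rule sw_cong, rule assms(3)) (use rep_set[OF assms(1,2)] in auto)

lemma linear_on_sw_rep_out:
  assumes "linear_on U X f" "is_space V" "is_space U" "t \<in> carrier (tensor_space V W)"
    "\<And>a b. a \<in> carrier V \<Longrightarrow> b \<in> carrier W \<Longrightarrow> F a b \<in> carrier U"
  shows "f (sw (rep V W t) F) = sw (rep V W t) (\<lambda>a b. f (F a b))"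
  by (rule linear_on_sw[OF assms(1,3)], rule assms(5)) (use rep_set[OF assms(2,4)] in auto)

lemma bilinear_on_bform: "bform (scale V) (scale W) \<beta> \<Longrightarrow> bilinear_on V W ground \<beta>"
  by (auto simp: bilinear_on_def bform_def lmap_def linear_on_def)

text \<open>Coassociativity lives in V1 \<otimes> (V2 \<otimes> V3). This lift of a trilinear form
  turns it into a scalar identity between nested sums.\<close>

definition ev3 :: "('k::field, 'a::ab_group_add, 'x) vspace_scheme \<Rightarrow>
    ('k, 'c::ab_group_add, 'y) vspace_scheme \<Rightarrow> ('k, 'd::ab_group_add, 'z) vspace_scheme \<Rightarrow>
    ('a \<Rightarrow> 'c \<Rightarrow> 'd \<Rightarrow> 'k) \<Rightarrow> ('a, ('c, 'd, 'k) tensor, 'k) tensor \<Rightarrow> 'k" where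
  "ev3 V1 V2 V3 \<gamma> t = sw (rep V1 (tensor_space V2 V3) t) (\<lambda>x u. sw (rep V2 V3 u) (\<gamma> x))"

context
  fixes V1 :: "('k::field, 'a::ab_group_add, 'x) vspace_scheme"
    and V2 :: "('k, 'c::ab_group_add, 'y) vspace_scheme"
    and V3 :: "('k, 'd::ab_group_add, 'z) vspace_scheme"
    and \<gamma>
  assumes V: "is_space V1" "is_space V2" "is_space V3"
    and \<gamma>: "tform (scale V1) (scale V2) (scale V3) \<gamma>"
begin

lemma bilinear_on_tform: "bilinear_on V1 (tensor_space V2 V3) ground (\<lambda>x u. sw (rep V2 V3 u) (\<gamma> x))"
proof (intro bilinear_onI)
  fix x
  have "bform (scale V2) (scale V3) (\<gamma> x)" using \<gamma> by (auto simp: tform_def bform_def)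
  then show "linear_on (tensor_space V2 V3) ground (\<lambda>u. sw (rep V2 V3 u) (\<gamma> x))"
    by (intro linear_on_sw_rep V bilinear_on_bform is_space_ground)
next
  fix u
  show "linear_on V1 ground (\<lambda>x. sw (rep V2 V3 u) (\<gamma> x))"
    by (rule linear_on_sum[OF is_space_ground]) (use \<gamma> in \<open>auto simp: tform_def linear_on_def lmap_def\<close>)
qed

lemma ev3_linear: "linear_on (tensor_space V1 (tensor_space V2 V3)) ground (ev3 V1 V2 V3 \<gamma>)"
  unfolding ev3_def by (intro linear_on_sw_rep V is_space_tensor_space is_space_ground bilinear_on_tform)

lemma ev3_tens:
  assumes "x \<in> carrier V1" "u \<in> carrier (tensor_space V2 V3)"
  shows "ev3 V1 V2 V3 \<gamma> (tens V1 (tensor_space V2 V3) x u) = sw (rep V2 V3 u) (\<gamma> x)"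
  unfolding ev3_def
  by (rule sw_rep_tens1[OF _ _ _ bilinear_on_tform assms])
    (simp_all add: V is_space_tensor_space)

lemma ev3_tens2:
  assumes "x \<in> carrier V1" "y \<in> carrier V2" "z \<in> carrier V3"
  shows "ev3 V1 V2 V3 \<gamma> (tens V1 (tensor_space V2 V3) x (tens V2 V3 y z)) = \<gamma> x y z"
proof -
  have "bform (scale V2) (scale V3) (\<gamma> x)" using \<gamma> by (auto simp: tform_def bform_def)
  then show ?thesis using assms
    by (simp add: ev3_tens tens_in sw_rep_tens1[OF V(2,3) is_space_ground bilinear_on_bform])
qed

lemma ev3_sw:
  assumes "\<And>a b. (a, b) \<in> set xs \<Longrightarrow> F a b \<in> carrier (tensor_space V1 (tensor_space V2 V3))"
  shows "ev3 V1 V2 V3 \<gamma> (sw xs F) = sw xs (\<lambda>a b. ev3 V1 V2 V3 \<gamma> (F a b))"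
  by (rule linear_on_sw[OF ev3_linear is_space_tensor_space assms])

end


subsection \<open>Tensor products of Yetter--Drinfeld data\<close>

text \<open>Only the linear part of a Yetter-Drinfeld module. Tensor products and braidings are
  computed from it alone, so the formulas already apply to \<integral> \<otimes> H before that
  object is known to satisfy the axioms.\<close>

definition yd_data :: "('k::field, 'b::ring_1, 'x) hopf_scheme \<Rightarrow> ('k, 'b, 'a::ab_group_add, 'y) ydm_scheme \<Rightarrow> bool"
  where "yd_data B M \<longleftrightarrow> is_space B \<and> carrier B = UNIV \<and> bilinear_on B B B (*) \<and>
    linear_on B (tensor_space B B) (comult B) \<and>
    is_space M \<and> bilinear_on B M M (act M) \<and> linear_on M (tensor_space B M) (coact M)"

lemma yd_dataI: "hopf_algebra B \<Longrightarrow> yd_module B M \<Longrightarrow> yd_data B M"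
  by (auto simp: yd_data_def hopf_algebra_def yd_module_def)

lemma yd_dataD:
  assumes "yd_data B M"
  shows "is_space B" "carrier B = UNIV" "bilinear_on B B B (*)" "linear_on B (tensor_space B B) (comult B)"
    "is_space M" "bilinear_on B M M (act M)" "linear_on M (tensor_space B M) (coact M)"
  using assms by (auto simp: yd_data_def)

lemma comult_in: "yd_data B M \<Longrightarrow> comult B b \<in> carrier (tensor_space B B)"
  and coact_in: "yd_data B M \<Longrightarrow> m \<in> carrier M \<Longrightarrow> coact M m \<in> carrier (tensor_space B M)"
  and act_in: "yd_data B M \<Longrightarrow> m \<in> carrier M \<Longrightarrow> act M b m \<in> carrier M"
  by (auto simp: yd_data_def linear_on_def bilinear_on_def)

lemma yd_tensor_simps [simp]:
  "carrier (yd_tensor B M N) = carrier (tensor_space M N)" "scale (yd_tensor B M N) = fscale"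
  by (simp_all add: yd_tensor_def)

lemma tensor_space_cong:
  "carrier V = carrier V' \<Longrightarrow> scale V = scale V' \<Longrightarrow> carrier W = carrier W' \<Longrightarrow> scale W = scale W' \<Longrightarrow>
   tensor_space V W = tensor_space V' W'"
  by (simp add: tensor_space_def tens_cong[of V V' W W'])

lemma rep_cong:
  "carrier V = carrier V' \<Longrightarrow> scale V = scale V' \<Longrightarrow> carrier W = carrier W' \<Longrightarrow> scale W = scale W' \<Longrightarrow>
   rep V W = rep V' W'"
  by (intro ext) (simp add: rep_def tens_cong[of V V' W W'])

lemma linear_on_cong:
  "carrier V = carrier V' \<Longrightarrow> scale V = scale V' \<Longrightarrow> carrier W = carrier W' \<Longrightarrow> scale W = scale W' \<Longrightarrow>
   linear_on V W = linear_on V' W'"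
  by (intro ext) (simp add: linear_on_def)

text \<open>\<open>yd_tensor\<close> and \<open>tensor_space\<close> give different records with the
  same carrier and scaling. Tensors, chosen lists and linearity depend on these two fields only, so
  the simplifier may replace one record by the other.\<close>

lemma tensor_space_yd_tensor [simp]:
  "tensor_space (yd_tensor B M N) W = tensor_space (tensor_space M N) W"
  "tensor_space W (yd_tensor B M N) = tensor_space W (tensor_space M N)"
  by (auto intro!: tensor_space_cong)

lemma tens_yd_tensor [simp]:
  "tens (yd_tensor B M N) W = tens (tensor_space M N) W"
  "tens W (yd_tensor B M N) = tens W (tensor_space M N)"
  by (auto intro!: tens_cong)

lemma rep_yd_tensor [simp]:
  "rep (yd_tensor B M N) W = rep (tensor_space M N) W"
  "rep W (yd_tensor B M N) = rep W (tensor_space M N)"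
  by (auto intro!: rep_cong)

lemma linear_on_yd_tensor [simp]:
  "linear_on (yd_tensor B M N) W = linear_on (tensor_space M N) W"
  "linear_on W (yd_tensor B M N) = linear_on W (tensor_space M N)"
  by (auto intro!: linear_on_cong)

context
  fixes B :: "('k::field, 'b::ring_1, 'x) hopf_scheme"
    and M :: "('k, 'b, 'a::ab_group_add, 'y) ydm_scheme"
    and N :: "('k, 'b, 'c::ab_group_add, 'z) ydm_scheme"
  assumes M: "yd_data B M" and N: "yd_data B N"
begin

lemmas yd_spaces = yd_dataD(1,5)[OF M] yd_dataD(5)[OF N] is_space_tensor_space
lemmas yd_linear_intros = lon bilinear_on_comp1[OF yd_dataD(3)[OF M]] bilinear_on_comp2[OF yd_dataD(3)[OF M]]
  bilinear_on_comp1[OF yd_dataD(6)[OF M]] bilinear_on_comp2[OF yd_dataD(6)[OF M]]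
  bilinear_on_comp1[OF yd_dataD(6)[OF N]] bilinear_on_comp2[OF yd_dataD(6)[OF N]]
  linear_on_comp[OF yd_dataD(7)[OF M]] linear_on_comp[OF yd_dataD(7)[OF N]]
  linear_on_comp[OF yd_dataD(4)[OF M]]
lemmas yd_in = tens_in comult_in[OF M] coact_in[OF M] coact_in[OF N] act_in[OF M] act_in[OF N]

lemma act_bilinear: "bilinear_on M N (tensor_space M N)
    (\<lambda>m n. sw (rep B B (comult B b)) (\<lambda>b1 b2. tens M N (act M b1 m) (act N b2 n)))"
  by (intro yd_linear_intros linear_on_sw_rep_body[OF yd_spaces(1)] yd_spaces yd_in) (simp_all add: yd_in yd_dataD(2)[OF M])

lemma yd_tensor_act_linear: "linear_on (tensor_space M N) (tensor_space M N) (act (yd_tensor B M N) b)"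
  unfolding yd_tensor_def
  by (simp add: tensor_lift_sw[abs_def] linear_on_sw_rep[OF yd_spaces(2,3,4) act_bilinear])

lemma yd_tensor_act_tens:
  "m \<in> carrier M \<Longrightarrow> n \<in> carrier N \<Longrightarrow> act (yd_tensor B M N) b (tens M N m n) =
    sw (rep B B (comult B b)) (\<lambda>b1 b2. tens M N (act M b1 m) (act N b2 n))"
  unfolding yd_tensor_def by (simp add: tensor_lift_sw sw_rep_tens1[OF yd_spaces(2,3,4) act_bilinear])

lemma coact_bilinear: "bilinear_on M N (tensor_space B (tensor_space M N))
    (\<lambda>m n. sw (rep B M (coact M m)) (\<lambda>b m0. sw (rep B N (coact N n)) (\<lambda>c n0.
       tens B (tensor_space M N) (b * c) (tens M N m0 n0))))"
  by (intro yd_linear_intros linear_on_sw_rep_body[OF yd_spaces(1)] linear_on_sw_rep_comp yd_spaces yd_in)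
    (simp_all add: yd_in yd_dataD(2)[OF M] yd_spaces)

lemma yd_tensor_coact_linear:
  "linear_on (tensor_space M N) (tensor_space B (tensor_space M N)) (coact (yd_tensor B M N))"
  unfolding yd_tensor_def
  by (simp add: tensor_lift_sw[abs_def] linear_on_sw_rep[OF yd_spaces(2,3,4) coact_bilinear])

lemma yd_tensor_coact_tens:
  "m \<in> carrier M \<Longrightarrow> n \<in> carrier N \<Longrightarrow> coact (yd_tensor B M N) (tens M N m n) =
    sw (rep B M (coact M m)) (\<lambda>b m0. sw (rep B N (coact N n)) (\<lambda>c n0.
       tens B (tensor_space M N) (b * c) (tens M N m0 n0)))"
  unfolding yd_tensor_def by (simp add: tensor_lift_sw sw_rep_tens1[OF yd_spaces(2,3,4) coact_bilinear])

lemma braid_bilinear: "bilinear_on M N (tensor_space N M)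
    (\<lambda>m n. sw (rep B M (coact M m)) (\<lambda>b m0. tens N M (act N b n) m0))"
  by (intro yd_linear_intros linear_on_sw_rep_body[OF yd_spaces(1)] linear_on_sw_rep_comp yd_spaces yd_in)
    (simp_all add: yd_in yd_dataD(2)[OF M] yd_spaces)

lemma braid_linear: "linear_on (tensor_space M N) (tensor_space N M) (braid B M N)"
  unfolding braid_def
  by (simp add: tensor_lift_sw[abs_def] linear_on_sw_rep[OF yd_spaces(2,3,4) braid_bilinear])

lemma braid_tens:
  "m \<in> carrier M \<Longrightarrow> n \<in> carrier N \<Longrightarrow> braid B M N (tens M N m n) =
    sw (rep B M (coact M m)) (\<lambda>b m0. tens N M (act N b n) m0)"
  unfolding braid_def by (simp add: tensor_lift_sw sw_rep_tens1[OF yd_spaces(2,3,4) braid_bilinear])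

lemma yd_hom_tensorD:
  fixes P :: "('k, 'b, 'd::ab_group_add, 'w) ydm_scheme"
  assumes P: "yd_data B P" and \<alpha>: "bilinear_on M N P \<alpha>"
    and h: "yd_hom B (yd_tensor B M N) P (tensor_lift M N \<alpha>)"
    and m: "m \<in> carrier M" "n \<in> carrier N"
  shows "act P b (\<alpha> m n) = sw (rep B B (comult B b)) (\<lambda>b1 b2. \<alpha> (act M b1 m) (act N b2 n))"
    and "coact P (\<alpha> m n) = sw (rep B M (coact M m)) (\<lambda>b m0. sw (rep B N (coact N n)) (\<lambda>c n0.
       tens B P (b * c) (\<alpha> m0 n0)))"
proof -
  note pP = yd_dataD(5)[OF P]
  let ?T = "tensor_lift M N \<alpha>"
  have T: "?T (tens M N x y) = \<alpha> x y" if "x \<in> carrier M" "y \<in> carrier N" for x y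
    using that by (rule tensor_lift_tens[OF yd_spaces(2,3) pP \<alpha>])
  have lT: "linear_on (tensor_space M N) P ?T"
    by (intro linear_on_tensor_lift yd_spaces pP \<alpha>)
  have t: "tens M N m n \<in> carrier (tensor_space M N)" using m by (rule tens_in)
  have "act P b (?T (tens M N m n)) = ?T (act (yd_tensor B M N) b (tens M N m n))"
    using h t by (simp add: yd_hom_def)
  also have "\<dots> = sw (rep B B (comult B b)) (\<lambda>b1 b2. ?T (tens M N (act M b1 m) (act N b2 n)))"
    unfolding yd_tensor_act_tens[OF m]
    by (rule linear_on_sw_rep_out[OF lT]) (intro yd_spaces yd_in m)+
  finally show "act P b (\<alpha> m n) = sw (rep B B (comult B b)) (\<lambda>b1 b2. \<alpha> (act M b1 m) (act N b2 n))"
    by (simp add: T m yd_in)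
  \<comment> \<open>\<open>?L\<close> is id \<otimes> \<open>?T\<close> on B \<otimes> (M \<otimes>
    N), the map that occurs in the definition of colinearity.\<close>
  let ?L = "\<lambda>s. sw (rep B (tensor_space M N) s) (\<lambda>b t. tens B P b (?T t))"
  have bL: "bilinear_on B (tensor_space M N) (tensor_space B P) (\<lambda>b t. tens B P b (?T t))"
    by (intro yd_spaces pP lon linear_on_comp[OF lT] linear_onD(1)[OF lT])
  have lL: "linear_on (tensor_space B (tensor_space M N)) (tensor_space B P) ?L"
    by (intro linear_on_sw_rep yd_spaces bL)
  have L: "?L (tens B (tensor_space M N) b (tens M N x y)) = tens B P b (\<alpha> x y)"
    if "x \<in> carrier M" "y \<in> carrier N" for b x y
    using that sw_rep_tens1[OF yd_spaces(1,4,4) bL, of b "tens M N x y"]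
    by (simp add: T yd_dataD(2)[OF M] tens_in)
  have "coact P (?T (tens M N m n)) = ?L (coact (yd_tensor B M N) (tens M N m n))"
    using h t by (simp add: yd_hom_def tensor_lift_sw)
  also have "\<dots> = sw (rep B M (coact M m)) (\<lambda>b m0. ?L (sw (rep B N (coact N n)) (\<lambda>c n0.
       tens B (tensor_space M N) (b * c) (tens M N m0 n0))))"
    unfolding yd_tensor_coact_tens[OF m]
    by (rule linear_on_sw_rep_out[OF lL]) (intro yd_spaces yd_in m sw_rep_in[OF yd_spaces(1)] | simp add: yd_dataD(2)[OF M])+
  also have "\<dots> = sw (rep B M (coact M m)) (\<lambda>b m0. sw (rep B N (coact N n)) (\<lambda>c n0.
       ?L (tens B (tensor_space M N) (b * c) (tens M N m0 n0))))"
    by (intro sw_rep_cong[OF yd_spaces(1)] linear_on_sw_rep_out[OF lL] yd_spaces yd_in m) (simp_all add: yd_dataD(2)[OF M])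
  also have "\<dots> = sw (rep B M (coact M m)) (\<lambda>b m0. sw (rep B N (coact N n)) (\<lambda>c n0. tens B P (b * c) (\<alpha> m0 n0)))"
    by (intro sw_rep_cong[OF yd_spaces(1)] L yd_in m)
  finally show "coact P (\<alpha> m n) = sw (rep B M (coact M m)) (\<lambda>b m0. sw (rep B N (coact N n)) (\<lambda>c n0.
       tens B P (b * c) (\<alpha> m0 n0)))"
    by (simp add: T m)
qed

text \<open>Equivariance and colinearity are equalities of linear maps on the tensor product, so it
  is enough to verify them on pure tensors.\<close>

lemma yd_hom_tensorI:
  fixes P :: "('k, 'b, 'd::ab_group_add, 'w) ydm_scheme"
  assumes P: "yd_data B P" and \<alpha>: "bilinear_on M N P \<alpha>"
    and "\<And>b m n. m \<in> carrier M \<Longrightarrow> n \<in> carrier N \<Longrightarrow>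
      act P b (\<alpha> m n) = sw (rep B B (comult B b)) (\<lambda>b1 b2. \<alpha> (act M b1 m) (act N b2 n))"
    and "\<And>m n. m \<in> carrier M \<Longrightarrow> n \<in> carrier N \<Longrightarrow>
      coact P (\<alpha> m n) = sw (rep B M (coact M m)) (\<lambda>b m0. sw (rep B N (coact N n)) (\<lambda>c n0.
       tens B P (b * c) (\<alpha> m0 n0)))"
  shows "yd_hom B (yd_tensor B M N) P (tensor_lift M N \<alpha>)"
proof -
  note pP = yd_dataD(5)[OF P]
  let ?T = "tensor_lift M N \<alpha>"
  have T: "?T (tens M N x y) = \<alpha> x y" if "x \<in> carrier M" "y \<in> carrier N" for x y
    using that by (rule tensor_lift_tens[OF yd_spaces(2,3) pP \<alpha>])
  have lT: "linear_on (tensor_space M N) P ?T"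
    by (intro linear_on_tensor_lift yd_spaces pP \<alpha>)
  have lA: "linear_on P P (act P b)" for b
    by (rule bilinear_onD1[OF yd_dataD(6)[OF P]]) (simp add: yd_dataD(2)[OF M])
  have act: "?T (act (yd_tensor B M N) b t) = act P b (?T t)" if t: "t \<in> carrier (tensor_space M N)" for b t
  proof (rule linear_on_tensor_eqI[OF yd_spaces(2) _ _ t])
    show "linear_on (tensor_space M N) P (\<lambda>t. ?T (act (yd_tensor B M N) b t))"
      by (rule linear_on_comp[OF lT yd_tensor_act_linear])
    show "linear_on (tensor_space M N) P (\<lambda>t. act P b (?T t))"
      by (rule linear_on_comp[OF lA lT])
    fix m n assume m: "m \<in> carrier M" "n \<in> carrier N"
    have "?T (act (yd_tensor B M N) b (tens M N m n)) =
        sw (rep B B (comult B b)) (\<lambda>b1 b2. ?T (tens M N (act M b1 m) (act N b2 n)))"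
      unfolding yd_tensor_act_tens[OF m]
      by (rule linear_on_sw_rep_out[OF lT]) (intro yd_spaces yd_in m)+
    then show "?T (act (yd_tensor B M N) b (tens M N m n)) = act P b (?T (tens M N m n))"
      using assms(3)[OF m] by (simp add: T m yd_in)
  qed
  let ?L = "\<lambda>s. sw (rep B (tensor_space M N) s) (\<lambda>b t. tens B P b (?T t))"
  have bL: "bilinear_on B (tensor_space M N) (tensor_space B P) (\<lambda>b t. tens B P b (?T t))"
    by (intro yd_spaces pP lon linear_on_comp[OF lT] linear_onD(1)[OF lT])
  have lL: "linear_on (tensor_space B (tensor_space M N)) (tensor_space B P) ?L"
    by (intro linear_on_sw_rep yd_spaces bL)
  have L: "?L (tens B (tensor_space M N) b (tens M N x y)) = tens B P b (\<alpha> x y)"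
    if "x \<in> carrier M" "y \<in> carrier N" for b x y
    using that sw_rep_tens1[OF yd_spaces(1,4,4) bL, of b "tens M N x y"]
    by (simp add: T yd_dataD(2)[OF M] tens_in)
  have coact: "coact P (?T t) = ?L (coact (yd_tensor B M N) t)" if t: "t \<in> carrier (tensor_space M N)" for t
  proof (rule linear_on_tensor_eqI[OF yd_spaces(2) _ _ t])
    show "linear_on (tensor_space M N) (tensor_space B P) (\<lambda>t. ?L (coact (yd_tensor B M N) t))"
      by (rule linear_on_comp[OF lL yd_tensor_coact_linear])
    show "linear_on (tensor_space M N) (tensor_space B P) (\<lambda>t. coact P (?T t))"
      by (rule linear_on_comp[OF yd_dataD(7)[OF P] lT])
    fix m n assume m: "m \<in> carrier M" "n \<in> carrier N"
    have "?L (coact (yd_tensor B M N) (tens M N m n)) =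
       sw (rep B M (coact M m)) (\<lambda>b m0. ?L (sw (rep B N (coact N n)) (\<lambda>c n0.
         tens B (tensor_space M N) (b * c) (tens M N m0 n0))))"
      unfolding yd_tensor_coact_tens[OF m]
      by (rule linear_on_sw_rep_out[OF lL]) (intro yd_spaces yd_in m sw_rep_in[OF yd_spaces(1)] | simp add: yd_dataD(2)[OF M])+
    also have "\<dots> = sw (rep B M (coact M m)) (\<lambda>b m0. sw (rep B N (coact N n)) (\<lambda>c n0.
         ?L (tens B (tensor_space M N) (b * c) (tens M N m0 n0))))"
      by (intro sw_rep_cong[OF yd_spaces(1)] linear_on_sw_rep_out[OF lL] yd_spaces yd_in m) (simp_all add: yd_dataD(2)[OF M])
    also have "\<dots> = sw (rep B M (coact M m)) (\<lambda>b m0. sw (rep B N (coact N n)) (\<lambda>c n0. tens B P (b * c) (\<alpha> m0 n0)))"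
      by (intro sw_rep_cong[OF yd_spaces(1)] L yd_in m)
    finally show "coact P (?T (tens M N m n)) = ?L (coact (yd_tensor B M N) (tens M N m n))"
      using assms(4)[OF m] by (simp add: T m)
  qed
  show ?thesis unfolding yd_hom_def using lT act coact by (simp add: tensor_lift_sw)
qed

end



subsection \<open>The two Hopf algebras in terms of multilinear forms\<close>

lemma tform_bform: "tform s t u \<gamma> \<Longrightarrow> bform t u (\<gamma> x)"
  by (simp add: tform_def bform_def)

lemma sw_rep_sw:
  assumes "is_space V" "is_space W" "bform (scale V) (scale W) \<beta>"
    "\<And>a b. (a, b) \<in> set xs \<Longrightarrow> F a b \<in> carrier (tensor_space V W)"
  shows "sw (rep V W (sw xs F)) \<beta> = sw xs (\<lambda>a b. sw (rep V W (F a b)) \<beta>)"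
  by (rule linear_on_sw[OF linear_on_sw_rep[OF assms(1,2) is_space_ground bilinear_on_bform[OF assms(3)]]
        is_space_tensor_space assms(4)])

lemma sw_rep_tens_form:
  assumes "is_space V" "is_space W" "bform (scale V) (scale W) \<beta>" "x \<in> carrier V" "y \<in> carrier W"
  shows "sw (rep V W (tens V W x y)) \<beta> = \<beta> x y"
  by (rule sw_rep_tens1[OF assms(1,2) is_space_ground bilinear_on_bform[OF assms(3)] assms(4,5)])

lemma coassoc_forms:
  fixes V :: "('k::field, 'a::ab_group_add, 'z) vspace_scheme"
  assumes V: "is_space V" "carrier V = UNIV" and \<Delta>: "linear_on V (tensor_space V V) \<Delta>"
    and c: "coassociative_counital V \<Delta> \<epsilon>"
    and \<gamma>: "tform (scale V) (scale V) (scale V) \<gamma>"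
  shows "sw (rep V V (\<Delta> x)) (\<lambda>a b. sw (rep V V (\<Delta> a)) (\<lambda>c d. \<gamma> c d b)) =
    sw (rep V V (\<Delta> x)) (\<lambda>a b. sw (rep V V (\<Delta> b)) (\<lambda>c d. \<gamma> a c d))"
proof -
  note [simp] = is_space_tensor_space
  have D: "\<Delta> y \<in> carrier (tensor_space V V)" for y using \<Delta> V by (auto simp: linear_on_def)
  have t: "tens V V y z \<in> carrier (tensor_space V V)" for y z by (rule tens_in) (simp_all add: V)
  have t3: "tens V (tensor_space V V) y u \<in> carrier (tensor_space V (tensor_space V V))"
    if "u \<in> carrier (tensor_space V V)" for y u using that by (intro tens_in) (simp_all add: V)
  let ?E = "ev3 V V V \<gamma>"
  have "sw (rep V V (\<Delta> x)) (\<lambda>a b. sw (rep V V (\<Delta> a)) (\<lambda>c d. tens V (tensor_space V V) c (tens V V d b))) =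
      sw (rep V V (\<Delta> x)) (\<lambda>a b. tens V (tensor_space V V) a (\<Delta> b))"
    using c V by (simp add: coassociative_counital_def tensor_lift_sw)
  then have "?E (sw (rep V V (\<Delta> x)) (\<lambda>a b. sw (rep V V (\<Delta> a)) (\<lambda>c d. tens V (tensor_space V V) c (tens V V d b)))) =
      ?E (sw (rep V V (\<Delta> x)) (\<lambda>a b. tens V (tensor_space V V) a (\<Delta> b)))"
    by simp
  then show ?thesis
    by (simp add: ev3_sw[OF V(1,1,1) \<gamma>] ev3_tens[OF V(1,1,1) \<gamma>] sw_rep_tens_form[OF V(1,1) tform_bform[OF \<gamma>]] sw_in t t3 D V)
qed

lemma lmap_sw_rep:
  assumes V: "is_space V" "is_space W" and \<Delta>: "linear_on U (tensor_space V W) \<Delta>" and U: "carrier U = UNIV"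
    and \<beta>: "bform (scale V) (scale W) \<beta>"
  shows "lform (scale U) (\<lambda>x. sw (rep V W (\<Delta> x)) \<beta>)"
proof -
  have "linear_on U ground (\<lambda>x. sw (rep V W (\<Delta> x)) \<beta>)"
    by (rule linear_on_sw_rep_comp[OF V is_space_ground bilinear_on_bform[OF \<beta>] \<Delta>])
  then show ?thesis using U by (simp add: lmap_def linear_on_def)
qed

section \<open>The two Hopf algebras as instances of the abstract setting\<close>

locale hopf_setup =
  fixes B :: "('k::field, 'b::ring_1) hopf"
    and H :: "('k, 'b, 'h::ring_1) braided_hopf"
  assumes hopf_B: "hopf_algebra B"
    and fin_B: "\<exists>E. finite_dimensional_vector_space (scale B) E"
    and bij_SB: "bij (antipode B)" and inv_SB: "antipode B = inv (antipode B)"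
    and hopf_H: "braided_hopf_algebra B H"
    and symm: "\<forall>t \<in> carrier (tensor_space H H). braid B H H (braid B H H t) = t"
begin

abbreviation sB where "sB \<equiv> scale B"
abbreviation sH where "sH \<equiv> scale H"
abbreviation SB where "SB \<equiv> antipode B"
abbreviation eB where "eB \<equiv> counit B"
abbreviation SH where "SH \<equiv> bantipode H"
abbreviation eH where "eH \<equiv> bcounit H"
abbreviation A where "A \<equiv> act H"
abbreviation DB where "DB x \<equiv> rep B B (comult B x)"
abbreviation DH where "DH x \<equiv> rep H H (bcomult H x)"
abbreviation K where "K x \<equiv> rep B H (coact H x)"
text \<open>The list comes from the coaction of \<open>x\<close> and not from \<open>rep\<close> of
  the braided tensor. By \<open>sw_CH\<close>, nested braidings then unfold directly into actions
  and coactions of \<open>B\<close>.\<close>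

abbreviation CH where "CH x y \<equiv> map (\<lambda>(b, z). (A b y, z)) (K x)"

lemma SB_SB [simp]: "SB (SB b) = b"
  by (metis bij_SB bij_inv_eq_iff inv_SB)

lemma spB: "is_space B" "carrier B = UNIV" and spH: "is_space H" "carrier H = UNIV"
  using hopf_B hopf_H by (auto simp: hopf_algebra_def braided_hopf_algebra_def yd_module_def)

lemma yd_H: "yd_module B H"
  using hopf_H by (simp add: braided_hopf_algebra_def)

lemma dat_H: "yd_data B H"
  by (rule yd_dataI[OF hopf_B yd_H])

lemma lin_comult: "linear_on B (tensor_space B B) (comult B)"
  and lin_bcomult: "linear_on H (tensor_space H H) (bcomult H)"
  and bil_B: "bilinear_on B B B (*)" and bil_H: "bilinear_on H H H (*)"
  and bil_A: "bilinear_on B H H A" and lin_coact: "linear_on H (tensor_space B H) (coact H)"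
  using hopf_B hopf_H by (auto simp: hopf_algebra_def braided_hopf_algebra_def yd_hom_def yd_module_def)

lemma tensor_in: "comult B b \<in> carrier (tensor_space B B)" "bcomult H x \<in> carrier (tensor_space H H)"
  "coact H x \<in> carrier (tensor_space B H)" "tens B B b c \<in> carrier (tensor_space B B)"
  "tens H H x y \<in> carrier (tensor_space H H)" "tens B H b x \<in> carrier (tensor_space B H)"
  "t \<in> carrier (tensor_space H H) \<Longrightarrow> tens B (tensor_space H H) b t \<in> carrier (tensor_space B (tensor_space H H))"
  "s \<in> carrier (tensor_space B H) \<Longrightarrow> tens B (tensor_space B H) b s \<in> carrier (tensor_space B (tensor_space B H))"
  by (auto intro!: tens_in linear_onD(1)[OF lin_comult] linear_onD(1)[OF lin_bcomult] linear_onD(1)[OF lin_coact]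
      simp: spB spH)

lemma swB: "bform sB sB \<beta> \<Longrightarrow> (\<And>a b. F a b \<in> carrier (tensor_space B B)) \<Longrightarrow>
    sw (rep B B (sw xs F)) \<beta> = sw xs (\<lambda>a b. sw (rep B B (F a b)) \<beta>)"
  and swH: "bform sH sH \<beta>' \<Longrightarrow> (\<And>a b. G a b \<in> carrier (tensor_space H H)) \<Longrightarrow>
    sw (rep H H (sw xs G)) \<beta>' = sw xs (\<lambda>a b. sw (rep H H (G a b)) \<beta>')"
  and swK: "bform sB sH \<beta>'' \<Longrightarrow> (\<And>a b. J a b \<in> carrier (tensor_space B H)) \<Longrightarrow>
    sw (rep B H (sw xs J)) \<beta>'' = sw xs (\<lambda>a b. sw (rep B H (J a b)) \<beta>'')"
  by (rule sw_rep_sw; simp add: spB spH)+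

lemma tB: "bform sB sB \<beta> \<Longrightarrow> sw (rep B B (tens B B b c)) \<beta> = \<beta> b c"
  and tH: "bform sH sH \<beta>' \<Longrightarrow> sw (rep H H (tens H H x y)) \<beta>' = \<beta>' x y"
  and tK: "bform sB sH \<beta>'' \<Longrightarrow> sw (rep B H (tens B H b x)) \<beta>'' = \<beta>'' b x"
  by (rule sw_rep_tens_form; simp add: spB spH)+

lemma lmaps:
  "lmap sB sB (\<lambda>b. b * c)" "lmap sB sB (\<lambda>c. b * c)" "lmap sH sH (\<lambda>x. x * y)" "lmap sH sH (\<lambda>y. x * y)"
  "lform sB eB" "lform sH eH" "lmap sB sB SB" "lmap sH sH SH" "lmap sB sH (\<lambda>b. A b x)" "lmap sH sH (\<lambda>x. A b x)"
  using hopf_B hopf_H bil_A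
  by (auto simp: hopf_algebra_def braided_hopf_algebra_def bilinear_on_def linear_on_def lmap_def
      yd_hom_def yd_unit_def)

lemma eB_mult: "eB (b * c) = eB b * eB c" and eB_one: "eB 1 = 1"
  and eH_mult: "eH (x * y) = eH x * eH y" and eH_one: "eH 1 = 1"
  using hopf_B hopf_H by (auto simp: hopf_algebra_def braided_hopf_algebra_def)

lemmas lmap_A1 [lin] = lmap_comp[OF lmaps(9)]
lemmas lmap_A2 [lin] = lmap_comp[OF lmaps(10)]

lemma form_DB: "bform sB sB \<beta> \<Longrightarrow> lform sB (\<lambda>x. sw (DB x) \<beta>)"
  and form_DH: "bform sH sH \<beta>' \<Longrightarrow> lform sH (\<lambda>x. sw (DH x) \<beta>')"
  and form_K: "bform sB sH \<beta>'' \<Longrightarrow> lform sH (\<lambda>x. sw (K x) \<beta>'')"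
  by (rule lmap_sw_rep; simp add: spB spH lin_comult lin_bcomult lin_coact)+

lemma lform_K [lin]: "bform sB sH \<beta> \<Longrightarrow> lmap r sH g \<Longrightarrow> lform r (\<lambda>x. sw (K (g x)) \<beta>)"
  by (rule lform_comp[OF form_K])

text \<open>An ordinary Hopf algebra is a braided one for the flip. The general lemmas hence show
  that the antipode of \<open>B\<close> reverses products and coproducts.\<close>

sublocale Bf: symmetric_forms sB DB "\<lambda>x y. [(y, x)]" eB SB
proof (unfold_locales, goal_cases)
  case (8 \<gamma> x)
  then show ?case using hopf_B
    by (intro coassoc_forms[OF spB lin_comult]) (auto simp: hopf_algebra_def)
next
  case (9 \<phi> x)
  have "sw (DB x) (\<lambda>a b. sB (eB a) b) = x"
    using hopf_B by (simp add: hopf_algebra_def coassociative_counital_def tensor_lift_sw)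
  then have "\<phi> (sw (DB x) (\<lambda>a b. sB (eB a) b)) = \<phi> x" by simp
  then show ?case by (simp add: lmap_sw[OF 9] lmapD(2)[OF 9])
next
  case (10 \<phi> x)
  have "sw (DB x) (\<lambda>a b. sB (eB b) a) = x"
    using hopf_B by (simp add: hopf_algebra_def coassociative_counital_def tensor_lift_sw)
  then have "\<phi> (sw (DB x) (\<lambda>a b. sB (eB b) a)) = \<phi> x" by simp
  then show ?case by (simp add: lmap_sw[OF 10] lmapD(2)[OF 10])
next
  case (11 \<beta> x y)
  have "comult B (x * y) = sw (DB x) (\<lambda>x1 x2. sw (DB y) (\<lambda>y1 y2. tens B B (x1 * y1) (x2 * y2)))"
    using hopf_B by (simp add: hopf_algebra_def tensor_lift_sw)
  then show ?case
    by (simp add: swB[OF 11] tB[OF 11] tensor_in sw_in[OF is_space_tensor_space])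
next
  case (12 \<beta>)
  then show ?case using hopf_B by (simp add: hopf_algebra_def tB)
next
  case (15 \<phi> x)
  have "sw (DB x) (\<lambda>a b. SB a * b) = sB (eB x) 1"
    using hopf_B by (simp add: hopf_algebra_def tensor_lift_sw)
  then have "\<phi> (sw (DB x) (\<lambda>a b. SB a * b)) = \<phi> (sB (eB x) 1)" by simp
  then show ?case by (simp add: lmap_sw[OF 15] lmapD(2)[OF 15])
next
  case (16 \<phi> x)
  have "sw (DB x) (\<lambda>a b. a * SB b) = sB (eB x) 1"
    using hopf_B by (simp add: hopf_algebra_def tensor_lift_sw)
  then have "\<phi> (sw (DB x) (\<lambda>a b. a * SB b)) = \<phi> (sB (eB x) 1)" by simp
  then show ?case by (simp add: lmap_sw[OF 16] lmapD(2)[OF 16])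
qed (simp_all add: lmaps form_DB eB_mult eB_one, simp_all add: bform_def)

lemma K_coassoc:
  assumes \<gamma>: "tform sB sB sH \<gamma>"
  shows "sw (K x) (\<lambda>b y. sw (DB b) (\<lambda>b1 b2. \<gamma> b1 b2 y)) = sw (K x) (\<lambda>b y. sw (K y) (\<lambda>c z. \<gamma> b c z))"
proof -
  note sp3 = spB(1) spB(1) spH(1)
  have "sw (K x) (\<lambda>b m0. sw (DB b) (\<lambda>b1 b2. tens B (tensor_space B H) b1 (tens B H b2 m0))) =
      sw (K x) (\<lambda>b m0. tens B (tensor_space B H) b (coact H m0))"
    using yd_H spH by (simp add: yd_module_def tensor_lift_sw)
  then have "ev3 B B H \<gamma> (sw (K x) (\<lambda>b m0. sw (DB b) (\<lambda>b1 b2. tens B (tensor_space B H) b1 (tens B H b2 m0)))) =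
      ev3 B B H \<gamma> (sw (K x) (\<lambda>b m0. tens B (tensor_space B H) b (coact H m0)))"
    by simp
  then show ?thesis
    by (simp add: ev3_sw[OF sp3 \<gamma>] ev3_tens[OF sp3 \<gamma>] sw_rep_tens_form[OF sp3(2,3) tform_bform[OF \<gamma>]] sw_in[OF is_space_tensor_space]
        tensor_in spB spH)
qed

lemma K_counit: "lform sH \<phi> \<Longrightarrow> sw (K x) (\<lambda>b y. eB b * \<phi> y) = \<phi> x"
proof -
  assume \<phi>: "lform sH \<phi>"
  have "sw (K x) (\<lambda>b y. sH (eB b) y) = x"
    using yd_H spH by (simp add: yd_module_def tensor_lift_sw)
  then have "\<phi> (sw (K x) (\<lambda>b y. sH (eB b) y)) = \<phi> x" by simp
  then show ?thesis by (simp add: lmap_sw[OF \<phi>] lmapD(2)[OF \<phi>])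
qed

lemma K_act: 
  assumes \<beta>: "bform sB sH \<beta>"
  shows "sw (K (A b x)) \<beta> = sw (DB b) (\<lambda>b1 b'. sw (DB b') (\<lambda>b2 b3.
    sw (K x) (\<lambda>c y. \<beta> (b1 * c * SB b3) (A b2 y))))"
proof -
  have "coact H (A b x) = sw (DB b) (\<lambda>b1 b'. sw (DB b') (\<lambda>b2 b3.
      sw (K x) (\<lambda>c y. tens B H (b1 * c * SB b3) (A b2 y))))"
    using yd_H spH by (simp add: yd_module_def tensor_lift_sw)
  then show ?thesis
    by (simp add: swK[OF \<beta>] tK[OF \<beta>] tensor_in sw_in[OF is_space_tensor_space])
qed

lemma A_one_left: "A 1 x = x" and A_mult_left: "A (b * c) x = A b (A c x)"
  using yd_H spH by (simp_all add: yd_module_def)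

lemma A_mult: "A b (x * y) = sw (DB b) (\<lambda>b1 b2. A b1 x * A b2 y)"
  and coact_mult: "coact H (x * y) = sw (K x) (\<lambda>b x0. sw (K y) (\<lambda>c y0. tens B H (b * c) (x0 * y0)))"
  using yd_hom_tensorD[OF dat_H dat_H dat_H bil_H, of x y] hopf_H spH
  by (simp_all add: braided_hopf_algebra_def)

lemma K_mult:
  "bform sB sH \<beta> \<Longrightarrow> sw (K (x * y)) \<beta> = sw (K x) (\<lambda>b x0. sw (K y) (\<lambda>c y0. \<beta> (b * c) (x0 * y0)))"
  by (simp add: coact_mult swK tK tensor_in sw_in[OF is_space_tensor_space])

lemma A_one: "A b 1 = sH (eB b) 1"
proof -
  have "yd_hom B (yd_unit B) H (\<lambda>c. sH c 1)" using hopf_H by (simp add: braided_hopf_algebra_def)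
  then have "\<forall>b m. sH (eB b * m) 1 = A b (sH m 1)" by (simp add: yd_hom_def yd_unit_def)
  from this[rule_format, of b 1] show ?thesis by (simp add: is_spaceD[OF spH(1)])
qed

lemma K_one: "bform sB sH \<beta> \<Longrightarrow> sw (K 1) \<beta> = \<beta> 1 1"
proof -
  assume \<beta>: "bform sB sH \<beta>"
  have u: "is_space (yd_unit B)" "carrier (yd_unit B) = UNIV" "scale (yd_unit B) = (*)"
    using is_space_ground[where 'k = 'k] by (simp_all add: yd_unit_def is_space_def)
  have "yd_hom B (yd_unit B) H (\<lambda>c. sH c 1)" using hopf_H by (simp add: braided_hopf_algebra_def)
  then have "coact H (sH 1 1) = sw (rep B (yd_unit B) (coact (yd_unit B) 1)) (\<lambda>b c. tens B H b (sH c 1))"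
    by (simp add: yd_hom_def yd_unit_def tensor_lift_sw)
  also have "coact (yd_unit B) 1 = tens B (yd_unit B) 1 1"
    by (simp add: yd_unit_def tens_cong[of B B ground "yd_unit B"] ground_def) (simp add: yd_unit_def tens_def)
  also have "sw (rep B (yd_unit B) (tens B (yd_unit B) 1 1)) (\<lambda>b c. tens B H b (sH c 1)) = tens B H 1 (sH 1 1)"
  proof (rule sw_rep_tens1[OF spB(1) u(1) is_space_tensor_space[of B H]])
    have "linear_on (yd_unit B) H (\<lambda>c. sH c 1)"
      using hopf_H by (simp add: braided_hopf_algebra_def yd_hom_def)
    then show "bilinear_on B (yd_unit B) (tensor_space B H) (\<lambda>b c. tens B H b (sH c 1))"
      by (intro lon) (simp_all add: spB spH)
  qed (simp_all add: u spB)
  finally show ?thesis using \<beta> by (simp add: is_spaceD[OF spH(1)] tK)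
qed

lemma e_act: "eH (A b x) = eB b * eH x"
  and coact_e: "tens B ground 1 (eH x) = sw (K x) (\<lambda>b y. tens B ground b (eH y))"
proof -
  have h: "yd_hom B H (yd_unit B) eH" using hopf_H by (simp add: braided_hopf_algebra_def)
  then show "eH (A b x) = eB b * eH x" by (simp add: yd_hom_def yd_unit_def spH)
  have "tens B (yd_unit B) = tens B (ground :: ('k, 'k) vspace)"
    by (rule tens_cong) (simp_all add: yd_unit_def)
  then show "tens B ground 1 (eH x) = sw (K x) (\<lambda>b y. tens B ground b (eH y))"
    using h by (simp add: yd_hom_def spH tensor_lift_sw) (simp add: yd_unit_def)
qed

lemma K_e: assumes p: "lform sB p" shows "sw (K x) (\<lambda>b y. p b * eH y) = p 1 * eH x"
proof -
  have \<beta>: "bform sB (scale ground) (\<lambda>b c. p b * c)"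
    using p by (auto simp: bform_def lmap_def algebra_simps)
  have t: "tens B ground b c \<in> carrier (tensor_space B ground)" for b and c :: 'k
    by (rule tens_in) (simp_all add: spB)
  have "sw (rep B ground (tens B ground 1 (eH x))) (\<lambda>b c. p b * c) =
      sw (rep B ground (sw (K x) (\<lambda>b y. tens B ground b (eH y)))) (\<lambda>b c. p b * c)"
    by (simp only: coact_e)
  then show ?thesis
    by (simp add: sw_rep_sw[OF spB(1) is_space_ground \<beta>] t sw_rep_tens_form[OF spB(1) is_space_ground \<beta>] spB)
qed

lemma DH_act:
  assumes \<beta>: "bform sH sH \<beta>"
  shows "sw (DH (A b x)) \<beta> = sw (DB b) (\<lambda>b1 b2. sw (DH x) (\<lambda>x1 x2. \<beta> (A b1 x1) (A b2 x2)))"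
proof -
  have "bcomult H (A b x) = act (yd_tensor B H H) b (bcomult H x)"
    using hopf_H by (simp add: braided_hopf_algebra_def yd_hom_def spH)
  also have "\<dots> = sw (DH x) (\<lambda>x1 x2. act (yd_tensor B H H) b (tens H H x1 x2))"
    by (rule linear_on_rep[OF spH(1) yd_tensor_act_linear[OF dat_H dat_H]]) (simp add: tensor_in)
  also have "\<dots> = sw (DH x) (\<lambda>x1 x2. sw (DB b) (\<lambda>b1 b2. tens H H (A b1 x1) (A b2 x2)))"
    by (simp add: yd_tensor_act_tens[OF dat_H dat_H] spH)
  finally show ?thesis
    by (simp add: swH[OF \<beta>] tH[OF \<beta>] tensor_in sw_in[OF is_space_tensor_space] sw_swap[of "DB b" "DH x"])
qed

lemma K_DH:
  assumes \<gamma>: "tform sB sH sH \<gamma>"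
  shows "sw (K x) (\<lambda>b y. sw (DH y) (\<lambda>y1 y2. \<gamma> b y1 y2)) =
    sw (DH x) (\<lambda>x1 x2. sw (K x1) (\<lambda>b y1. sw (K x2) (\<lambda>c y2. \<gamma> (b * c) y1 y2)))"
proof -
  note sp3 = spB(1) spH(1) spH(1)
  have "sw (K x) (\<lambda>b y. tens B (tensor_space H H) b (bcomult H y)) = coact (yd_tensor B H H) (bcomult H x)"
    using hopf_H by (simp add: braided_hopf_algebra_def yd_hom_def spH tensor_lift_sw)
  also have "\<dots> = sw (DH x) (\<lambda>x1 x2. coact (yd_tensor B H H) (tens H H x1 x2))"
    by (rule linear_on_rep[OF spH(1) yd_tensor_coact_linear[OF dat_H dat_H]]) (simp add: tensor_in)
  also have "\<dots> = sw (DH x) (\<lambda>x1 x2. sw (K x1) (\<lambda>b y1. sw (K x2) (\<lambda>c y2.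
      tens B (tensor_space H H) (b * c) (tens H H y1 y2))))"
    by (simp add: yd_tensor_coact_tens[OF dat_H dat_H] spH)
  finally have "ev3 B H H \<gamma> (sw (K x) (\<lambda>b y. tens B (tensor_space H H) b (bcomult H y))) =
     ev3 B H H \<gamma> (sw (DH x) (\<lambda>x1 x2. sw (K x1) (\<lambda>b y1. sw (K x2) (\<lambda>c y2.
      tens B (tensor_space H H) (b * c) (tens H H y1 y2)))))" by simp
  then show ?thesis
    by (simp add: ev3_sw[OF sp3 \<gamma>] ev3_tens[OF sp3 \<gamma>] sw_rep_tens_form[OF sp3(2,3) tform_bform[OF \<gamma>]] sw_in[OF is_space_tensor_space]
        tensor_in spB spH)
qed

lemma S_act: "SH (A b x) = A b (SH x)"
  using hopf_H by (simp add: braided_hopf_algebra_def yd_hom_def spH)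

lemma K_S: "bform sB sH \<beta> \<Longrightarrow> sw (K (SH x)) \<beta> = sw (K x) (\<lambda>b y. \<beta> b (SH y))"
proof -
  assume \<beta>: "bform sB sH \<beta>"
  have "coact H (SH x) = sw (K x) (\<lambda>b y. tens B H b (SH y))"
    using hopf_H by (simp add: braided_hopf_algebra_def yd_hom_def spH tensor_lift_sw)
  then show ?thesis by (simp add: swK[OF \<beta>] tK[OF \<beta>] tensor_in)
qed

lemma sw_CH: "sw (CH x y) \<beta> = sw (K x) (\<lambda>b z. \<beta> (A b y) z)"
  by (rule sw_map)

lemma braid_tens_H: "braid B H H (tens H H x y) = sw (CH x y) (tens H H)"
  by (simp add: braid_tens[OF dat_H dat_H] spH sw_CH)

text \<open>The antipode-free form of the Yetter-Drinfeld condition. In the given form the last leg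
  of the coproduct appears under S; multiplied by the next leg it collapses to a counit.\<close>

lemma act_coact:
  assumes \<Theta>: "bform sB sH \<Theta>"
  shows "sw (DB b) (\<lambda>b1 b2. sw (K (A b1 y)) (\<lambda>d y0. \<Theta> (d * b2) y0)) =
    sw (DB b) (\<lambda>p q. sw (K y) (\<lambda>c y0. \<Theta> (p * c) (A q y0)))"
proof -
  note [lin] = bform_left[OF \<Theta>] bform_right[OF \<Theta>]
  let ?F = "\<lambda>p q r b2. sw (K y) (\<lambda>c y0. \<Theta> (p * c * (SB r * b2)) (A q y0))"
  have "sw (DB b) (\<lambda>b1 b2. sw (K (A b1 y)) (\<lambda>d y0. \<Theta> (d * b2) y0)) =
      sw (DB b) (\<lambda>b1 b2. sw (DB b1) (\<lambda>p b'. sw (DB b') (\<lambda>q r. ?F p q r b2)))"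
    by (subst K_act, intro lin) (simp add: mult.assoc)
  also have "\<dots> = sw (DB b) (\<lambda>p t. sw (DB t) (\<lambda>b' b2. sw (DB b') (\<lambda>q r. ?F p q r b2)))"
    by (rule Bf.coassoc) (intro lin)
  also have "\<dots> = sw (DB b) (\<lambda>p t. sw (DB t) (\<lambda>q u. sw (DB u) (\<lambda>r b2. ?F p q r b2)))"
    by (rule sw_cong, rule Bf.coassoc) (intro lin)
  also have "\<dots> = sw (DB b) (\<lambda>p t. sw (DB t) (\<lambda>q u. eB u * sw (K y) (\<lambda>c y0. \<Theta> (p * c) (A q y0))))"
  proof (intro sw_cong)
    fix p q u
    have "sw (DB u) (\<lambda>r b2. ?F p q r b2) = eB u * sw (K y) (\<lambda>c y0. \<Theta> (p * c * 1) (A q y0))"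
      by (rule Bf.antipode_left[of "\<lambda>t. sw (K y) (\<lambda>c y0. \<Theta> (p * c * t) (A q y0))"]) (intro lin)
    then show "sw (DB u) (\<lambda>r b2. ?F p q r b2) = eB u * sw (K y) (\<lambda>c y0. \<Theta> (p * c) (A q y0))"
      by simp
  qed
  also have "\<dots> = sw (DB b) (\<lambda>p q. sw (K y) (\<lambda>c y0. \<Theta> (p * c) (A q y0)))"
    by (subst Bf.counit_right) (intro lin, simp)
  finally show ?thesis .
qed

text \<open>Naturality of C with respect to a structure map in one argument expresses compatibility
  of that map with the action, in the other argument with the coaction. The braid relation is the
  place where the Yetter-Drinfeld condition enters, through \<open>act_coact\<close>.\<close>

sublocale Hf: symmetric_forms sH DH CH eH SH
proof (unfold_locales, goal_cases)
  case (6 \<beta> y)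
  then have [lin]: "\<And>r g y. lmap r sH g \<Longrightarrow> lform r (\<lambda>x. \<beta> (g x) y)" "\<And>r g y. lmap r sH g \<Longrightarrow> lform r (\<lambda>x. \<beta> y (g x))"
    by (simp_all add: bform_left bform_right)
  show ?case unfolding sw_CH by (intro lin)
next
  case (7 \<beta> x)
  then have [lin]: "\<And>r g y. lmap r sH g \<Longrightarrow> lform r (\<lambda>x. \<beta> (g x) y)" "\<And>r g y. lmap r sH g \<Longrightarrow> lform r (\<lambda>x. \<beta> y (g x))"
    by (simp_all add: bform_left bform_right)
  show ?case unfolding sw_CH by (intro lin)
next
  case (8 \<gamma> x)
  then show ?case using hopf_H
    by (intro coassoc_forms[OF spH lin_bcomult]) (auto simp: braided_hopf_algebra_def)
next
  case (9 \<phi> x)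
  have "sw (DH x) (\<lambda>a b. sH (eH a) b) = x"
    using hopf_H by (simp add: braided_hopf_algebra_def coassociative_counital_def tensor_lift_sw)
  then have "\<phi> (sw (DH x) (\<lambda>a b. sH (eH a) b)) = \<phi> x" by simp
  then show ?case by (simp add: lmap_sw[OF 9] lmapD(2)[OF 9])
next
  case (10 \<phi> x)
  have "sw (DH x) (\<lambda>a b. sH (eH b) a) = x"
    using hopf_H by (simp add: braided_hopf_algebra_def coassociative_counital_def tensor_lift_sw)
  then have "\<phi> (sw (DH x) (\<lambda>a b. sH (eH b) a)) = \<phi> x" by simp
  then show ?case by (simp add: lmap_sw[OF 10] lmapD(2)[OF 10])
next
  case (11 \<beta> x y)
  then have [lin]: "\<And>r g y. lmap r sH g \<Longrightarrow> lform r (\<lambda>x. \<beta> (g x) y)" "\<And>r g y. lmap r sH g \<Longrightarrow> lform r (\<lambda>x. \<beta> y (g x))"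
    by (simp_all add: bform_left bform_right)
  have [lin]: "lmap r sH g \<Longrightarrow> lmap r sH (\<lambda>x. g x * y)" "lmap r sH g \<Longrightarrow> lmap r sH (\<lambda>x. y * g x)"
    for y and r :: "'k \<Rightarrow> 'r::ab_group_add \<Rightarrow> 'r" and g
    by (rule lmap_comp[OF lmaps(3)] lmap_comp[OF lmaps(4)]; assumption)+
  have "bcomult H (x * y) = sw (DH x) (\<lambda>x1 x2. sw (DH y) (\<lambda>y1 y2.
      sw (rep H H (braid B H H (tens H H x2 y1))) (\<lambda>u v. tens H H (x1 * u) (v * y2))))"
    using hopf_H by (simp add: braided_hopf_algebra_def tensor_lift_sw)
  moreover have "sw (rep H H (sw xs (tens H H))) \<beta>' = sw xs \<beta>'" if "bform sH sH \<beta>'" for xs \<beta>'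
    using swH[OF that, of "tens H H" xs] by (simp add: tensor_in tH[OF that])
  moreover have "bform sH sH (\<lambda>u v. \<beta> (x1 * u) (v * y2))" for x1 y2
    by (intro lin)
  ultimately show ?case
    by (simp add: swH[OF 11] tH[OF 11] tensor_in sw_in[OF is_space_tensor_space] braid_tens_H)
next
  case (12 \<beta>)
  then show ?case using hopf_H by (simp add: braided_hopf_algebra_def tH)
next
  case (15 \<phi> x)
  have "sw (DH x) (\<lambda>a b. SH a * b) = sH (eH x) 1"
    using hopf_H by (simp add: braided_hopf_algebra_def tensor_lift_sw)
  then have "\<phi> (sw (DH x) (\<lambda>a b. SH a * b)) = \<phi> (sH (eH x) 1)" by simp
  then show ?case by (simp add: lmap_sw[OF 15] lmapD(2)[OF 15])
next
  case (16 \<phi> x)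
  have "sw (DH x) (\<lambda>a b. a * SH b) = sH (eH x) 1"
    using hopf_H by (simp add: braided_hopf_algebra_def tensor_lift_sw)
  then have "\<phi> (sw (DH x) (\<lambda>a b. a * SH b)) = \<phi> (sH (eH x) 1)" by simp
  then show ?case by (simp add: lmap_sw[OF 16] lmapD(2)[OF 16])
next
  case (17 \<beta> x x' y)
  note [lin] = bform_left[OF 17] bform_right[OF 17] lmap_comp[OF lmaps(3)] lmap_comp[OF lmaps(4)]
  show ?case unfolding sw_CH
    by (subst K_mult, intro lin) (subst sw_swap, simp add: A_mult_left)
next
  case (18 \<beta> x y y')
  note [lin] = bform_left[OF 18] bform_right[OF 18] lmap_comp[OF lmaps(3)] lmap_comp[OF lmaps(4)]
  have "sw (K x) (\<lambda>b z. \<beta> (A b (y * y')) z) = sw (K x) (\<lambda>b z. sw (DB b) (\<lambda>b1 b2. \<beta> (A b1 y * A b2 y') z))"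
  proof (rule sw_cong)
    fix b z
    have "lform sH (\<lambda>x. \<beta> x z)" using 18 by (simp add: bform_def)
    from lmap_sw[OF this] show "\<beta> (A b (y * y')) z = sw (DB b) (\<lambda>b1 b2. \<beta> (A b1 y * A b2 y') z)"
      by (simp add: A_mult)
  qed
  also have "\<dots> = sw (K x) (\<lambda>b z. sw (K z) (\<lambda>c w. \<beta> (A b y * A c y') w))"
    by (rule K_coassoc) (intro lin)
  finally show ?case unfolding sw_CH .
next
  case (19 \<gamma> x y)
  note [lin] = tform_1[OF 19] tform_2[OF 19] tform_3[OF 19]
  have "sw (K x) (\<lambda>b v. sw (DH (A b y)) (\<lambda>u1 u2. \<gamma> u1 u2 v)) =
      sw (K x) (\<lambda>b v. sw (DB b) (\<lambda>b1 b2. sw (DH y) (\<lambda>y1 y2. \<gamma> (A b1 y1) (A b2 y2) v)))"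
    by (subst DH_act) (intro lin, simp)
  also have "\<dots> = sw (K x) (\<lambda>b v. sw (K v) (\<lambda>c w. sw (DH y) (\<lambda>y1 y2. \<gamma> (A b y1) (A c y2) w)))"
    by (rule K_coassoc) (intro lin lform_comp[OF form_DH])
  also have "\<dots> = sw (DH y) (\<lambda>y1 y2. sw (K x) (\<lambda>b v. sw (K v) (\<lambda>c w. \<gamma> (A b y1) (A c y2) w)))"
    by (rule sw_swap3)
  finally show ?case unfolding sw_CH .
next
  case (20 \<gamma> x y)
  note [lin] = tform_1[OF 20] tform_2[OF 20] tform_3[OF 20]
  have "sw (K x) (\<lambda>b v. sw (DH v) (\<lambda>v1 v2. \<gamma> (A b y) v1 v2)) =
      sw (DH x) (\<lambda>x1 x2. sw (K x1) (\<lambda>b v1. sw (K x2) (\<lambda>c v2. \<gamma> (A (b * c) y) v1 v2)))"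
    by (rule K_DH) (intro lin)
  also have "\<dots> = sw (DH x) (\<lambda>x1 x2. sw (K x2) (\<lambda>c v2. sw (K x1) (\<lambda>b v1. \<gamma> (A (b * c) y) v1 v2)))"
    by (rule sw_cong, rule sw_swap)
  finally show ?case unfolding sw_CH A_mult_left .
next
  case (21 \<phi> x y)
  have "sw (K x) (\<lambda>u v. eH (A u y) * \<phi> v) = eH y * sw (K x) (\<lambda>u v. eB u * \<phi> v)"
    by (simp add: e_act mult_ac sw_mult_left[symmetric])
  then show ?case unfolding sw_CH by (simp add: K_counit 21)
next
  case (22 \<phi> x y)
  note [lin] = lform_comp[OF 22]
  have "sw (K x) (\<lambda>u v. \<phi> (A u y) * eH v) = \<phi> (A 1 y) * eH x"
    by (rule K_e) (intro lin)
  then show ?case unfolding sw_CH by (simp add: mult.commute A_one_left)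
next
  case (23 \<beta> y)
  note [lin] = bform_left[OF 23] bform_right[OF 23]
  show ?case unfolding sw_CH by (subst K_one) (intro lin, simp add: A_one_left)
next
  case (24 \<beta> x)
  have "sw (K x) (\<lambda>b z. \<beta> (A b 1) z) = sw (K x) (\<lambda>b z. eB b * \<beta> 1 z)"
    using 24 by (simp add: A_one bform_def lmap_def)
  also have "\<dots> = \<beta> 1 x" by (rule K_counit) (use 24 in \<open>simp add: bform_def\<close>)
  finally show ?case unfolding sw_CH .
next
  case (25 \<beta> x y)
  note [lin] = bform_left[OF 25] bform_right[OF 25]
  show ?case unfolding sw_CH by (subst K_S) (intro lin, simp)
next
  case (26 \<beta> x y)
  show ?case unfolding sw_CH by (simp add: S_act)
next
  case (27 \<gamma> x y z)
  note [lin] = tform_1[OF 27] tform_2[OF 27] tform_3[OF 27] lmap_comp[OF lmaps(1)] lmap_comp[OF lmaps(2)]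
  have "sw (K x) (\<lambda>b x0. sw (K x0) (\<lambda>c x1. sw (K (A b y)) (\<lambda>d y0. \<gamma> (A d (A c z)) y0 x1))) =
      sw (K x) (\<lambda>b x1. sw (DB b) (\<lambda>b1 b2. sw (K (A b1 y)) (\<lambda>d y0. \<gamma> (A (d * b2) z) y0 x1)))"
    by (subst K_coassoc, intro lin) (simp add: A_mult_left)
  also have "\<dots> = sw (K x) (\<lambda>b x1. sw (DB b) (\<lambda>p q. sw (K y) (\<lambda>c y0. \<gamma> (A (p * c) z) (A q y0) x1)))"
  proof (rule sw_cong)
    fix b x1
    show "sw (DB b) (\<lambda>b1 b2. sw (K (A b1 y)) (\<lambda>d y0. \<gamma> (A (d * b2) z) y0 x1)) =
        sw (DB b) (\<lambda>p q. sw (K y) (\<lambda>c y0. \<gamma> (A (p * c) z) (A q y0) x1))"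
      by (rule act_coact[of "\<lambda>t y0. \<gamma> (A t z) y0 x1"]) (intro lin)
  qed
  also have "\<dots> = sw (K x) (\<lambda>b x0. sw (K x0) (\<lambda>c x1. sw (K y) (\<lambda>d y0. \<gamma> (A b (A d z)) (A c y0) x1)))"
    by (subst K_coassoc, intro lin) (simp add: A_mult_left)
  also have "\<dots> = sw (K y) (\<lambda>d y0. sw (K x) (\<lambda>b x0. sw (K x0) (\<lambda>c x1. \<gamma> (A b (A d z)) (A c y0) x1)))"
    by (rule sw_swap3)
  finally show ?case unfolding sw_CH .
next
  case (28 \<beta> x y)
  have "braid B H H (sw (CH x y) (tens H H)) = tens H H x y"
    using symm tensor_in(5) by (simp add: braid_tens_H[symmetric])
  moreover have "braid B H H (sw (CH x y) (tens H H)) = sw (CH x y) (\<lambda>u v. sw (CH u v) (tens H H))"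
    unfolding braid_tens_H[symmetric]
    by (subst linear_on_sw[OF braid_linear[OF dat_H dat_H] is_space_tensor_space, symmetric])
      (simp_all add: tensor_in braid_tens_H)
  ultimately have "sw (rep H H (sw (CH x y) (\<lambda>u v. sw (CH u v) (tens H H)))) \<beta> = sw (rep H H (tens H H x y)) \<beta>"
    by simp
  moreover have "sw (rep H H (sw xs (tens H H))) \<beta> = sw xs \<beta>" for xs
    using swH[OF 28, of "tens H H" xs] by (simp add: tensor_in tH[OF 28])
  ultimately show ?case
    using swH[OF 28, of "\<lambda>u v. sw (CH u v) (tens H H)" "CH x y"]
    by (simp add: tH[OF 28] tensor_in sw_in[OF is_space_tensor_space])
qed (simp_all add: lmaps form_DH eH_mult eH_one)

end



subsection \<open>The antipode of \<open>B\<close>\<close>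

context hopf_setup
begin

lemma eq_by_forms_B: "(\<And>p. lform sB p \<Longrightarrow> p b = p c) \<Longrightarrow> b = c"
  using separating_eqI[OF separating_lforms[OF spB(1)] spB(1), of b c] by (simp add: spB)

lemma SB_mult: "SB (b * c) = SB c * SB b"
  by (rule eq_by_forms_B) (simp add: Bf.antipode_mult)

lemma SB_one: "SB 1 = 1"
proof (rule eq_by_forms_B)
  fix p assume p: "lform sB p"
  have "sw (DB 1) (\<lambda>a b. p (SB a * b)) = eB 1 * p 1" by (rule Bf.antipode_left[OF p])
  moreover have "sw (DB 1) (\<lambda>a b. p (SB a * b)) = p (SB 1 * 1)"
    by (rule Bf.D_one) (intro lin lform_comp[OF p])
  ultimately show "p (SB 1) = p 1" by (simp add: eB_one)
qed

lemma eB_SB: "eB (SB b) = eB b"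
proof -
  have "sw (DB b) (\<lambda>a c. eB (SB a * c)) = eB b * eB 1" by (rule Bf.antipode_left) (intro lin)
  moreover have "sw (DB b) (\<lambda>a c. eB (SB a * c)) = eB (SB b)"
    unfolding eB_mult by (subst mult.commute, rule Bf.counit_right) (intro lin)
  ultimately show ?thesis by (simp add: eB_one)
qed

text \<open>Insert \<open>h2 * S h3\<close> as a counit next to the first leg of the coproduct of
  \<open>S h1\<close>. For the flip, \<open>comult_antipode_right\<close> then evaluates the sum
  over \<open>h1\<close> and \<open>h2\<close>.\<close>

lemma DB_SB:
  assumes \<beta>: "bform sB sB \<beta>"
  shows "sw (DB (SB b)) \<beta> = sw (DB b) (\<lambda>u v. \<beta> (SB v) (SB u))"
proof -
  note [lin] = bform_left[OF \<beta>] bform_right[OF \<beta>] lform_comp[OF Bf.D[OF \<beta>]]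
  have 1: "eB h' * sw (DB (SB h1)) \<beta> = sw (DB h') (\<lambda>h2 h3. sw (DB (SB h1)) (\<lambda>s1 s2. \<beta> (s1 * (h2 * SB h3)) s2))"
    for h1 h'
    by (subst Bf.antipode_right[of "\<lambda>t. sw (DB (SB h1)) (\<lambda>s1 s2. \<beta> (s1 * t) s2)"]) (intro lin, simp)
  have "sw (DB (SB b)) \<beta> = sw (DB b) (\<lambda>h1 h'. eB h' * sw (DB (SB h1)) \<beta>)"
    by (subst Bf.counit_right) (intro lin, simp)
  also have "\<dots> = sw (DB b) (\<lambda>c h3. sw (DB c) (\<lambda>h1 h2. sw (DB (SB h1)) (\<lambda>s1 s2. \<beta> (s1 * (h2 * SB h3)) s2)))"
    unfolding 1 by (rule Bf.coassoc[symmetric]) (intro lin)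
  also have "\<dots> = sw (DB b) (\<lambda>c h3. \<beta> (SB h3) (SB c))"
  proof (rule sw_cong)
    fix c h3
    show "sw (DB c) (\<lambda>h1 h2. sw (DB (SB h1)) (\<lambda>s1 s2. \<beta> (s1 * (h2 * SB h3)) s2)) = \<beta> (SB h3) (SB c)"
      using Bf.comult_antipode_right[of "\<lambda>x y. \<beta> (x * SB h3) y" c]
      by (simp add: mult.assoc) (rule meta_mp, assumption, intro lin)
  qed
  finally show ?thesis .
qed

text \<open>The factors stand in the order opposite to the antipode axiom. Apply S to that axiom: it
  reverses the product, and S^2 = 1 removes the double antipode.\<close>

lemma antipode_left_inv:
  assumes \<phi>: "lform sB \<phi>" shows "sw (DB b) (\<lambda>b1 b2. \<phi> (SB b2 * b1)) = eB b * \<phi> 1"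
proof -
  note [lin] = lform_comp[OF \<phi>]
  have "sw (DB b) (\<lambda>b1 b2. \<phi> (SB (SB b1 * b2))) = eB b * \<phi> (SB 1)"
    by (rule Bf.antipode_left) (intro lin)
  then show ?thesis by (simp add: SB_mult SB_one)
qed

lemma antipode_right_inv:
  assumes \<phi>: "lform sB \<phi>" shows "sw (DB b) (\<lambda>b1 b2. \<phi> (b2 * SB b1)) = eB b * \<phi> 1"
proof -
  note [lin] = lform_comp[OF \<phi>]
  have "sw (DB b) (\<lambda>b1 b2. \<phi> (SB (b1 * SB b2))) = eB b * \<phi> (SB 1)"
    by (rule Bf.antipode_right) (intro lin)
  then show ?thesis by (simp add: SB_mult SB_one)
qed


subsection \<open>Equivariance of the braiding\<close>

text \<open>Together with \<open>CH_coact\<close> this says that C is a morphism of the category.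
  Each is the Yetter-Drinfeld condition in the form \<open>act_coact\<close>.\<close>

lemma CH_act:
  assumes \<beta>: "bform sH sH \<beta>"
  shows "sw (DB b) (\<lambda>b1 b2. sw (CH (A b1 x) (A b2 y)) \<beta>) =
    sw (CH x y) (\<lambda>u v. sw (DB b) (\<lambda>b1 b2. \<beta> (A b1 u) (A b2 v)))"
proof -
  note [lin] = bform_left[OF \<beta>] bform_right[OF \<beta>]
  have "sw (DB b) (\<lambda>b1 b2. sw (K (A b1 x)) (\<lambda>d x0. \<beta> (A (d * b2) y) x0)) =
      sw (DB b) (\<lambda>p q. sw (K x) (\<lambda>c x0. \<beta> (A (p * c) y) (A q x0)))"
    by (rule act_coact) (intro lin)
  then show ?thesis unfolding sw_CH by (simp add: A_mult_left) (rule sw_swap)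
qed

lemma CH_coact:
  assumes \<theta>: "tform sB sH sH \<theta>"
  shows "sw (K h) (\<lambda>c h0. sw (K x) (\<lambda>d x0. sw (CH h0 x0) (\<lambda>u v. \<theta> (c * d) u v))) =
    sw (CH h x) (\<lambda>u v. sw (K u) (\<lambda>b u0. sw (K v) (\<lambda>c v0. \<theta> (b * c) u0 v0)))"
proof -
  note [lin] = tform_1[OF \<theta>] tform_2[OF \<theta>] tform_3[OF \<theta>]
  have "sw (K h) (\<lambda>c h0. sw (K x) (\<lambda>d x0. sw (K h0) (\<lambda>e h00. \<theta> (c * d) (A e x0) h00))) =
      sw (K h) (\<lambda>c h0. sw (K h0) (\<lambda>e h00. sw (K x) (\<lambda>d x0. \<theta> (c * d) (A e x0) h00)))"
    by (rule sw_cong, rule sw_swap)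
  also have "\<dots> = sw (K h) (\<lambda>e v0. sw (DB e) (\<lambda>p q. sw (K x) (\<lambda>d x0. \<theta> (p * d) (A q x0) v0)))"
    by (rule K_coassoc[symmetric]) (intro lin)
  also have "\<dots> = sw (K h) (\<lambda>e v0. sw (DB e) (\<lambda>b1 b2. sw (K (A b1 x)) (\<lambda>d y0. \<theta> (d * b2) y0 v0)))"
    by (rule sw_cong, rule act_coact[symmetric]) (intro lin)
  also have "\<dots> = sw (K h) (\<lambda>b v. sw (K v) (\<lambda>c v0. sw (K (A b x)) (\<lambda>d y0. \<theta> (d * c) y0 v0)))"
    by (rule K_coassoc) (intro lin)
  also have "\<dots> = sw (K h) (\<lambda>b v. sw (K (A b x)) (\<lambda>d y0. sw (K v) (\<lambda>c v0. \<theta> (d * c) y0 v0)))"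
    by (rule sw_cong, rule sw_swap)
  finally show ?thesis unfolding sw_CH .
qed

text \<open>The right-hand side is the inverse braiding, which is the braiding by symmetry.\<close>

lemma CH_inverse:
  assumes \<beta>: "bform sH sH \<beta>"
  shows "sw (CH x y) (\<lambda>u v. \<beta> v u) = sw (K y) (\<lambda>b z. \<beta> (A (SB b) x) z)"
proof -
  note [lin] = bform_left[OF \<beta>] bform_right[OF \<beta>]
  let ?G = "\<lambda>x y. sw (K y) (\<lambda>b z. \<beta> (A (SB b) x) z)"
  have G: "sw (CH y x) (\<lambda>u v. ?G u v) = \<beta> x y" for x y
  proof -
    have "sw (K y) (\<lambda>b y0. sw (K y0) (\<lambda>c z. \<beta> (A (SB c * b) x) z)) =
        sw (K y) (\<lambda>b z. sw (DB b) (\<lambda>b1 b2. \<beta> (A (SB b2 * b1) x) z))"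
      by (rule K_coassoc[symmetric]) (intro lin)
    also have "\<dots> = sw (K y) (\<lambda>b z. eB b * \<beta> (A 1 x) z)"
      by (rule sw_cong, rule antipode_left_inv[of "\<lambda>t. \<beta> (A t x) _"]) (intro lin)
    also have "\<dots> = \<beta> (A 1 x) y" by (rule K_counit) (intro lin)
    finally show ?thesis unfolding sw_CH by (simp add: A_mult_left A_one_left)
  qed
  have "?G x y = sw (CH x y) (\<lambda>u v. sw (CH u v) (\<lambda>p q. ?G p q))"
    by (rule Hf.C_inv[symmetric]) (intro lin)
  then show ?thesis by (simp only: G)
qed

text \<open>\<open>W x \<beta>\<close> evaluates \<open>\<beta>\<close> on the braided coproduct \<open>C \<Delta>(x)\<close>.\<close>

abbreviation W where "W x \<beta> \<equiv> sw (DH x) (\<lambda>x1 x2. sw (CH x1 x2) \<beta>)"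

lemma W_act:
  assumes \<beta>: "bform sH sH \<beta>"
  shows "W (A b x) \<beta> = sw (DB b) (\<lambda>b1 b2. W x (\<lambda>u v. \<beta> (A b1 u) (A b2 v)))"
proof -
  note [lin] = bform_left[OF \<beta>] bform_right[OF \<beta>] Hf.lform_C_left[OF \<beta>] Hf.lform_C_right[OF \<beta>]
  have "W (A b x) \<beta> = sw (DH x) (\<lambda>x1 x2. sw (DB b) (\<lambda>b1 b2. sw (CH (A b1 x1) (A b2 x2)) \<beta>))"
    by (subst DH_act) (intro lin, rule sw_swap)
  then show ?thesis by (simp only: CH_act[OF \<beta>]) (subst sw_swap3, rule refl)
qed

lemma W_coact:
  assumes \<theta>: "tform sB sH sH \<theta>"
  shows "sw (K x) (\<lambda>c x0. W x0 (\<theta> c)) =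
    W x (\<lambda>u v. sw (K u) (\<lambda>b u0. sw (K v) (\<lambda>c v0. \<theta> (b * c) u0 v0)))"
proof -
  note [lin] = tform_1[OF \<theta>] tform_2[OF \<theta>] tform_3[OF \<theta>]
  have "sw (K x) (\<lambda>c x0. W x0 (\<lambda>u v. \<theta> c u v)) =
      sw (DH x) (\<lambda>x1 x2. sw (K x1) (\<lambda>c x1'. sw (K x2) (\<lambda>d x2'. sw (CH x1' x2') (\<lambda>u v. \<theta> (c * d) u v))))"
    by (rule K_DH) (intro lin)
  then show ?thesis by (simp only: CH_coact[OF \<theta>])
qed

text \<open>Since b acts on functionals through S b, the right-hand side is what b f requires; the
  left-hand side involves f only at changed arguments. Writing b1, b2, b3 for the legs, S b3 lands
  on the first factor and b1 S(b2), a counit, on the second. It serves both the rational coaction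
  and the integrals.\<close>

lemma W_act_right:
  assumes \<psi>: "bform sH sH \<psi>"
  shows "sw (DB b) (\<lambda>b1 b2. W (A (SB b2) x) (\<lambda>u v. \<psi> u (A b1 v))) = W x (\<lambda>u v. \<psi> (A (SB b) u) v)"
proof -
  note [lin] = bform_left[OF \<psi>] bform_right[OF \<psi>]
  have "sw (DB b) (\<lambda>b1 b2. W (A (SB b2) x) (\<lambda>u v. \<psi> u (A b1 v))) =
      sw (DB b) (\<lambda>b1 b2. sw (DB (SB b2)) (\<lambda>c1 c2. W x (\<lambda>u v. \<psi> (A c1 u) (A b1 (A c2 v)))))"
    by (subst W_act) (intro lin, simp)
  also have "\<dots> = sw (DB b) (\<lambda>b1 b2. sw (DB b2) (\<lambda>d1 d2. W x (\<lambda>u v. \<psi> (A (SB d2) u) (A (b1 * SB d1) v))))"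
    by (subst DB_SB) (intro lin, simp add: A_mult_left)
  also have "\<dots> = sw (DB b) (\<lambda>c d2. sw (DB c) (\<lambda>b1 d1. W x (\<lambda>u v. \<psi> (A (SB d2) u) (A (b1 * SB d1) v))))"
    by (rule Bf.coassoc[symmetric]) (intro lin)
  also have "\<dots> = sw (DB b) (\<lambda>c d2. eB c * W x (\<lambda>u v. \<psi> (A (SB d2) u) (A 1 v)))"
    by (rule sw_cong, rule Bf.antipode_right[of "\<lambda>t. W x (\<lambda>u v. \<psi> (A (SB _) u) (A t v))"]) (intro lin)
  also have "\<dots> = W x (\<lambda>u v. \<psi> (A (SB b) u) (A 1 v))"
    by (rule Bf.counit_left) (intro lin)
  finally show ?thesis by (simp add: A_one_left)
qed

text \<open>The companion of \<open>W_act_right\<close> for the pairing of f \<otimes> h. On the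
  left b acts diagonally on f \<otimes> h; on the right it has moved to the point and to the test
  functional. The two together give equivariance of the rational coaction.\<close>

lemma CH_act_right:
  assumes \<psi>: "bform sH sH \<psi>"
  shows "sw (DB b) (\<lambda>b1 b2. sw (CH (A b2 h) x) (\<lambda>u v. \<psi> (A (SB b1) u) v)) =
    sw (DB b) (\<lambda>b1 b2. sw (CH h (A (SB b2) x)) (\<lambda>u v. \<psi> u (A b1 v)))"
proof -
  note [lin] = bform_left[OF \<psi>] bform_right[OF \<psi>]
  have 1: "sw (CH y x) (\<lambda>u v. \<psi> (A (SB c) u) v) =
      sw (DB c) (\<lambda>c1 c2. sw (DB c2) (\<lambda>e1 e2. sw (CH (A (SB e2) y) (A (SB e1) x)) (\<lambda>u v. \<psi> u (A c1 v))))" for c y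
  proof -
    have "sw (DB c) (\<lambda>c1 c2. sw (DB c2) (\<lambda>e1 e2. sw (CH (A (SB e2) y) (A (SB e1) x)) (\<lambda>u v. \<psi> u (A c1 v)))) =
        sw (DB c) (\<lambda>c1 c2. sw (DB (SB c2)) (\<lambda>d1 d2. sw (CH (A d1 y) (A d2 x)) (\<lambda>u v. \<psi> u (A c1 v))))"
      by (subst DB_SB) (intro lin, simp)
    also have "\<dots> = sw (DB c) (\<lambda>c1 c2. sw (CH y x) (\<lambda>u v. sw (DB (SB c2)) (\<lambda>d1 d2. \<psi> (A d1 u) (A c1 (A d2 v)))))"
      by (subst CH_act) (intro lin, simp)
    also have "\<dots> = sw (DB c) (\<lambda>c1 c2. sw (CH y x) (\<lambda>u v. sw (DB c2) (\<lambda>e1 e2. \<psi> (A (SB e2) u) (A (c1 * SB e1) v))))"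
      by (subst DB_SB) (intro lin, simp add: A_mult_left)
    also have "\<dots> = sw (CH y x) (\<lambda>u v. sw (DB c) (\<lambda>c1 c2. sw (DB c2) (\<lambda>e1 e2. \<psi> (A (SB e2) u) (A (c1 * SB e1) v))))"
      by (rule sw_swap)
    also have "\<dots> = sw (CH y x) (\<lambda>u v. sw (DB c) (\<lambda>t e2. sw (DB t) (\<lambda>c1 e1. \<psi> (A (SB e2) u) (A (c1 * SB e1) v))))"
      by (rule sw_cong, rule Bf.coassoc[symmetric]) (intro lin)
    also have "\<dots> = sw (CH y x) (\<lambda>u v. sw (DB c) (\<lambda>t e2. eB t * \<psi> (A (SB e2) u) (A 1 v)))"
      by (rule sw_cong, rule sw_cong, rule Bf.antipode_right[of "\<lambda>t. \<psi> (A (SB _) _) (A t _)"]) (intro lin)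
    also have "\<dots> = sw (CH y x) (\<lambda>u v. \<psi> (A (SB c) u) v)"
      by (subst Bf.counit_left) (intro lin, simp add: A_one_left)
    finally show ?thesis ..
  qed
  let ?F = "\<lambda>c1 e1 t. sw (CH (A t h) (A (SB e1) x)) (\<lambda>u v. \<psi> u (A c1 v))"
  have "sw (DB b) (\<lambda>c b2. sw (CH (A b2 h) x) (\<lambda>u v. \<psi> (A (SB c) u) v)) =
      sw (DB b) (\<lambda>c b2. sw (DB c) (\<lambda>c1 c2. sw (DB c2) (\<lambda>e1 e2. ?F c1 e1 (SB e2 * b2))))"
    by (simp add: 1 A_mult_left)
  also have "\<dots> = sw (DB b) (\<lambda>c1 c'. sw (DB c') (\<lambda>c2 b2. sw (DB c2) (\<lambda>e1 e2. ?F c1 e1 (SB e2 * b2))))"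
    by (rule Bf.coassoc) (intro lin)
  also have "\<dots> = sw (DB b) (\<lambda>c1 c'. sw (DB c') (\<lambda>e1 t. sw (DB t) (\<lambda>e2 b2. ?F c1 e1 (SB e2 * b2))))"
    by (rule sw_cong, rule Bf.coassoc) (intro lin)
  also have "\<dots> = sw (DB b) (\<lambda>c1 c'. sw (DB c') (\<lambda>e1 t. eB t * ?F c1 e1 1))"
    by (rule sw_cong, rule sw_cong, rule Bf.antipode_left) (intro lin)
  also have "\<dots> = sw (DB b) (\<lambda>c1 e1. ?F c1 e1 1)"
    by (subst Bf.counit_right) (intro lin, simp)
  finally show ?thesis by (simp add: A_one_left)
qed

text \<open>A factor that sums to a counit is taken from the coaction of \<open>v\<close>. It
  completes S of the coaction of \<open>u\<close> to S of the diagonal coaction of u \<otimes> v, to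
  which colinearity of C and of C \<Delta> applies.\<close>

lemma K_insert:
  assumes \<theta>: "tform sB sH sH \<theta>"
  shows "sw (K u) (\<lambda>b y. \<theta> (SB b * a) y v) =
    sw (K u) (\<lambda>b u0. sw (K v) (\<lambda>c v'. sw (K v') (\<lambda>d v0. \<theta> (d * SB (b * c) * a) u0 v0)))"
proof -
  note [lin] = tform_1[OF \<theta>] tform_2[OF \<theta>] tform_3[OF \<theta>]
  have "sw (K v) (\<lambda>c v'. sw (K v') (\<lambda>d v0. \<theta> (d * SB c * (SB b * a)) u0 v0)) = \<theta> (SB b * a) u0 v" for b u0
  proof -
    have "sw (K v) (\<lambda>c v'. sw (K v') (\<lambda>d v0. \<theta> (d * SB c * (SB b * a)) u0 v0)) =
        sw (K v) (\<lambda>c v0. sw (DB c) (\<lambda>c d. \<theta> (d * SB c * (SB b * a)) u0 v0))"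
      by (rule K_coassoc[symmetric]) (intro lin)
    also have "\<dots> = sw (K v) (\<lambda>c v0. eB c * \<theta> (1 * (SB b * a)) u0 v0)"
      by (rule sw_cong, rule antipode_right_inv[of "\<lambda>t. \<theta> (t * (SB b * a)) u0 _"]) (intro lin)
    also have "\<dots> = \<theta> (1 * (SB b * a)) u0 v"
      by (rule K_counit) (intro lin)
    finally show ?thesis by simp
  qed
  then show ?thesis by (simp add: SB_mult mult.assoc)
qed

text \<open>The coaction counterpart of \<open>W_act_right\<close>: the dual coaction puts S on the
  coaction of \<open>u\<close>, which is traded here for coactions of \<open>x\<close> and
  \<open>v\<close>.\<close>

lemma W_coact_right:
  assumes \<theta>: "tform sB sH sH \<theta>"
  shows "W x (\<lambda>u v. sw (K u) (\<lambda>b y. \<theta> (SB b) y v)) =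
    sw (K x) (\<lambda>d x0. W x0 (\<lambda>u v. sw (K v) (\<lambda>b v0. \<theta> (b * SB d) u v0)))"
proof -
  note [lin] = tform_1[OF \<theta>] tform_2[OF \<theta>] tform_3[OF \<theta>]
  let ?T = "\<lambda>t u v. sw (K v) (\<lambda>d v0. \<theta> (d * SB t) u v0)"
  have "sw (K x) (\<lambda>c x0. W x0 (?T c)) = W x (\<lambda>u v. sw (K u) (\<lambda>b u0. sw (K v) (\<lambda>c v0. ?T (b * c) u0 v0)))"
    by (rule W_coact) (intro lin)
  then show ?thesis using K_insert[OF \<theta>, where a = 1] by simp
qed

lemma CH_coact_right:
  assumes \<theta>: "tform sB sH sH \<theta>"
  shows "sw (K h) (\<lambda>c h0. sw (CH h0 x) (\<lambda>u v. sw (K u) (\<lambda>b y. \<theta> (SB b * c) y v))) =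
    sw (K x) (\<lambda>d x0. sw (CH h x0) (\<lambda>u v. sw (K v) (\<lambda>b v0. \<theta> (b * SB d) u v0)))"
proof -
  note [lin] = tform_1[OF \<theta>] tform_2[OF \<theta>] tform_3[OF \<theta>]
  let ?T = "\<lambda>a t u v. sw (K v) (\<lambda>d v0. \<theta> (d * SB t * a) u v0)"
  have "sw (K h) (\<lambda>a h0. sw (CH h0 x) (\<lambda>u v. sw (K u) (\<lambda>b y. \<theta> (SB b * a) y v))) =
      sw (K h) (\<lambda>a h0. sw (CH h0 x) (\<lambda>u v. sw (K u) (\<lambda>b u0. sw (K v) (\<lambda>c v'. ?T a (b * c) u0 v'))))"
    by (simp only: K_insert[OF \<theta>])
  also have "\<dots> = sw (K h) (\<lambda>a h0. sw (K h0) (\<lambda>c h00. sw (K x) (\<lambda>e x0. sw (CH h00 x0) (\<lambda>u v. ?T a (c * e) u v))))"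
    by (rule sw_cong, rule CH_coact[symmetric]) (intro lin)
  also have "\<dots> = sw (K h) (\<lambda>t h00. sw (DB t) (\<lambda>a c. sw (K x) (\<lambda>e x0. sw (CH h00 x0) (\<lambda>u v. ?T a (c * e) u v))))"
    by (rule K_coassoc[symmetric]) (intro lin)
  also have "\<dots> = sw (K h) (\<lambda>t h00. eB t * sw (K x) (\<lambda>e x0. sw (CH h00 x0) (\<lambda>u v. ?T 1 e u v)))"
  proof (rule sw_cong)
    fix t h00
    show "sw (DB t) (\<lambda>a c. sw (K x) (\<lambda>e x0. sw (CH h00 x0) (\<lambda>u v. ?T a (c * e) u v))) =
        eB t * sw (K x) (\<lambda>e x0. sw (CH h00 x0) (\<lambda>u v. ?T 1 e u v))"
      using antipode_left_inv[of "\<lambda>s. sw (K x) (\<lambda>e x0. sw (CH h00 x0) (\<lambda>u v. sw (K v) (\<lambda>d v0. \<theta> (d * SB e * s) u v0)))" t]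
      by (simp add: SB_mult mult.assoc) (rule meta_mp, assumption, intro lin)
  qed
  also have "\<dots> = sw (K x) (\<lambda>e x0. sw (CH h x0) (\<lambda>u v. ?T 1 e u v))"
    by (rule K_counit) (intro lin)
  finally show ?thesis by simp
qed

end



subsection \<open>The dual as a Yetter--Drinfeld module\<close>

context hopf_setup
begin

abbreviation HD where "HD \<equiv> dual B H"

lemma HD_simps [simp]: "scale HD = fscale" "act HD b f x = f (A (SB b) x)" "coact HD = dual_coact B H"
  by (simp_all add: dual_def)

lemma in_HD: "f \<in> carrier HD \<longleftrightarrow> lform sH f"
  using spH vector_space_times[where 'k = 'k]
  by (auto simp: dual_def dual_carrier_def lmap_def linear_iff is_space_def)

lemma is_space_fscale:
  assumes "scale N = (fscale :: 'k \<Rightarrow> ('x \<Rightarrow> 'k) \<Rightarrow> _)" "0 \<in> carrier N"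
    "\<And>f g. f \<in> carrier N \<Longrightarrow> g \<in> carrier N \<Longrightarrow> f + g \<in> carrier N"
    "\<And>c f. f \<in> carrier N \<Longrightarrow> fscale c f \<in> carrier N"
  shows "is_space N"
proof -
  interpret F: vector_space "fscale :: 'k \<Rightarrow> ('x \<Rightarrow> 'k) \<Rightarrow> _" by (rule vector_space_fscale)
  show ?thesis unfolding is_space_def assms(1) using assms F.vector_space_axioms by (auto simp: F.subspace_def)
qed

lemma spHD: "is_space HD"
  by (rule is_space_fscale) (auto simp: in_HD lmap_def fscale_def algebra_simps)

lemma separating_eval: "scale N = fscale \<Longrightarrow> separating N (range (\<lambda>x f. f x))"
  by (auto simp: separating_def linear_on_def fscale_def fun_eq_iff)

lemma bform_eval [lin]: "lform sB p \<Longrightarrow> bform sB fscale (\<lambda>b g. p b * g x)"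
  by (auto simp: bform_def lmap_def fscale_def algebra_simps)

lemma tensor_B_eqI:
  fixes N :: "('k, 'x \<Rightarrow> 'k, 'z) vspace_scheme"
  assumes "is_space N" "scale N = fscale"
    "t \<in> carrier (tensor_space B N)" "t' \<in> carrier (tensor_space B N)"
    "\<And>p x. lform sB p \<Longrightarrow> sw (rep B N t) (\<lambda>b g. p b * g x) = sw (rep B N t') (\<lambda>b g. p b * g x)"
  shows "t = t'"
  by (rule tensor_eqI[OF spB(1) assms(1) separating_lforms[OF spB(1)] separating_eval[OF assms(2)] assms(3,4)])
    (use assms(5) in auto)

lemma sw_sum_list: "sw (map (\<lambda>e. (e, g e)) es) \<beta> = (\<Sum>e\<leftarrow>es. \<beta> e (g e))"
  by (induction es) auto

text \<open>Finite dimension of \<open>B\<close> enters here. In a finite basis of \<open>B\<close>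
  the map sending x to \<Sigma> f(x_0) S(x_(-1)) becomes a finite sum of e \<otimes> g with
  coordinate functionals g. Their explicit form is recorded because closure of the integrals under
  the coaction depends on it.\<close>

lemma dual_coact_exists:
  assumes f: "lform sH f"
  obtains xs where "\<And>e g. (e, g) \<in> set xs \<Longrightarrow>
      \<exists>p. lform sB p \<and> g = (\<lambda>x. sw (K x) (\<lambda>b y. p (SB b) * f y))"
    and "\<And>x. sw xs (\<lambda>e g. sB (g x) e) = sw (K x) (\<lambda>b y. sB (f y) (SB b))"
proof -
  obtain E where "finite_dimensional_vector_space sB E" using fin_B by blast
  then interpret V: finite_dimensional_vector_space sB E .
  obtain es where es: "set es = E" "distinct es"
    using finite_distinct_list[OF V.finite_Basis] by blast
  let ?p = "\<lambda>e b. V.representation E b e"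
  let ?T = "\<lambda>x. sw (K x) (\<lambda>b y. sB (f y) (SB b))"
  let ?xs = "map (\<lambda>e. (e, \<lambda>x. sw (K x) (\<lambda>b y. ?p e (SB b) * f y))) es"
  have span: "b \<in> V.span E" for b using V.span_Basis by auto
  have p: "lform sB (?p e)" for e
    by (auto simp: lmap_def V.representation_add[OF V.independent_Basis] V.representation_scale[OF V.independent_Basis] span)
  have pT: "?p e (?T x) = sw (K x) (\<lambda>b y. ?p e (SB b) * f y)" for e x
    by (simp add: lmap_sw[OF p] lmapD(2)[OF p] mult.commute)
  have "sw ?xs (\<lambda>e g. sB (g x) e) = ?T x" for x
  proof -
    have "sw ?xs (\<lambda>e g. sB (g x) e) = (\<Sum>e\<leftarrow>es. sB (?p e (?T x)) e)"
      by (simp add: sw_sum_list pT)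
    also have "\<dots> = (\<Sum>e\<in>E. sB (?p e (?T x)) e)"
      using es by (simp add: sum_list_distinct_conv_sum_set)
    also have "\<dots> = ?T x"
      by (rule V.sum_representation_eq[OF V.independent_Basis span V.finite_Basis]) simp
    finally show ?thesis .
  qed
  then show ?thesis using p by (intro that[of ?xs]) auto
qed

lemma lform_coact_form:
  "lform sB p \<Longrightarrow> lform sH f \<Longrightarrow> lform sH (\<lambda>x. sw (K x) (\<lambda>b y. p (SB b) * f y))"
proof -
  assume [THEN lform_comp, lin]: "lform sB p" "lform sH f"
  show "lform sH (\<lambda>x. sw (K x) (\<lambda>b y. p (SB b) * f y))" by (intro lin)
qed

text \<open>The \<open>THE\<close> is justified since functionals of \<open>B\<close> and points of
  \<open>H\<close> separate B \<otimes> H*. Because S is its own inverse, S can stand for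
  \<open>inv (antipode B)\<close> from here on.\<close>

lemma dual_coact_characterization:
  assumes f: "lform sH f"
  shows "dual_coact B H f \<in> carrier (tensor_space B HD)" (is ?A)
    and "lform sB p \<Longrightarrow>
      sw (rep B HD (dual_coact B H f)) (\<lambda>b g. p b * g x) = sw (K x) (\<lambda>b y. p (SB b) * f y)" (is "_ \<Longrightarrow> ?B")
    and "\<exists>xs. dual_coact B H f = sw xs (tens B HD) \<and>
      (\<forall>(e, g) \<in> set xs. \<exists>p. lform sB p \<and> g = (\<lambda>x. sw (K x) (\<lambda>b y. p (SB b) * f y)))" (is ?C)
proof -
  let ?P = "\<lambda>t. t \<in> carrier (tensor_space B HD) \<and>
    (\<forall>x. sw (rep B HD t) (\<lambda>b g. sB (g x) b) = sw (K x) (\<lambda>b y. sB (f y) (SB b)))"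
  \<comment> \<open>\<open>dual_space\<close> and \<open>dual\<close> share carrier and scaling, so
    even the chosen lists coincide.\<close>
  have ds: "tensor_space B (dual_space H) = tensor_space B HD" "rep B (dual_space H) = rep B HD"
    by (auto intro!: tensor_space_cong rep_cong simp: dual_space_def dual_def)
  have eq: "dual_coact B H f = (THE t. ?P t)"
    unfolding dual_coact_def by (simp add: ds tensor_lift_sw inv_SB[symmetric])
  obtain xs where xs: "\<And>e g. (e, g) \<in> set xs \<Longrightarrow>
      \<exists>p. lform sB p \<and> g = (\<lambda>x. sw (K x) (\<lambda>b y. p (SB b) * f y))"
    "\<And>x. sw xs (\<lambda>e g. sB (g x) e) = sw (K x) (\<lambda>b y. sB (f y) (SB b))"
    using dual_coact_exists[OF f] by blast
  have sub: "set xs \<subseteq> carrier B \<times> carrier HD"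
    using xs(1) lform_coact_form[OF _ f] by (fastforce simp: spB in_HD)
  let ?t = "sw xs (tens B HD)"
  have bil: "bilinear_on B HD B (\<lambda>b g. sB (g x) b)" for x
  proof -
    have "sB c (sB d b) = sB d (sB c b)" for c d b
      by (simp add: is_spaceD(8)[OF spB(1), symmetric] mult.commute)
    then show ?thesis
      by (auto simp: bilinear_on_def linear_on_def spB is_spaceD(6,8,9)[OF spB(1)] fscale_def)
  qed
  have t: "?P ?t"
    using sw_tens_in[OF sub] sw_rep[OF spB(1) spHD spB(1) bil sub] xs(2) by simp
  have P: "sw (rep B HD t) (\<lambda>b g. p b * g x) = sw (K x) (\<lambda>b y. p (SB b) * f y)"
    if t: "?P t" and p: "lform sB p" for t p x
  proof -
    have "p (sw (rep B HD t) (\<lambda>b g. sB (g x) b)) = p (sw (K x) (\<lambda>b y. sB (f y) (SB b)))"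
      using t by simp
    then show ?thesis by (simp add: lmap_sw[OF p] lmapD(2)[OF p] mult.commute)
  qed
  have "t = ?t" if "?P t" for t
    by (rule tensor_B_eqI[OF spHD]) (use that t P in auto)
  then have "dual_coact B H f = ?t" unfolding eq using t by (intro the_equality) blast+
  with t P xs(1) show ?A "lform sB p \<Longrightarrow> ?B" ?C by auto
qed

abbreviation KD where "KD f \<equiv> rep B HD (dual_coact B H f)"

lemmas dual_coact_in = dual_coact_characterization(1)
lemmas KD_eval = dual_coact_characterization(2)

lemma dual_coact_eqI:
  assumes "lform sH f" "t \<in> carrier (tensor_space B HD)"
    and "\<And>p x. lform sB p \<Longrightarrow> sw (rep B HD t) (\<lambda>b g. p b * g x) = sw (K x) (\<lambda>b y. p (SB b) * f y)"
  shows "dual_coact B H f = t"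
  by (rule tensor_B_eqI[OF spHD]) (use assms in \<open>auto simp: dual_coact_in KD_eval\<close>)

lemma KD_in: "lform sH f \<Longrightarrow> (b, g) \<in> set (KD f) \<Longrightarrow> lform sH g"
  using rep_set[OF spB(1) dual_coact_in, of f] by (fastforce simp: in_HD)

lemma sw_rep_B_tens:
  fixes N :: "('k, 'x \<Rightarrow> 'k, 'z) vspace_scheme"
  assumes "is_space N" "scale N = fscale" "lform sB p" "\<And>a c. (a, c) \<in> set xs \<Longrightarrow> G a c \<in> carrier N"
  shows "sw (rep B N (sw xs (\<lambda>a c. tens B N (F a c) (G a c)))) (\<lambda>b g. p b * g x) =
    sw xs (\<lambda>a c. p (F a c) * G a c x)"
proof -
  have \<beta>: "bform sB (scale N) (\<lambda>b g. p b * g x)" using assms(2,3) by (simp add: bform_eval)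
  have "sw (rep B N (sw xs (\<lambda>a c. tens B N (F a c) (G a c)))) (\<lambda>b g. p b * g x) =
      sw xs (\<lambda>a c. sw (rep B N (tens B N (F a c) (G a c))) (\<lambda>b g. p b * g x))"
    by (rule sw_rep_sw[OF spB(1) assms(1) \<beta>]) (use assms(4) in \<open>auto intro!: tens_in simp: spB\<close>)
  also have "\<dots> = sw xs (\<lambda>a c. p (F a c) * G a c x)"
    by (rule sw_cong, rule sw_rep_tens_form[OF spB(1) assms(1) \<beta>]) (use assms(4) in \<open>auto simp: spB\<close>)
  finally show ?thesis .
qed

lemma lin_dual_coact: "linear_on HD (tensor_space B HD) (dual_coact B H)"
proof
  fix f g c assume f: "f \<in> carrier HD"
  then have f': "lform sH f" by (simp add: in_HD)
  show "dual_coact B H f \<in> carrier (tensor_space B HD)" by (rule dual_coact_in[OF f'])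
  have lin_rep: "linear_on (tensor_space B HD) ground (\<lambda>t. sw (rep B HD t) (\<lambda>b g. p b * g x))"
    if "lform sB p" for p x
    by (intro linear_on_sw_rep spB spHD is_space_ground bilinear_on_bform) (simp add: bform_eval that)
  { assume g: "g \<in> carrier HD"
    then have g': "lform sH g" by (simp add: in_HD)
    show "dual_coact B H (f + g) = dual_coact B H f + dual_coact B H g"
    proof (rule dual_coact_eqI)
      show "lform sH (f + g)" using is_spaceD(2)[OF spHD f g] by (simp add: in_HD)
      show "dual_coact B H f + dual_coact B H g \<in> carrier (tensor_space B HD)"
        using is_spaceD(2)[OF is_space_tensor_space] dual_coact_in[OF f'] dual_coact_in[OF g'] by blast
    qed (simp add: linear_onD(2)[OF lin_rep] dual_coact_in f' g' KD_eval algebra_simps sw_add) }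
  show "dual_coact B H (scale HD c f) = scale (tensor_space B HD) c (dual_coact B H f)"
  proof (rule dual_coact_eqI)
    show "lform sH (scale HD c f)" using is_spaceD(4)[OF spHD f] by (simp add: in_HD)
    show "scale (tensor_space B HD) c (dual_coact B H f) \<in> carrier (tensor_space B HD)"
      using is_spaceD(4)[OF is_space_tensor_space] dual_coact_in[OF f'] by blast
  next
    fix p x assume p: "lform sB p"
    show "sw (rep B HD (scale (tensor_space B HD) c (dual_coact B H f))) (\<lambda>b g. p b * g x) =
        sw (K x) (\<lambda>b y. p (SB b) * scale HD c f y)"
      using linear_onD(3)[OF lin_rep[OF p] dual_coact_in[OF f'], of c x]
      by (simp add: KD_eval f' p fscale_def sw_mult_left[symmetric] mult.left_commute)
  qed
qed

lemma act_HD_in: "lform sH f \<Longrightarrow> lform sH (act HD b f)"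
proof -
  assume [THEN lform_comp, lin]: "lform sH f"
  have "lform sH (\<lambda>x. f (A (SB b) x))" by (intro lin)
  then show ?thesis by (simp add: dual_def)
qed

lemma bil_act_HD: "bilinear_on B HD HD (act HD)"
proof (intro bilinear_onI linear_onI)
  fix b c f g r
  have HD_a: "act HD b f = (\<lambda>x. f (A (SB b) x))" for b f by (simp add: dual_def)
  { assume f: "f \<in> carrier HD"
    then have f': "lform sH f" by (simp add: in_HD)
    show "act HD b f \<in> carrier HD" by (simp add: in_HD act_HD_in f')
    then show "act HD b f \<in> carrier HD" .
    have *: "A (SB (b + c)) x = A (SB b) x + A (SB c) x" "A (SB (sB r b)) x = sH r (A (SB b) x)" for x
      by (simp_all add: lmapD[OF lmaps(7)] lmapD[OF lmaps(9)])
    show "act HD (b + c) f = act HD b f + act HD c f" "act HD (sB r b) f = scale HD r (act HD b f)"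
      by (auto simp: HD_a fun_eq_iff lmapD[OF f'] fscale_def *) }
  show "act HD b (f + g) = act HD b f + act HD b g" "act HD b (scale HD r f) = scale HD r (act HD b f)"
    by (simp_all add: HD_a fun_eq_iff fscale_def)
qed

lemma dat_HD: "yd_data B HD"
  using lin_dual_coact by (simp add: yd_data_def spB bil_B lin_comult spHD bil_act_HD)

lemma tensor_BB_eqI:
  fixes N :: "('k, 'x \<Rightarrow> 'k, 'z) vspace_scheme"
  assumes N: "is_space N" "scale N = fscale"
    and "t \<in> carrier (tensor_space B (tensor_space B N))" "t' \<in> carrier (tensor_space B (tensor_space B N))"
    and eq: "\<And>p q x. lform sB p \<Longrightarrow> lform sB q \<Longrightarrow>
      ev3 B B N (\<lambda>b c g. p b * (q c * g x)) t = ev3 B B N (\<lambda>b c g. p b * (q c * g x)) t'"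
  shows "t = t'"
proof (rule tensor_eqI[OF spB(1) is_space_tensor_space separating_lforms[OF spB(1)]
      separating_tensor[OF spB(1) N(1) separating_lforms[OF spB(1)] separating_eval[OF N(2)]] assms(3,4)])
  fix p F assume p: "p \<in> {\<phi>. lform sB \<phi>}" and "F \<in> tensor_forms B N {\<phi>. lform sB \<phi>} (range (\<lambda>x f. f x))"
  then obtain q x where "lform sB q" "F = (\<lambda>t. sw (rep B N t) (\<lambda>c g. q c * g x))"
    by (auto simp: tensor_forms_def)
  then show "sw (rep B (tensor_space B N) t) (\<lambda>b s. p b * F s) = sw (rep B (tensor_space B N) t') (\<lambda>b s. p b * F s)"
    using eq[of p q x] p by (simp add: ev3_def sw_mult_left)
qed

lemma tform_BB [lin]: "lform sB p \<Longrightarrow> lform sB q \<Longrightarrow> tform sB sB fscale (\<lambda>b c g. p b * (q c * g x))"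
  by (auto simp: tform_def lmap_def fscale_def algebra_simps)

text \<open>Tested against functionals of \<open>B\<close> and a point of \<open>H\<close>, each
  axiom becomes one for \<open>H\<close> with S applied. Action and coaction remain left-sided
  because S reverses both products and coproducts.\<close>

lemma yd_HD: "yd_module B HD"
  unfolding yd_module_def
proof (intro conjI allI ballI)
  show "is_space HD" "bilinear_on B HD HD (act HD)" by (fact spHD, fact bil_act_HD)
  show "linear_on HD (tensor_space B HD) (coact HD)" using lin_dual_coact by simp
  fix b c f
  show "act HD (b * c) f = act HD b (act HD c f)"
    by (rule ext) (simp add: SB_mult A_mult_left)
  assume "f \<in> carrier HD"
  then have f: "lform sH f" by (simp add: in_HD)
  note [lin] = lform_comp[OF f]
  show "act HD 1 f = f" by (rule ext) (simp add: SB_one A_one_left)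
  note tin = tens_in[of _ B _ HD] tens_in[of _ B _ "tensor_space B HD"]
  note inKD = KD_in[OF f] dual_coact_in spB(2) in_HD
  show "tensor_lift B HD (\<lambda>b m0. tensor_lift B B (\<lambda>b1 b2. tens B (tensor_space B HD) b1 (tens B HD b2 m0)) (comult B b))
          (coact HD f) = tensor_lift B HD (\<lambda>b m0. tens B (tensor_space B HD) b (coact HD m0)) (coact HD f)"
    unfolding tensor_lift_sw HD_simps(1,3)
  proof (rule tensor_BB_eqI[OF spHD HD_simps(1)])
    fix p q x assume p: "lform sB p" and q: "lform sB q"
    note [lin] = lform_comp[OF p] lform_comp[OF q]
    note sp3 = spB(1) spB(1) spHD
    have \<gamma>: "tform sB sB (scale HD) (\<lambda>b c g. p b * (q c * g x))" using tform_BB[OF p q] by simp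
    have "ev3 B B HD (\<lambda>b c g. p b * (q c * g x)) (sw (KD f) (\<lambda>b m0. sw (DB b) (\<lambda>b1 b2. tens B (tensor_space B HD) b1 (tens B HD b2 m0)))) =
        sw (KD f) (\<lambda>b m0. sw (DB b) (\<lambda>b1 b2. p b1 * (q b2 * m0 x)))"
      by (simp add: ev3_sw[OF sp3 \<gamma>] ev3_tens2[OF sp3 \<gamma>] inKD tin sw_in[OF is_space_tensor_space] cong: sw_cong)
    also have "\<dots> = sw (KD f) (\<lambda>b m0. sw (DB b) (\<lambda>b1 b2. p b1 * q b2) * m0 x)"
      by (simp add: sw_mult_right[symmetric] mult.assoc)
    also have "\<dots> = sw (K x) (\<lambda>b y. sw (DB (SB b)) (\<lambda>b1 b2. p b1 * q b2) * f y)"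
      by (rule KD_eval[OF f]) (intro lin)
    also have "\<dots> = sw (K x) (\<lambda>b y. sw (DB b) (\<lambda>b1 b2. p (SB b2) * q (SB b1) * f y))"
      by (subst DB_SB, intro lin) (simp add: sw_mult_right)
    also have "\<dots> = sw (K x) (\<lambda>b y. sw (K y) (\<lambda>c z. p (SB c) * q (SB b) * f z))"
      by (rule K_coassoc) (intro lin)
    also have "\<dots> = sw (K x) (\<lambda>b y. sw (KD f) (\<lambda>c g. p c * (q (SB b) * g y)))"
      using KD_eval[OF f lform_mult_right[OF p]]
      by (simp add: mult.assoc) 
    also have "\<dots> = sw (KD f) (\<lambda>c g. p c * sw (K x) (\<lambda>b y. q (SB b) * g y))"
      by (subst sw_swap) (simp add: sw_mult_left)
    also have "\<dots> = sw (KD f) (\<lambda>c g. p c * sw (KD g) (\<lambda>b g'. q b * g' x))"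
      by (rule sw_cong) (simp add: KD_eval[OF KD_in[OF f] q])
    also have "\<dots> = ev3 B B HD (\<lambda>b c g. p b * (q c * g x)) (sw (KD f) (\<lambda>b m0. tens B (tensor_space B HD) b (dual_coact B H m0)))"
      by (simp add: ev3_sw[OF sp3 \<gamma>] ev3_tens[OF sp3 \<gamma>] inKD tin sw_mult_left cong: sw_cong)
    finally show "ev3 B B HD (\<lambda>b c g. p b * (q c * g x)) (sw (KD f) (\<lambda>b m0. sw (DB b) (\<lambda>b1 b2. tens B (tensor_space B HD) b1 (tens B HD b2 m0)))) =
      ev3 B B HD (\<lambda>b c g. p b * (q c * g x)) (sw (KD f) (\<lambda>b m0. tens B (tensor_space B HD) b (dual_coact B H m0)))" .
  qed (auto intro!: sw_in[OF is_space_tensor_space] tin simp: inKD)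
  show "tensor_lift B HD (\<lambda>b m0. scale HD (eB b) m0) (coact HD f) = f"
    unfolding tensor_lift_sw HD_simps(1,3)
    by (rule ext) (simp add: sw_apply fscale_def KD_eval[OF f lmaps(5)] eB_SB K_counit[OF f])
  show "coact HD (act HD b f) = tensor_lift B B (\<lambda>b1 b'. tensor_lift B B (\<lambda>b2 b3.
            tensor_lift B HD (\<lambda>c m0. tens B HD (b1 * c * SB b3) (act HD b2 m0)) (coact HD f))
          (comult B b')) (comult B b)"
    unfolding tensor_lift_sw HD_simps(1,3)
  proof (rule dual_coact_eqI[OF act_HD_in[OF f]])
    fix p x assume p: "lform sB p"
    note [lin] = lform_comp[OF p]
    have \<beta>: "bform sB (scale HD) (\<lambda>b g. p b * g x)" using p by (simp add: bform_eval)
    \<comment> \<open>The Yetter-Drinfeld condition of \<open>H\<close> at \<open>SB b2\<close>,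
      whose threefold coproduct is that of \<open>b2\<close> reversed under S.\<close>
    have 1: "sw (K (A (SB b2) x)) (\<lambda>c y. p (b1 * SB c * SB b3) * f y) =
       sw (DB b2) (\<lambda>e1 e2. sw (DB e1) (\<lambda>g1 g2. sw (K x) (\<lambda>c y. p (b1 * SB g1 * (SB c * (e2 * SB b3))) * f (A (SB g2) y))))"
      for b1 b2 b3
    proof -
      have "sw (K (A (SB b2) x)) (\<lambda>c y. p (b1 * SB c * SB b3) * f y) =
        sw (DB (SB b2)) (\<lambda>d1 d'. sw (DB d') (\<lambda>d2 d3. sw (K x) (\<lambda>c y. p (b1 * SB (d1 * c * SB d3) * SB b3) * f (A d2 y))))"
        by (rule K_act) (intro lin)
      also have "\<dots> = sw (DB b2) (\<lambda>e1 e2. sw (DB (SB e1)) (\<lambda>d2 d3. sw (K x) (\<lambda>c y. p (b1 * SB (SB e2 * c * SB d3) * SB b3) * f (A d2 y))))"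
        by (rule DB_SB) (intro lin)
      also have "\<dots> = sw (DB b2) (\<lambda>e1 e2. sw (DB e1) (\<lambda>g1 g2. sw (K x) (\<lambda>c y. p (b1 * SB (SB e2 * c * SB (SB g1)) * SB b3) * f (A (SB g2) y))))"
        by (rule sw_cong, rule DB_SB) (intro lin)
      finally show ?thesis by (simp add: SB_mult mult.assoc)
    qed
    \<comment> \<open>The neighbours \<open>e2 * SB b3\<close> cancel here, and
      \<open>b1 * SB g1\<close> cancels in the main computation. What survives is the action of S b
      on the argument of \<open>f\<close>.\<close>
    have 2: "sw (DB b') (\<lambda>b2 b3. sw (DB b2) (\<lambda>e1 e2. sw (DB e1) (\<lambda>g1 g2. sw (K x) (\<lambda>c y. p (r * SB g1 * (SB c * (e2 * SB b3))) * f (A (SB g2) y))))) =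
        sw (DB b') (\<lambda>g1 g2. sw (K x) (\<lambda>c y. p (r * SB g1 * SB c) * f (A (SB g2) y)))" for b' r
    proof -
      let ?Z = "\<lambda>e1 t. sw (DB e1) (\<lambda>g1 g2. sw (K x) (\<lambda>c y. p (r * SB g1 * (SB c * t)) * f (A (SB g2) y)))"
      have "sw (DB b') (\<lambda>b2 b3. sw (DB b2) (\<lambda>e1 e2. ?Z e1 (e2 * SB b3))) =
          sw (DB b') (\<lambda>e1 t. sw (DB t) (\<lambda>e2 b3. ?Z e1 (e2 * SB b3)))"
        by (rule Bf.coassoc) (intro lin)
      also have "\<dots> = sw (DB b') (\<lambda>e1 t. eB t * ?Z e1 1)"
        by (rule sw_cong, rule Bf.antipode_right) (intro lin)
      also have "\<dots> = ?Z b' 1" by (rule Bf.counit_right) (intro lin)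
      finally show ?thesis by simp
    qed
    let ?Y = "\<lambda>t g2. sw (K x) (\<lambda>c y. p (t * SB c) * f (A (SB g2) y))"
    have "sw (rep B HD (sw (DB b) (\<lambda>b1 b'. sw (DB b') (\<lambda>b2 b3. sw (KD f) (\<lambda>c m0. tens B HD (b1 * c * SB b3) (act HD b2 m0)))))) (\<lambda>b g. p b * g x)
      = sw (DB b) (\<lambda>b1 b'. sw (DB b') (\<lambda>b2 b3. sw (KD f) (\<lambda>c m0. p (b1 * c * SB b3) * m0 (A (SB b2) x))))"
      by (simp add: sw_rep_sw[OF spB(1) spHD \<beta>] sw_rep_tens_form[OF spB(1) spHD \<beta>] inKD act_HD_in tin
          sw_in[OF is_space_tensor_space] cong: sw_cong)
    also have "\<dots> = sw (DB b) (\<lambda>b1 b'. sw (DB b') (\<lambda>b2 b3. sw (K (A (SB b2) x)) (\<lambda>c y. p (b1 * SB c * SB b3) * f y)))"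
      by (subst KD_eval[OF f]) (intro lin, simp)
    also have "\<dots> = sw (DB b) (\<lambda>b1 b'. sw (DB b') (\<lambda>g1 g2. ?Y (b1 * SB g1) g2))"
      unfolding 1 2 ..
    also have "\<dots> = sw (DB b) (\<lambda>t g2. sw (DB t) (\<lambda>b1 g1. ?Y (b1 * SB g1) g2))"
      by (rule Bf.coassoc[symmetric]) (intro lin)
    also have "\<dots> = sw (DB b) (\<lambda>t g2. eB t * ?Y 1 g2)"
      by (rule sw_cong, rule Bf.antipode_right) (intro lin)
    also have "\<dots> = ?Y 1 b" by (rule Bf.counit_left) (intro lin)
    finally show "sw (rep B HD (sw (DB b) (\<lambda>b1 b'. sw (DB b') (\<lambda>b2 b3. sw (KD f) (\<lambda>c m0. tens B HD (b1 * c * SB b3) (act HD b2 m0)))))) (\<lambda>b g. p b * g x)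
      = sw (K x) (\<lambda>b' y. p (SB b') * act HD b f y)" by simp
  qed (auto intro!: sw_in[OF is_space_tensor_space] tin simp: inKD act_HD_in)
qed

end



subsection \<open>The product of the dual\<close>

lemma sw_list_cong:
  "xs = ys \<Longrightarrow> (\<And>x y. (x, y) \<in> set ys \<Longrightarrow> \<beta> x y = \<gamma> x y) \<Longrightarrow> sw xs \<beta> = sw ys \<gamma>"
  using sw_cong by blast

lemma fscale_simps:
  "fscale (a + b) f = fscale a f + fscale b f" "fscale a (f + g) = fscale a f + fscale a g"
  "fscale (a * b) f = fscale a (fscale b f)"
  by (auto simp: fscale_def algebra_simps)

lemma fscale_commute: "fscale a (fscale b f) = fscale b (fscale a f)"
  by (simp add: fscale_def mult.left_commute)

context hopf_setup
begin

text \<open>The braiding of H* with \<open>H\<close> evaluates to the inverse braiding of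
  \<open>H\<close>, since the coaction of H* carries an antipode. By symmetry that inverse is C
  itself.\<close>

lemma dual_mult_eq:
  assumes f: "lform sH f" and g: "lform sH g"
  shows "dual_mult B H f g = (\<lambda>x. W x (\<lambda>u v. g u * f v))"
proof
  fix x
  note [lin] = lform_comp[OF f] lform_comp[OF g]
  have in_lists: "tens H HD a c \<in> carrier (tensor_space H HD)" if "lform sH c" for a c
    by (rule tens_in) (simp_all add: spH in_HD that)
  have "sw (rep H HD (braid B HD H (tens HD H g h1))) (\<lambda>u v. f u * v h2) = sw (CH h1 h2) (\<lambda>u v. g u * f v)" for h1 h2
  proof -
    have \<beta>: "bform sH (scale HD) (\<lambda>u v. f u * v h2)"
      by (auto simp: bform_def lmap_def lmapD[OF f] fscale_def algebra_simps)
    have "sw (rep H HD (braid B HD H (tens HD H g h1))) (\<lambda>u v. f u * v h2) = sw (KD g) (\<lambda>b g0. f (A b h1) * g0 h2)"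
      by (simp add: braid_tens[OF dat_HD dat_H] spH in_HD g sw_rep_sw[OF spH(1) spHD \<beta>] KD_in[OF g] in_lists
          sw_rep_tens_form[OF spH(1) spHD \<beta>] cong: sw_list_cong)
    also have "\<dots> = sw (K h2) (\<lambda>b y. f (A (SB b) h1) * g y)"
      by (rule KD_eval[OF g]) (intro lin)
    also have "\<dots> = sw (CH h1 h2) (\<lambda>u v. f v * g u)"
      by (rule CH_inverse[of "\<lambda>a z. f a * g z", symmetric]) (intro lin)
    finally show ?thesis by (simp add: mult.commute)
  qed
  then show "dual_mult B H f g x = W x (\<lambda>u v. g u * f v)"
    by (simp add: dual_mult_def tensor_lift_sw)
qed

lemma dual_mult_in: "lform sH f \<Longrightarrow> lform sH g \<Longrightarrow> lform sH (dual_mult B H f g)"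
proof -
  assume fg: "lform sH f" "lform sH g"
  note [lin] = fg[THEN lform_comp]
  show ?thesis unfolding dual_mult_eq[OF fg] by (intro lin)
qed

lemma dual_mult_assoc:
  assumes f: "lform sH f" and g: "lform sH g" and m: "lform sH m"
  shows "dual_mult B H (dual_mult B H f g) m = dual_mult B H f (dual_mult B H g m)"
proof
  fix x
  note [lin] = lform_comp[OF f] lform_comp[OF g] lform_comp[OF m]
  have "sw (DH x) (\<lambda>x1 x2. sw (CH x1 x2) (\<lambda>a c. sw (DH c) (\<lambda>c1 c2. sw (CH c1 c2) (\<lambda>b v. m a * (g b * f v))))) =
    sw (DH x) (\<lambda>x1 x2. sw (CH x1 x2) (\<lambda>p q. sw (DH p) (\<lambda>p1 p2. sw (CH p1 p2) (\<lambda>a c. m a * (g c * f q)))))"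
    by (rule Hf.braided_coassoc) (intro lin)
  moreover have "dual_mult B H (dual_mult B H f g) m x = W x (\<lambda>a c. W c (\<lambda>b v. m a * (g b * f v)))"
    unfolding dual_mult_eq[OF dual_mult_in[OF f g] m] by (simp add: dual_mult_eq[OF f g] sw_mult_left)
  moreover have "dual_mult B H f (dual_mult B H g m) x = W x (\<lambda>p q. W p (\<lambda>a c. m a * (g c * f q)))"
    unfolding dual_mult_eq[OF f dual_mult_in[OF g m]]
    by (simp add: dual_mult_eq[OF g m] mult.assoc[symmetric] sw_mult_right)
  ultimately show "dual_mult B H (dual_mult B H f g) m x = dual_mult B H f (dual_mult B H g m) x"
    by simp
qed

lemma dual_mult_unit: "lform sH f \<Longrightarrow> dual_mult B H eH f = f"
proof
  fix x
  assume f: "lform sH f"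
  have "W x (\<lambda>u v. eH v * f u) = f x"
    by (simp add: Hf.C_e_right f Hf.counit_left)
  then show "dual_mult B H eH f x = f x"
    by (simp add: dual_mult_eq f lmaps mult.commute)
qed

text \<open>The product of H* reverses its factors and S reverses the coproduct of \<open>B\<close>;
  the two reversals cancel. The same happens for the coaction in
  \<open>dual_mult_coact\<close>.\<close>

lemma dual_mult_act:
  assumes f: "lform sH f" and g: "lform sH g"
  shows "act HD b (dual_mult B H f g) = sw (DB b) (\<lambda>b1 b2. dual_mult B H (act HD b1 f) (act HD b2 g))"
proof
  fix x
  note [lin] = lform_comp[OF f] lform_comp[OF g]
  have "W (A (SB b) x) (\<lambda>u v. g u * f v) = sw (DB (SB b)) (\<lambda>b1 b2. W x (\<lambda>u v. g (A b1 u) * f (A b2 v)))"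
    by (rule W_act) (intro lin)
  also have "\<dots> = sw (DB b) (\<lambda>b1 b2. W x (\<lambda>u v. g (A (SB b2) u) * f (A (SB b1) v)))"
    by (rule DB_SB) (intro lin)
  finally show "act HD b (dual_mult B H f g) x = sw (DB b) (\<lambda>b1 b2. dual_mult B H (act HD b1 f) (act HD b2 g)) x"
    by (simp add: dual_mult_eq f g act_HD_in sw_apply)
qed

lemma dual_mult_coact:
  assumes f: "lform sH f" and g: "lform sH g" and p: "lform sB p"
  shows "sw (K x) (\<lambda>b y. p (SB b) * dual_mult B H f g y) =
    sw (KD f) (\<lambda>b f0. sw (KD g) (\<lambda>c g0. p (b * c) * dual_mult B H f0 g0 x))"
proof -
  note [lin] = lform_comp[OF f] lform_comp[OF g] lform_comp[OF p]
  have "sw (KD f) (\<lambda>b f0. sw (KD g) (\<lambda>c g0. p (b * c) * dual_mult B H f0 g0 x)) =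
      sw (KD f) (\<lambda>b f0. sw (KD g) (\<lambda>c g0. W x (\<lambda>u v. p (b * c) * (g0 u * f0 v))))"
    by (intro sw_cong) (simp add: dual_mult_eq KD_in[OF f] KD_in[OF g] sw_mult_left)
  also have "\<dots> = sw (DH x) (\<lambda>x1 x2. sw (KD f) (\<lambda>b f0. sw (KD g) (\<lambda>c g0. sw (CH x1 x2) (\<lambda>u v. p (b * c) * (g0 u * f0 v)))))"
    by (rule sw_swap3)
  also have "\<dots> = W x (\<lambda>u v. sw (KD f) (\<lambda>b f0. sw (KD g) (\<lambda>c g0. p (b * c) * (g0 u * f0 v))))"
    by (rule sw_cong, rule sw_swap3)
  also have "\<dots> = W x (\<lambda>u v. sw (KD f) (\<lambda>b f0. sw (K u) (\<lambda>c y. p (b * SB c) * g y) * f0 v))"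
  proof (rule sw_cong, rule sw_cong, rule sw_cong)
    fix u v b f0
    have "sw (KD g) (\<lambda>c g0. p (b * c) * g0 u) = sw (K u) (\<lambda>c y. p (b * SB c) * g y)"
      by (rule KD_eval[OF g]) (intro lin)
    then show "sw (KD g) (\<lambda>c g0. p (b * c) * (g0 u * f0 v)) = sw (K u) (\<lambda>c y. p (b * SB c) * g y) * f0 v"
      by (simp add: mult.assoc[symmetric] sw_mult_right)
  qed
  also have "\<dots> = W x (\<lambda>u v. sw (K v) (\<lambda>b z. sw (K u) (\<lambda>c y. p (SB b * SB c) * g y) * f z))"
    by (rule sw_cong, rule sw_cong, rule KD_eval[OF f]) (intro lin)
  also have "\<dots> = W x (\<lambda>u v. sw (K u) (\<lambda>c y. sw (K v) (\<lambda>b z. p (SB (c * b)) * (g y * f z))))"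
    by (rule sw_cong, rule sw_cong, subst sw_swap) (simp add: SB_mult sw_mult_right[symmetric] mult.assoc)
  also have "\<dots> = sw (K x) (\<lambda>b x0. W x0 (\<lambda>u v. p (SB b) * (g u * f v)))"
    by (rule W_coact[symmetric]) (intro lin)
  finally show ?thesis by (simp add: dual_mult_eq f g sw_mult_left)
qed


subsection \<open>Subobjects of the dual\<close>

abbreviation Sub where "Sub N \<equiv> sub_object HD N"

lemma Sub_simps [simp]:
  "carrier (Sub N) = N" "scale (Sub N) = fscale" "act (Sub N) = act HD" "coact (Sub N) = dual_coact B H"
  by (simp_all add: sub_object_def dual_def)

definition sub_yd :: "('h \<Rightarrow> 'k) set \<Rightarrow> bool" where
  "sub_yd N \<longleftrightarrow> N \<subseteq> carrier HD \<and> is_space (Sub N) \<and> (\<forall>b. \<forall>f\<in>N. act HD b f \<in> N) \<and>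
     (\<forall>f\<in>N. dual_coact B H f \<in> carrier (tensor_space B (Sub N)))"

lemma sub_ydD:
  assumes "sub_yd N"
  shows "f \<in> N \<Longrightarrow> lform sH f" "is_space (Sub N)" "f \<in> N \<Longrightarrow> act HD b f \<in> N"
    "f \<in> N \<Longrightarrow> dual_coact B H f \<in> carrier (tensor_space B (Sub N))" "N \<subseteq> carrier HD"
  using assms by (auto simp: sub_yd_def in_HD)

text \<open>\<open>tens\<close> looks only at the ambient scalings and not at the carriers, so pure
  tensors over a subobject are literally those over H*.\<close>

lemma tens_Sub [simp]: "tens U (Sub N) = tens U HD" "tens (Sub N) U = tens HD U"
  by (rule tens_cong; simp)+

lemma tens_tensor_Sub [simp]: "tens U (tensor_space B (Sub N)) = tens U (tensor_space B HD)"
  by (rule tens_cong) simp_all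

lemma sw_rep_Sub:
  assumes "sub_yd N" "is_space U" "bilinear_on B HD U \<beta>" "t \<in> carrier (tensor_space B (Sub N))"
  shows "sw (rep B (Sub N) t) \<beta> = sw (rep B HD t) \<beta>"
  by (rule sw_rep_mono[OF _ _ _ _ spB(1) spB(1) spHD assms(2,3,4)]) (simp_all add: sub_ydD[OF assms(1)])

text \<open>The axioms are equations that already hold in H*. The point to check is that sums over
  lists chosen inside \<open>N\<close> agree with sums over lists chosen in H*; this is the purpose
  of the bilinearity facts \<open>b1\<close> to \<open>b4\<close>.\<close>

lemma sub_yd_module:
  assumes N: "sub_yd N" shows "yd_module B (Sub N)"
proof -
  note HD = yd_HD[unfolded yd_module_def tensor_lift_sw HD_simps(1,3)]
  note lo = lon linear_on_comp[OF lin_dual_coact] linear_on_comp[OF lin_comult]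
    bilinear_on_comp1[OF bil_act_HD] bilinear_on_comp2[OF bil_act_HD] bilinear_on_comp1[OF bil_B] bilinear_on_comp2[OF bil_B]
  note sp = spB(1) spHD is_space_tensor_space
  note ins = tens_in tensor_in lin_dual_coact[THEN linear_onD(1)] bilinear_on_in[OF bil_act_HD]
  have b1: "bilinear_on B HD (tensor_space B (tensor_space B HD))
      (\<lambda>b m0. sw (DB b) (\<lambda>b1 b2. tens B (tensor_space B HD) b1 (tens B HD b2 m0)))"
    by (intro lo linear_on_sw_rep_body[OF sp(1)] linear_on_sw_rep_comp sp ins) (simp_all add: spB ins)
  have b2: "bilinear_on B HD (tensor_space B (tensor_space B HD)) (\<lambda>b m0. tens B (tensor_space B HD) b (dual_coact B H m0))"
    by (intro lo sp ins) (simp_all add: spB ins)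
  have b3: "bilinear_on B HD HD (\<lambda>b m0. fscale (eB b) m0)"
    using is_spaceD(4)[OF spHD]
    by (intro bilinear_onI linear_onI) (auto simp: spB lmapD[OF lmaps(5)] fscale_simps fscale_commute)
  have b4: "bilinear_on B HD (tensor_space B HD) (\<lambda>c m0. tens B HD (b1 * c * SB b3) (act HD b2 m0))" for b1 b2 b3
    by (intro lo sp ins) (simp_all add: spB ins)
  note R = sw_rep_Sub[OF N]
  have m: "m \<in> N \<Longrightarrow> m \<in> carrier HD" for m using sub_ydD(5)[OF N] by auto
  note ts = sub_ydD(4)[OF N]
  show ?thesis
    unfolding yd_module_def tensor_lift_sw Sub_simps tens_Sub tens_tensor_Sub
  proof (intro conjI allI ballI)
    show "is_space (Sub N)" by (fact sub_ydD(2)[OF N])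
    show "bilinear_on B (Sub N) (Sub N) (act HD)"
      using bil_act_HD sub_ydD(3)[OF N] sub_ydD(5)[OF N]
      by (simp add: bilinear_on_def linear_on_def subset_iff)
    show "linear_on (Sub N) (tensor_space B (Sub N)) (dual_coact B H)"
      using lin_dual_coact ts m by (simp add: linear_on_def)
  qed (use HD m in \<open>simp_all add: R[OF _ b1 ts] R[OF _ b2 ts] R[OF _ b3 ts] R[OF _ b4 ts] sp\<close>)
qed

lemma sub_yd_if_module:
  assumes "yd_module B (Sub N)" "N \<subseteq> carrier HD" shows "sub_yd N"
  using assms by (auto simp: yd_module_def sub_yd_def bilinear_on_def linear_on_def spB)

lemma dat_Sub: "sub_yd N \<Longrightarrow> yd_data B (Sub N)"
  by (rule yd_dataI[OF hopf_B sub_yd_module])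

lemma KD_Sub:
  assumes "sub_yd N" "f \<in> N" "bform sB fscale \<beta>"
  shows "sw (rep B (Sub N) (dual_coact B H f)) \<beta> = sw (KD f) \<beta>"
  by (rule sw_rep_Sub[OF assms(1) is_space_ground bilinear_on_bform sub_ydD(4)[OF assms(1,2)]])
    (use assms(3) in simp)

lemma KD_Sub_in: "sub_yd N \<Longrightarrow> f \<in> N \<Longrightarrow> (b, g) \<in> set (rep B (Sub N) (dual_coact B H f)) \<Longrightarrow> g \<in> N"
  using rep_set[OF spB(1) sub_ydD(4), of N f] by fastforce


subsection \<open>Rational coactions\<close>

lemma pairing_bilinear:
  assumes \<phi>: "lform sH \<phi>"
  shows "bilinear_on HD H ground (\<lambda>m h. sw (CH h x) (\<lambda>u v. m u * \<phi> v))"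
proof (intro bilinear_onI)
  fix m assume "m \<in> carrier HD"
  then have m: "lform sH m" by (simp add: in_HD)
  note [lin] = lform_comp[OF \<phi>] lform_comp[OF m]
  have "lform sH (\<lambda>h. sw (CH h x) (\<lambda>u v. m u * \<phi> v))" by (intro lin)
  then show "linear_on H ground (\<lambda>h. sw (CH h x) (\<lambda>u v. m u * \<phi> v))" by (rule linear_on_lform)
next
  fix h
  have "lform fscale (\<lambda>m. sw (CH h x) (\<lambda>u v. m u * \<phi> v))" by (intro lin)
  then show "linear_on HD ground (\<lambda>m. sw (CH h x) (\<lambda>u v. m u * \<phi> v))" using linear_on_lform[of HD] by simp
qed

text \<open>Acting on the test functional by the coaction of \<open>x\<close> undoes the braiding in
  the pairing: \<open>CH_inverse\<close> introduces S of the next leg, and the product of the two is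
  a counit. Plain evaluations are thus recovered from braided ones.\<close>

lemma CH_undo:
  assumes m: "lform sH m" and \<phi>: "lform sH \<phi>"
  shows "sw (K x) (\<lambda>b y. sw (CH h y) (\<lambda>u v. m u * \<phi> (A b v))) = m x * \<phi> h"
proof -
  note [lin] = lform_comp[OF m] lform_comp[OF \<phi>]
  have "sw (K x) (\<lambda>b y. sw (CH h y) (\<lambda>u v. m u * \<phi> (A b v))) =
      sw (K x) (\<lambda>b y. sw (K y) (\<lambda>c z. m z * \<phi> (A b (A (SB c) h))))"
    by (rule sw_cong, rule CH_inverse[of "\<lambda>v u. m u * \<phi> (A _ v)"]) (intro lin)
  also have "\<dots> = sw (K x) (\<lambda>b z. sw (DB b) (\<lambda>b1 b2. m z * \<phi> (A (b1 * SB b2) h)))"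
    unfolding A_mult_left[symmetric] by (rule K_coassoc[symmetric]) (intro lin)
  also have "\<dots> = sw (K x) (\<lambda>b z. eB b * (m z * \<phi> (A 1 h)))"
    by (rule sw_cong, rule Bf.antipode_right[of "\<lambda>t. m _ * \<phi> (A t h)"]) (intro lin)
  also have "\<dots> = m x * \<phi> (A 1 h)"
    by (rule K_counit) (intro lin)
  finally show ?thesis by (simp add: A_one_left)
qed

text \<open>This gives uniqueness of the rational coaction: the action of H* determines the braided
  pairings, and through \<open>CH_undo\<close> they determine the tensor.\<close>

lemma tensor_H_eqI:
  assumes N: "is_space (Sub N)" "N \<subseteq> carrier HD"
    and t: "t \<in> carrier (tensor_space (Sub N) H)" "t' \<in> carrier (tensor_space (Sub N) H)"
    and eq: "\<And>\<phi> x. lform sH \<phi> \<Longrightarrow> sw (rep (Sub N) H t) (\<lambda>m h. sw (CH h x) (\<lambda>u v. m u * \<phi> v)) =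
      sw (rep (Sub N) H t') (\<lambda>m h. sw (CH h x) (\<lambda>u v. m u * \<phi> v))"
  shows "t = t'"
proof (rule tensor_eqI[OF N(1) spH(1) separating_eval separating_lforms[OF spH(1)] t])
  fix \<psi> \<phi> assume "\<psi> \<in> range (\<lambda>x (f :: 'h \<Rightarrow> 'k). f x)" "\<phi> \<in> {\<phi>. lform sH \<phi>}"
  then obtain x where \<psi>: "\<psi> = (\<lambda>f. f x)" and \<phi>: "lform sH \<phi>" by auto
  note [lin] = lform_comp[OF \<phi>]
  have "sw (rep (Sub N) H t) (\<lambda>m h. m x * \<phi> h) =
      sw (K x) (\<lambda>b y. sw (rep (Sub N) H t) (\<lambda>m h. sw (CH h y) (\<lambda>u v. m u * \<phi> (A b v))))"
    if t: "t \<in> carrier (tensor_space (Sub N) H)" for t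
  proof -
    have "sw (K x) (\<lambda>b y. sw (rep (Sub N) H t) (\<lambda>m h. sw (CH h y) (\<lambda>u v. m u * \<phi> (A b v)))) =
        sw (rep (Sub N) H t) (\<lambda>m h. sw (K x) (\<lambda>b y. sw (CH h y) (\<lambda>u v. m u * \<phi> (A b v))))"
      by (rule sw_swap)
    also have "\<dots> = sw (rep (Sub N) H t) (\<lambda>m h. m x * \<phi> h)"
    proof (rule sw_rep_cong[OF N(1) t])
      fix m h assume "m \<in> carrier (Sub N)"
      then have "lform sH m" using N(2) by (auto simp: in_HD)
      then show "sw (K x) (\<lambda>b y. sw (CH h y) (\<lambda>u v. m u * \<phi> (A b v))) = m x * \<phi> h"
        by (rule CH_undo[OF _ \<phi>])
    qed
    finally show ?thesis ..
  qed
  note this[OF t(1)] this[OF t(2)]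
  moreover have "sw (rep (Sub N) H t) (\<lambda>m h. sw (CH h y) (\<lambda>u v. m u * \<phi> (A b v))) =
      sw (rep (Sub N) H t') (\<lambda>m h. sw (CH h y) (\<lambda>u v. m u * \<phi> (A b v)))" for b y
    by (rule eq[of "\<lambda>v. \<phi> (A b v)"]) (intro lin)
  ultimately show "sw (rep (Sub N) H t) (\<lambda>v w. \<psi> v * \<phi> w) = sw (rep (Sub N) H t') (\<lambda>v w. \<psi> v * \<phi> w)"
    unfolding \<psi> by simp
qed simp

lemma rational_coaction_formula:
  assumes N: "sub_yd N" and f: "lform sH f" and t: "t \<in> carrier (tensor_space (Sub N) H)"
  shows "tensor_lift (Sub N) H (\<lambda>m0 m1. tensor_lift (Sub N) HD (\<lambda>u v. scale (Sub N) (v m1) u)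
      (braid B HD (Sub N) (tens HD (Sub N) f m0))) t =
    (\<lambda>x. sw (rep (Sub N) H t) (\<lambda>m h. sw (CH h x) (\<lambda>u v. m u * f v)))"
proof
  fix x
  note spN = sub_ydD(2)[OF N]
  have bil: "bilinear_on (Sub N) HD (Sub N) (\<lambda>u v. fscale (v h) u)" for h
    using is_spaceD(4)[OF spN]
    by (intro bilinear_onI linear_onI) (auto simp: fscale_simps fscale_commute, simp add: fscale_def mult.assoc)
  have "sw (rep (Sub N) HD (braid B HD (Sub N) (tens HD (Sub N) f m))) (\<lambda>u v. fscale (v h) u) x =
      sw (CH h x) (\<lambda>u v. m u * f v)" if m: "m \<in> N" for m h
  proof -
    have m': "lform sH m" using sub_ydD(1)[OF N m] .
    note [lin] = lform_comp[OF m']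
    have br: "braid B HD (Sub N) (tens HD (Sub N) f m) = sw (KD f) (\<lambda>b f0. tens (Sub N) HD (act HD b m) f0)"
      using braid_tens[OF dat_HD dat_Sub[OF N], of f m] f m by (simp add: in_HD)
    have "sw (rep (Sub N) HD (sw (KD f) (\<lambda>b f0. tens (Sub N) HD (act HD b m) f0))) (\<lambda>u v. fscale (v h) u) =
        sw (KD f) (\<lambda>b f0. sw (rep (Sub N) HD (tens (Sub N) HD (act HD b m) f0)) (\<lambda>u v. fscale (v h) u))"
      by (rule linear_on_sw[OF linear_on_sw_rep[OF spN spHD spN bil] is_space_tensor_space])
        (use KD_in[OF f] m sub_ydD(3)[OF N] in \<open>auto intro!: tens_in simp: in_HD simp del: tens_Sub\<close>)
    also have "\<dots> = sw (KD f) (\<lambda>b f0. fscale (f0 h) (act HD b m))"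
      by (rule sw_cong, rule sw_rep_tens1[OF spN spHD spN bil])
        (use KD_in[OF f] m sub_ydD(3)[OF N] in \<open>auto simp: in_HD\<close>)
    finally have "sw (rep (Sub N) HD (braid B HD (Sub N) (tens HD (Sub N) f m))) (\<lambda>u v. fscale (v h) u) x =
        sw (KD f) (\<lambda>b f0. m (A (SB b) x) * f0 h)"
      unfolding br by (simp add: sw_apply fscale_def mult.commute)
    \<comment> \<open>One S comes from the action on \<open>m\<close>, the other from the coaction
      of \<open>f\<close>. They compose to the identity and leave the plain braiding of
      \<open>h\<close> with \<open>x\<close>.\<close>
    also have "\<dots> = sw (K h) (\<lambda>b y. m (A (SB (SB b)) x) * f y)"
      by (rule KD_eval[OF f]) (intro lin)
    finally show ?thesis unfolding sw_CH by simp
  qed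
  then show "tensor_lift (Sub N) H (\<lambda>m0 m1. tensor_lift (Sub N) HD (\<lambda>u v. scale (Sub N) (v m1) u)
      (braid B HD (Sub N) (tens HD (Sub N) f m0))) t x =
    sw (rep (Sub N) H t) (\<lambda>m h. sw (CH h x) (\<lambda>u v. m u * f v))"
    unfolding tensor_lift_sw sw_apply Sub_simps(2)
    by (intro sw_rep_cong[OF spN t]) (simp del: tens_Sub add: tens_Sub(1))
qed

lemma rational_coaction_iff:
  assumes N: "sub_yd N" and \<rho>: "\<And>n. n \<in> N \<Longrightarrow> \<rho> n \<in> carrier (tensor_space (Sub N) H)"
  shows "rational_coaction B H (Sub N) (dual_mult B H) \<rho> \<longleftrightarrow> yd_hom B (Sub N) (yd_tensor B (Sub N) H) \<rho> \<and>
    (\<forall>n\<in>N. \<forall>\<phi>. lform sH \<phi> \<longrightarrow> (\<forall>x. sw (rep (Sub N) H (\<rho> n)) (\<lambda>m h. sw (CH h x) (\<lambda>u v. m u * \<phi> v)) =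
      W x (\<lambda>u v. n u * \<phi> v)))"
proof -
  have "tensor_lift (Sub N) H (\<lambda>m0 m1. tensor_lift (Sub N) HD (\<lambda>u v. scale (Sub N) (v m1) u)
      (braid B HD (Sub N) (tens HD (Sub N) \<phi> m0))) (\<rho> n) = dual_mult B H \<phi> n \<longleftrightarrow>
    (\<forall>x. sw (rep (Sub N) H (\<rho> n)) (\<lambda>m h. sw (CH h x) (\<lambda>u v. m u * \<phi> v)) = W x (\<lambda>u v. n u * \<phi> v))"
    if "n \<in> N" "lform sH \<phi>" for n \<phi>
    unfolding rational_coaction_formula[OF N that(2) \<rho>[OF that(1)]]
    by (simp add: dual_mult_eq that sub_ydD(1)[OF N that(1)] fun_eq_iff)
  then show ?thesis unfolding rational_coaction_def by (auto simp: in_HD)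
qed

end



section \<open>Rationality tested by the braided pairing\<close>

context hopf_setup
begin

text \<open>\<open>Lam \<phi> x\<close> is evaluation at \<open>x\<close> of the action of \<open>\<phi>\<close> through an element of \<open>H* \<otimes> H\<close>.\<close>

abbreviation Lam where
  "Lam \<phi> x t \<equiv> sw (rep HD H t) (\<lambda>m h. sw (CH h x) (\<lambda>u v. m u * \<phi> v))"

lemma Lam_Sub:
  assumes N: "is_space (Sub N)" "N \<subseteq> carrier HD" and \<phi>: "lform sH \<phi>"
    and t: "t \<in> carrier (tensor_space (Sub N) H)"
  shows "sw (rep (Sub N) H t) (\<lambda>m h. sw (CH h x) (\<lambda>u v. m u * \<phi> v)) = Lam \<phi> x t"
  by (rule sw_rep_mono[OF _ _ _ _ N(1) spHD spH(1) is_space_ground pairing_bilinear[OF \<phi>] t])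
    (simp_all add: N(2))

lemma Lam_linear: "lform sH \<phi> \<Longrightarrow> linear_on (tensor_space HD H) ground (Lam \<phi> x)"
  by (rule linear_on_sw_rep[OF spHD spH(1) is_space_ground pairing_bilinear])

lemma Lam_tens: "lform sH \<phi> \<Longrightarrow> lform sH m \<Longrightarrow> Lam \<phi> x (tens HD H m h) = sw (CH h x) (\<lambda>u v. m u * \<phi> v)"
  by (rule sw_rep_tens1[OF spHD spH(1) is_space_ground pairing_bilinear]) (simp_all add: in_HD spH)

lemma tensor_Sub_H_mono: "N \<subseteq> M \<Longrightarrow> carrier (tensor_space (Sub N) H) \<subseteq> carrier (tensor_space (Sub M) H)"
  and tensor_B_Sub_mono: "N \<subseteq> M \<Longrightarrow> carrier (tensor_space B (Sub N)) \<subseteq> carrier (tensor_space B (Sub M))"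
  and tensor_Sub_HD: "N \<subseteq> carrier HD \<Longrightarrow> carrier (tensor_space (Sub N) H) \<subseteq> carrier (tensor_space HD H)"
  by (rule tensor_space_mono; simp)+

lemma separating_Lam:
  assumes N: "is_space (Sub N)" "N \<subseteq> carrier HD"
  shows "separating (tensor_space (Sub N) H) {Lam \<phi> x | \<phi> x. lform sH \<phi>}"
  unfolding separating_def
proof (intro conjI ballI impI)
  fix F assume "F \<in> {Lam \<phi> x | \<phi> x. lform sH \<phi>}"
  then obtain \<phi> x where F: "F = Lam \<phi> x" "lform sH \<phi>" by blast
  show "linear_on (tensor_space (Sub N) H) ground F"
    using Lam_linear[OF F(2), of x] tensor_Sub_HD[OF N(2)] unfolding F(1) linear_on_def
    by (simp add: subset_iff)
next
  fix t assume t: "t \<in> carrier (tensor_space (Sub N) H)" "\<forall>F\<in>{Lam \<phi> x | \<phi> x. lform sH \<phi>}. F t = 0"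
  have 0: "0 \<in> carrier (tensor_space (Sub N) H)" by (rule is_spaceD(1)[OF is_space_tensor_space])
  show "t = 0"
  proof (rule tensor_H_eqI[OF N t(1) 0])
    fix \<phi> x assume \<phi>: "lform sH \<phi>"
    then have "Lam \<phi> x \<in> {Lam \<phi> x | \<phi> x. lform sH \<phi>}" by blast
    from t(2)[rule_format, OF this] show "sw (rep (Sub N) H t) (\<lambda>m h. sw (CH h x) (\<lambda>u v. m u * \<phi> v)) =
      sw (rep (Sub N) H 0) (\<lambda>m h. sw (CH h x) (\<lambda>u v. m u * \<phi> v))"
      unfolding Lam_Sub[OF N \<phi> t(1)] Lam_Sub[OF N \<phi> 0]
      by (simp add: linear_on_0[OF Lam_linear[OF \<phi>] is_space_tensor_space])
  qed
qed

text \<open>A subobject whose elements all have a candidate for their coaction is rational: being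
  determined by the action of \<open>H*\<close>, the candidates form a morphism of Yetter--Drinfeld modules.\<close>

lemma rational_criterion:
  assumes N: "sub_yd N" and t: "\<And>n. n \<in> N \<Longrightarrow> t n \<in> carrier (tensor_space (Sub N) H)"
    and Lt: "\<And>n \<phi> x. n \<in> N \<Longrightarrow> lform sH \<phi> \<Longrightarrow> Lam \<phi> x (t n) = W x (\<lambda>u v. n u * \<phi> v)"
  shows "rational_submodule B H N" and "rational_coaction B H (Sub N) (dual_mult B H) t"
proof -
  let ?T = "tensor_space (Sub N) H"
  note N' = sub_ydD[OF N]
  note spN = N'(2) and NHD = N'(5)
  note dN = dat_Sub[OF N]
  have tHD: "s \<in> carrier ?T \<Longrightarrow> s \<in> carrier (tensor_space HD H)" for s using tensor_Sub_HD[OF NHD] by blast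
  have lLam: "linear_on ?T ground (Lam \<phi> x)" if "lform sH \<phi>" for \<phi> x
    using Lam_linear[OF that, of x] tHD by (simp add: linear_on_def)
  have T_eqI: "s = s'" if "s \<in> carrier ?T" "s' \<in> carrier ?T" "\<And>\<phi> x. lform sH \<phi> \<Longrightarrow> Lam \<phi> x s = Lam \<phi> x s'" for s s'
    by (rule separating_eqI[OF separating_Lam[OF spN NHD] is_space_tensor_space that(1,2)]) (use that(3) in blast)
  have Lt': "sw (rep (Sub N) H (t n)) (\<lambda>m h. sw (CH h x) (\<lambda>u v. m u * \<phi> v)) = W x (\<lambda>u v. n u * \<phi> v)"
    if "n \<in> N" "lform sH \<phi>" for n \<phi> x
    using Lam_Sub[OF spN NHD that(2) t[OF that(1)]] Lt[OF that] by simp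
  \<comment> \<open>Closure under the product is read off from the candidate: \<open>t n\<close>
    expresses the product through left factors that lie in \<open>N\<close>, acted on by
    \<open>B\<close> and scaled.\<close>
  have mult_in: "dual_mult B H f n \<in> N" if f: "lform sH f" and n: "n \<in> N" for f n
  proof -
    have "dual_mult B H f n = sw (rep (Sub N) H (t n)) (\<lambda>m h. sw (K h) (\<lambda>b y. fscale (f y) (act HD (SB b) m)))"
    proof
      fix x
      show "dual_mult B H f n x = sw (rep (Sub N) H (t n)) (\<lambda>m h. sw (K h) (\<lambda>b y. fscale (f y) (act HD (SB b) m))) x"
        using Lt'[OF n f, of x] by (simp add: dual_mult_eq[OF f N'(1)[OF n]] sw_CH sw_apply fscale_def mult.commute)
    qed
    also have "\<dots> \<in> N"
    proof (rule sw_rep_in[OF spN spN t[OF n], unfolded Sub_simps(1)], rule sw_in[OF spN, unfolded Sub_simps(1)])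
      fix m h b y assume "m \<in> N"
      then show "fscale (f y) (act HD (SB b) m) \<in> N" using is_spaceD(4)[OF spN] N'(3) by simp
    qed
    finally show ?thesis .
  qed
  have bil: "bilinear_on HD (Sub N) (Sub N) (dual_mult B H)"
  proof (intro bilinear_onI linear_onI)
    fix f g n m c
    assume f: "f \<in> carrier HD"
    then have f': "lform sH f" by (simp add: in_HD)
    { assume n: "n \<in> carrier (Sub N)"
      then show "dual_mult B H f n \<in> carrier (Sub N)" using mult_in f' by simp
      then show "dual_mult B H f n \<in> carrier (Sub N)" .
      have n': "lform sH n" using n N'(1) by simp
      have fg: "lform sH (scale HD c f)" "lform sH (fscale c n)"
        using is_spaceD(4)[OF spHD f] is_spaceD(4)[OF spN n] N'(1) by (auto simp: in_HD)
      show "dual_mult B H f (scale (Sub N) c n) = scale (Sub N) c (dual_mult B H f n)"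
        "dual_mult B H (scale HD c f) n = scale (Sub N) c (dual_mult B H f n)"
        using fg by (simp_all add: dual_mult_eq f' n' fun_eq_iff fscale_def sw_mult_left[symmetric] mult_ac)
      { assume m: "m \<in> carrier (Sub N)"
        have "lform sH (n + m)" "lform sH m" using is_spaceD(2)[OF spN n m] m N'(1) by auto
        then show "dual_mult B H f (n + m) = dual_mult B H f n + dual_mult B H f m"
          by (simp add: dual_mult_eq f' n' fun_eq_iff sw_add algebra_simps) }
      { assume g: "g \<in> carrier HD"
        have "lform sH (f + g)" "lform sH g" using is_spaceD(2)[OF spHD f g] g by (auto simp: in_HD)
        then show "dual_mult B H (f + g) n = dual_mult B H f n + dual_mult B H g n"
          by (simp add: dual_mult_eq f' n' fun_eq_iff sw_add algebra_simps) } }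
  qed
  have "yd_hom B (yd_tensor B HD (Sub N)) (Sub N) (tensor_lift HD (Sub N) (dual_mult B H))"
  proof (rule yd_hom_tensorI[OF dat_HD dN dN bil])
    fix b f n assume "f \<in> carrier HD" "n \<in> carrier (Sub N)"
    then have f: "lform sH f" and n: "n \<in> N" by (simp_all add: in_HD)
    note n' = N'(1)[OF n]
    show "act (Sub N) b (dual_mult B H f n) = sw (DB b) (\<lambda>b1 b2. dual_mult B H (act HD b1 f) (act (Sub N) b2 n))"
      using dual_mult_act[OF f n'] by simp
    let ?s = "sw (KD f) (\<lambda>b m0. sw (rep B (Sub N) (dual_coact B H n)) (\<lambda>c n0. tens B (Sub N) (b * c) (dual_mult B H m0 n0)))"
    have ins: "tens B (Sub N) (b * c) (dual_mult B H m0 n0) \<in> carrier (tensor_space B (Sub N))"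
      if "(b, m0) \<in> set (KD f)" "(c, n0) \<in> set (rep B (Sub N) (dual_coact B H n))" for b c m0 n0
      by (rule tens_in) (use that KD_in[OF f] KD_Sub_in[OF N n] mult_in in \<open>auto simp: spB\<close>)
    have "dual_coact B H (dual_mult B H f n) = ?s"
    proof (rule tensor_B_eqI[OF spN])
      show "?s \<in> carrier (tensor_space B (Sub N))"
        by (intro sw_in[OF is_space_tensor_space] ins)
      fix p x assume p: "lform sB p"
      note [lin] = lform_comp[OF p]
      have \<beta>: "bform sB (scale (Sub N)) (\<lambda>b g. p b * g x)" using p by (simp add: bform_eval)
      have "sw (rep B (Sub N) ?s) (\<lambda>b g. p b * g x) = sw (KD f) (\<lambda>b m0. sw (rep B (Sub N) (sw (rep B (Sub N) (dual_coact B H n)) (\<lambda>c n0.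
          tens B (Sub N) (b * c) (dual_mult B H m0 n0)))) (\<lambda>b g. p b * g x))"
        by (rule sw_rep_sw[OF spB(1) spN \<beta>]) (intro sw_in[OF is_space_tensor_space] ins)
      also have "\<dots> = sw (KD f) (\<lambda>b m0. sw (rep B (Sub N) (dual_coact B H n)) (\<lambda>c n0. p (b * c) * dual_mult B H m0 n0 x))"
        by (rule sw_cong, rule sw_rep_B_tens[OF spN]) (use KD_in[OF f] KD_Sub_in[OF N n] mult_in p in auto)
      also have "\<dots> = sw (KD f) (\<lambda>b m0. sw (rep B (Sub N) (dual_coact B H n)) (\<lambda>c n0. p (b * c) * W x (\<lambda>u v. n0 u * m0 v)))"
        by (intro sw_cong) (use KD_in[OF f] KD_Sub_in[OF N n] N'(1) in \<open>auto simp: dual_mult_eq\<close>)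
      also have "\<dots> = sw (KD f) (\<lambda>b m0. sw (KD n) (\<lambda>c n0. p (b * c) * W x (\<lambda>u v. n0 u * m0 v)))"
        by (rule sw_cong, rule KD_Sub[OF N n]) (intro lin)
      also have "\<dots> = sw (KD f) (\<lambda>b m0. sw (KD n) (\<lambda>c n0. p (b * c) * dual_mult B H m0 n0 x))"
        by (intro sw_cong) (use KD_in[OF f] KD_in[OF n'] in \<open>auto simp: dual_mult_eq\<close>)
      finally show "sw (rep B (Sub N) (dual_coact B H (dual_mult B H f n))) (\<lambda>b g. p b * g x) = sw (rep B (Sub N) ?s) (\<lambda>b g. p b * g x)"
        by (simp add: KD_Sub[OF N mult_in[OF f n]] bform_eval p KD_eval[OF dual_mult_in[OF f n'] p] dual_mult_coact[OF f n' p])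
    qed (use N'(4)[OF mult_in[OF f n]] in auto)
    then show "coact (Sub N) (dual_mult B H f n) = sw (rep B HD (coact HD f)) (\<lambda>b m0.
        sw (rep B (Sub N) (coact (Sub N) n)) (\<lambda>c n0. tens B (Sub N) (b * c) (dual_mult B H m0 n0)))"
      by simp
  qed
  then have mod: "dual_module B H (Sub N) (dual_mult B H)"
    unfolding dual_module_def using sub_yd_module[OF N] bil N'(1)
    by (simp add: dual_mult_unit dual_mult_assoc in_HD)
  have hom: "yd_hom B (Sub N) (yd_tensor B (Sub N) H) t"
    unfolding yd_hom_def linear_on_yd_tensor
  proof (intro conjI allI ballI linear_onI)
    fix n m c b assume n: "n \<in> carrier (Sub N)"
    then have nN: "n \<in> N" by simp
    note n' = N'(1)[OF nN]
    note [lin] = lform_comp[OF n']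
    show "t n \<in> carrier ?T" using t nN by simp
    { assume m: "m \<in> carrier (Sub N)"
      show "t (n + m) = t n + t m"
        using is_spaceD(2)[OF spN n m] n m t is_spaceD(2)[OF is_space_tensor_space, of "t n" "Sub N" H "t m"]
        by (intro T_eqI) (auto simp: Lt linear_onD(2)[OF lLam] distrib_right sw_add) }
    show "t (scale (Sub N) c n) = scale ?T c (t n)"
    proof (rule T_eqI)
      have cn: "fscale c n \<in> N" using is_spaceD(4)[OF spN n] by simp
      show "t (scale (Sub N) c n) \<in> carrier ?T" using t[OF cn] by simp
      show "scale ?T c (t n) \<in> carrier ?T" by (rule is_spaceD(4)[OF is_space_tensor_space t[OF nN]])
      fix \<phi> x assume \<phi>: "lform sH \<phi>"
      have "Lam \<phi> x (t (fscale c n)) = W x (\<lambda>u v. fscale c n u * \<phi> v)" by (rule Lt[OF cn \<phi>])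
      also have "\<dots> = c * W x (\<lambda>u v. n u * \<phi> v)" by (simp add: fscale_def sw_mult_left mult.assoc)
      also have "\<dots> = Lam \<phi> x (scale ?T c (t n))"
        using linear_onD(3)[OF lLam[OF \<phi>] t[OF nN], of c x] by (simp add: Lt[OF nN \<phi>])
      finally show "Lam \<phi> x (t (scale (Sub N) c n)) = Lam \<phi> x (scale ?T c (t n))" by simp
    qed
    let ?a = "act (yd_tensor B (Sub N) H) b"
    note la = yd_tensor_act_linear[OF dN dat_H]
    \<comment> \<open>On the tensor side \<open>CH_act_right\<close> moves b to the test data, where
      the pairing of \<open>t n\<close> is known. \<open>W_act_right\<close> then collects it again
      as the action on \<open>n\<close>.\<close>
    show "t (act (Sub N) b n) = ?a (t n)"
    proof (rule T_eqI)
      show "t (act (Sub N) b n) \<in> carrier ?T" using t N'(3) nN by simp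
      show "?a (t n) \<in> carrier ?T" by (rule linear_onD(1)[OF la t[OF nN]])
      fix \<phi> x assume \<phi>: "lform sH \<phi>"
      note [lin] = lform_comp[OF \<phi>]
      have \<phi>A: "lform sH (\<lambda>v. \<phi> (A b v))" for b by (intro lin)
      have "Lam \<phi> x (?a (t n)) = sw (rep (Sub N) H (t n)) (\<lambda>f h. Lam \<phi> x (?a (tens (Sub N) H f h)))"
        by (rule linear_on_rep[OF spN linear_on_comp[OF lLam[OF \<phi>] la] t[OF nN]])
      also have "\<dots> = sw (rep (Sub N) H (t n)) (\<lambda>f h. sw (DB b) (\<lambda>b1 b2. sw (CH h (A (SB b2) x)) (\<lambda>u v. f u * \<phi> (A b1 v))))"
      proof (rule sw_rep_cong[OF spN t[OF nN]])
        fix f h assume f: "f \<in> carrier (Sub N)"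
        then have f': "lform sH f" using N'(1) by simp
        note [lin] = lform_comp[OF f']
        have "Lam \<phi> x (?a (tens (Sub N) H f h)) = Lam \<phi> x (sw (DB b) (\<lambda>b1 b2. tens HD H (act HD b1 f) (A b2 h)))"
          using yd_tensor_act_tens[OF dN dat_H f] by (simp add: spH)
        also have "\<dots> = sw (DB b) (\<lambda>b1 b2. Lam \<phi> x (tens HD H (act HD b1 f) (A b2 h)))"
          by (rule linear_on_sw[OF Lam_linear[OF \<phi>] is_space_tensor_space])
            (auto intro!: tens_in simp: in_HD act_HD_in f' spH)
        also have "\<dots> = sw (DB b) (\<lambda>b1 b2. sw (CH (A b2 h) x) (\<lambda>u v. f (A (SB b1) u) * \<phi> v))"
          by (simp add: Lam_tens \<phi> act_HD_in f')
        also have "\<dots> = sw (DB b) (\<lambda>b1 b2. sw (CH h (A (SB b2) x)) (\<lambda>u v. f u * \<phi> (A b1 v)))"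
          by (rule CH_act_right) (intro lin)
        finally show "Lam \<phi> x (?a (tens (Sub N) H f h)) =
            sw (DB b) (\<lambda>b1 b2. sw (CH h (A (SB b2) x)) (\<lambda>u v. f u * \<phi> (A b1 v)))" .
      qed
      also have "\<dots> = sw (DB b) (\<lambda>b1 b2. W (A (SB b2) x) (\<lambda>u v. n u * \<phi> (A b1 v)))"
        by (subst sw_swap) (simp add: Lt'[OF nN \<phi>A])
      also have "\<dots> = W x (\<lambda>u v. n (A (SB b) u) * \<phi> v)"
        by (rule W_act_right) (intro lin)
      finally show "Lam \<phi> x (t (act (Sub N) b n)) = Lam \<phi> x (?a (t n))"
        using Lt[OF N'(3)[OF nN] \<phi>] by simp
    qed
    let ?c = "coact (yd_tensor B (Sub N) H)"
    note lc = yd_tensor_coact_linear[OF dN dat_H]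
    have tin: "tens B ?T b s \<in> carrier (tensor_space B ?T)" if "s \<in> carrier ?T" for b s
      by (rule tens_in) (use that in \<open>simp_all add: spB\<close>)
    have N_list: "(b, g) \<in> set (rep B (Sub N) (dual_coact B H f)) \<Longrightarrow> f \<in> N \<Longrightarrow> g \<in> N" for b g f
      using KD_Sub_in[OF N] .
    show "?c (t n) = tensor_lift B (Sub N) (\<lambda>b m0. tens B (yd_tensor B (Sub N) H) b (t m0)) (coact (Sub N) n)"
      unfolding tensor_lift_sw tens_yd_tensor Sub_simps
    proof (rule tensor_eqI[OF spB(1) is_space_tensor_space separating_lforms[OF spB(1)] separating_Lam[OF spN NHD]])
      show "?c (t n) \<in> carrier (tensor_space B ?T)" by (rule linear_onD(1)[OF lc t[OF nN]])
      show "sw (rep B (Sub N) (dual_coact B H n)) (\<lambda>b m0. tens B ?T b (t m0)) \<in> carrier (tensor_space B ?T)"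
        by (intro sw_in[OF is_space_tensor_space] tin t) (use N_list nN in blast)
      fix p F assume "p \<in> {\<phi>. lform sB \<phi>}" "F \<in> {Lam \<phi> x | \<phi> x. lform sH \<phi>}"
      then obtain \<phi> x where p: "lform sB p" and F: "F = Lam \<phi> x" and \<phi>: "lform sH \<phi>" by blast
      note [lin] = lform_comp[OF p] lform_comp[OF \<phi>]
      let ?E = "\<lambda>s. sw (rep B ?T s) (\<lambda>b w. p b * Lam \<phi> x w)"
      have bE: "bilinear_on B ?T ground (\<lambda>b w. p b * Lam \<phi> x w)"
        by (rule bilinear_on_mult[OF linear_on_lform[OF p] lLam[OF \<phi>]])
      have lE: "linear_on (tensor_space B ?T) ground ?E"
        by (rule linear_on_sw_rep[OF spB(1) is_space_tensor_space is_space_ground bE])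
      have E: "?E (tens B ?T b s) = p b * Lam \<phi> x s" if "s \<in> carrier ?T" for b s
        by (rule sw_rep_tens1[OF spB(1) is_space_tensor_space is_space_ground bE]) (use that in \<open>simp_all add: spB\<close>)
      \<comment> \<open>This functional absorbs \<open>p\<close> together with the coaction of the
        second leg, so that the known pairing of \<open>t n\<close> applies.
        \<open>CH_coact_right\<close> creates it and \<open>W_coact_right\<close> removes
        it.\<close>
      let ?\<phi> = "\<lambda>d v. sw (K v) (\<lambda>b v0. p (b * SB d) * \<phi> v0)"
      have l\<phi>: "lform sH (?\<phi> d)" for d by (intro lin)
      have "?E (?c (t n)) = sw (rep (Sub N) H (t n)) (\<lambda>f h. ?E (?c (tens (Sub N) H f h)))"
        by (rule linear_on_rep[OF spN linear_on_comp[OF lE lc] t[OF nN]])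
      also have "\<dots> = sw (rep (Sub N) H (t n)) (\<lambda>f h. sw (K x) (\<lambda>d x0. sw (CH h x0) (\<lambda>u v. f u * ?\<phi> d v)))"
      proof (rule sw_rep_cong[OF spN t[OF nN]])
        fix f h assume fS: "f \<in> carrier (Sub N)"
        then have f: "f \<in> N" by simp
        note f' = N'(1)[OF f]
        note [lin] = lform_comp[OF f']
        have ht: "tens (Sub N) H f0 h0 \<in> carrier ?T" if "f0 \<in> N" for f0 h0
          by (rule tens_in) (use that in \<open>simp_all add: spH\<close>)
        have "?E (?c (tens (Sub N) H f h)) = ?E (sw (rep B (Sub N) (dual_coact B H f)) (\<lambda>b f0. sw (K h) (\<lambda>c h0.
            tens B ?T (b * c) (tens (Sub N) H f0 h0))))"
          using yd_tensor_coact_tens[OF dN dat_H fS] by (simp add: spH)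
        also have "\<dots> = sw (rep B (Sub N) (dual_coact B H f)) (\<lambda>b f0. ?E (sw (K h) (\<lambda>c h0. tens B ?T (b * c) (tens (Sub N) H f0 h0))))"
          by (rule linear_on_sw[OF lE is_space_tensor_space])
            (intro sw_in[OF is_space_tensor_space] tin ht; use N_list f in blast)
        also have "\<dots> = sw (rep B (Sub N) (dual_coact B H f)) (\<lambda>b f0. sw (K h) (\<lambda>c h0. ?E (tens B ?T (b * c) (tens (Sub N) H f0 h0))))"
          by (rule sw_cong, rule linear_on_sw[OF lE is_space_tensor_space])
            (intro tin ht; use N_list f in blast)
        also have "\<dots> = sw (rep B (Sub N) (dual_coact B H f)) (\<lambda>b f0. sw (K h) (\<lambda>c h0. p (b * c) * sw (CH h0 x) (\<lambda>u v. f0 u * \<phi> v)))"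
        proof (rule sw_cong, rule sw_cong)
          fix b f0 c h0 assume "(b, f0) \<in> set (rep B (Sub N) (dual_coact B H f))"
          then have f0: "f0 \<in> N" using N_list f by blast
          show "?E (tens B ?T (b * c) (tens (Sub N) H f0 h0)) = p (b * c) * sw (CH h0 x) (\<lambda>u v. f0 u * \<phi> v)"
            unfolding E[OF ht[OF f0]] using Lam_tens[OF \<phi> N'(1)[OF f0]] by simp
        qed
        also have "\<dots> = sw (KD f) (\<lambda>b f0. sw (K h) (\<lambda>c h0. p (b * c) * sw (CH h0 x) (\<lambda>u v. f0 u * \<phi> v)))"
          by (rule KD_Sub[OF N f]) (intro lin)
        also have "\<dots> = sw (KD f) (\<lambda>b f0. sw (K h) (\<lambda>c h0. sw (CH h0 x) (\<lambda>u v. p (b * c) * f0 u * \<phi> v)))"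
          by (simp add: sw_mult_left mult.assoc)
        also have "\<dots> = sw (K h) (\<lambda>c h0. sw (KD f) (\<lambda>b f0. sw (CH h0 x) (\<lambda>u v. p (b * c) * f0 u * \<phi> v)))"
          by (rule sw_swap)
        also have "\<dots> = sw (K h) (\<lambda>c h0. sw (CH h0 x) (\<lambda>u v. sw (KD f) (\<lambda>b f0. p (b * c) * f0 u * \<phi> v)))"
          by (rule sw_cong, rule sw_swap)
        also have "\<dots> = sw (K h) (\<lambda>c h0. sw (CH h0 x) (\<lambda>u v. sw (K u) (\<lambda>b y. p (SB b * c) * f y * \<phi> v)))"
        proof (rule sw_cong, rule sw_cong)
          fix c h0 u v
          have "sw (KD f) (\<lambda>b f0. p (b * c) * f0 u) = sw (K u) (\<lambda>b y. p (SB b * c) * f y)"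
            by (rule KD_eval[OF f']) (intro lin)
          then show "sw (KD f) (\<lambda>b f0. p (b * c) * f0 u * \<phi> v) = sw (K u) (\<lambda>b y. p (SB b * c) * f y * \<phi> v)"
            by (simp add: sw_mult_right)
        qed
        also have "\<dots> = sw (K x) (\<lambda>d x0. sw (CH h x0) (\<lambda>u v. sw (K v) (\<lambda>b v0. p (b * SB d) * f u * \<phi> v0)))"
          by (rule CH_coact_right) (intro lin)
        finally show "?E (?c (tens (Sub N) H f h)) = sw (K x) (\<lambda>d x0. sw (CH h x0) (\<lambda>u v. f u * ?\<phi> d v))"
          by (simp add: sw_mult_left[symmetric] mult_ac)
      qed
      also have "\<dots> = sw (K x) (\<lambda>d x0. W x0 (\<lambda>u v. n u * ?\<phi> d v))"
        by (subst sw_swap) (simp only: Lt'[OF nN l\<phi>])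
      also have "\<dots> = sw (K x) (\<lambda>d x0. W x0 (\<lambda>u v. sw (K v) (\<lambda>b v0. p (b * SB d) * n u * \<phi> v0)))"
        by (simp add: sw_mult_left[symmetric] mult_ac)
      also have "\<dots> = W x (\<lambda>u v. sw (K u) (\<lambda>b y. p (SB b) * n y * \<phi> v))"
        by (rule W_coact_right[symmetric]) (intro lin)
      also have "\<dots> = W x (\<lambda>u v. sw (KD n) (\<lambda>b m0. p b * m0 u * \<phi> v))"
        by (simp add: sw_mult_right KD_eval[OF n' p])
      also have "\<dots> = sw (KD n) (\<lambda>b m0. W x (\<lambda>u v. p b * m0 u * \<phi> v))"
        by (rule sw_swap3)
      also have "\<dots> = sw (KD n) (\<lambda>b m0. p b * W x (\<lambda>u v. m0 u * \<phi> v))"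
        by (simp add: sw_mult_left mult.assoc)
      also have "\<dots> = sw (rep B (Sub N) (dual_coact B H n)) (\<lambda>b m0. p b * W x (\<lambda>u v. m0 u * \<phi> v))"
        by (rule KD_Sub[OF N nN, symmetric]) (intro lin)
      also have "\<dots> = sw (rep B (Sub N) (dual_coact B H n)) (\<lambda>b m0. ?E (tens B ?T b (t m0)))"
        by (rule sw_cong) (use N_list nN in \<open>auto simp: E[OF t] Lt \<phi>\<close>)
      also have "\<dots> = ?E (sw (rep B (Sub N) (dual_coact B H n)) (\<lambda>b m0. tens B ?T b (t m0)))"
        by (rule linear_on_sw[OF lE is_space_tensor_space, symmetric]) (intro tin t, use N_list nN in blast)
      finally show "sw (rep B ?T (?c (t n))) (\<lambda>v w. p v * F w) =
          sw (rep B ?T (sw (rep B (Sub N) (dual_coact B H n)) (\<lambda>b m0. tens B ?T b (t m0)))) (\<lambda>v w. p v * F w)"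
        unfolding F .
    qed
  qed
  show rc: "rational_coaction B H (Sub N) (dual_mult B H) t"
    using rational_coaction_iff[OF N, where \<rho> = t] t hom Lt' by blast
  show "rational_submodule B H N"
    using NHD mod rc by (auto simp: rational_submodule_def rational_module_def)
qed

lemma rational_submoduleD:
  assumes "rational_submodule B H N"
  shows "sub_yd N"
    and "\<exists>\<rho>. rational_coaction B H (Sub N) (dual_mult B H) \<rho>"
  using assms sub_yd_if_module
  by (auto simp: rational_submodule_def rational_module_def dual_module_def)

lemma rational_coactionD:
  assumes N: "sub_yd N" and \<rho>: "rational_coaction B H (Sub N) (dual_mult B H) \<rho>"
  shows "n \<in> N \<Longrightarrow> \<rho> n \<in> carrier (tensor_space (Sub N) H)"
    and "n \<in> N \<Longrightarrow> lform sH \<phi> \<Longrightarrow> Lam \<phi> x (\<rho> n) = W x (\<lambda>u v. n u * \<phi> v)"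
    and "yd_hom B (Sub N) (yd_tensor B (Sub N) H) \<rho>"
proof -
  show h: "yd_hom B (Sub N) (yd_tensor B (Sub N) H) \<rho>" using \<rho> by (simp add: rational_coaction_def)
  have i: "\<rho> n \<in> carrier (tensor_space (Sub N) H)" if "n \<in> N" for n
    using h that by (auto simp: yd_hom_def linear_on_def)
  then show "n \<in> N \<Longrightarrow> \<rho> n \<in> carrier (tensor_space (Sub N) H)" .
  show "Lam \<phi> x (\<rho> n) = W x (\<lambda>u v. n u * \<phi> v)" if "n \<in> N" "lform sH \<phi>"
    using rational_coaction_iff[OF N, where \<rho> = \<rho>] i \<rho> that Lam_Sub[OF sub_ydD(2,5)[OF N] that(2) i[OF that(1)]] by simp
qed

end



context hopf_setup
begin

subsection \<open>The maximal rational submodule\<close>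

lemma span_rational:
  assumes U: "\<And>n. n \<in> U \<Longrightarrow> lform sH n"
    "\<And>n b. n \<in> U \<Longrightarrow> act HD b n \<in> module.span fscale U"
    "\<And>n. n \<in> U \<Longrightarrow> dual_coact B H n \<in> carrier (tensor_space B (Sub (module.span fscale U)))"
    "\<And>n. n \<in> U \<Longrightarrow> \<exists>t \<in> carrier (tensor_space (Sub (module.span fscale U)) H).
       \<forall>\<phi> x. lform sH \<phi> \<longrightarrow> Lam \<phi> x t = W x (\<lambda>u v. n u * \<phi> v)"
  shows "rational_submodule B H (module.span fscale U)"
proof -
  interpret F: vector_space "fscale :: 'k \<Rightarrow> ('h \<Rightarrow> 'k) \<Rightarrow> _" by (rule vector_space_fscale)
  let ?R = "F.span U"
  have UHD: "F.span U \<subseteq> carrier HD"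
    using spHD by (intro F.span_minimal) (auto simp: in_HD U(1) is_space_def)
  have spR: "is_space (Sub ?R)"
    by (rule is_space_fscale) (simp_all add: F.span_zero F.span_add F.span_scale)
  have spT: "is_space (tensor_space (Sub ?R) H)" "is_space (tensor_space B (Sub ?R))"
    by (rule is_space_tensor_space)+
  have THD: "t \<in> carrier (tensor_space (Sub ?R) H) \<Longrightarrow> t \<in> carrier (tensor_space HD H)" for t
    using tensor_Sub_HD[OF UHD] by blast
  let ?P = "\<lambda>n. n \<in> carrier HD \<and> (\<forall>b. act HD b n \<in> ?R) \<and> dual_coact B H n \<in> carrier (tensor_space B (Sub ?R)) \<and>
    (\<exists>t \<in> carrier (tensor_space (Sub ?R) H). \<forall>\<phi> x. lform sH \<phi> \<longrightarrow> Lam \<phi> x t = W x (\<lambda>u v. n u * \<phi> v))"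
  note lc = lin_dual_coact bilinear_onD1[OF bil_act_HD]
  have "?R \<subseteq> {n. ?P n}"
  proof (rule F.span_minimal)
    show "U \<subseteq> {n. ?P n}" using U by (auto simp: in_HD)
    show "F.subspace {n. ?P n}"
      unfolding F.subspace_def mem_Collect_eq
    proof (intro conjI ballI allI)
      show "0 \<in> carrier HD" by (rule is_spaceD(1)[OF spHD])
      show "act HD b 0 \<in> ?R" for b by (simp add: linear_on_0[OF lc(2) spHD] F.span_zero spB)
      show "dual_coact B H 0 \<in> carrier (tensor_space B (Sub ?R))"
        by (simp add: linear_on_0[OF lc(1) spHD] is_spaceD(1)[OF spT(2)])
      show "\<exists>t \<in> carrier (tensor_space (Sub ?R) H). \<forall>\<phi> x. lform sH \<phi> \<longrightarrow> Lam \<phi> x t = W x (\<lambda>u v. 0 u * \<phi> v)"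
        by (rule bexI[of _ 0]) (simp_all add: linear_on_0[OF Lam_linear is_space_tensor_space] is_spaceD(1)[OF spT(1)])
    next
      fix n m b assume "n \<in> {n. ?P n}" "m \<in> {n. ?P n}"
      then have n: "?P n" and m: "?P m" by blast+
      from n m show "n + m \<in> carrier HD" using is_spaceD(2)[OF spHD] by blast
      from n m show "act HD b (n + m) \<in> ?R"
        by (simp add: linear_onD(2)[OF lc(2)] F.span_add spB)
      from n m show "dual_coact B H (n + m) \<in> carrier (tensor_space B (Sub ?R))"
        by (simp add: linear_onD(2)[OF lc(1)] is_spaceD(2)[OF spT(2)])
      from n obtain t where t: "t \<in> carrier (tensor_space (Sub ?R) H)" "\<And>\<phi> x. lform sH \<phi> \<Longrightarrow> Lam \<phi> x t = W x (\<lambda>u v. n u * \<phi> v)"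
        by blast
      from m obtain s where s: "s \<in> carrier (tensor_space (Sub ?R) H)" "\<And>\<phi> x. lform sH \<phi> \<Longrightarrow> Lam \<phi> x s = W x (\<lambda>u v. m u * \<phi> v)"
        by blast
      show "\<exists>t \<in> carrier (tensor_space (Sub ?R) H). \<forall>\<phi> x. lform sH \<phi> \<longrightarrow> Lam \<phi> x t = W x (\<lambda>u v. (n + m) u * \<phi> v)"
        by (rule bexI[of _ "t + s"])
          (use t s in \<open>simp_all add: linear_onD(2)[OF Lam_linear] THD is_spaceD(2)[OF spT(1)] distrib_right sw_add\<close>)
    next
      fix c n b assume "n \<in> {n. ?P n}"
      then have n: "?P n" by blast
      from n show "fscale c n \<in> carrier HD" using is_spaceD(4)[OF spHD] by simp
      from n show "act HD b (fscale c n) \<in> ?R"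
        using linear_onD(3)[OF lc(2), of b n c] F.span_scale by (simp add: spB)
      from n show "dual_coact B H (fscale c n) \<in> carrier (tensor_space B (Sub ?R))"
        using linear_onD(3)[OF lc(1), of n c] is_spaceD(4)[OF spT(2)] by simp
      from n obtain t where t: "t \<in> carrier (tensor_space (Sub ?R) H)" "\<And>\<phi> x. lform sH \<phi> \<Longrightarrow> Lam \<phi> x t = W x (\<lambda>u v. n u * \<phi> v)"
        by blast
      show "\<exists>t \<in> carrier (tensor_space (Sub ?R) H). \<forall>\<phi> x. lform sH \<phi> \<longrightarrow> Lam \<phi> x t = W x (\<lambda>u v. fscale c n u * \<phi> v)"
      proof (intro bexI[of _ "fscale c t"] allI impI)
        fix \<phi> x assume \<phi>: "lform sH \<phi>"
        have "Lam \<phi> x (fscale c t) = c * Lam \<phi> x t"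
          using linear_onD(3)[OF Lam_linear[OF \<phi>] THD[OF t(1)], of c x] by simp
        then show "Lam \<phi> x (fscale c t) = W x (\<lambda>u v. fscale c n u * \<phi> v)"
          by (simp add: t(2)[OF \<phi>] fscale_def sw_mult_left mult.assoc)
      qed (use is_spaceD(4)[OF spT(1) t(1), of c] in simp)
    qed
  qed
  then have P: "n \<in> ?R \<Longrightarrow> ?P n" for n by blast
  then have sub: "sub_yd ?R" using UHD spR by (simp add: sub_yd_def)
  have "\<forall>n\<in>?R. \<exists>t. t \<in> carrier (tensor_space (Sub ?R) H) \<and> (\<forall>\<phi> x. lform sH \<phi> \<longrightarrow> Lam \<phi> x t = W x (\<lambda>u v. n u * \<phi> v))"
    using P by blast
  then obtain t where "\<forall>n\<in>?R. t n \<in> carrier (tensor_space (Sub ?R) H) \<and>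
      (\<forall>\<phi> x. lform sH \<phi> \<longrightarrow> Lam \<phi> x (t n) = W x (\<lambda>u v. n u * \<phi> v))" by metis
  then show ?thesis by (intro rational_criterion(1)[OF sub, of t]) auto
qed

text \<open>The maximum is the span of the union of all rational submodules. Coactions of different
  submodules need not be matched by hand: each supplies tensors with the right pairing, and the
  pairing determines the tensor.\<close>

lemma rational_dual_rat: "rational_submodule B H (dual_rat_carrier B H)"
  and rational_le_dual_rat: "rational_submodule B H N \<Longrightarrow> N \<subseteq> dual_rat_carrier B H"
proof -
  interpret F: vector_space "fscale :: 'k \<Rightarrow> ('h \<Rightarrow> 'k) \<Rightarrow> _" by (rule vector_space_fscale)
  let ?U = "\<Union>{N. rational_submodule B H N}"
  let ?R = "F.span ?U"
  have le: "N \<subseteq> ?R" if "rational_submodule B H N" for N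
    using that F.span_superset[of ?U] by blast
  have rat: "rational_submodule B H ?R"
  proof (rule span_rational)
    fix n b assume "n \<in> ?U"
    then obtain N where N: "rational_submodule B H N" "n \<in> N" by blast
    note sN = rational_submoduleD(1)[OF N(1)]
    obtain \<rho> where \<rho>: "rational_coaction B H (Sub N) (dual_mult B H) \<rho>" using rational_submoduleD(2)[OF N(1)] by blast
    show "lform sH n" by (rule sub_ydD(1)[OF sN N(2)])
    show "act HD b n \<in> ?R" using sub_ydD(3)[OF sN N(2)] le[OF N(1)] by blast
    show "dual_coact B H n \<in> carrier (tensor_space B (Sub ?R))"
      using sub_ydD(4)[OF sN N(2)] tensor_B_Sub_mono[OF le[OF N(1)]] by blast
    show "\<exists>t \<in> carrier (tensor_space (Sub ?R) H). \<forall>\<phi> x. lform sH \<phi> \<longrightarrow> Lam \<phi> x t = W x (\<lambda>u v. n u * \<phi> v)"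
      using rational_coactionD(1,2)[OF sN \<rho> N(2)] tensor_Sub_H_mono[OF le[OF N(1)]] by blast
  qed
  have "dual_rat_carrier B H = ?R"
    unfolding dual_rat_carrier_def by (rule Greatest_equality) (fact rat, fact le)
  then show "rational_submodule B H (dual_rat_carrier B H)" "rational_submodule B H N \<Longrightarrow> N \<subseteq> dual_rat_carrier B H"
    using rat le by simp_all
qed


subsection \<open>The action of \<open>H\<close> on its dual\<close>

text \<open>The explicit form of \<leftharpoonup>. It is defined for every functional, so it can be
  studied before rationality is known; \<open>dual_rat_act_eq\<close> identifies it with the
  prescribed action on \<open>R\<close>.\<close>

definition hit :: "('h \<Rightarrow> 'k) \<Rightarrow> 'h \<Rightarrow> 'h \<Rightarrow> 'k" where
  "hit f h = (\<lambda>x. sw (CH (SH h) x) (\<lambda>a b. f (a * b)))"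

lemma hit_in: "lform sH f \<Longrightarrow> lform sH (hit f h)"
  and hit_lform: "lform sH f \<Longrightarrow> lform sH (\<lambda>h. hit f h x)"
proof -
  assume f: "lform sH f"
  note [lin] = lform_comp[OF f]
  show "lform sH (hit f h)" "lform sH (\<lambda>h. hit f h x)" unfolding hit_def by (intro lin)+
qed

lemmas lform_hit [lin] = lform_comp[OF hit_lform]

lemma lform_hit_left [lin]: "lform fscale (\<lambda>f. hit f h x)"
  unfolding hit_def by (intro lin)

lemma hit_one: "lform sH f \<Longrightarrow> hit f 1 = f"
proof
  fix x assume f: "lform sH f"
  note [lin] = lform_comp[OF f]
  have S1: "\<phi> (SH 1) = \<phi> 1" if \<phi>: "lform sH \<phi>" for \<phi>
  proof -
    note [lin] = lform_comp[OF \<phi>]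
    have "sw (DH 1) (\<lambda>a b. \<phi> (SH a * b)) = eH 1 * \<phi> 1" by (rule Hf.antipode_left[OF \<phi>])
    moreover have "sw (DH 1) (\<lambda>a b. \<phi> (SH a * b)) = \<phi> (SH 1 * 1)" by (rule Hf.D_one) (intro lin)
    ultimately show ?thesis by (simp add: eH_one)
  qed
  have "sw (CH (SH 1) x) (\<lambda>a b. f (a * b)) = sw (CH 1 x) (\<lambda>a b. f (a * b))"
    by (rule S1) (intro lin)
  also have "\<dots> = f (x * 1)" by (rule Hf.C_one_left) (intro lin)
  finally show "hit f 1 x = f x" by (simp add: hit_def)
qed

lemma hit_mult: "lform sH f \<Longrightarrow> hit f (x * y) = hit (hit f x) y"
  by (rule ext) (simp add: hit_def Hf.antipode_mult_braided)

text \<open>The coproduct of S b1 reaches both S h and the argument. On S h it meets b2 and cancels,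
  which leaves S b acting on the argument alone.\<close>

lemma hit_act:
  assumes f: "lform sH f"
  shows "act HD b (hit f h) = sw (DB b) (\<lambda>b1 b2. hit (act HD b1 f) (A b2 h))"
proof
  fix x
  note [lin] = lform_comp[OF f]
  let ?w = "SH h"
  have 1: "sw (CH w x) (\<lambda>u v. f (A c (u * v))) = sw (DB c) (\<lambda>d1 d2. sw (CH (A d1 w) (A d2 x)) (\<lambda>u v. f (u * v)))"
    for c w
  proof -
    have "sw (CH w x) (\<lambda>u v. f (A c (u * v))) = sw (CH w x) (\<lambda>u v. sw (DB c) (\<lambda>d1 d2. f (A d1 u * A d2 v)))"
      by (simp add: A_mult lmap_sw[OF f])
    also have "\<dots> = sw (DB c) (\<lambda>d1 d2. sw (CH (A d1 w) (A d2 x)) (\<lambda>u v. f (u * v)))"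
      by (rule CH_act[symmetric]) (intro lin)
    finally show ?thesis .
  qed
  have "sw (DB b) (\<lambda>b1 b2. hit (act HD b1 f) (A b2 h)) x =
      sw (DB b) (\<lambda>b1 b2. sw (DB (SB b1)) (\<lambda>d1 d2. sw (CH (A d1 (A b2 ?w)) (A d2 x)) (\<lambda>u v. f (u * v))))"
    by (simp add: sw_apply hit_def S_act 1)
  also have "\<dots> = sw (DB b) (\<lambda>b1 b2. sw (DB b1) (\<lambda>e1 e2. sw (CH (A (SB e2 * b2) ?w) (A (SB e1) x)) (\<lambda>u v. f (u * v))))"
    by (subst DB_SB, intro lin) (simp add: A_mult_left)
  also have "\<dots> = sw (DB b) (\<lambda>e1 t. sw (DB t) (\<lambda>e2 b2. sw (CH (A (SB e2 * b2) ?w) (A (SB e1) x)) (\<lambda>u v. f (u * v))))"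
    by (rule Bf.coassoc) (intro lin)
  also have "\<dots> = sw (DB b) (\<lambda>e1 t. eB t * sw (CH (A 1 ?w) (A (SB e1) x)) (\<lambda>u v. f (u * v)))"
    by (rule sw_cong, rule Bf.antipode_left) (intro lin)
  also have "\<dots> = sw (CH (A 1 ?w) (A (SB b) x)) (\<lambda>u v. f (u * v))"
    by (rule Bf.counit_right) (intro lin)
  finally show "act HD b (hit f h) x = sw (DB b) (\<lambda>b1 b2. hit (act HD b1 f) (A b2 h)) x"
    by (simp add: hit_def A_one_left)
qed

text \<open>The coaction counterpart of \<open>hit_act\<close>. The coaction of S h and the antipode
  in the dual coaction meet in the order \<open>SB d * c\<close>, which is a counit by
  \<open>antipode_left_inv\<close>.\<close>

lemma hit_coact:
  assumes f: "lform sH f" and p: "lform sB p"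
  shows "sw (K x) (\<lambda>b y. p (SB b) * hit f h y) =
    sw (KD f) (\<lambda>b f0. sw (K h) (\<lambda>c h0. p (b * c) * hit f0 h0 x))"
proof -
  note [lin] = lform_comp[OF f] lform_comp[OF p]
  let ?w = "SH h"
  have "sw (KD f) (\<lambda>b f0. sw (K h) (\<lambda>c h0. p (b * c) * hit f0 h0 x)) =
      sw (K h) (\<lambda>c h0. sw (KD f) (\<lambda>b f0. sw (CH (SH h0) x) (\<lambda>u v. p (b * c) * f0 (u * v))))"
    by (subst sw_swap) (simp add: hit_def sw_mult_left)
  also have "\<dots> = sw (K h) (\<lambda>c h0. sw (CH (SH h0) x) (\<lambda>u v. sw (KD f) (\<lambda>b f0. p (b * c) * f0 (u * v))))"
    by (rule sw_cong, rule sw_swap)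
  also have "\<dots> = sw (K h) (\<lambda>c h0. sw (CH (SH h0) x) (\<lambda>u v. sw (K (u * v)) (\<lambda>b y. p (SB b * c) * f y)))"
    by (rule sw_cong, rule sw_cong, rule KD_eval[OF f]) (intro lin)
  also have "\<dots> = sw (K h) (\<lambda>c h0. sw (CH (SH h0) x) (\<lambda>u v. sw (K u) (\<lambda>b u0. sw (K v) (\<lambda>d v0. p (SB (b * d) * c) * f (u0 * v0)))))"
    by (rule sw_cong, rule sw_cong, rule K_mult) (intro lin)
  also have "\<dots> = sw (K ?w) (\<lambda>c w0. sw (CH w0 x) (\<lambda>u v. sw (K u) (\<lambda>b u0. sw (K v) (\<lambda>d v0. p (SB (b * d) * c) * f (u0 * v0)))))"
    by (rule K_S[symmetric]) (intro lin)
  also have "\<dots> = sw (K ?w) (\<lambda>c w0. sw (K w0) (\<lambda>d w1. sw (K x) (\<lambda>e x0. sw (CH w1 x0) (\<lambda>u v. p (SB (d * e) * c) * f (u * v)))))"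
    by (rule sw_cong, rule CH_coact[symmetric]) (intro lin)
  also have "\<dots> = sw (K ?w) (\<lambda>t w1. sw (DB t) (\<lambda>c d. sw (K x) (\<lambda>e x0. sw (CH w1 x0) (\<lambda>u v. p (SB (d * e) * c) * f (u * v)))))"
    by (rule K_coassoc[symmetric]) (intro lin)
  also have "\<dots> = sw (K ?w) (\<lambda>t w1. sw (DB t) (\<lambda>c d. sw (K x) (\<lambda>e x0. sw (CH w1 x0) (\<lambda>u v. p (SB e * (SB d * c)) * f (u * v)))))"
    by (simp add: SB_mult mult.assoc)
  also have "\<dots> = sw (K ?w) (\<lambda>t w1. eB t * sw (K x) (\<lambda>e x0. sw (CH w1 x0) (\<lambda>u v. p (SB e * 1) * f (u * v))))"
    by (rule sw_cong, rule antipode_left_inv[of "\<lambda>s. sw (K x) (\<lambda>e x0. sw (CH _ x0) (\<lambda>u v. p (SB e * s) * f (u * v)))"]) (intro lin)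
  also have "\<dots> = sw (K x) (\<lambda>e x0. sw (CH ?w x0) (\<lambda>u v. p (SB e * 1) * f (u * v)))"
    by (rule K_counit) (intro lin)
  finally show ?thesis by (simp add: hit_def sw_mult_left)
qed

text \<open>The value of the coaction of \<open>f \<leftharpoonup> h\<close> in terms of that of \<open>f\<close>.\<close>

lemma hit_compat:
  assumes f: "lform sH f" and N: "sub_yd N" and t: "t \<in> carrier (tensor_space (Sub N) H)"
    and Lt: "\<And>\<phi> x. lform sH \<phi> \<Longrightarrow> Lam \<phi> x t = W x (\<lambda>u v. f u * \<phi> v)" and \<phi>: "lform sH \<phi>"
  shows "sw (rep (Sub N) H t) (\<lambda>m m1. sw (DH h) (\<lambda>h1 h2. sw (CH m1 h1) (\<lambda>p q.
      sw (CH (q * h2) x) (\<lambda>y z. hit m p y * \<phi> z)))) = W x (\<lambda>u v. hit f h u * \<phi> v)"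
proof -
  note [lin] = lform_comp[OF \<phi>] lform_comp[OF f]
  \<comment> \<open>For one summand of the coaction the braidings are reordered until
    \<open>m\<close> and \<open>m1\<close> occur only in the pairing at the point
    \<open>a * b\<close>. There the hypothesis on \<open>t\<close> can be applied to the whole
    sum.\<close>
  have inner: "sw (DH h) (\<lambda>h1 h2. sw (CH m1 h1) (\<lambda>p q. sw (CH (q * h2) x) (\<lambda>y z. hit m p y * \<phi> z))) =
      sw (DH h) (\<lambda>h1 h2. sw (CH h2 x) (\<lambda>x' h2'. sw (CH (SH h1) x') (\<lambda>a b. sw (CH m1 (a * b)) (\<lambda>z q. m z * \<phi> (q * h2')))))"
    if m: "lform sH m" for m m1
  proof -
    note [lin] = lform_comp[OF m] lform_comp[OF hit_in[OF m]]
    have "sw (DH h) (\<lambda>h1 h2. sw (CH m1 h1) (\<lambda>p q. sw (CH (q * h2) x) (\<lambda>y z. hit m p y * \<phi> z))) =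
        sw (DH h) (\<lambda>h1 h2. sw (CH m1 h1) (\<lambda>p q. sw (CH h2 x) (\<lambda>x' h2'. sw (CH q x') (\<lambda>u q'. hit m p u * \<phi> (q' * h2')))))"
      by (rule sw_cong, rule sw_cong, rule Hf.C_mult_left) (intro lin)
    also have "\<dots> = sw (DH h) (\<lambda>h1 h2. sw (CH h2 x) (\<lambda>x' h2'. sw (CH m1 h1) (\<lambda>p q. sw (CH q x') (\<lambda>u q'.
        sw (CH (SH p) u) (\<lambda>a b. m (a * b) * \<phi> (q' * h2'))))))"
      by (rule sw_cong, subst sw_swap) (simp add: hit_def sw_mult_right)
    also have "\<dots> = sw (DH h) (\<lambda>h1 h2. sw (CH h2 x) (\<lambda>x' h2'. sw (CH m1 (SH h1)) (\<lambda>p q. sw (CH q x') (\<lambda>u q'.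
        sw (CH p u) (\<lambda>a b. m (a * b) * \<phi> (q' * h2'))))))"
      by (rule sw_cong, rule sw_cong, rule Hf.C_S_right[symmetric]) (intro lin)
    also have "\<dots> = sw (DH h) (\<lambda>h1 h2. sw (CH h2 x) (\<lambda>x' h2'. sw (CH (SH h1) x') (\<lambda>z1 y1. sw (CH m1 z1) (\<lambda>z2 x1.
        sw (CH x1 y1) (\<lambda>y2 x2. m (z2 * y2) * \<phi> (x2 * h2'))))))"
      by (rule sw_cong, rule sw_cong, rule Hf.C_braid) (intro lin)
    also have "\<dots> = sw (DH h) (\<lambda>h1 h2. sw (CH h2 x) (\<lambda>x' h2'. sw (CH (SH h1) x') (\<lambda>a b. sw (CH m1 (a * b)) (\<lambda>z q. m z * \<phi> (q * h2')))))"
      by (rule sw_cong, rule sw_cong, rule sw_cong, rule Hf.C_mult_right[symmetric]) (intro lin)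
    finally show ?thesis .
  qed
  have Lt': "sw (rep (Sub N) H t) (\<lambda>m m1. sw (CH m1 y) (\<lambda>z q. m z * \<phi> (q * c))) = W y (\<lambda>u v. f u * \<phi> (v * c))" for y c
  proof -
    have "lform sH (\<lambda>q. \<phi> (q * c))" by (intro lin)
    from Lam_Sub[OF sub_ydD(2,5)[OF N] this t] Lt[OF this] show ?thesis by simp
  qed
  have "sw (rep (Sub N) H t) (\<lambda>m m1. sw (DH h) (\<lambda>h1 h2. sw (CH m1 h1) (\<lambda>p q.
      sw (CH (q * h2) x) (\<lambda>y z. hit m p y * \<phi> z)))) =
    sw (rep (Sub N) H t) (\<lambda>m m1. sw (DH h) (\<lambda>h1 h2. sw (CH h2 x) (\<lambda>x' h2'. sw (CH (SH h1) x') (\<lambda>a b.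
      sw (CH m1 (a * b)) (\<lambda>z q. m z * \<phi> (q * h2'))))))"
    by (rule sw_rep_cong[OF sub_ydD(2)[OF N] t], rule inner) (use sub_ydD(1)[OF N] in simp)
  also have "\<dots> = sw (DH h) (\<lambda>h1 h2. sw (rep (Sub N) H t) (\<lambda>m m1. sw (CH h2 x) (\<lambda>x' h2'. sw (CH (SH h1) x') (\<lambda>a b.
      sw (CH m1 (a * b)) (\<lambda>z q. m z * \<phi> (q * h2'))))))"
    by (rule sw_swap)
  also have "\<dots> = sw (DH h) (\<lambda>h1 h2. sw (CH h2 x) (\<lambda>x' h2'. sw (rep (Sub N) H t) (\<lambda>m m1. sw (CH (SH h1) x') (\<lambda>a b.
      sw (CH m1 (a * b)) (\<lambda>z q. m z * \<phi> (q * h2'))))))"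
    by (rule sw_cong, rule sw_swap)
  also have "\<dots> = sw (DH h) (\<lambda>h1 h2. sw (CH h2 x) (\<lambda>x' h2'. sw (CH (SH h1) x') (\<lambda>a b. sw (rep (Sub N) H t) (\<lambda>m m1.
      sw (CH m1 (a * b)) (\<lambda>z q. m z * \<phi> (q * h2'))))))"
    by (rule sw_cong, rule sw_cong, rule sw_swap)
  also have "\<dots> = W x (\<lambda>u v. sw (CH (SH h) u) (\<lambda>a b. f (a * b) * \<phi> v))"
    unfolding Lt' by (rule Hf.braided_antipode_shift[symmetric]) (intro lin)
  finally show ?thesis by (simp add: hit_def sw_mult_right)
qed

end



lemma linear_on_fun_cong:
  "linear_on V U f \<Longrightarrow> is_space V \<Longrightarrow> (\<And>x. x \<in> carrier V \<Longrightarrow> g x = f x) \<Longrightarrow> linear_on V U g"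
  by (simp add: linear_on_def is_spaceD(2,4))

context hopf_setup
begin

abbreviation R where "R \<equiv> dual_rat_carrier B H"

lemma dual_rat_Sub: "dual_rat B H = Sub R"
  by (simp add: dual_rat_def)

lemma sub_R: "sub_yd R"
  by (rule rational_submoduleD(1)[OF rational_dual_rat])

lemma hit_coact_tensor:
  assumes N: "sub_yd N" and f: "f \<in> N"
  shows "dual_coact B H (hit f h) = sw (rep B (Sub N) (dual_coact B H f)) (\<lambda>b f0. sw (K h) (\<lambda>c h0.
      tens B HD (b * c) (hit f0 h0)))" (is "_ = ?s")
proof (rule dual_coact_eqI)
  note f' = sub_ydD(1)[OF N f]
  show "lform sH (hit f h)" by (rule hit_in[OF f'])
  have ins: "tens B HD (b * c) (hit f0 h0) \<in> carrier (tensor_space B HD)"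
    if "(b, f0) \<in> set (rep B (Sub N) (dual_coact B H f))" for b c f0 h0
    by (rule tens_in) (use hit_in[OF sub_ydD(1)[OF N KD_Sub_in[OF N f that]]] in \<open>simp_all add: spB in_HD\<close>)
  show "?s \<in> carrier (tensor_space B HD)"
    by (intro sw_in[OF is_space_tensor_space] ins)
  fix p x assume p: "lform sB p"
  note [lin] = lform_comp[OF p]
  have \<beta>: "bform sB (scale HD) (\<lambda>b g. p b * g x)" using p by (simp add: bform_eval)
  have "sw (rep B HD ?s) (\<lambda>b g. p b * g x) = sw (rep B (Sub N) (dual_coact B H f)) (\<lambda>b f0.
      sw (rep B HD (sw (K h) (\<lambda>c h0. tens B HD (b * c) (hit f0 h0)))) (\<lambda>b g. p b * g x))"
    by (rule sw_rep_sw[OF spB(1) spHD \<beta>]) (intro sw_in[OF is_space_tensor_space] ins)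
  also have "\<dots> = sw (rep B (Sub N) (dual_coact B H f)) (\<lambda>b f0. sw (K h) (\<lambda>c h0. p (b * c) * hit f0 h0 x))"
  proof (rule sw_cong)
    fix b f0 assume "(b, f0) \<in> set (rep B (Sub N) (dual_coact B H f))"
    then have "lform sH f0" using KD_Sub_in[OF N f] sub_ydD(1)[OF N] by blast
    then show "sw (rep B HD (sw (K h) (\<lambda>c h0. tens B HD (b * c) (hit f0 h0)))) (\<lambda>b g. p b * g x) =
        sw (K h) (\<lambda>c h0. p (b * c) * hit f0 h0 x)"
      by (intro sw_rep_B_tens[OF spHD HD_simps(1) p]) (simp add: in_HD hit_in)
  qed
  also have "\<dots> = sw (KD f) (\<lambda>b f0. sw (K h) (\<lambda>c h0. p (b * c) * hit f0 h0 x))"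
    by (rule KD_Sub[OF N f]) (intro lin)
  finally show "sw (rep B HD ?s) (\<lambda>b g. p b * g x) = sw (K x) (\<lambda>b y. p (SB b) * hit f h y)"
    by (simp add: hit_coact[OF f' p])
qed

text \<open>The right-hand side of the Hopf module axiom, formed from a tensor \<open>t\<close> in
  the role of the coaction of f. It provides a coaction for f \<leftharpoonup> h before that
  functional is known to be rational.\<close>

definition hit_coaction :: "('h \<Rightarrow> 'k, 'h, 'k) tensor \<Rightarrow> 'h \<Rightarrow> ('h \<Rightarrow> 'k, 'h, 'k) tensor" where
  "hit_coaction t h = sw (rep (Sub R) H t) (\<lambda>m m1. sw (DH h) (\<lambda>h1 h2. sw (CH m1 h1) (\<lambda>p q.
     tens HD H (hit m p) (q * h2))))"

lemma hit_coaction_in: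
  assumes t: "t \<in> carrier (tensor_space (Sub R) H)"
    and M: "\<And>m p. m \<in> R \<Longrightarrow> hit m p \<in> M"
  shows "hit_coaction t h \<in> carrier (tensor_space (Sub M) H)"
proof -
  have "tens HD H (hit m p) q \<in> carrier (tensor_space (Sub M) H)" if "m \<in> R" for m p q
    using tens_in[of "hit m p" "Sub M" q H] M[OF that] by (simp add: spH)
  then show ?thesis unfolding hit_coaction_def
    by (intro sw_rep_in[OF sub_ydD(2)[OF sub_R] is_space_tensor_space t] sw_in[OF is_space_tensor_space]) simp
qed

lemma Lam_hit_coaction:
  assumes f: "lform sH f" and t: "t \<in> carrier (tensor_space (Sub R) H)"
    and Lt: "\<And>\<phi> x. lform sH \<phi> \<Longrightarrow> Lam \<phi> x t = W x (\<lambda>u v. f u * \<phi> v)" and \<phi>: "lform sH \<phi>"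
  shows "Lam \<phi> x (hit_coaction t h) = W x (\<lambda>u v. hit f h u * \<phi> v)"
proof -
  have ins: "tens HD H (hit m p) q \<in> carrier (tensor_space HD H)" if "m \<in> R" for m p q
    by (rule tens_in) (use that hit_in sub_ydD(1)[OF sub_R] in \<open>simp_all add: in_HD spH\<close>)
  have mR: "m \<in> R" if "(m, m1) \<in> set (rep (Sub R) H t)" for m m1
    using rep_set[OF sub_ydD(2)[OF sub_R] t] that by auto
  note push = linear_on_sw[OF Lam_linear[OF \<phi>] is_space_tensor_space]
  have "Lam \<phi> x (hit_coaction t h) = sw (rep (Sub R) H t) (\<lambda>m m1. Lam \<phi> x (sw (DH h) (\<lambda>h1 h2. sw (CH m1 h1) (\<lambda>p q.
     tens HD H (hit m p) (q * h2)))))"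
    unfolding hit_coaction_def by (rule push) (intro sw_in[OF is_space_tensor_space] ins mR)
  also have "\<dots> = sw (rep (Sub R) H t) (\<lambda>m m1. sw (DH h) (\<lambda>h1 h2. sw (CH m1 h1) (\<lambda>p q.
     sw (CH (q * h2) x) (\<lambda>y z. hit m p y * \<phi> z))))"
  proof (rule sw_cong)
    fix m m1 assume "(m, m1) \<in> set (rep (Sub R) H t)"
    then have m: "m \<in> R" by (rule mR)
    have "Lam \<phi> x (sw (DH h) (\<lambda>h1 h2. sw (CH m1 h1) (\<lambda>p q. tens HD H (hit m p) (q * h2)))) =
        sw (DH h) (\<lambda>h1 h2. Lam \<phi> x (sw (CH m1 h1) (\<lambda>p q. tens HD H (hit m p) (q * h2))))"
      by (rule push) (intro sw_in[OF is_space_tensor_space] ins m)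
    also have "\<dots> = sw (DH h) (\<lambda>h1 h2. sw (CH m1 h1) (\<lambda>p q. Lam \<phi> x (tens HD H (hit m p) (q * h2))))"
      by (rule sw_cong, rule push) (intro ins m)
    finally show "Lam \<phi> x (sw (DH h) (\<lambda>h1 h2. sw (CH m1 h1) (\<lambda>p q. tens HD H (hit m p) (q * h2)))) =
        sw (DH h) (\<lambda>h1 h2. sw (CH m1 h1) (\<lambda>p q. sw (CH (q * h2) x) (\<lambda>y z. hit m p y * \<phi> z)))"
      by (simp add: Lam_tens[OF \<phi> hit_in[OF sub_ydD(1)[OF sub_R m]]])
  qed
  also have "\<dots> = W x (\<lambda>u v. hit f h u * \<phi> v)"
    by (rule hit_compat[OF f sub_R t Lt \<phi>])
  finally show ?thesis .
qed

text \<open>The span of all f \<leftharpoonup> h with f in \<open>R\<close> is a rational submodule,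
  with \<open>hit_coaction\<close> as coactions on generators. Maximality of \<open>R\<close> then
  forces it into \<open>R\<close>.\<close>

lemma hit_in_R:
  assumes f: "f \<in> R" shows "hit f h \<in> R"
proof -
  interpret F: vector_space "fscale :: 'k \<Rightarrow> ('h \<Rightarrow> 'k) \<Rightarrow> _" by (rule vector_space_fscale)
  let ?U = "{hit f h | f h. f \<in> R}"
  let ?M = "F.span ?U"
  have U: "hit f h \<in> ?M" if "f \<in> R" for f h using that by (intro F.span_base) auto
  have spM: "is_space (Sub ?M)"
    by (rule is_space_fscale) (simp_all add: F.span_zero F.span_add F.span_scale)
  obtain \<rho> where \<rho>: "rational_coaction B H (Sub R) (dual_mult B H) \<rho>"
    using rational_submoduleD(2)[OF rational_dual_rat] by blast
  note \<rho>D = rational_coactionD[OF sub_R \<rho>]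
  have "rational_submodule B H ?M"
  proof (rule span_rational)
    fix n b assume "n \<in> ?U"
    then obtain f h where n: "n = hit f h" and f: "f \<in> R" by blast
    note f' = sub_ydD(1)[OF sub_R f]
    show "lform sH n" unfolding n by (rule hit_in[OF f'])
    show "act HD b n \<in> ?M"
      unfolding n hit_act[OF f'] using sw_in[OF spM, of "DB b"] U sub_ydD(3)[OF sub_R f] by simp
    show "dual_coact B H n \<in> carrier (tensor_space B (Sub ?M))"
      unfolding n hit_coact_tensor[OF sub_R f]
    proof (intro sw_in[OF is_space_tensor_space])
      fix b f0 c h0 assume "(b, f0) \<in> set (rep B (Sub R) (dual_coact B H f))"
      then have "hit f0 h0 \<in> ?M" using KD_Sub_in[OF sub_R f] U by blast
      then show "tens B HD (b * c) (hit f0 h0) \<in> carrier (tensor_space B (Sub ?M))"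
        using tens_in[of "b * c" B "hit f0 h0" "Sub ?M"] by (simp add: spB)
    qed
    show "\<exists>t \<in> carrier (tensor_space (Sub ?M) H). \<forall>\<phi> x. lform sH \<phi> \<longrightarrow> Lam \<phi> x t = W x (\<lambda>u v. n u * \<phi> v)"
      using hit_coaction_in[OF \<rho>D(1)[OF f] U, of h] Lam_hit_coaction[OF f' \<rho>D(1,2)[OF f]] unfolding n by blast
  qed
  then show ?thesis using rational_le_dual_rat U[OF f] by blast
qed


subsection \<open>Integrals\<close>

abbreviation V where "V \<equiv> carrier (left_integrals B H)"

lemma left_integrals_Sub: "left_integrals B H = Sub V"
  by (simp add: left_integrals_def sub_object_def)

lemma in_V: "f \<in> V \<longleftrightarrow> lform sH f \<and> (\<forall>\<phi> x. lform sH \<phi> \<longrightarrow> W x (\<lambda>u v. f u * \<phi> v) = \<phi> 1 * f x)"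
  by (auto simp: left_integrals_def in_HD dual_mult_eq fun_eq_iff fscale_def)

lemma sub_V: "sub_yd V"
  unfolding sub_yd_def
proof (intro conjI allI ballI)
  show "V \<subseteq> carrier HD" by (auto simp: in_V in_HD)
  show "is_space (Sub V)"
    by (rule is_space_fscale)
      (auto simp: in_V lmap_def fscale_def sw_add distrib_right distrib_left sw_mult_left mult_ac)
  fix f b assume "f \<in> V"
  then have f: "lform sH f" and If: "\<And>\<phi> x. lform sH \<phi> \<Longrightarrow> W x (\<lambda>u v. f u * \<phi> v) = \<phi> 1 * f x"
    by (simp_all add: in_V)
  note [lin] = lform_comp[OF f]
  show "act HD b f \<in> V"
    unfolding in_V
  proof (intro conjI allI impI act_HD_in[OF f])
    fix \<phi> x assume \<phi>: "lform sH \<phi>"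
    note [lin] = lform_comp[OF \<phi>]
    have \<phi>A: "lform sH (\<lambda>v. \<phi> (A b v))" for b by (intro lin)
    have "W x (\<lambda>u v. f (A (SB b) u) * \<phi> v) = sw (DB b) (\<lambda>b1 b2. W (A (SB b2) x) (\<lambda>u v. f u * \<phi> (A b1 v)))"
      by (rule W_act_right[symmetric]) (intro lin)
    also have "\<dots> = sw (DB b) (\<lambda>b1 b2. eB b1 * (\<phi> 1 * f (A (SB b2) x)))"
      by (simp add: If[OF \<phi>A] A_one lmapD(2)[OF \<phi>] mult.assoc)
    also have "\<dots> = \<phi> 1 * f (A (SB b) x)"
      by (rule Bf.counit_left) (intro lin)
    finally show "W x (\<lambda>u v. act HD b f u * \<phi> v) = \<phi> 1 * act HD b f x" by simp
  qed
  \<comment> \<open>An arbitrary list for this tensor need not have integrals as right factors. The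
    list with explicit coefficient functionals does, as shown next.\<close>
  obtain xs where xs: "dual_coact B H f = sw xs (tens B HD)"
    "\<And>e g. (e, g) \<in> set xs \<Longrightarrow> \<exists>p. lform sB p \<and> g = (\<lambda>x. sw (K x) (\<lambda>b y. p (SB b) * f y))"
    using dual_coact_characterization(3)[OF f] by blast
  have "g \<in> V" if eg: "(e, g) \<in> set xs" for e g
  proof -
    obtain p where p: "lform sB p" and g: "g = (\<lambda>x. sw (K x) (\<lambda>b y. p (SB b) * f y))" using xs(2)[OF eg] by blast
    note [lin] = lform_comp[OF p]
    show ?thesis unfolding in_V g
    proof (intro conjI allI impI lform_coact_form[OF p f])
      fix \<phi> x assume \<phi>: "lform sH \<phi>"
      note [lin] = lform_comp[OF \<phi>]
      \<comment> \<open>The absorbing functional once more. As 1 is coinvariant, its value at 1 is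
        p(S d) \<phi>(1), and the integral property applied to it reproduces \<phi>(1) times the
        coefficient.\<close>
      let ?\<phi> = "\<lambda>d v. sw (K v) (\<lambda>b v0. p (b * SB d) * \<phi> v0)"
      have l\<phi>: "lform sH (?\<phi> d)" for d by (intro lin)
      have \<phi>1: "?\<phi> d 1 = p (1 * SB d) * \<phi> 1" for d by (rule K_one) (intro lin)
      have "W x (\<lambda>u v. sw (K u) (\<lambda>b y. p (SB b) * f y) * \<phi> v) = W x (\<lambda>u v. sw (K u) (\<lambda>b y. p (SB b) * (f y * \<phi> v)))"
        by (simp add: sw_mult_right[symmetric] mult.assoc)
      also have "\<dots> = sw (K x) (\<lambda>d x0. W x0 (\<lambda>u v. sw (K v) (\<lambda>b v0. p (b * SB d) * (f u * \<phi> v0))))"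
        by (rule W_coact_right) (intro lin)
      also have "\<dots> = sw (K x) (\<lambda>d x0. W x0 (\<lambda>u v. f u * ?\<phi> d v))"
        by (simp add: sw_mult_left[symmetric] mult_ac)
      also have "\<dots> = \<phi> 1 * sw (K x) (\<lambda>b y. p (SB b) * f y)"
        unfolding If[OF l\<phi>] \<phi>1 by (simp add: sw_mult_left[symmetric] mult_ac)
      finally show "W x (\<lambda>u v. sw (K u) (\<lambda>b y. p (SB b) * f y) * \<phi> v) = \<phi> 1 * sw (K x) (\<lambda>b y. p (SB b) * f y)" .
    qed
  qed
  then have "sw xs (tens B (Sub V)) \<in> carrier (tensor_space B (Sub V))"
    by (intro sw_tens_in) (auto simp: spB)
  then show "dual_coact B H f \<in> carrier (tensor_space B (Sub V))" by (simp add: xs(1))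
qed

lemma tens_V_in: "f \<in> V \<Longrightarrow> tens HD H f x \<in> carrier (tensor_space (Sub V) H)"
  using tens_in[of f "Sub V" x H] by (simp add: spH)

lemma Lam_one: "lform sH \<phi> \<Longrightarrow> lform sH f \<Longrightarrow> Lam \<phi> x (tens HD H f 1) = \<phi> 1 * f x"
proof -
  assume \<phi>: "lform sH \<phi>" and f: "lform sH f"
  note [lin] = lform_comp[OF \<phi>] lform_comp[OF f]
  have "sw (CH 1 x) (\<lambda>u v. f u * \<phi> v) = f x * \<phi> 1" by (rule Hf.C_one_left) (intro lin)
  then show ?thesis by (simp add: Lam_tens \<phi> f mult.commute)
qed

text \<open>The equation that defines an integral v says exactly that v \<otimes> 1 has the pairing
  required of its coaction.\<close>

lemma V_subset_R: "V \<subseteq> R"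
proof (rule rational_le_dual_rat, rule rational_criterion(1)[OF sub_V, of "\<lambda>f. tens HD H f 1"])
  fix n \<phi> x assume n: "n \<in> V"
  then show "tens HD H n 1 \<in> carrier (tensor_space (Sub V) H)" by (rule tens_V_in)
  assume "lform sH \<phi>"
  then show "Lam \<phi> x (tens HD H n 1) = W x (\<lambda>u v. n u * \<phi> v)"
    using n by (simp add: Lam_one in_V)
qed


subsection \<open>The action in the definition of the Hopf module\<close>

lemma dual_hit_eq:
  assumes f: "lform sH f"
  shows "dual_hit B H h f = (\<lambda>x. sw (K h) (\<lambda>b h0. sw (CH h0 x) (\<lambda>u v. f (A (SB b) (u * v)))))"
proof
  fix x
  let ?\<beta> = "\<lambda>f' h'. sw (rep H H (braid B H H (tens H H h' x))) (\<lambda>u v. f' (u * v))"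
  have \<beta>: "?\<beta> g h' = sw (CH h' x) (\<lambda>u v. g (u * v))" if "g \<in> carrier HD" for g h'
  proof -
    have [THEN lform_comp, lin]: "lform sH g" using that by (simp add: in_HD)
    have "bilinear_on H H ground (\<lambda>u v. g (u * v))" by (rule bilinear_on_bform) (intro lin)
    then show ?thesis
      using sw_rep[OF spH(1) spH(1) is_space_ground, of _ "CH h' x"] by (simp add: braid_tens_H spH)
  qed
  have bil: "bilinear_on HD H ground ?\<beta>"
  proof (intro bilinear_onI)
    fix g assume g: "g \<in> carrier HD"
    then have [THEN lform_comp, lin]: "lform sH g" by (simp add: in_HD)
    show "linear_on H ground (?\<beta> g)" unfolding \<beta>[OF g] by (rule linear_on_lform) (intro lin)
  next
    fix h'
    have "linear_on HD ground (\<lambda>g. sw (CH h' x) (\<lambda>u v. g (u * v)))"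
      using linear_on_lform[of HD] by simp (rule meta_mp, assumption, intro lin)
    then show "linear_on HD ground (\<lambda>g. ?\<beta> g h')" by (rule linear_on_fun_cong[OF _ spHD \<beta>])
  qed
  have "dual_hit B H h f x = sw (rep HD H (sw (K h) (\<lambda>b h0. tens HD H (act HD b f) h0))) ?\<beta>"
    using braid_tens[OF dat_H dat_HD, of h f] f by (simp add: dual_hit_def tensor_lift_sw spH in_HD)
  also have "\<dots> = sw (K h) (\<lambda>b h0. sw (rep HD H (tens HD H (act HD b f) h0)) ?\<beta>)"
    by (rule linear_on_sw[OF linear_on_sw_rep[OF spHD spH(1) is_space_ground bil] is_space_tensor_space])
      (auto intro!: tens_in simp: in_HD act_HD_in f spH)
  also have "\<dots> = sw (K h) (\<lambda>b h0. ?\<beta> (act HD b f) h0)"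
    by (rule sw_cong, rule sw_rep_tens1[OF spHD spH(1) is_space_ground bil]) (simp_all add: in_HD act_HD_in f spH)
  also have "\<dots> = sw (K h) (\<lambda>b h0. sw (CH h0 x) (\<lambda>u v. f (A (SB b) (u * v))))"
    by (rule sw_cong, subst \<beta>) (simp_all add: in_HD act_HD_in f)
  finally show "dual_hit B H h f x = sw (K h) (\<lambda>b h0. sw (CH h0 x) (\<lambda>u v. f (A (SB b) (u * v))))" .
qed

text \<open>The prescribed action braids f past h, and \<rightharpoonup> braids again. Rewritten as
  an inverse, the first braiding cancels the second: together they contribute
  \<open>b * SB c\<close>, which collapses to a counit.\<close>

lemma dual_rat_act_eq:
  assumes fR: "f \<in> R"
  shows "dual_rat_act B H f h = hit f h"
proof
  fix x
  note f = sub_ydD(1)[OF sub_R fR] and spR = sub_ydD(2)[OF sub_R]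
  note [lin] = lform_comp[OF f]
  have RHD: "g \<in> R \<Longrightarrow> lform sH g" for g by (rule sub_ydD(1)[OF sub_R])
  have aR: "act HD b f \<in> R" for b by (rule sub_ydD(3)[OF sub_R fR])
  let ?T = "tensor_space H (Sub R)"
  have tin: "g \<in> R \<Longrightarrow> tens H HD y g \<in> carrier ?T" for g y using tens_in[of y H g "Sub R"] by (simp add: spH)
  have "braid B (Sub R) H (tens (Sub R) H f h) = sw (rep B (Sub R) (dual_coact B H f)) (\<lambda>b f0. tens H HD (A b h) f0)"
    using braid_tens[OF dat_Sub[OF sub_R] dat_H, of f h] fR by (simp add: spH)
  \<comment> \<open>The braiding of \<open>R\<close> with \<open>H\<close> is rewritten through the
    coaction of \<open>h\<close> in place of that of \<open>f\<close>. Tested on both factors this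
    is \<open>CH_inverse\<close>.\<close>
  also have "\<dots> = sw (K h) (\<lambda>b h0. tens H HD h0 (act HD (SB b) f))" (is "?s = ?t")
  proof (rule tensor_eqI[OF spH(1) spR separating_lforms[OF spH(1)] separating_eval])
    show "?s \<in> carrier ?T"
      by (intro sw_in[OF is_space_tensor_space] tin) (use KD_Sub_in[OF sub_R fR] in blast)
    show "?t \<in> carrier ?T" by (intro sw_in[OF is_space_tensor_space] tin aR)
    fix \<phi> \<psi> assume "\<phi> \<in> {\<phi>. lform sH \<phi>}" "\<psi> \<in> range (\<lambda>x (f :: 'h \<Rightarrow> 'k). f x)"
    then obtain y where \<phi>: "lform sH \<phi>" and \<psi>: "\<psi> = (\<lambda>f. f y)" by blast
    note [lin] = lform_comp[OF \<phi>]
    have \<beta>: "bform sH (scale (Sub R)) (\<lambda>v w. \<phi> v * w y)"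
      by (auto simp: bform_def lmap_def lmapD[OF \<phi>] fscale_def algebra_simps)
    note push = sw_rep_sw[OF spH(1) spR \<beta>]
    have ev: "sw (rep H (Sub R) (tens H HD v w)) (\<lambda>v w. \<phi> v * w y) = \<phi> v * w y" if "w \<in> R" for v w
      using sw_rep_tens_form[OF spH(1) spR \<beta>, of v w] that by (simp add: spH)
    have "sw (rep H (Sub R) ?s) (\<lambda>v w. \<phi> v * w y) = sw (rep B (Sub R) (dual_coact B H f)) (\<lambda>b f0. \<phi> (A b h) * f0 y)"
      by (subst push) (use KD_Sub_in[OF sub_R fR] in \<open>auto intro!: tin sw_cong ev\<close>)
    also have "\<dots> = sw (KD f) (\<lambda>b f0. \<phi> (A b h) * f0 y)"
      by (rule KD_Sub[OF sub_R fR]) (intro lin)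
    also have "\<dots> = sw (K y) (\<lambda>b z. \<phi> (A (SB b) h) * f z)"
      by (rule KD_eval[OF f]) (intro lin)
    also have "\<dots> = sw (CH h y) (\<lambda>u v. \<phi> v * f u)"
      by (rule CH_inverse[symmetric, of "\<lambda>v u. \<phi> v * f u"]) (intro lin)
    also have "\<dots> = sw (K h) (\<lambda>b h0. \<phi> h0 * act HD (SB b) f y)"
      unfolding sw_CH by simp
    also have "\<dots> = sw (rep H (Sub R) ?t) (\<lambda>v w. \<phi> v * w y)"
      by (subst push) (auto intro!: tin aR sw_cong ev[symmetric] simp del: HD_simps)
    finally show "sw (rep H (Sub R) ?s) (\<lambda>v w. \<phi> v * \<psi> w) = sw (rep H (Sub R) ?t) (\<lambda>v w. \<phi> v * \<psi> w)"
      unfolding \<psi> .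
  qed simp
  finally have br: "braid B (Sub R) H (tens (Sub R) H f h) = ?t" .
  have dh: "lform sH (dual_hit B H k g)" "lform sH (\<lambda>k. dual_hit B H k g y)" if "lform sH g" for g k y
  proof -
    note [lin] = lform_comp[OF that]
    show "lform sH (dual_hit B H k g)" "lform sH (\<lambda>k. dual_hit B H k g y)"
      unfolding dual_hit_eq[OF that] by (intro lin)+
  qed
  let ?\<beta> = "\<lambda>u v. dual_hit B H (SH u) v x"
  have bil: "bilinear_on H (Sub R) ground ?\<beta>"
  proof (intro bilinear_onI)
    fix g assume "g \<in> carrier (Sub R)"
    then have "lform sH g" using RHD by simp
    note [lin] = lform_comp[OF dh(2)[OF this]]
    show "linear_on H ground (\<lambda>u. ?\<beta> u g)" by (rule linear_on_lform) (intro lin)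
  next
    fix u
    have "linear_on (Sub R) ground (\<lambda>g. sw (K (SH u)) (\<lambda>b h0. sw (CH h0 x) (\<lambda>u v. g (A (SB b) (u * v)))))"
      using linear_on_lform[of "Sub R"] by simp (rule meta_mp, assumption, intro lin)
    then show "linear_on (Sub R) ground (?\<beta> u)"
      by (rule linear_on_fun_cong[OF _ spR]) (simp add: dual_hit_eq RHD)
  qed
  have "dual_rat_act B H f h x = sw (rep H (Sub R) ?t) ?\<beta>"
    unfolding dual_rat_act_def dual_rat_Sub tensor_lift_sw br sw_apply ..
  also have "\<dots> = sw (K h) (\<lambda>b h0. sw (rep H (Sub R) (tens H HD h0 (act HD (SB b) f))) ?\<beta>)"
    by (rule linear_on_sw[OF linear_on_sw_rep[OF spH(1) spR is_space_ground bil] is_space_tensor_space])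
      (intro tin aR)
  also have "\<dots> = sw (K h) (\<lambda>b h0. ?\<beta> h0 (act HD (SB b) f))"
    using sw_rep_tens1[OF spH(1) spR is_space_ground bil] aR by (simp add: spH)
  also have "\<dots> = sw (K h) (\<lambda>b h0. sw (K (SH h0)) (\<lambda>c w. sw (CH w x) (\<lambda>u v. f (A (b * SB c) (u * v)))))"
    by (simp add: dual_hit_eq act_HD_in f A_mult_left)
  also have "\<dots> = sw (K (SH h)) (\<lambda>b h0. sw (K h0) (\<lambda>c w. sw (CH w x) (\<lambda>u v. f (A (b * SB c) (u * v)))))"
    by (rule K_S[symmetric]) (intro lin)
  also have "\<dots> = sw (K (SH h)) (\<lambda>b w. sw (DB b) (\<lambda>b c. sw (CH w x) (\<lambda>u v. f (A (b * SB c) (u * v)))))"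
    by (rule K_coassoc[symmetric]) (intro lin)
  also have "\<dots> = sw (K (SH h)) (\<lambda>b w. eB b * sw (CH w x) (\<lambda>u v. f (A 1 (u * v))))"
    by (rule sw_cong, rule Bf.antipode_right[of "\<lambda>t. sw (CH _ x) (\<lambda>u v. f (A t (u * v)))"]) (intro lin)
  also have "\<dots> = sw (CH (SH h) x) (\<lambda>u v. f (A 1 (u * v)))"
    by (rule K_counit) (intro lin)
  finally show "dual_rat_act B H f h x = hit f h x" by (simp add: hit_def A_one_left)
qed

end



lemma lform_sw_set:
  "(\<And>a b. (a, b) \<in> set xs \<Longrightarrow> lform s (\<lambda>x. F x a b)) \<Longrightarrow> lform s (\<lambda>x. sw xs (\<lambda>a b. F x a b))"
proof (induction xs)
  case (Cons p xs)
  then show ?case by (cases p) (auto simp: lmap_def algebra_simps)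
qed (simp add: lmap_def)

subsection \<open>The Hopf module structure of the rational part\<close>

context hopf_setup
begin

lemma hit_sw: "hit (sw xs F) h = sw xs (\<lambda>a b. hit (F a b) h)"
  by (rule ext) (simp add: hit_def sw_apply sw_swap[of _ xs])

lemma R_lform: "f \<in> R \<Longrightarrow> lform sH f" and spR: "is_space (Sub R)" and R_HD: "R \<subseteq> carrier HD"
  using sub_ydD[OF sub_R] by auto

abbreviation T where "T \<equiv> tensor_space (Sub R) H"

lemma T_HD: "w \<in> carrier T \<Longrightarrow> w \<in> carrier (tensor_space HD H)"
  using tensor_Sub_HD[OF R_HD] by blast

lemma tens_T_in: "m \<in> R \<Longrightarrow> tens HD H m h \<in> carrier T"
  using tens_in[of m "Sub R" h H] by (simp add: spH)

lemma Lam_linear_T: "lform sH \<phi> \<Longrightarrow> linear_on T ground (Lam \<phi> x)"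
  using Lam_linear[of \<phi> x] T_HD by (simp add: linear_on_def)

lemma T_eqI:
  assumes "t \<in> carrier T" "t' \<in> carrier T" "\<And>\<phi> x. lform sH \<phi> \<Longrightarrow> Lam \<phi> x t = Lam \<phi> x t'"
  shows "t = t'"
  by (rule separating_eqI[OF separating_Lam[OF spR R_HD] is_space_tensor_space assms(1,2)])
    (use assms(3) in blast)

lemma lform_Lam: "lform sH \<phi> \<Longrightarrow> w \<in> carrier T \<Longrightarrow> lform sH (\<lambda>x. Lam \<phi> x w)"
proof (rule lform_sw_set)
  fix m h assume \<phi>: "lform sH \<phi>" and "w \<in> carrier T" "(m, h) \<in> set (rep HD H w)"
  then have m: "lform sH m" using rep_set[OF spHD T_HD, of w] by (auto simp: in_HD)
  note [lin] = lform_comp[OF \<phi>] lform_comp[OF m]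
  show "lform sH (\<lambda>x. sw (CH h x) (\<lambda>u v. m u * \<phi> v))" by (intro lin)
qed

lemma TH_bilinear:
  assumes \<phi>: "lform sH \<phi>" and \<phi>': "lform sH \<phi>'"
  shows "bilinear_on T H ground (\<lambda>w h. sw (CH h x) (\<lambda>u v. Lam \<phi> u w * \<phi>' v))"
proof (intro bilinear_onI)
  fix w assume w: "w \<in> carrier T"
  note [lin] = lform_comp[OF lform_Lam[OF \<phi> w]] lform_comp[OF \<phi>']
  show "linear_on H ground (\<lambda>h. sw (CH h x) (\<lambda>u v. Lam \<phi> u w * \<phi>' v))"
    by (rule linear_on_lform) (intro lin)
next
  fix h
  have "linear_on T ground (\<lambda>w. Lam \<phi> u w * c)" for u c
    using Lam_linear_T[OF \<phi>, of u] by (simp add: linear_on_def algebra_simps)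
  then show "linear_on T ground (\<lambda>w. sw (CH h x) (\<lambda>u v. Lam \<phi> u w * \<phi>' v))"
    by (intro linear_on_sum is_space_ground)
qed

text \<open>In coassociativity the outer factor is tested by a braided pairing as well.
  \<open>CH_undo\<close> applies there because the inner pairing is a functional of its
  point.\<close>

lemma TH_eqI:
  assumes s: "s \<in> carrier (tensor_space T H)" "s' \<in> carrier (tensor_space T H)"
    and eq: "\<And>\<phi> \<phi>' x. lform sH \<phi> \<Longrightarrow> lform sH \<phi>' \<Longrightarrow>
      sw (rep T H s) (\<lambda>w h. sw (CH h x) (\<lambda>u v. Lam \<phi> u w * \<phi>' v)) =
      sw (rep T H s') (\<lambda>w h. sw (CH h x) (\<lambda>u v. Lam \<phi> u w * \<phi>' v))"
  shows "s = s'"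
proof (rule tensor_eqI[OF is_space_tensor_space spH(1) separating_Lam[OF spR R_HD] separating_lforms[OF spH(1)] s])
  fix F \<phi>' assume "F \<in> {Lam \<phi> x | \<phi> x. lform sH \<phi>}" "\<phi>' \<in> {\<phi>. lform sH \<phi>}"
  then obtain \<phi> x where \<phi>: "lform sH \<phi>" and F: "F = Lam \<phi> x" and \<phi>': "lform sH \<phi>'" by blast
  note [lin] = lform_comp[OF \<phi>']
  have *: "sw (rep T H s) (\<lambda>w h. Lam \<phi> x w * \<phi>' h) =
      sw (K x) (\<lambda>b y. sw (rep T H s) (\<lambda>w h. sw (CH h y) (\<lambda>u v. Lam \<phi> u w * \<phi>' (A b v))))"
    if s: "s \<in> carrier (tensor_space T H)" for s
  proof -
    have "sw (K x) (\<lambda>b y. sw (rep T H s) (\<lambda>w h. sw (CH h y) (\<lambda>u v. Lam \<phi> u w * \<phi>' (A b v)))) =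
        sw (rep T H s) (\<lambda>w h. sw (K x) (\<lambda>b y. sw (CH h y) (\<lambda>u v. Lam \<phi> u w * \<phi>' (A b v))))"
      by (rule sw_swap)
    also have "\<dots> = sw (rep T H s) (\<lambda>w h. Lam \<phi> x w * \<phi>' h)"
      by (rule sw_rep_cong[OF is_space_tensor_space s], rule CH_undo[OF lform_Lam[OF \<phi>] \<phi>'])
    finally show ?thesis ..
  qed
  have "sw (rep T H s) (\<lambda>w h. sw (CH h y) (\<lambda>u v. Lam \<phi> u w * \<phi>' (A b v))) =
      sw (rep T H s') (\<lambda>w h. sw (CH h y) (\<lambda>u v. Lam \<phi> u w * \<phi>' (A b v)))" for b y
    by (rule eq[OF \<phi>]) (intro lin)
  then show "sw (rep T H s) (\<lambda>v w. F v * \<phi>' w) = sw (rep T H s') (\<lambda>v w. F v * \<phi>' w)"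
    unfolding F *[OF s(1)] *[OF s(2)] by simp
qed

lemma hit_linear: "linear_on (Sub R) (Sub R) (\<lambda>f. hit f h)"
  by (rule linear_onI, simp add: hit_in_R) (auto simp: hit_def fun_eq_iff sw_add fscale_def sw_mult_left)

lemma hit_bilinear: "bilinear_on (Sub R) H (Sub R) hit"
proof (intro bilinear_onI hit_linear)
  fix f assume "f \<in> carrier (Sub R)"
  then have f: "f \<in> R" by simp
  show "linear_on H (Sub R) (hit f)"
    by (rule linear_onI)
      (auto simp: hit_in_R f fun_eq_iff lmapD[OF hit_lform[OF R_lform[OF f]]] fscale_def)
qed

lemma act_bilinear_R: "bilinear_on (Sub R) H (Sub R) (dual_rat_act B H)"
proof (intro bilinear_onI)
  fix h
  show "linear_on (Sub R) (Sub R) (\<lambda>f. dual_rat_act B H f h)"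
    by (rule linear_on_fun_cong[OF hit_linear spR]) (simp add: dual_rat_act_eq)
next
  fix f assume f: "f \<in> carrier (Sub R)"
  show "linear_on H (Sub R) (dual_rat_act B H f)"
    by (rule linear_on_fun_cong[OF bilinear_onD1[OF hit_bilinear f] spH(1)]) (use f in \<open>simp add: dual_rat_act_eq\<close>)
qed

lemma act_yd_hom: "yd_hom B (yd_tensor B (Sub R) H) (Sub R) (tensor_lift (Sub R) H (dual_rat_act B H))"
proof (rule yd_hom_tensorI[OF dat_Sub[OF sub_R] dat_H dat_Sub[OF sub_R] act_bilinear_R])
  fix b m h assume "m \<in> carrier (Sub R)"
  then have m: "m \<in> R" by simp
  show "act (Sub R) b (dual_rat_act B H m h) = sw (DB b) (\<lambda>b1 b2. dual_rat_act B H (act (Sub R) b1 m) (A b2 h))"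
    by (simp add: dual_rat_act_eq m sub_ydD(3)[OF sub_R] hit_act R_lform)
  have "dual_coact B H (hit m h) = sw (rep B (Sub R) (dual_coact B H m)) (\<lambda>b f0. sw (K h) (\<lambda>c h0.
      tens B HD (b * c) (dual_rat_act B H f0 h0)))"
    unfolding hit_coact_tensor[OF sub_R m]
    by (rule sw_cong) (use KD_Sub_in[OF sub_R m] in \<open>simp add: dual_rat_act_eq\<close>)
  then show "coact (Sub R) (dual_rat_act B H m h) = sw (rep B (Sub R) (coact (Sub R) m)) (\<lambda>b m0.
      sw (K h) (\<lambda>c n0. tens B (Sub R) (b * c) (dual_rat_act B H m0 n0)))"
    by (simp add: dual_rat_act_eq m)
qed

end

section \<open>The rational part with a given coaction\<close>

locale rational_setup = hopf_setup B H
  for B :: "('k::field, 'b::ring_1) hopf" and H :: "('k, 'b, 'h::ring_1) braided_hopf" +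
  fixes \<rho> :: "('h \<Rightarrow> 'k) \<Rightarrow> ('h \<Rightarrow> 'k, 'h, 'k) tensor"
  assumes \<rho>: "rational_coaction B H (sub_object (dual B H) (dual_rat_carrier B H)) (dual_mult B H) \<rho>"
begin

abbreviation PR where "PR f \<equiv> rep (Sub R) H (\<rho> f)"

lemma \<rho>_in: "f \<in> R \<Longrightarrow> \<rho> f \<in> carrier T"
  and \<rho>_Lam: "f \<in> R \<Longrightarrow> lform sH \<phi> \<Longrightarrow> Lam \<phi> x (\<rho> f) = W x (\<lambda>u v. f u * \<phi> v)"
  and \<rho>_hom: "yd_hom B (Sub R) (yd_tensor B (Sub R) H) \<rho>"
  using rational_coactionD[OF sub_R \<rho>] by auto

lemma PR_Lam: "f \<in> R \<Longrightarrow> lform sH \<phi> \<Longrightarrow> sw (PR f) (\<lambda>m h. sw (CH h x) (\<lambda>u v. m u * \<phi> v)) = W x (\<lambda>u v. f u * \<phi> v)"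
  using \<rho>_Lam[of f \<phi> x] Lam_Sub[OF spR R_HD _ \<rho>_in] by simp

lemma PR_in: "f \<in> R \<Longrightarrow> (m, h) \<in> set (PR f) \<Longrightarrow> m \<in> R"
  using rep_set[OF spR \<rho>_in] by fastforce

lemma \<rho>_linear: "linear_on (Sub R) T \<rho>"
  using \<rho>_hom by (simp add: yd_hom_def)

lemma \<rho>_hit:
  assumes f: "f \<in> R" shows "\<rho> (hit f h) = hit_coaction (\<rho> f) h"
proof (rule T_eqI)
  fix \<phi> x assume \<phi>: "lform sH \<phi>"
  show "Lam \<phi> x (\<rho> (hit f h)) = Lam \<phi> x (hit_coaction (\<rho> f) h)"
    unfolding \<rho>_Lam[OF hit_in_R[OF f] \<phi>]
    by (rule Lam_hit_coaction[OF R_lform[OF f] \<rho>_in[OF f] _ \<phi>, symmetric]) (rule \<rho>_Lam[OF f])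
qed (simp_all add: \<rho>_in hit_in_R f hit_coaction_in)

text \<open>Pair the coaction with the counit: C is natural for it, so the braiding disappears on
  both sides and the counit axioms remain.\<close>

lemma PR_counit: "f \<in> R \<Longrightarrow> sw (PR f) (\<lambda>m h. eH h * m x) = f x"
proof -
  assume f: "f \<in> R"
  have "sw (PR f) (\<lambda>m h. eH h * m x) = sw (PR f) (\<lambda>m h. sw (CH h x) (\<lambda>u v. m u * eH v))"
  proof (rule sw_cong)
    fix m h assume "(m, h) \<in> set (PR f)"
    then have "lform sH m" using PR_in[OF f] R_lform by blast
    then show "eH h * m x = sw (CH h x) (\<lambda>u v. m u * eH v)"
      using Hf.C_e_right[of m x h] by (simp add: mult.commute)
  qed
  also have "\<dots> = W x (\<lambda>u v. eH v * f u)"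
    using PR_Lam[OF f lmaps(6)] by (simp add: mult.commute)
  also have "\<dots> = f x"
    by (simp add: Hf.C_e_right R_lform f Hf.counit_left)
  finally show ?thesis .
qed

text \<open>Tested on two functionals, the left side iterates C \<Delta> and adds a braiding, while
  the right side applies \<Delta> to the second leg of C \<Delta>. They agree by
  \<open>braided_copy\<close>.\<close>

lemma \<rho>_coassoc:
  assumes f: "f \<in> R"
  shows "sw (PR f) (\<lambda>m0 m1. tens T H (\<rho> m0) m1) =
    sw (PR f) (\<lambda>m0 m1. sw (DH m1) (\<lambda>x1 x2. tens T H (tens HD H m0 x1) x2))"
proof (rule TH_eqI)
  have in1: "tens T H w h \<in> carrier (tensor_space T H)" if "w \<in> carrier T" for w h
    by (rule tens_in) (use that in \<open>simp_all add: spH\<close>)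
  have PT: "(m0, m1) \<in> set (PR f) \<Longrightarrow> \<rho> m0 \<in> carrier T" for m0 m1 using \<rho>_in PR_in[OF f] by blast
  show "sw (PR f) (\<lambda>m0 m1. tens T H (\<rho> m0) m1) \<in> carrier (tensor_space T H)"
    by (intro sw_in[OF is_space_tensor_space] in1 PT)
  show "sw (PR f) (\<lambda>m0 m1. sw (DH m1) (\<lambda>x1 x2. tens T H (tens HD H m0 x1) x2)) \<in> carrier (tensor_space T H)"
    by (intro sw_in[OF is_space_tensor_space] in1 tens_T_in PR_in[OF f])
  fix \<phi> \<phi>' x assume \<phi>: "lform sH \<phi>" and \<phi>': "lform sH \<phi>'"
  note [lin] = lform_comp[OF \<phi>] lform_comp[OF \<phi>'] lform_comp[OF R_lform[OF f]]
  note bil = TH_bilinear[OF \<phi> \<phi>', of x]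
  let ?E = "\<lambda>s. sw (rep T H s) (\<lambda>w h. sw (CH h x) (\<lambda>u v. Lam \<phi> u w * \<phi>' v))"
  note push = linear_on_sw[OF linear_on_sw_rep[OF is_space_tensor_space spH(1) is_space_ground bil] is_space_tensor_space]
  have E: "?E (tens T H w h) = sw (CH h x) (\<lambda>u v. Lam \<phi> u w * \<phi>' v)" if "w \<in> carrier T" for w h
    using sw_rep_tens1[OF is_space_tensor_space spH(1) is_space_ground bil that] by (simp add: spH)
  have "?E (sw (PR f) (\<lambda>m0 m1. tens T H (\<rho> m0) m1)) = sw (PR f) (\<lambda>m0 m1. ?E (tens T H (\<rho> m0) m1))"
    by (rule push) (intro in1 PT)
  also have "\<dots> = sw (PR f) (\<lambda>m0 m1. sw (CH m1 x) (\<lambda>u v. W u (\<lambda>a b. m0 a * \<phi> b) * \<phi>' v))"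
    by (rule sw_cong) (use PR_in[OF f] in \<open>simp add: E PT \<rho>_Lam \<phi>\<close>)
  also have "\<dots> = sw (PR f) (\<lambda>m0 m1. sw (DH x) (\<lambda>x1 x2. sw (CH x1 x2) (\<lambda>z1 y1. sw (CH m1 z1) (\<lambda>z2 w.
      m0 z2 * sw (CH w y1) (\<lambda>y2 v. \<phi> y2 * \<phi>' v)))))"
  proof (rule sw_cong)
    fix m0 m1 assume "(m0, m1) \<in> set (PR f)"
    then have m0: "lform sH m0" using PR_in[OF f] R_lform by blast
    note [lin] = lform_comp[OF m0]
    have "sw (CH m1 x) (\<lambda>u v. W u (\<lambda>a b. m0 a * \<phi> b) * \<phi>' v) =
        sw (CH m1 x) (\<lambda>u v. sw (DH u) (\<lambda>u1 u2. sw (CH u1 u2) (\<lambda>a b. m0 a * \<phi> b * \<phi>' v)))"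
      by (simp add: sw_mult_right)
    also have "\<dots> = sw (DH x) (\<lambda>x1 x2. sw (CH m1 x1) (\<lambda>u1 w. sw (CH w x2) (\<lambda>u2 v. sw (CH u1 u2) (\<lambda>a b. m0 a * \<phi> b * \<phi>' v))))"
      by (rule Hf.C_D_left) (intro lin)
    also have "\<dots> = sw (DH x) (\<lambda>x1 x2. sw (CH x1 x2) (\<lambda>z1 y1. sw (CH m1 z1) (\<lambda>z2 w. sw (CH w y1) (\<lambda>y2 v. m0 z2 * \<phi> y2 * \<phi>' v))))"
      by (rule sw_cong, rule Hf.C_braid) (intro lin)
    finally show "sw (CH m1 x) (\<lambda>u v. W u (\<lambda>a b. m0 a * \<phi> b) * \<phi>' v) =
        sw (DH x) (\<lambda>x1 x2. sw (CH x1 x2) (\<lambda>z1 y1. sw (CH m1 z1) (\<lambda>z2 w. m0 z2 * sw (CH w y1) (\<lambda>y2 v. \<phi> y2 * \<phi>' v))))"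
      by (simp add: sw_mult_left mult.assoc)
  qed
  also have "\<dots> = sw (DH x) (\<lambda>x1 x2. sw (CH x1 x2) (\<lambda>z1 y1. sw (PR f) (\<lambda>m0 m1. sw (CH m1 z1) (\<lambda>z2 w.
      m0 z2 * sw (CH w y1) (\<lambda>y2 v. \<phi> y2 * \<phi>' v)))))"
    by (rule sw_swap3[symmetric])
  \<comment> \<open>The pairing of the coaction of \<open>f\<close> is used at the point
    \<open>z1\<close>, with the whole inner braided sum serving as the test functional.\<close>
  also have "\<dots> = W x (\<lambda>z1 y1. W z1 (\<lambda>a c. f a * sw (CH c y1) (\<lambda>y2 v. \<phi> y2 * \<phi>' v)))"
    by (rule sw_cong, rule sw_cong, rule PR_Lam[OF f]) (intro lin)
  also have "\<dots> = W x (\<lambda>p q. W p (\<lambda>a c. sw (CH c q) (\<lambda>b v. f a * (\<phi> b * \<phi>' v))))"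
    by (simp add: sw_mult_left)
  also have "\<dots> = W x (\<lambda>a c. sw (DH c) (\<lambda>c1 c2. f a * (\<phi> c1 * \<phi>' c2)))"
    by (rule Hf.braided_copy[symmetric]) (intro lin)
  also have "\<dots> = W x (\<lambda>a c. f a * sw (DH c) (\<lambda>c1 c2. \<phi> c1 * \<phi>' c2))"
    by (simp add: sw_mult_left)
  also have "\<dots> = sw (PR f) (\<lambda>m0 m1. sw (CH m1 x) (\<lambda>a w. m0 a * sw (DH w) (\<lambda>b v. \<phi> b * \<phi>' v)))"
    by (rule PR_Lam[OF f, symmetric]) (intro lin)
  also have "\<dots> = sw (PR f) (\<lambda>m0 m1. sw (DH m1) (\<lambda>x1 x2. ?E (tens T H (tens HD H m0 x1) x2)))"
  proof (rule sw_cong)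
    fix m0 m1 assume "(m0, m1) \<in> set (PR f)"
    then have m0R: "m0 \<in> R" using PR_in[OF f] by blast
    note m0 = R_lform[OF m0R]
    note [lin] = lform_comp[OF m0]
    have "sw (CH m1 x) (\<lambda>a w. sw (DH w) (\<lambda>b v. m0 a * (\<phi> b * \<phi>' v))) =
        sw (DH m1) (\<lambda>h1 h2. sw (CH h2 x) (\<lambda>u v. sw (CH h1 u) (\<lambda>a b. m0 a * (\<phi> b * \<phi>' v))))"
      by (rule Hf.C_D_right) (intro lin)
    moreover have "sw (DH m1) (\<lambda>x1 x2. ?E (tens T H (tens HD H m0 x1) x2)) =
        sw (DH m1) (\<lambda>h1 h2. sw (CH h2 x) (\<lambda>u v. sw (CH h1 u) (\<lambda>a b. m0 a * \<phi> b) * \<phi>' v))"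
      by (simp add: E tens_T_in m0R Lam_tens \<phi> m0)
    ultimately show "sw (CH m1 x) (\<lambda>a w. m0 a * sw (DH w) (\<lambda>b v. \<phi> b * \<phi>' v)) =
        sw (DH m1) (\<lambda>x1 x2. ?E (tens T H (tens HD H m0 x1) x2))"
      by (simp add: sw_mult_left sw_mult_right[symmetric] mult.assoc)
  qed
  also have "\<dots> = sw (PR f) (\<lambda>m0 m1. ?E (sw (DH m1) (\<lambda>x1 x2. tens T H (tens HD H m0 x1) x2)))"
    by (rule sw_cong, rule push[symmetric]) (intro in1 tens_T_in PR_in[OF f])
  also have "\<dots> = ?E (sw (PR f) (\<lambda>m0 m1. sw (DH m1) (\<lambda>x1 x2. tens T H (tens HD H m0 x1) x2)))"
    by (rule push[symmetric]) (intro sw_in[OF is_space_tensor_space] in1 tens_T_in PR_in[OF f])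
  finally show "?E (sw (PR f) (\<lambda>m0 m1. tens T H (\<rho> m0) m1)) =
      ?E (sw (PR f) (\<lambda>m0 m1. sw (DH m1) (\<lambda>x1 x2. tens T H (tens HD H m0 x1) x2)))" .
qed

lemma sw_braid_CH:
  assumes "is_space U" "bilinear_on H H U \<beta>"
  shows "sw (rep H H (braid B H H (tens H H x y))) \<beta> = sw (CH x y) \<beta>"
  unfolding braid_tens_H by (rule sw_rep[OF spH(1) spH(1) assms]) (simp add: spH)

theorem hopf_module_dual_rat: "hopf_module B H (Sub R) (dual_rat_act B H) \<rho>"
  unfolding hopf_module_def tensor_lift_sw tens_Sub
proof (intro conjI ballI allI)
  show "yd_module B (Sub R)" by (rule sub_yd_module[OF sub_R])
  show "bilinear_on (Sub R) H (Sub R) (dual_rat_act B H)" by (fact act_bilinear_R)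
  show "yd_hom B (yd_tensor B (Sub R) H) (Sub R) (\<lambda>t. sw (rep (Sub R) H t) (dual_rat_act B H))"
    using act_yd_hom unfolding tensor_lift_sw .
  show "yd_hom B (Sub R) (yd_tensor B (Sub R) H) \<rho>" by (fact \<rho>_hom)
  fix m x y h assume "m \<in> carrier (Sub R)"
  then have m: "m \<in> R" by simp
  note m' = R_lform[OF m]
  show "dual_rat_act B H m 1 = m" by (simp add: dual_rat_act_eq m hit_one m')
  show "dual_rat_act B H m (x * y) = dual_rat_act B H (dual_rat_act B H m x) y"
    by (simp add: dual_rat_act_eq m hit_in_R hit_mult m')
  show "sw (PR m) (\<lambda>m0 m1. tens T H (\<rho> m0) m1) =
      sw (PR m) (\<lambda>m0 m1. sw (DH m1) (\<lambda>x1 x2. tens T H (tens HD H m0 x1) x2))"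
    by (rule \<rho>_coassoc[OF m])
  show "sw (PR m) (\<lambda>m0 m1. scale (Sub R) (eH m1) m0) = m"
    by (rule ext) (simp add: sw_apply fscale_def PR_counit[OF m])
  have "sw (rep H H (braid B H H (tens H H m1 h1))) (\<lambda>u v. tens HD H (dual_rat_act B H m0 u) (v * h2)) =
      sw (CH m1 h1) (\<lambda>u v. tens HD H (hit m0 u) (v * h2))" if m0: "m0 \<in> R" for m0 m1 h1 h2
  proof -
    have "bilinear_on H H T (\<lambda>u v. tens (Sub R) H (dual_rat_act B H m0 u) (v * h2))"
      by (intro lon bilinear_on_comp2[OF act_bilinear_R] bilinear_on_comp1[OF bil_H])
        (use bilinear_on_in[OF act_bilinear_R] m0 in \<open>simp_all add: spH\<close>)
    from sw_braid_CH[OF is_space_tensor_space this, of m1 h1] show ?thesis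
      by (simp add: dual_rat_act_eq m0)
  qed
  then show "\<rho> (dual_rat_act B H m h) = sw (PR m) (\<lambda>m0 m1. sw (DH h) (\<lambda>h1 h2.
      sw (rep H H (braid B H H (tens H H m1 h1))) (\<lambda>u v. tens HD H (dual_rat_act B H m0 u) (v * h2))))"
    unfolding dual_rat_act_eq[OF m] \<rho>_hit[OF m] hit_coaction_def
    by (intro sw_cong) (use PR_in[OF m] in simp)
qed

end



subsection \<open>Transport of Hopf modules along bijections\<close>

lemma sw_rep_map:
  assumes sp: "is_space V" "is_space V'" "is_space W'" "is_space U" and \<beta>: "bilinear_on V' W' U \<beta>"
    and t: "t \<in> carrier (tensor_space V W)"
    and fg: "\<And>v. v \<in> carrier V \<Longrightarrow> f v \<in> carrier V'" "\<And>w. w \<in> carrier W \<Longrightarrow> g w \<in> carrier W'"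
  shows "sw (rep V' W' (sw (rep V W t) (\<lambda>v w. tens V' W' (f v) (g w)))) \<beta> = sw (rep V W t) (\<lambda>v w. \<beta> (f v) (g w))"
proof -
  have "sw (rep V' W' (sw (rep V W t) (\<lambda>v w. tens V' W' (f v) (g w)))) \<beta> =
      sw (rep V W t) (\<lambda>v w. sw (rep V' W' (tens V' W' (f v) (g w))) \<beta>)"
    by (rule linear_on_sw_rep_out[OF linear_on_sw_rep[OF sp(2,3,4) \<beta>] sp(1) is_space_tensor_space t])
      (intro tens_in fg)
  also have "\<dots> = sw (rep V W t) (\<lambda>v w. \<beta> (f v) (g w))"
    by (rule sw_rep_cong[OF sp(1) t], rule sw_rep_tens1[OF sp(2,3,4) \<beta>]) (auto intro: fg)
  finally show ?thesis .
qed

text \<open>The axioms are equations between maps built linearly from the structure, so they pass to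
  the image of a morphism. By surjectivity each element of \<open>M'\<close> is such an image; only
  linearity of its structure maps is presupposed.\<close>

locale yd_transport =
  fixes B :: "('k::field, 'b::ring_1, 'x) hopf_scheme"
    and M :: "('k, 'b, 'a::ab_group_add, 'y) ydm_scheme"
    and M' :: "('k, 'b, 'c::ab_group_add, 'z) ydm_scheme"
    and \<Psi> :: "'a \<Rightarrow> 'c"
  assumes hopf: "hopf_algebra B"
    and yd: "yd_module B M" and dat': "yd_data B M'"
    and hom: "yd_hom B M M' \<Psi>" and surj: "\<Psi> ` carrier M = carrier M'"
begin

lemma dat: "yd_data B M" by (rule yd_dataI[OF hopf yd])

lemmas sp = yd_dataD(1,5)[OF dat] yd_dataD(5)[OF dat'] is_space_tensor_space
lemmas BU [simp] = yd_dataD(2)[OF dat]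

lemma \<Psi>_linear: "linear_on M M' \<Psi>" and \<Psi>_act: "m \<in> carrier M \<Longrightarrow> act M' b (\<Psi> m) = \<Psi> (act M b m)"
  and \<Psi>_coact: "m \<in> carrier M \<Longrightarrow> coact M' (\<Psi> m) = sw (rep B M (coact M m)) (\<lambda>b m0. tens B M' b (\<Psi> m0))"
  using hom by (simp_all add: yd_hom_def tensor_lift_sw)

lemmas \<Psi>_in = linear_onD(1)[OF \<Psi>_linear]

lemmas lons = lon linear_on_comp[OF \<Psi>_linear]
  bilinear_on_comp1[OF yd_dataD(3)[OF dat]] bilinear_on_comp2[OF yd_dataD(3)[OF dat]]
  bilinear_on_comp1[OF yd_dataD(6)[OF dat]] bilinear_on_comp2[OF yd_dataD(6)[OF dat]]
  bilinear_on_comp1[OF yd_dataD(6)[OF dat']] bilinear_on_comp2[OF yd_dataD(6)[OF dat']]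
  linear_on_comp[OF yd_dataD(7)[OF dat]] linear_on_comp[OF yd_dataD(7)[OF dat']]
  linear_on_comp[OF yd_dataD(4)[OF dat]]
lemmas ins = tens_in comult_in[OF dat] coact_in[OF dat] coact_in[OF dat'] act_in[OF dat] act_in[OF dat'] \<Psi>_in

lemma coact_map:
  assumes "is_space U" "bilinear_on B M' U \<beta>" "m \<in> carrier M"
  shows "sw (rep B M' (coact M' (\<Psi> m))) \<beta> = sw (rep B M (coact M m)) (\<lambda>b m0. \<beta> b (\<Psi> m0))"
  unfolding \<Psi>_coact[OF assms(3)]
  by (rule sw_rep_map[OF sp(1,1,3) assms(1,2) coact_in[OF dat assms(3)]]) (auto intro: \<Psi>_in)

lemma yd_module': "yd_module B M'"
proof -
  have surj': "\<exists>m\<in>carrier M. m' = \<Psi> m" if "m' \<in> carrier M'" for m' using that surj by blast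
  note Y = yd[unfolded yd_module_def tensor_lift_sw]
  \<comment> \<open>\<open>?G\<close> is id \<otimes> \<Psi>, and \<open>?F\<close> below is id
    \<otimes> (id \<otimes> \<Psi>). Applied to both sides of an axiom for \<open>M\<close> they
    give the corresponding axiom for \<open>M'\<close>.\<close>
  let ?G = "\<lambda>s. sw (rep B M s) (\<lambda>b m. tens B M' b (\<Psi> m))"
  have bG: "bilinear_on B M (tensor_space B M') (\<lambda>b m. tens B M' b (\<Psi> m))"
    by (intro lons ins) simp_all
  have lG: "linear_on (tensor_space B M) (tensor_space B M') ?G"
    by (rule linear_on_sw_rep[OF sp(1,2,4) bG])
  have G: "?G (tens B M b m) = tens B M' b (\<Psi> m)" if "m \<in> carrier M" for b m
    by (rule sw_rep_tens1[OF sp(1,2,4) bG]) (use that in simp_all)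
  let ?F = "\<lambda>s. sw (rep B (tensor_space B M) s) (\<lambda>b t. tens B (tensor_space B M') b (?G t))"
  have bF: "bilinear_on B (tensor_space B M) (tensor_space B (tensor_space B M')) (\<lambda>b t. tens B (tensor_space B M') b (?G t))"
    by (intro lons linear_on_comp[OF lG] linear_onD(1)[OF lG]) simp_all
  have lF: "linear_on (tensor_space B (tensor_space B M)) (tensor_space B (tensor_space B M')) ?F"
    by (rule linear_on_sw_rep[OF sp(1,4,4) bF])
  have F: "?F (tens B (tensor_space B M) b t) = tens B (tensor_space B M') b (?G t)" if "t \<in> carrier (tensor_space B M)" for b t
    by (rule sw_rep_tens1[OF sp(1,4,4) bF]) (use that in simp_all)
  show ?thesis
    unfolding yd_module_def tensor_lift_sw
  proof (intro conjI allI ballI)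
    show "is_space M'" "bilinear_on B M' M' (act M')" "linear_on M' (tensor_space B M') (coact M')"
      by (fact sp(3), fact yd_dataD(6)[OF dat'], fact yd_dataD(7)[OF dat'])
    fix b c m' assume "m' \<in> carrier M'"
    then obtain m where m: "m \<in> carrier M" and m': "m' = \<Psi> m" using surj' by blast
    note cm = coact_in[OF dat m]
    show "act M' 1 m' = m'" "act M' (b * c) m' = act M' b (act M' c m')"
      using Y m by (simp_all add: m' \<Psi>_act act_in[OF dat])
    have b1: "bilinear_on B M' (tensor_space B (tensor_space B M'))
        (\<lambda>b m0. sw (rep B B (comult B b)) (\<lambda>b1 b2. tens B (tensor_space B M') b1 (tens B M' b2 m0)))"
      by (intro lons linear_on_sw_rep_body[OF sp(1)] linear_on_sw_rep_comp sp ins) (simp_all add: ins)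
    have b2: "bilinear_on B M' (tensor_space B (tensor_space B M')) (\<lambda>b m0. tens B (tensor_space B M') b (coact M' m0))"
      by (intro lons ins) simp_all
    have "sw (rep B M (coact M m)) (\<lambda>b m0. sw (rep B B (comult B b)) (\<lambda>b1 b2. tens B (tensor_space B M') b1 (tens B M' b2 (\<Psi> m0)))) =
        ?F (sw (rep B M (coact M m)) (\<lambda>b m0. sw (rep B B (comult B b)) (\<lambda>b1 b2. tens B (tensor_space B M) b1 (tens B M b2 m0))))"
    proof -
      have "?F (sw (rep B M (coact M m)) (\<lambda>b m0. sw (rep B B (comult B b)) (\<lambda>b1 b2. tens B (tensor_space B M) b1 (tens B M b2 m0)))) =
        sw (rep B M (coact M m)) (\<lambda>b m0. ?F (sw (rep B B (comult B b)) (\<lambda>b1 b2. tens B (tensor_space B M) b1 (tens B M b2 m0))))"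
        by (rule linear_on_sw_rep_out[OF lF sp(1,4) cm]) (intro sw_rep_in[OF sp(1,4)] ins; simp)
      also have "\<dots> = sw (rep B M (coact M m)) (\<lambda>b m0. sw (rep B B (comult B b)) (\<lambda>b1 b2. ?F (tens B (tensor_space B M) b1 (tens B M b2 m0))))"
        by (rule sw_rep_cong[OF sp(1) cm], rule linear_on_sw_rep_out[OF lF sp(1,4)]) (intro ins; simp)+
      also have "\<dots> = sw (rep B M (coact M m)) (\<lambda>b m0. sw (rep B B (comult B b)) (\<lambda>b1 b2. tens B (tensor_space B M') b1 (tens B M' b2 (\<Psi> m0))))"
        by (intro sw_rep_cong[OF sp(1)] cm ins) (simp_all add: F G ins)
      finally show ?thesis ..
    qed
    also have "\<dots> = ?F (sw (rep B M (coact M m)) (\<lambda>b m0. tens B (tensor_space B M) b (coact M m0)))"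
      using Y m by simp
    also have "\<dots> = sw (rep B M (coact M m)) (\<lambda>b m0. ?F (tens B (tensor_space B M) b (coact M m0)))"
      by (rule linear_on_sw_rep_out[OF lF sp(1,4) cm]) (intro ins; simp)
    also have "\<dots> = sw (rep B M (coact M m)) (\<lambda>b m0. tens B (tensor_space B M') b (coact M' (\<Psi> m0)))"
      by (intro sw_rep_cong[OF sp(1)] cm) (simp add: F coact_in[OF dat] \<Psi>_coact)
    finally show "sw (rep B M' (coact M' m')) (\<lambda>b m0. sw (rep B B (comult B b)) (\<lambda>b1 b2. tens B (tensor_space B M') b1 (tens B M' b2 m0))) =
        sw (rep B M' (coact M' m')) (\<lambda>b m0. tens B (tensor_space B M') b (coact M' m0))"
      unfolding m' coact_map[OF sp(4) b1 m] coact_map[OF sp(4) b2 m] .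
    have b3: "bilinear_on B M' M' (\<lambda>b m0. scale M' (counit B b) m0)"
    proof -
      have "scale M' c (scale M' d x) = scale M' d (scale M' c x)" for c d x
        by (simp add: is_spaceD(8)[OF sp(3), symmetric] mult.commute)
      moreover have "linear_on B ground (counit B)" using hopf by (simp add: hopf_algebra_def)
      ultimately show ?thesis
        by (intro bilinear_onI linear_onI) (auto simp: linear_on_def is_spaceD(4,6,8,9)[OF sp(3)])
    qed
    have "sw (rep B M (coact M m)) (\<lambda>b m0. scale M' (counit B b) (\<Psi> m0)) =
        sw (rep B M (coact M m)) (\<lambda>b m0. \<Psi> (scale M (counit B b) m0))"
      by (rule sw_rep_cong[OF sp(1) cm]) (simp add: linear_onD(3)[OF \<Psi>_linear])
    also have "\<dots> = \<Psi> (sw (rep B M (coact M m)) (\<lambda>b m0. scale M (counit B b) m0))"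
      by (rule linear_on_sw_rep_out[OF \<Psi>_linear sp(1,2) cm, symmetric]) (rule is_spaceD(4)[OF sp(2)])
    finally show "sw (rep B M' (coact M' m')) (\<lambda>b m0. scale M' (counit B b) m0) = m'"
      using Y m unfolding m' coact_map[OF sp(3) b3 m] by simp
    have b4: "bilinear_on B M' (tensor_space B M') (\<lambda>c m0. tens B M' (b1 * c * antipode B b3) (act M' b2 m0))" for b1 b2 b3
      by (intro lons ins) (simp_all add: ins)
    have "coact M' (act M' b m') = ?G (coact M (act M b m))"
      by (simp add: m' \<Psi>_act m \<Psi>_coact act_in[OF dat])
    also have "coact M (act M b m) = sw (rep B B (comult B b)) (\<lambda>b1 b'. sw (rep B B (comult B b')) (\<lambda>b2 b3.
        sw (rep B M (coact M m)) (\<lambda>c m0. tens B M (b1 * c * antipode B b3) (act M b2 m0))))"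
      using Y m by blast
    also have "?G \<dots> = sw (rep B B (comult B b)) (\<lambda>b1 b'. ?G (sw (rep B B (comult B b')) (\<lambda>b2 b3.
        sw (rep B M (coact M m)) (\<lambda>c m0. tens B M (b1 * c * antipode B b3) (act M b2 m0)))))"
      by (rule linear_on_sw[OF lG sp(4)]) (intro sw_in[OF sp(4)] sw_rep_in[OF sp(1,4) cm] ins; simp)
    also have "\<dots> = sw (rep B B (comult B b)) (\<lambda>b1 b'. sw (rep B B (comult B b')) (\<lambda>b2 b3. ?G (
        sw (rep B M (coact M m)) (\<lambda>c m0. tens B M (b1 * c * antipode B b3) (act M b2 m0)))))"
      by (rule sw_cong, rule linear_on_sw[OF lG sp(4)]) (intro sw_rep_in[OF sp(1,4) cm] ins; simp)
    also have "\<dots> = sw (rep B B (comult B b)) (\<lambda>b1 b'. sw (rep B B (comult B b')) (\<lambda>b2 b3.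
        sw (rep B M (coact M m)) (\<lambda>c m0. tens B M' (b1 * c * antipode B b3) (act M' b2 (\<Psi> m0)))))"
    proof (rule sw_cong, rule sw_cong)
      fix b1 b' b2 b3
      have "?G (sw (rep B M (coact M m)) (\<lambda>c m0. tens B M (b1 * c * antipode B b3) (act M b2 m0))) =
          sw (rep B M (coact M m)) (\<lambda>c m0. ?G (tens B M (b1 * c * antipode B b3) (act M b2 m0)))"
        by (rule linear_on_sw_rep_out[OF lG sp(1,4) cm]) (intro ins; simp)
      also have "\<dots> = sw (rep B M (coact M m)) (\<lambda>c m0. tens B M' (b1 * c * antipode B b3) (act M' b2 (\<Psi> m0)))"
        by (rule sw_rep_cong[OF sp(1) cm]) (simp add: G act_in[OF dat] \<Psi>_act)
      finally show "?G (sw (rep B M (coact M m)) (\<lambda>c m0. tens B M (b1 * c * antipode B b3) (act M b2 m0))) =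
          sw (rep B M (coact M m)) (\<lambda>c m0. tens B M' (b1 * c * antipode B b3) (act M' b2 (\<Psi> m0)))" .
    qed
    finally show "coact M' (act M' b m') = sw (rep B B (comult B b)) (\<lambda>b1 b'. sw (rep B B (comult B b')) (\<lambda>b2 b3.
        sw (rep B M' (coact M' m')) (\<lambda>c m0. tens B M' (b1 * c * antipode B b3) (act M' b2 m0))))"
      unfolding m' coact_map[OF sp(4) b4 m] .
  qed
qed

end

section \<open>Transport of the Hopf module axioms\<close>

locale hopf_transport = yd_transport B M M' \<Psi>
  for B :: "('k::field, 'b::ring_1, 'x) hopf_scheme"
    and M :: "('k, 'b, 'a::ab_group_add, 'y) ydm_scheme"
    and M' :: "('k, 'b, 'c::ab_group_add, 'z) ydm_scheme"
    and \<Psi> :: "'a \<Rightarrow> 'c" +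
  fixes H :: "('k, 'b, 'h::ring_1, 'w) braided_hopf_scheme"
    and \<alpha> :: "'a \<Rightarrow> 'h \<Rightarrow> 'a" and \<rho> :: "'a \<Rightarrow> ('a, 'h, 'k) tensor"
    and \<alpha>' :: "'c \<Rightarrow> 'h \<Rightarrow> 'c" and \<rho>' :: "'c \<Rightarrow> ('c, 'h, 'k) tensor"
  assumes H: "braided_hopf_algebra B H" and hm: "hopf_module B H M \<alpha> \<rho>"
    and \<alpha>': "bilinear_on M' H M' \<alpha>'" and \<rho>': "linear_on M' (tensor_space M' H) \<rho>'"
    and \<Psi>_\<alpha>: "m \<in> carrier M \<Longrightarrow> \<alpha>' (\<Psi> m) h = \<Psi> (\<alpha> m h)"
    and \<Psi>_\<rho>: "m \<in> carrier M \<Longrightarrow> \<rho>' (\<Psi> m) = sw (rep M H (\<rho> m)) (\<lambda>m0 m1. tens M' H (\<Psi> m0) m1)"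
begin

abbreviation T where "T \<equiv> tensor_space M H"
abbreviation T' where "T' \<equiv> tensor_space M' H"
abbreviation J where "J t \<equiv> sw (rep M H t) (\<lambda>m0 m1. tens M' H (\<Psi> m0) m1)"

lemma datH: "yd_data B H"
  by (rule yd_dataI[OF hopf]) (use H in \<open>simp add: braided_hopf_algebra_def\<close>)

lemma HU [simp]: "carrier H = UNIV"
  using H by (simp add: braided_hopf_algebra_def)

lemmas spH = yd_dataD(5)[OF datH]

lemma bil_H: "bilinear_on H H H (*)" and lin_\<Delta>: "linear_on H (tensor_space H H) (bcomult H)"
  using H by (simp_all add: braided_hopf_algebra_def yd_hom_def)

lemma \<alpha>: "bilinear_on M H M \<alpha>" and \<rho>_hom: "yd_hom B M (yd_tensor B M H) \<rho>"
  and \<alpha>_hom: "yd_hom B (yd_tensor B M H) M (tensor_lift M H \<alpha>)"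
  using hm unfolding hopf_module_def by blast+

lemma \<rho>_linear: "linear_on M T \<rho>"
  using \<rho>_hom by (simp add: yd_hom_def)

lemmas \<rho>_in = linear_onD(1)[OF \<rho>_linear]
lemmas \<alpha>_in = bilinear_on_in[OF \<alpha>]
lemmas \<alpha>'_in = bilinear_on_in[OF \<alpha>']

lemmas lonsH = lons bilinear_on_comp1[OF bil_H] bilinear_on_comp2[OF bil_H]
  bilinear_on_comp1[OF \<alpha>] bilinear_on_comp2[OF \<alpha>] bilinear_on_comp1[OF \<alpha>'] bilinear_on_comp2[OF \<alpha>']
  linear_on_comp[OF lin_\<Delta>] linear_on_comp[OF \<rho>'] linear_on_comp[OF \<rho>_linear]
  linear_on_comp[OF braid_linear[OF datH datH]]
  bilinear_on_comp1[OF yd_dataD(6)[OF datH]] bilinear_on_comp2[OF yd_dataD(6)[OF datH]]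
  linear_on_comp[OF yd_dataD(7)[OF datH]]
lemma bJ: "bilinear_on M H T' (\<lambda>m0 m1. tens M' H (\<Psi> m0) m1)"
  by (intro lons ins) simp_all

lemma lJ: "linear_on T T' (\<lambda>t. J t)"
  by (rule linear_on_sw_rep[OF sp(2) spH sp(4) bJ])

lemma J_tens: "m \<in> carrier M \<Longrightarrow> J (tens M H m h) = tens M' H (\<Psi> m) h"
  by (rule sw_rep_tens1[OF sp(2) spH sp(4) bJ]) simp_all

lemma \<rho>_map:
  assumes "is_space U" "bilinear_on M' H U \<beta>" "m \<in> carrier M"
  shows "sw (rep M' H (\<rho>' (\<Psi> m))) \<beta> = sw (rep M H (\<rho> m)) (\<lambda>m0 m1. \<beta> (\<Psi> m0) m1)"
  unfolding \<Psi>_\<rho>[OF assms(3)]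
  by (rule sw_rep_map[OF sp(2,3) spH assms(1,2) \<rho>_in[OF assms(3)]]) (auto intro: \<Psi>_in)

theorem hopf_module': "hopf_module B H M' \<alpha>' \<rho>'"
proof -
  have surj': "\<exists>m\<in>carrier M. m' = \<Psi> m" if "m' \<in> carrier M'" for m' using that surj by blast
  have Y: "\<forall>m\<in>carrier M. \<alpha> m 1 = m" "\<forall>m\<in>carrier M. \<forall>x y. \<alpha> m (x * y) = \<alpha> (\<alpha> m x) y"
    "\<forall>m\<in>carrier M. sw (rep M H (\<rho> m)) (\<lambda>m0 m1. tens T H (\<rho> m0) m1) =
       sw (rep M H (\<rho> m)) (\<lambda>m0 m1. sw (rep H H (bcomult H m1)) (\<lambda>x1 x2. tens T H (tens M H m0 x1) x2))"
    "\<forall>m\<in>carrier M. sw (rep M H (\<rho> m)) (\<lambda>m0 m1. scale M (bcounit H m1) m0) = m"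
    "\<forall>m\<in>carrier M. \<forall>h. \<rho> (\<alpha> m h) = sw (rep M H (\<rho> m)) (\<lambda>m0 m1. sw (rep H H (bcomult H h)) (\<lambda>h1 h2.
       sw (rep H H (braid B H H (tens H H m1 h1))) (\<lambda>u v. tens M H (\<alpha> m0 u) (v * h2))))"
    using hm unfolding hopf_module_def tensor_lift_sw by blast+
  let ?G = "\<lambda>s. sw (rep B M s) (\<lambda>b m. tens B M' b (\<Psi> m))"
  have bG: "bilinear_on B M (tensor_space B M') (\<lambda>b m. tens B M' b (\<Psi> m))"
    by (intro lons ins) simp_all
  have lG: "linear_on (tensor_space B M) (tensor_space B M') ?G"
    by (rule linear_on_sw_rep[OF sp(1,2,4) bG])
  have G: "?G (tens B M b m) = tens B M' b (\<Psi> m)" if "m \<in> carrier M" for b m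
    by (rule sw_rep_tens1[OF sp(1,2,4) bG]) (use that in simp_all)
  have \<alpha>'_hom: "yd_hom B (yd_tensor B M' H) M' (tensor_lift M' H \<alpha>')"
  proof (rule yd_hom_tensorI[OF dat' datH dat' \<alpha>'])
    fix b m' h assume "m' \<in> carrier M'"
    then obtain m where m: "m \<in> carrier M" and m': "m' = \<Psi> m" using surj' by blast
    note D = yd_hom_tensorD[OF dat datH dat \<alpha> \<alpha>_hom m, of h]
    have "act M' b (\<alpha>' m' h) = \<Psi> (sw (rep B B (comult B b)) (\<lambda>b1 b2. \<alpha> (act M b1 m) (act H b2 h)))"
      using D(1) by (simp add: m' \<Psi>_\<alpha> m \<Psi>_act \<alpha>_in)
    also have "\<dots> = sw (rep B B (comult B b)) (\<lambda>b1 b2. \<Psi> (\<alpha> (act M b1 m) (act H b2 h)))"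
      by (rule linear_on_sw[OF \<Psi>_linear sp(2)]) (simp add: \<alpha>_in m ins)
    finally show "act M' b (\<alpha>' m' h) = sw (rep B B (comult B b)) (\<lambda>b1 b2. \<alpha>' (act M' b1 m') (act H b2 h))"
      by (simp add: m' \<Psi>_\<alpha> \<Psi>_act m ins)
    note cm = coact_in[OF dat m] and ch = coact_in[OF datH, of h]
    have ch: "coact H h \<in> carrier (tensor_space B H)" by (rule coact_in[OF datH]) simp
    have b: "bilinear_on B M' (tensor_space B M') (\<lambda>b m0. sw (rep B H (coact H h)) (\<lambda>c n0. tens B M' (b * c) (\<alpha>' m0 n0)))"
      by (intro lonsH linear_on_sw_rep_body[OF sp(1) sp(4) ch] ins) (simp_all add: \<alpha>'_in)
    have "coact M' (\<alpha>' m' h) = ?G (coact M (\<alpha> m h))"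
      by (simp add: m' \<Psi>_\<alpha> m \<Psi>_coact \<alpha>_in)
    also have "coact M (\<alpha> m h) = sw (rep B M (coact M m)) (\<lambda>b m0. sw (rep B H (coact H h)) (\<lambda>c n0. tens B M (b * c) (\<alpha> m0 n0)))"
      using D(2) by simp
    also have "?G \<dots> = sw (rep B M (coact M m)) (\<lambda>b m0. ?G (sw (rep B H (coact H h)) (\<lambda>c n0. tens B M (b * c) (\<alpha> m0 n0))))"
      by (rule linear_on_sw_rep_out[OF lG sp(1,4) cm]) (intro sw_rep_in[OF sp(1,4) ch] ins \<alpha>_in; simp)
    also have "\<dots> = sw (rep B M (coact M m)) (\<lambda>b m0. sw (rep B H (coact H h)) (\<lambda>c n0. ?G (tens B M (b * c) (\<alpha> m0 n0))))"
      by (rule sw_rep_cong[OF sp(1) cm], rule linear_on_sw_rep_out[OF lG sp(1,4) ch]) (intro ins \<alpha>_in; simp)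
    also have "\<dots> = sw (rep B M (coact M m)) (\<lambda>b m0. sw (rep B H (coact H h)) (\<lambda>c n0. tens B M' (b * c) (\<alpha>' (\<Psi> m0) n0)))"
      by (intro sw_rep_cong[OF sp(1)] cm ch) (simp add: G \<alpha>_in \<Psi>_\<alpha>)
    finally show "coact M' (\<alpha>' m' h) = sw (rep B M' (coact M' m')) (\<lambda>b m0. sw (rep B H (coact H h)) (\<lambda>c n0. tens B M' (b * c) (\<alpha>' m0 n0)))"
      unfolding m' coact_map[OF sp(4) b m] .
  qed
  have \<rho>'_hom: "yd_hom B M' (yd_tensor B M' H) \<rho>'"
    unfolding yd_hom_def linear_on_yd_tensor tens_yd_tensor tensor_lift_sw
  proof (intro conjI allI ballI \<rho>')
    fix b m' assume "m' \<in> carrier M'"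
    then obtain m where m: "m \<in> carrier M" and m': "m' = \<Psi> m" using surj' by blast
    note rm = \<rho>_in[OF m] and cm = coact_in[OF dat m]
    note la = yd_tensor_act_linear[OF dat datH] yd_tensor_act_linear[OF dat' datH]
    note lc = yd_tensor_coact_linear[OF dat datH] yd_tensor_coact_linear[OF dat' datH]
    have J_act: "J (act (yd_tensor B M H) b (tens M H m0 m1)) = act (yd_tensor B M' H) b (tens M' H (\<Psi> m0) m1)"
      if m0: "m0 \<in> carrier M" for m0 m1
    proof -
      have "J (act (yd_tensor B M H) b (tens M H m0 m1)) = J (sw (rep B B (comult B b)) (\<lambda>b1 b2. tens M H (act M b1 m0) (act H b2 m1)))"
        by (simp add: yd_tensor_act_tens[OF dat datH] m0)
      also have "\<dots> = sw (rep B B (comult B b)) (\<lambda>b1 b2. J (tens M H (act M b1 m0) (act H b2 m1)))"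
        by (rule linear_on_sw[OF lJ sp(4)]) (simp add: ins m0)
      finally show ?thesis
        by (simp add: yd_tensor_act_tens[OF dat' datH] m0 ins J_tens \<Psi>_act)
    qed
    have "\<rho>' (act M' b m') = J (\<rho> (act M b m))"
      by (simp add: m' \<Psi>_act m \<Psi>_\<rho> ins)
    also have "\<rho> (act M b m) = act (yd_tensor B M H) b (\<rho> m)"
      using \<rho>_hom m by (simp add: yd_hom_def)
    also have "J \<dots> = sw (rep M H (\<rho> m)) (\<lambda>m0 m1. J (act (yd_tensor B M H) b (tens M H m0 m1)))"
      by (rule linear_on_rep[OF sp(2) linear_on_comp[OF lJ la(1)] rm])
    also have "\<dots> = sw (rep M H (\<rho> m)) (\<lambda>m0 m1. act (yd_tensor B M' H) b (tens M' H (\<Psi> m0) m1))"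
      by (rule sw_rep_cong[OF sp(2) rm]) (rule J_act)
    also have "\<dots> = act (yd_tensor B M' H) b (\<rho>' m')"
      unfolding m' \<Psi>_\<rho>[OF m]
      by (rule linear_on_sw_rep_out[OF la(2) sp(2,4) rm, symmetric]) (intro ins; simp)
    finally show "\<rho>' (act M' b m') = act (yd_tensor B M' H) b (\<rho>' m')" .
    \<comment> \<open>\<open>?L\<close> is id \<otimes> \<open>J\<close>, with \<open>J\<close> =
      \<Psi> \<otimes> id; colinearity of the coaction of \<open>M\<close> is carried over along
      it.\<close>
    let ?L = "\<lambda>s. sw (rep B T s) (\<lambda>b t. tens B T' b (J t))"
    have bL: "bilinear_on B T (tensor_space B T') (\<lambda>b t. tens B T' b (J t))"
      by (intro lons linear_on_comp[OF lJ] linear_onD(1)[OF lJ]) simp_all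
    have lL: "linear_on (tensor_space B T) (tensor_space B T') ?L"
      by (rule linear_on_sw_rep[OF sp(1,4,4) bL])
    have L: "?L (tens B T b t) = tens B T' b (J t)" if "t \<in> carrier T" for b t
      by (rule sw_rep_tens1[OF sp(1,4,4) bL]) (use that in simp_all)
    have L_coact: "?L (coact (yd_tensor B M H) (tens M H m0 m1)) = coact (yd_tensor B M' H) (tens M' H (\<Psi> m0) m1)"
      if m0: "m0 \<in> carrier M" for m0 m1
    proof -
      note c0 = coact_in[OF dat m0]
      have ch: "coact H m1 \<in> carrier (tensor_space B H)" by (rule coact_in[OF datH]) simp
      have b: "bilinear_on B M' (tensor_space B T') (\<lambda>b m0. sw (rep B H (coact H m1)) (\<lambda>c n0. tens B T' (b * c) (tens M' H m0 n0)))"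
        by (intro lonsH linear_on_sw_rep_body[OF sp(1) sp(4) ch] ins) (simp_all add: ins)
      have "?L (coact (yd_tensor B M H) (tens M H m0 m1)) = ?L (sw (rep B M (coact M m0)) (\<lambda>b m0. sw (rep B H (coact H m1)) (\<lambda>c n0.
          tens B T (b * c) (tens M H m0 n0))))"
        by (simp add: yd_tensor_coact_tens[OF dat datH] m0)
      also have "\<dots> = sw (rep B M (coact M m0)) (\<lambda>b m0. ?L (sw (rep B H (coact H m1)) (\<lambda>c n0. tens B T (b * c) (tens M H m0 n0))))"
        by (rule linear_on_sw_rep_out[OF lL sp(1,4) c0]) (intro sw_rep_in[OF sp(1,4) ch] ins; simp)
      also have "\<dots> = sw (rep B M (coact M m0)) (\<lambda>b m0. sw (rep B H (coact H m1)) (\<lambda>c n0. ?L (tens B T (b * c) (tens M H m0 n0))))"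
        by (rule sw_rep_cong[OF sp(1) c0], rule linear_on_sw_rep_out[OF lL sp(1,4) ch]) (intro ins; simp)
      also have "\<dots> = sw (rep B M (coact M m0)) (\<lambda>b m0. sw (rep B H (coact H m1)) (\<lambda>c n0. tens B T' (b * c) (tens M' H (\<Psi> m0) n0)))"
        by (intro sw_rep_cong[OF sp(1)] c0 ch) (simp add: L ins J_tens)
      also have "\<dots> = sw (rep B M' (coact M' (\<Psi> m0))) (\<lambda>b m0. sw (rep B H (coact H m1)) (\<lambda>c n0. tens B T' (b * c) (tens M' H m0 n0)))"
        by (rule coact_map[OF sp(4) b m0, symmetric])
      finally show ?thesis
        by (simp add: yd_tensor_coact_tens[OF dat' datH] m0 ins)
    qed
    have b: "bilinear_on B M' (tensor_space B T') (\<lambda>b m0. tens B T' b (\<rho>' m0))"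
      by (intro lonsH linear_onD(1)[OF \<rho>']) simp_all
    have "coact (yd_tensor B M' H) (\<rho>' m') = sw (rep M H (\<rho> m)) (\<lambda>m0 m1. coact (yd_tensor B M' H) (tens M' H (\<Psi> m0) m1))"
      unfolding m' \<Psi>_\<rho>[OF m]
      by (rule linear_on_sw_rep_out[OF lc(2) sp(2,4) rm]) (intro ins; simp)
    also have "\<dots> = sw (rep M H (\<rho> m)) (\<lambda>m0 m1. ?L (coact (yd_tensor B M H) (tens M H m0 m1)))"
      by (rule sw_rep_cong[OF sp(2) rm]) (rule L_coact[symmetric])
    also have "\<dots> = ?L (coact (yd_tensor B M H) (\<rho> m))"
      by (rule linear_on_rep[OF sp(2) linear_on_comp[OF lL lc(1)] rm, symmetric])
    also have "coact (yd_tensor B M H) (\<rho> m) = sw (rep B M (coact M m)) (\<lambda>b m0. tens B T b (\<rho> m0))"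
      using \<rho>_hom m by (simp add: yd_hom_def tensor_lift_sw)
    also have "?L \<dots> = sw (rep B M (coact M m)) (\<lambda>b m0. ?L (tens B T b (\<rho> m0)))"
      by (rule linear_on_sw_rep_out[OF lL sp(1,4) cm]) (intro ins \<rho>_in; simp)
    also have "\<dots> = sw (rep B M (coact M m)) (\<lambda>b m0. tens B T' b (\<rho>' (\<Psi> m0)))"
      by (rule sw_rep_cong[OF sp(1) cm]) (simp add: L \<rho>_in \<Psi>_\<rho>)
    finally show "coact (yd_tensor B M' H) (\<rho>' m') = sw (rep B M' (coact M' m')) (\<lambda>b m0. tens B T' b (\<rho>' m0))"
      unfolding m' coact_map[OF sp(4) b m] .
  qed
  \<comment> \<open>\<open>?J2\<close> is \<Psi> \<otimes> id \<otimes> id, the map that carries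
    coassociativity over.\<close>
  let ?J2 = "\<lambda>s. sw (rep T H s) (\<lambda>t h. tens T' H (J t) h)"
  have bJ2: "bilinear_on T H (tensor_space T' H) (\<lambda>t h. tens T' H (J t) h)"
    by (intro lons linear_on_comp[OF lJ] linear_onD(1)[OF lJ]) simp_all
  have lJ2: "linear_on (tensor_space T H) (tensor_space T' H) ?J2"
    by (rule linear_on_sw_rep[OF sp(4) spH sp(4) bJ2])
  have J2: "?J2 (tens T H t h) = tens T' H (J t) h" if "t \<in> carrier T" for t h
    by (rule sw_rep_tens1[OF sp(4) spH sp(4) bJ2]) (use that in simp_all)
  have \<Delta>_in: "bcomult H x \<in> carrier (tensor_space H H)" for x by (rule linear_onD(1)[OF lin_\<Delta>]) simp
  have br_in: "braid B H H (tens H H x y) \<in> carrier (tensor_space H H)" for x y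
    by (rule linear_onD(1)[OF braid_linear[OF datH datH]]) (intro tens_in; simp)
  show ?thesis
    unfolding hopf_module_def tensor_lift_sw
  proof (intro conjI allI ballI)
    show "yd_module B M'" by (rule yd_module')
    show "bilinear_on M' H M' \<alpha>'" by (fact \<alpha>')
    show "yd_hom B (yd_tensor B M' H) M' (\<lambda>t. sw (rep M' H t) \<alpha>')"
      using \<alpha>'_hom unfolding tensor_lift_sw .
    show "yd_hom B M' (yd_tensor B M' H) \<rho>'" by (fact \<rho>'_hom)
    fix m' h x y assume "m' \<in> carrier M'"
    then obtain m where m: "m \<in> carrier M" and m': "m' = \<Psi> m" using surj' by blast
    note rm = \<rho>_in[OF m]
    show "\<alpha>' m' 1 = m'" "\<alpha>' m' (x * y) = \<alpha>' (\<alpha>' m' x) y"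
      using Y(1,2) m by (simp_all add: m' \<Psi>_\<alpha> \<alpha>_in)
    have b1: "bilinear_on M' H (tensor_space T' H) (\<lambda>m0 m1. tens T' H (\<rho>' m0) m1)"
      by (intro lonsH linear_onD(1)[OF \<rho>']) simp_all
    have b2: "bilinear_on M' H (tensor_space T' H) (\<lambda>m0 m1. sw (rep H H (bcomult H m1)) (\<lambda>x1 x2. tens T' H (tens M' H m0 x1) x2))"
      by (intro lonsH linear_on_sw_rep_body[OF spH sp(4)] linear_on_sw_rep_comp spH sp \<Delta>_in ins) simp_all
    have "sw (rep M H (\<rho> m)) (\<lambda>m0 m1. tens T' H (\<rho>' (\<Psi> m0)) m1) = sw (rep M H (\<rho> m)) (\<lambda>m0 m1. ?J2 (tens T H (\<rho> m0) m1))"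
      by (rule sw_rep_cong[OF sp(2) rm]) (simp add: J2 \<rho>_in \<Psi>_\<rho>)
    also have "\<dots> = ?J2 (sw (rep M H (\<rho> m)) (\<lambda>m0 m1. tens T H (\<rho> m0) m1))"
      by (rule linear_on_sw_rep_out[OF lJ2 sp(2,4) rm, symmetric]) (intro ins \<rho>_in; simp)
    also have "sw (rep M H (\<rho> m)) (\<lambda>m0 m1. tens T H (\<rho> m0) m1) =
        sw (rep M H (\<rho> m)) (\<lambda>m0 m1. sw (rep H H (bcomult H m1)) (\<lambda>x1 x2. tens T H (tens M H m0 x1) x2))"
      using Y(3) m by blast
    also have "?J2 \<dots> = sw (rep M H (\<rho> m)) (\<lambda>m0 m1. ?J2 (sw (rep H H (bcomult H m1)) (\<lambda>x1 x2. tens T H (tens M H m0 x1) x2)))"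
      by (rule linear_on_sw_rep_out[OF lJ2 sp(2,4) rm]) (intro sw_rep_in[OF spH sp(4) \<Delta>_in] ins; simp)
    also have "\<dots> = sw (rep M H (\<rho> m)) (\<lambda>m0 m1. sw (rep H H (bcomult H m1)) (\<lambda>x1 x2. ?J2 (tens T H (tens M H m0 x1) x2)))"
      by (rule sw_rep_cong[OF sp(2) rm], rule linear_on_sw_rep_out[OF lJ2 spH sp(4) \<Delta>_in]) (intro ins; simp)
    also have "\<dots> = sw (rep M H (\<rho> m)) (\<lambda>m0 m1. sw (rep H H (bcomult H m1)) (\<lambda>x1 x2. tens T' H (tens M' H (\<Psi> m0) x1) x2))"
      by (rule sw_rep_cong[OF sp(2) rm]) (simp add: J2 ins J_tens)
    finally show "sw (rep M' H (\<rho>' m')) (\<lambda>m0 m1. tens T' H (\<rho>' m0) m1) =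
        sw (rep M' H (\<rho>' m')) (\<lambda>m0 m1. sw (rep H H (bcomult H m1)) (\<lambda>x1 x2. tens T' H (tens M' H m0 x1) x2))"
      unfolding m' \<rho>_map[OF sp(4) b1 m] \<rho>_map[OF sp(4) b2 m] .
    have b3: "bilinear_on M' H M' (\<lambda>m0 m1. scale M' (bcounit H m1) m0)"
    proof -
      have "scale M' c (scale M' d x) = scale M' d (scale M' c x)" for c d x
        by (simp add: is_spaceD(8)[OF sp(3), symmetric] mult.commute)
      moreover have "bcounit H (x + y) = bcounit H x + bcounit H y" "bcounit H (scale H c x) = c * bcounit H x" for c x y
        using H by (auto simp: braided_hopf_algebra_def yd_hom_def linear_on_def yd_unit_def)
      ultimately show ?thesis
        by (intro bilinear_onI linear_onI) (auto simp: is_spaceD(4,6,8,9)[OF sp(3)])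
    qed
    have "sw (rep M H (\<rho> m)) (\<lambda>m0 m1. scale M' (bcounit H m1) (\<Psi> m0)) = sw (rep M H (\<rho> m)) (\<lambda>m0 m1. \<Psi> (scale M (bcounit H m1) m0))"
      by (rule sw_rep_cong[OF sp(2) rm]) (simp add: linear_onD(3)[OF \<Psi>_linear])
    also have "\<dots> = \<Psi> (sw (rep M H (\<rho> m)) (\<lambda>m0 m1. scale M (bcounit H m1) m0))"
      by (rule linear_on_sw_rep_out[OF \<Psi>_linear sp(2,2) rm, symmetric]) (rule is_spaceD(4)[OF sp(2)])
    finally show "sw (rep M' H (\<rho>' m')) (\<lambda>m0 m1. scale M' (bcounit H m1) m0) = m'"
      using Y(4) m unfolding m' \<rho>_map[OF sp(3) b3 m] by simp
    have b4: "bilinear_on M' H T' (\<lambda>m0 m1. sw (rep H H (bcomult H h)) (\<lambda>h1 h2.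
        sw (rep H H (braid B H H (tens H H m1 h1))) (\<lambda>u v. tens M' H (\<alpha>' m0 u) (v * h2))))"
      by (intro lonsH linear_on_sw_rep_body[OF spH sp(4)] linear_on_sw_rep_comp spH sp \<Delta>_in br_in ins) (simp_all add: \<alpha>'_in)
    let ?in = "\<lambda>m0 m1 h1 h2. sw (rep H H (braid B H H (tens H H m1 h1))) (\<lambda>u v. tens M H (\<alpha> m0 u) (v * h2))"
    have in_T: "m0 \<in> carrier M \<Longrightarrow> ?in m0 m1 h1 h2 \<in> carrier T" for m0 m1 h1 h2
      by (intro sw_rep_in[OF spH sp(4) br_in] tens_in \<alpha>_in) simp_all
    have "\<rho>' (\<alpha>' m' h) = J (\<rho> (\<alpha> m h))"
      by (simp add: m' \<Psi>_\<alpha> m \<Psi>_\<rho> \<alpha>_in)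
    also have "\<rho> (\<alpha> m h) = sw (rep M H (\<rho> m)) (\<lambda>m0 m1. sw (rep H H (bcomult H h)) (\<lambda>h1 h2. ?in m0 m1 h1 h2))"
      using Y(5) m by blast
    also have "J \<dots> = sw (rep M H (\<rho> m)) (\<lambda>m0 m1. J (sw (rep H H (bcomult H h)) (\<lambda>h1 h2. ?in m0 m1 h1 h2)))"
      by (rule linear_on_sw_rep_out[OF lJ sp(2,4) rm]) (intro sw_rep_in[OF spH sp(4) \<Delta>_in] in_T; simp)
    also have "\<dots> = sw (rep M H (\<rho> m)) (\<lambda>m0 m1. sw (rep H H (bcomult H h)) (\<lambda>h1 h2. J (?in m0 m1 h1 h2)))"
      by (rule sw_rep_cong[OF sp(2) rm], rule linear_on_sw_rep_out[OF lJ spH sp(4) \<Delta>_in]) (intro in_T; simp)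
    also have "\<dots> = sw (rep M H (\<rho> m)) (\<lambda>m0 m1. sw (rep H H (bcomult H h)) (\<lambda>h1 h2.
        sw (rep H H (braid B H H (tens H H m1 h1))) (\<lambda>u v. tens M' H (\<alpha>' (\<Psi> m0) u) (v * h2))))"
    proof (rule sw_rep_cong[OF sp(2) rm], rule sw_cong)
      fix m0 m1 h1 h2 assume m0: "m0 \<in> carrier M"
      have "J (?in m0 m1 h1 h2) = sw (rep H H (braid B H H (tens H H m1 h1))) (\<lambda>u v. J (tens M H (\<alpha> m0 u) (v * h2)))"
        by (rule linear_on_sw_rep_out[OF lJ spH sp(4) br_in]) (use m0 in \<open>intro tens_in \<alpha>_in; simp\<close>)
      then show "J (?in m0 m1 h1 h2) = sw (rep H H (braid B H H (tens H H m1 h1))) (\<lambda>u v. tens M' H (\<alpha>' (\<Psi> m0) u) (v * h2))"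
        by (simp add: J_tens \<alpha>_in m0 \<Psi>_\<alpha>)
    qed
    finally show "\<rho>' (\<alpha>' m' h) = sw (rep M' H (\<rho>' m')) (\<lambda>m0 m1. sw (rep H H (bcomult H h)) (\<lambda>h1 h2.
        sw (rep H H (braid B H H (tens H H m1 h1))) (\<lambda>u v. tens M' H (\<alpha>' m0 u) (v * h2))))"
      unfolding m' \<rho>_map[OF sp(4) b4 m] .
  qed
qed

end



subsection \<open>The fundamental theorem for the rational part\<close>

context
  fixes B :: "('k::field, 'b::ring_1, 'x) hopf_scheme"
    and M :: "('k, 'b, 'a::ab_group_add, 'y) ydm_scheme"
    and N :: "('k, 'b, 'c::ab_group_add, 'z) ydm_scheme"
  assumes M: "yd_data B M" and N: "yd_data B N"
begin

lemma yd_tensor_data: "yd_data B (yd_tensor B M N)"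
proof -
  note sp = yd_dataD(1,5)[OF M] yd_dataD(5)[OF N] is_space_tensor_space
  have "bilinear_on B (yd_tensor B M N) (yd_tensor B M N) (act (yd_tensor B M N))"
  proof (intro bilinear_onI)
    fix b show "linear_on (yd_tensor B M N) (yd_tensor B M N) (act (yd_tensor B M N) b)"
      using yd_tensor_act_linear[OF M N] by simp
  next
    fix t assume "t \<in> carrier (yd_tensor B M N)"
    then have t: "t \<in> carrier (tensor_space M N)" by simp
    have "linear_on B (tensor_space M N) (\<lambda>b. sw (rep M N t) (\<lambda>m n.
        sw (rep B B (comult B b)) (\<lambda>b1 b2. tens M N (act M b1 m) (act N b2 n))))"
      by (intro linear_on_sw_rep_body[OF sp(2,4) t] linear_on_sw_rep_comp sp lon yd_dataD(4)[OF M]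
          bilinear_on_comp1[OF yd_dataD(6)[OF M]] bilinear_on_comp1[OF yd_dataD(6)[OF N]]
          act_in[OF M] act_in[OF N])
    then show "linear_on B (yd_tensor B M N) (\<lambda>b. act (yd_tensor B M N) b t)"
    proof (subst linear_on_yd_tensor, rule linear_on_fun_cong[OF _ sp(1)])
      fix b
      show "act (yd_tensor B M N) b t = sw (rep M N t) (\<lambda>m n. sw (rep B B (comult B b)) (\<lambda>b1 b2. tens M N (act M b1 m) (act N b2 n)))"
        unfolding linear_on_rep[OF sp(2) yd_tensor_act_linear[OF M N] t]
        by (rule sw_rep_cong[OF sp(2) t]) (rule yd_tensor_act_tens[OF M N])
    qed
  qed
  moreover have "is_space (yd_tensor B M N)"
    using is_space_tensor_space[of M N] by (simp add: is_space_def)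
  ultimately show ?thesis
    using yd_tensor_coact_linear[OF M N] M by (simp add: yd_data_def)
qed

text \<open>Compatibility with \<open>B\<close> is checked only in the direction where it is easy.
  For the map that uses the projection onto the integrals, linearity is then enough.\<close>

lemma inverse_yd_hom:
  assumes \<Phi>: "yd_hom B N M \<Phi>" and \<Psi>: "linear_on M N \<Psi>"
    and inv: "\<And>m. m \<in> carrier M \<Longrightarrow> \<Phi> (\<Psi> m) = m" "\<And>n. n \<in> carrier N \<Longrightarrow> \<Psi> (\<Phi> n) = n"
  shows "yd_hom B M N \<Psi>"
proof -
  note sp = yd_dataD(1,5)[OF M] yd_dataD(5)[OF N] is_space_tensor_space
  have l\<Phi>: "linear_on N M \<Phi>" and \<Phi>_act: "\<And>b n. n \<in> carrier N \<Longrightarrow> \<Phi> (act N b n) = act M b (\<Phi> n)"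
    and \<Phi>_coact: "\<And>n. n \<in> carrier N \<Longrightarrow> coact M (\<Phi> n) = sw (rep B N (coact N n)) (\<lambda>b n0. tens B M b (\<Phi> n0))"
    using \<Phi> by (simp_all add: yd_hom_def tensor_lift_sw)
  show ?thesis
    unfolding yd_hom_def tensor_lift_sw
  proof (intro conjI allI ballI \<Psi>)
    fix b m assume m: "m \<in> carrier M"
    note n = linear_onD(1)[OF \<Psi> m]
    show "\<Psi> (act M b m) = act N b (\<Psi> m)"
      using \<Phi>_act[OF n, of b] inv(1)[OF m] inv(2)[OF act_in[OF N n]] by metis
    have bil: "bilinear_on B M (tensor_space B N) (\<lambda>b m0. tens B N b (\<Psi> m0))"
      by (intro lon linear_on_comp[OF \<Psi>] linear_onD(1)[OF \<Psi>]) simp_all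
    note cn = coact_in[OF N n]
    have "sw (rep B M (coact M m)) (\<lambda>b m0. tens B N b (\<Psi> m0)) =
        sw (rep B M (sw (rep B N (coact N (\<Psi> m))) (\<lambda>b n0. tens B M b (\<Phi> n0)))) (\<lambda>b m0. tens B N b (\<Psi> m0))"
      using \<Phi>_coact[OF n] inv(1)[OF m] by simp
    also have "\<dots> = sw (rep B N (coact N (\<Psi> m))) (\<lambda>b n0. tens B N b (\<Psi> (\<Phi> n0)))"
      by (rule sw_rep_map[OF sp(1,1,2,4) bil cn]) (auto intro: linear_onD(1)[OF l\<Phi>])
    also have "\<dots> = sw (rep B N (coact N (\<Psi> m))) (tens B N)"
      by (rule sw_rep_cong[OF sp(1) cn]) (simp add: inv(2))
    also have "\<dots> = coact N (\<Psi> m)" by (rule sw_rep_tens[OF sp(1) cn])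
    finally show "coact N (\<Psi> m) = sw (rep B M (coact M m)) (\<lambda>b m0. tens B N b (\<Psi> m0))" ..
  qed
qed

end

section \<open>The projection onto the integrals and the inverse bijection\<close>

context rational_setup
begin

text \<open>Coassociativity in the form used for computation. The premises are restricted to
  \<open>R\<close> because the forms that occur are built from \<open>hit p\<close>, which is linear
  in the remaining variables only when \<open>p\<close> is a functional.\<close>

lemma PR_coassoc:
  assumes f: "f \<in> R"
    and \<gamma>: "\<And>q h. linear_on (Sub R) ground (\<lambda>p. \<gamma> p q h)" "\<And>p h. p \<in> R \<Longrightarrow> lform sH (\<lambda>q. \<gamma> p q h)"
      "\<And>p q. p \<in> R \<Longrightarrow> lform sH (\<lambda>h. \<gamma> p q h)"
  shows "sw (PR f) (\<lambda>m0 m1. sw (PR m0) (\<lambda>p q. \<gamma> p q m1)) = sw (PR f) (\<lambda>m0 m1. sw (DH m1) (\<lambda>a b. \<gamma> m0 a b))"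
proof -
  have b1: "bilinear_on (Sub R) H ground (\<lambda>p q. \<gamma> p q h)" for h
    by (intro bilinear_onI \<gamma>(1) linear_on_lform \<gamma>(2)) simp
  have b2: "bilinear_on T H ground (\<lambda>w h. sw (rep (Sub R) H w) (\<lambda>p q. \<gamma> p q h))"
  proof (intro bilinear_onI)
    fix h show "linear_on T ground (\<lambda>w. sw (rep (Sub R) H w) (\<lambda>p q. \<gamma> p q h))"
      by (rule linear_on_sw_rep[OF spR spH(1) is_space_ground b1])
  next
    fix w assume "w \<in> carrier T"
    then show "linear_on H ground (\<lambda>h. sw (rep (Sub R) H w) (\<lambda>p q. \<gamma> p q h))"
      by (rule linear_on_sw_rep_body[OF spR is_space_ground]) (intro linear_on_lform \<gamma>(3), simp)
  qed
  let ?F = "\<lambda>s. sw (rep T H s) (\<lambda>w h. sw (rep (Sub R) H w) (\<lambda>p q. \<gamma> p q h))"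
  have lF: "linear_on (tensor_space T H) ground ?F"
    by (rule linear_on_sw_rep[OF is_space_tensor_space spH(1) is_space_ground b2])
  have F: "?F (tens T H w h) = sw (rep (Sub R) H w) (\<lambda>p q. \<gamma> p q h)" if "w \<in> carrier T" for w h
    by (rule sw_rep_tens1[OF is_space_tensor_space spH(1) is_space_ground b2]) (use that in \<open>simp_all add: spH\<close>)
  have F2: "?F (tens T H (tens HD H m x) h) = \<gamma> m x h" if "m \<in> R" for m x h
    using F[OF tens_T_in[OF that]] sw_rep_tens1[OF spR spH(1) is_space_ground b1, of m x h] that
    by (simp add: spH)
  have in1: "tens T H w h \<in> carrier (tensor_space T H)" if "w \<in> carrier T" for w h
    by (rule tens_in) (use that in \<open>simp_all add: spH\<close>)
  note push = linear_on_sw[OF lF is_space_tensor_space]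
  have PT: "(m0, m1) \<in> set (PR f) \<Longrightarrow> \<rho> m0 \<in> carrier T" for m0 m1 using \<rho>_in PR_in[OF f] by blast
  have "sw (PR f) (\<lambda>m0 m1. sw (PR m0) (\<lambda>p q. \<gamma> p q m1)) = sw (PR f) (\<lambda>m0 m1. ?F (tens T H (\<rho> m0) m1))"
    by (rule sw_cong) (simp add: F PT)
  also have "\<dots> = ?F (sw (PR f) (\<lambda>m0 m1. tens T H (\<rho> m0) m1))"
    by (rule push[symmetric]) (intro in1 PT)
  also have "\<dots> = ?F (sw (PR f) (\<lambda>m0 m1. sw (DH m1) (\<lambda>x1 x2. tens T H (tens HD H m0 x1) x2)))"
    by (simp only: \<rho>_coassoc[OF f])
  also have "\<dots> = sw (PR f) (\<lambda>m0 m1. ?F (sw (DH m1) (\<lambda>x1 x2. tens T H (tens HD H m0 x1) x2)))"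
    by (rule push) (intro sw_in[OF is_space_tensor_space] in1 tens_T_in PR_in[OF f])
  also have "\<dots> = sw (PR f) (\<lambda>m0 m1. sw (DH m1) (\<lambda>x1 x2. ?F (tens T H (tens HD H m0 x1) x2)))"
    by (rule sw_cong, rule push) (intro in1 tens_T_in PR_in[OF f])
  also have "\<dots> = sw (PR f) (\<lambda>m0 m1. sw (DH m1) (\<lambda>a b. \<gamma> m0 a b))"
    by (rule sw_cong) (simp add: F2 PR_in[OF f])
  finally show ?thesis .
qed

text \<open>The projection of the rational part onto the integrals.\<close>

definition E :: "('h \<Rightarrow> 'k) \<Rightarrow> 'h \<Rightarrow> 'k" where
  "E m = sw (PR m) (\<lambda>m0 m1. hit m0 (SH m1))"

lemma lin_SH: "linear_on H H SH"
  using lmaps(8) by (simp add: linear_on_def lmap_def spH)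

lemma E_bilinear: "bilinear_on (Sub R) H (Sub R) (\<lambda>m0 m1. hit m0 (SH m1))"
  by (intro bilinear_onI bilinear_on_comp2[OF hit_bilinear lin_SH] hit_linear)

lemma E_linear_R: "linear_on (Sub R) (Sub R) E"
  unfolding E_def by (rule linear_on_sw_rep_comp[OF spR spH(1) spR E_bilinear \<rho>_linear])

lemma E_in_R: "m \<in> R \<Longrightarrow> E m \<in> R"
  using linear_onD(1)[OF E_linear_R, of m] by simp

lemma linear_on_lform_Sub: "lform fscale \<phi> \<Longrightarrow> linear_on (Sub R) ground \<phi>"
  using linear_on_lform[of "Sub R" \<phi>] by simp

text \<open>Apply \<open>hit_compat\<close> to each term of the projection and use coassociativity.
  The sum over the coproduct of n is then the one in \<open>comult_antipode_left\<close> and leaves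
  S n \<otimes> 1; braiding with 1 turns \<phi> into \<phi>(1).\<close>

lemma E_in_V:
  assumes m: "m \<in> R" shows "E m \<in> V"
  unfolding in_V
proof (intro conjI allI impI)
  show "lform sH (E m)" by (rule R_lform[OF E_in_R[OF m]])
  fix \<phi> x assume \<phi>: "lform sH \<phi>"
  note [lin] = lform_comp[OF \<phi>]
  let ?Z = "\<lambda>p u t. sw (CH t x) (\<lambda>y z. hit p u y * \<phi> z)"
  let ?\<gamma> = "\<lambda>p q n. sw (DH (SH n)) (\<lambda>s1 s2. sw (CH q s1) (\<lambda>u v. ?Z p u (v * s2)))"
  have "W x (\<lambda>u v. E m u * \<phi> v) = W x (\<lambda>u v. sw (PR m) (\<lambda>m0 m1. hit m0 (SH m1) u * \<phi> v))"
    by (simp add: E_def sw_apply sw_mult_right)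
  also have "\<dots> = sw (PR m) (\<lambda>m0 m1. W x (\<lambda>u v. hit m0 (SH m1) u * \<phi> v))"
    by (rule sw_swap3)
  also have "\<dots> = sw (PR m) (\<lambda>m0 m1. sw (PR m0) (\<lambda>p q. ?\<gamma> p q m1))"
  proof (rule sw_cong)
    fix m0 m1 assume "(m0, m1) \<in> set (PR m)"
    then have m0: "m0 \<in> R" by (rule PR_in[OF m])
    show "W x (\<lambda>u v. hit m0 (SH m1) u * \<phi> v) = sw (PR m0) (\<lambda>p q. ?\<gamma> p q m1)"
      by (rule hit_compat[OF R_lform[OF m0] sub_R \<rho>_in[OF m0] _ \<phi>, symmetric]) (rule \<rho>_Lam[OF m0])
  qed
  also have "\<dots> = sw (PR m) (\<lambda>p n. sw (DH n) (\<lambda>q m1. ?\<gamma> p q m1))"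
  proof (rule PR_coassoc[OF m])
    fix q h
    show "linear_on (Sub R) ground (\<lambda>p. ?\<gamma> p q h)"
      by (rule linear_on_lform_Sub) (intro lin)
  next
    fix p q h assume "p \<in> R"
    then have p: "lform sH p" by (rule R_lform)
    note [lin] = lform_comp[OF p] lform_comp[OF hit_in[OF p]] lform_hit[OF p]
    show "lform sH (\<lambda>q. ?\<gamma> p q h)" "lform sH (\<lambda>h. ?\<gamma> p q h)" by (intro lin)+
  qed
  also have "\<dots> = sw (PR m) (\<lambda>p n. hit p (SH n) x * \<phi> 1)"
  proof (rule sw_cong)
    fix p n assume "(p, n) \<in> set (PR m)"
    then have p: "lform sH p" using PR_in[OF m] R_lform by blast
    note [lin] = lform_comp[OF p] lform_comp[OF hit_in[OF p]] lform_hit[OF p]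
    have "sw (DH n) (\<lambda>q m1. ?\<gamma> p q m1) = ?Z p (SH n) 1"
      by (rule Hf.comult_antipode_left) (intro lin)
    also have "\<dots> = hit p (SH n) x * \<phi> 1"
      by (rule Hf.C_one_left) (intro lin)
    finally show "sw (DH n) (\<lambda>q m1. ?\<gamma> p q m1) = hit p (SH n) x * \<phi> 1" .
  qed
  finally show "W x (\<lambda>u v. E m u * \<phi> v) = \<phi> 1 * E m x"
    by (simp add: E_def sw_apply sw_mult_right)
qed

lemma E_linear: "linear_on (Sub R) (Sub V) E"
  using E_linear_R E_in_V by (simp add: linear_on_def)

lemma spV: "is_space (Sub V)"
  by (rule sub_ydD(2)[OF sub_V])

lemma \<rho>_V: "v \<in> V \<Longrightarrow> \<rho> v = tens HD H v 1"
proof (rule T_eqI)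
  fix \<phi> x assume v: "v \<in> V" and \<phi>: "lform sH \<phi>"
  show "Lam \<phi> x (\<rho> v) = Lam \<phi> x (tens HD H v 1)"
  proof -
    have vR: "v \<in> R" using v V_subset_R by blast
    have "W x (\<lambda>u w. v u * \<phi> w) = \<phi> 1 * v x" using v \<phi> by (simp add: in_V)
    then show ?thesis by (simp add: \<rho>_Lam[OF vR \<phi>] Lam_one[OF \<phi> R_lform[OF vR]])
  qed
qed (use V_subset_R in \<open>auto intro: \<rho>_in tens_T_in\<close>)

text \<open>For an integral the coaction is v \<otimes> 1 and braiding with 1 is trivial, so the
  compatibility formula reduces to the coproduct of h: the map h \<mapsto> v \<leftharpoonup> h is
  colinear.\<close>

lemma \<rho>_hit_V:
  assumes v: "v \<in> V"
  shows "\<rho> (hit v h) = sw (DH h) (\<lambda>h1 h2. tens HD H (hit v h1) h2)"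
proof (rule T_eqI)
  have vR: "v \<in> R" using v V_subset_R by blast
  note v' = R_lform[OF vR]
  show "\<rho> (hit v h) \<in> carrier T" by (rule \<rho>_in[OF hit_in_R[OF vR]])
  show "sw (DH h) (\<lambda>h1 h2. tens HD H (hit v h1) h2) \<in> carrier T"
    by (intro sw_in[OF is_space_tensor_space] tens_T_in hit_in_R vR)
  fix \<phi> x assume \<phi>: "lform sH \<phi>"
  note [lin] = lform_comp[OF \<phi>]
  let ?\<zeta> = "\<lambda>m m1. sw (DH h) (\<lambda>h1 h2. sw (CH m1 h1) (\<lambda>p q. sw (CH (q * h2) x) (\<lambda>y z. hit m p y * \<phi> z)))"
  have bil: "bilinear_on (Sub R) H ground ?\<zeta>"
  proof (intro bilinear_onI)
    fix m assume "m \<in> carrier (Sub R)"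
    then have m: "lform sH m" using R_lform by simp
    note [lin] = lform_comp[OF hit_in[OF m]] lform_hit[OF m]
    show "linear_on H ground (?\<zeta> m)" by (rule linear_on_lform) (intro lin)
  next
    fix m1 show "linear_on (Sub R) ground (\<lambda>m. ?\<zeta> m m1)" by (rule linear_on_lform_Sub) (intro lin)
  qed
  note [lin] = lform_comp[OF hit_in[OF v']] lform_hit[OF v']
  have "Lam \<phi> x (\<rho> (hit v h)) = W x (\<lambda>u v'. hit v h u * \<phi> v')"
    by (rule \<rho>_Lam[OF hit_in_R[OF vR] \<phi>])
  also have "\<dots> = sw (PR v) ?\<zeta>"
    by (rule hit_compat[OF v' sub_R \<rho>_in[OF vR] _ \<phi>, symmetric]) (rule \<rho>_Lam[OF vR])
  also have "\<dots> = ?\<zeta> v 1"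
    unfolding \<rho>_V[OF v]
    using sw_rep_tens1[OF spR spH(1) is_space_ground bil, of v 1] vR by (simp add: spH)
  also have "\<dots> = sw (DH h) (\<lambda>h1 h2. sw (CH (1 * h2) x) (\<lambda>y z. hit v h1 y * \<phi> z))"
    by (rule sw_cong, rule Hf.C_one_left) (intro lin)
  also have "\<dots> = sw (DH h) (\<lambda>h1 h2. Lam \<phi> x (tens HD H (hit v h1) h2))"
    by (simp add: Lam_tens \<phi> hit_in v')
  also have "\<dots> = Lam \<phi> x (sw (DH h) (\<lambda>h1 h2. tens HD H (hit v h1) h2))"
    by (rule linear_on_sw[OF Lam_linear_T[OF \<phi>] is_space_tensor_space, symmetric])
      (intro tens_T_in hit_in_R vR)
  finally show "Lam \<phi> x (\<rho> (hit v h)) = Lam \<phi> x (sw (DH h) (\<lambda>h1 h2. tens HD H (hit v h1) h2))" .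
qed

lemma rep_\<rho>_hit_V:
  assumes "is_space U" "bilinear_on (Sub R) H U \<beta>" "v \<in> V"
  shows "sw (PR (hit v h)) \<beta> = sw (DH h) (\<lambda>h1 h2. \<beta> (hit v h1) h2)"
proof -
  have vR: "v \<in> R" using assms(3) V_subset_R by blast
  have "sw (rep (Sub R) H (sw (DH h) (\<lambda>h1 h2. tens (Sub R) H (hit v h1) h2))) \<beta> =
      sw (DH h) (\<lambda>h1 h2. sw (rep (Sub R) H (tens (Sub R) H (hit v h1) h2)) \<beta>)"
    by (rule linear_on_sw[OF linear_on_sw_rep[OF spR spH(1) assms(1,2)] is_space_tensor_space])
      (intro tens_in; simp add: hit_in_R vR spH)
  also have "\<dots> = sw (DH h) (\<lambda>h1 h2. \<beta> (hit v h1) h2)"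
    by (rule sw_cong, rule sw_rep_tens1[OF spR spH(1) assms(1,2)]) (simp_all add: hit_in_R vR spH)
  finally show ?thesis unfolding \<rho>_hit_V[OF assms(3)] by simp
qed

lemma E_hit:
  assumes v: "v \<in> V" shows "E (hit v h) = fscale (eH h) v"
proof
  fix x
  have vR: "v \<in> R" using v V_subset_R by blast
  note v' = R_lform[OF vR]
  have "E (hit v h) x = sw (DH h) (\<lambda>h1 h2. hit (hit v h1) (SH h2)) x"
    unfolding E_def rep_\<rho>_hit_V[OF spR E_bilinear v] ..
  also have "\<dots> = sw (DH h) (\<lambda>h1 h2. hit v (h1 * SH h2) x)"
    by (simp add: sw_apply hit_mult v')
  also have "\<dots> = eH h * hit v 1 x"
    by (rule Hf.antipode_right) (rule hit_lform[OF v'])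
  finally show "E (hit v h) x = fscale (eH h) v x" by (simp add: hit_one v' fscale_def)
qed

text \<open>By coassociativity the two successive actions combine to p \<leftharpoonup> (S q) m1,
  summed over a coproduct. The antipode axiom leaves a counit, and the counit axiom of the coaction
  returns m.\<close>

lemma hit_E: 
  assumes m: "m \<in> R" shows "sw (PR m) (\<lambda>m0 m1. hit (E m0) m1) = m"
proof
  fix x
  let ?\<gamma> = "\<lambda>p q m1. hit p (SH q * m1) x"
  have "sw (PR m) (\<lambda>m0 m1. hit (E m0) m1) x = sw (PR m) (\<lambda>m0 m1. sw (PR m0) (\<lambda>p q. ?\<gamma> p q m1))"
    unfolding sw_apply
  proof (rule sw_cong)
    fix m0 m1 assume "(m0, m1) \<in> set (PR m)"
    then have m0: "m0 \<in> R" by (rule PR_in[OF m])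
    have "hit (E m0) m1 x = sw (PR m0) (\<lambda>p q. hit (hit p (SH q)) m1 x)"
      by (simp add: E_def hit_sw sw_apply)
    also have "\<dots> = sw (PR m0) (\<lambda>p q. ?\<gamma> p q m1)"
      by (rule sw_cong) (use PR_in[OF m0] R_lform in \<open>simp add: hit_mult\<close>)
    finally show "hit (E m0) m1 x = sw (PR m0) (\<lambda>p q. ?\<gamma> p q m1)" .
  qed
  also have "\<dots> = sw (PR m) (\<lambda>p n. sw (DH n) (\<lambda>q m1. ?\<gamma> p q m1))"
  proof (rule PR_coassoc[OF m])
    fix q h show "linear_on (Sub R) ground (\<lambda>p. ?\<gamma> p q h)" by (rule linear_on_lform_Sub) (intro lin)
  next
    fix p q h assume "p \<in> R"
    then have p: "lform sH p" by (rule R_lform)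
    note [lin] = lform_hit[OF p]
    show "lform sH (\<lambda>q. ?\<gamma> p q h)" "lform sH (\<lambda>h. ?\<gamma> p q h)" by (intro lin)+
  qed
  also have "\<dots> = sw (PR m) (\<lambda>p n. eH n * p x)"
  proof (rule sw_cong)
    fix p n assume "(p, n) \<in> set (PR m)"
    then have p: "lform sH p" using PR_in[OF m] R_lform by blast
    have "sw (DH n) (\<lambda>q m1. ?\<gamma> p q m1) = eH n * hit p 1 x"
      by (rule Hf.antipode_left) (rule hit_lform[OF p])
    then show "sw (DH n) (\<lambda>q m1. ?\<gamma> p q m1) = eH n * p x" by (simp add: hit_one p)
  qed
  also have "\<dots> = m x" by (rule PR_counit[OF m])
  finally show "sw (PR m) (\<lambda>m0 m1. hit (E m0) m1) x = m x" .
qed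

abbreviation M' where "M' \<equiv> yd_tensor B (Sub V) H"

definition \<Phi> :: "('h \<Rightarrow> 'k, 'h, 'k) tensor \<Rightarrow> 'h \<Rightarrow> 'k" where
  "\<Phi> t = sw (rep (Sub V) H t) hit"

definition \<Psi> :: "('h \<Rightarrow> 'k) \<Rightarrow> ('h \<Rightarrow> 'k, 'h, 'k) tensor" where
  "\<Psi> m = sw (PR m) (\<lambda>m0 m1. tens HD H (E m0) m1)"

lemma hit_bilinear_V: "bilinear_on (Sub V) H (Sub R) hit"
proof (intro bilinear_onI)
  fix f assume "f \<in> carrier (Sub V)"
  then show "linear_on H (Sub R) (hit f)"
    using V_subset_R by (intro bilinear_onD1[OF hit_bilinear]) auto
next
  fix h show "linear_on (Sub V) (Sub R) (\<lambda>f. hit f h)"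
    using hit_linear[of h] V_subset_R unfolding linear_on_def Sub_simps by (meson subsetD)
qed

lemma \<Phi>_linear: "linear_on (tensor_space (Sub V) H) (Sub R) \<Phi>"
  unfolding \<Phi>_def[abs_def] by (rule linear_on_sw_rep[OF spV spH(1) spR hit_bilinear_V])

lemma \<Phi>_tens: "v \<in> V \<Longrightarrow> \<Phi> (tens HD H v h) = hit v h"
  using sw_rep_tens1[OF spV spH(1) spR hit_bilinear_V, of v h] by (simp add: \<Phi>_def spH)

lemma \<Psi>_bilinear: "bilinear_on (Sub R) H (tensor_space (Sub V) H) (\<lambda>m0 m1. tens HD H (E m0) m1)"
proof -
  have "bilinear_on (Sub R) H (tensor_space (Sub V) H) (\<lambda>m0 m1. tens (Sub V) H (E m0) m1)"
    by (intro lon linear_on_comp[OF _ E_linear] linear_onD(1)[OF E_linear])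
  then show ?thesis by simp
qed

lemma \<Psi>_linear: "linear_on (Sub R) (tensor_space (Sub V) H) \<Psi>"
  unfolding \<Psi>_def[abs_def]
  by (rule linear_on_sw_rep_comp[OF spR spH(1) is_space_tensor_space \<Psi>_bilinear \<rho>_linear])

lemma \<Phi>_\<Psi>: assumes m: "m \<in> R" shows "\<Phi> (\<Psi> m) = m"
proof -
  have "\<Phi> (\<Psi> m) = sw (PR m) (\<lambda>m0 m1. \<Phi> (tens HD H (E m0) m1))"
    unfolding \<Psi>_def
    by (rule linear_on_sw[OF \<Phi>_linear is_space_tensor_space]) (use PR_in[OF m] E_in_V tens_V_in in blast)
  also have "\<dots> = sw (PR m) (\<lambda>m0 m1. hit (E m0) m1)"
    by (rule sw_cong) (use PR_in[OF m] E_in_V \<Phi>_tens in blast)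
  finally show ?thesis by (simp add: hit_E m)
qed

lemma \<Psi>_hit: assumes v: "v \<in> V" shows "\<Psi> (hit v h) = tens HD H v h"
proof (rule T_eqI)
  have vR: "v \<in> R" using v V_subset_R by blast
  show "tens HD H v h \<in> carrier T" by (rule tens_T_in[OF vR])
  show "\<Psi> (hit v h) \<in> carrier T"
    using linear_onD(1)[OF \<Psi>_linear, of "hit v h"] hit_in_R[OF vR] tensor_Sub_H_mono[OF V_subset_R] by auto
  fix \<phi> x assume \<phi>: "lform sH \<phi>"
  note [lin] = lform_comp[OF \<phi>] lform_comp[OF R_lform[OF vR]]
  have "Lam \<phi> x (\<Psi> (hit v h)) = Lam \<phi> x (sw (DH h) (\<lambda>h1 h2. tens HD H (fscale (eH h1) v) h2))"
    unfolding \<Psi>_def rep_\<rho>_hit_V[OF is_space_tensor_space \<Psi>_bilinear v] by (simp add: E_hit v)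
  also have "\<dots> = sw (DH h) (\<lambda>h1 h2. Lam \<phi> x (tens HD H (fscale (eH h1) v) h2))"
    by (rule linear_on_sw[OF Lam_linear_T[OF \<phi>] is_space_tensor_space])
      (use is_spaceD(4)[OF spR] vR in \<open>auto intro!: tens_T_in\<close>)
  also have "\<dots> = sw (DH h) (\<lambda>h1 h2. eH h1 * sw (CH h2 x) (\<lambda>u w. v u * \<phi> w))"
  proof (rule sw_cong)
    fix h1 h2
    have "lform sH (fscale (eH h1) v)" using is_spaceD(4)[OF spR, of v] vR R_lform by simp
    then show "Lam \<phi> x (tens HD H (fscale (eH h1) v) h2) = eH h1 * sw (CH h2 x) (\<lambda>u w. v u * \<phi> w)"
      by (simp add: Lam_tens \<phi> fscale_def mult.assoc sw_mult_left)
  qed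
  also have "\<dots> = sw (CH h x) (\<lambda>u w. v u * \<phi> w)"
    by (rule Hf.counit_left) (intro lin)
  finally show "Lam \<phi> x (\<Psi> (hit v h)) = Lam \<phi> x (tens HD H v h)"
    by (simp add: Lam_tens \<phi> R_lform vR)
qed

lemma \<Psi>_\<Phi>: assumes t: "t \<in> carrier (tensor_space (Sub V) H)" shows "\<Psi> (\<Phi> t) = t"
proof (rule linear_on_tensor_eqI[OF spV linear_on_comp[OF \<Psi>_linear \<Phi>_linear] linear_on_ident t])
  fix v h assume "v \<in> carrier (Sub V)"
  then show "\<Psi> (\<Phi> (tens (Sub V) H v h)) = tens (Sub V) H v h" by (simp add: \<Phi>_tens \<Psi>_hit)
qed

lemma \<Phi>_hom: "yd_hom B M' (Sub R) \<Phi>"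
proof -
  have "yd_hom B M' (Sub R) (tensor_lift (Sub V) H hit)"
  proof (rule yd_hom_tensorI[OF dat_Sub[OF sub_V] dat_H dat_Sub[OF sub_R] hit_bilinear_V])
    fix b m h assume "m \<in> carrier (Sub V)"
    then have m: "m \<in> V" and mR: "m \<in> R" using V_subset_R by auto
    show "act (Sub R) b (hit m h) = sw (DB b) (\<lambda>b1 b2. hit (act (Sub V) b1 m) (A b2 h))"
      by (simp add: hit_act R_lform mR)
    show "coact (Sub R) (hit m h) = sw (rep B (Sub V) (coact (Sub V) m)) (\<lambda>b m0. sw (K h) (\<lambda>c n0. tens B (Sub R) (b * c) (hit m0 n0)))"
      using hit_coact_tensor[OF sub_V m] by simp
  qed
  then show ?thesis by (simp add: tensor_lift_sw[abs_def] \<Phi>_def[abs_def])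
qed

lemma dat_M': "yd_data B M'"
  by (rule yd_tensor_data[OF dat_Sub[OF sub_V] dat_H])

lemma \<Psi>_hom: "yd_hom B (Sub R) M' \<Psi>"
  by (rule inverse_yd_hom[OF dat_Sub[OF sub_R] dat_M' \<Phi>_hom]) (simp_all add: \<Psi>_linear \<Phi>_\<Psi> \<Psi>_\<Phi>)

lemma free_act_bilinear: "bilinear_on M' H M' (free_act (Sub V) H)"
proof -
  note sps = spV spH(1) is_space_tensor_space
  have b: "bilinear_on (Sub V) H (tensor_space (Sub V) H) (\<lambda>v x. tens (Sub V) H v (x * h))" for h
    by (intro lon bilinear_on_comp1[OF bil_H] bilinear_on_in[OF bil_H]) (simp_all add: spH)
  have "bilinear_on (tensor_space (Sub V) H) H (tensor_space (Sub V) H) (free_act (Sub V) H)"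
    unfolding free_act_def[abs_def] tensor_lift_sw
  proof (intro bilinear_onI)
    fix h show "linear_on (tensor_space (Sub V) H) (tensor_space (Sub V) H) (\<lambda>t. sw (rep (Sub V) H t) (\<lambda>v x. tens (Sub V) H v (x * h)))"
      by (rule linear_on_sw_rep[OF sps b])
  next
    fix t assume t: "t \<in> carrier (tensor_space (Sub V) H)"
    show "linear_on H (tensor_space (Sub V) H) (\<lambda>h. sw (rep (Sub V) H t) (\<lambda>v x. tens (Sub V) H v (x * h)))"
      by (intro linear_on_sw_rep_body[OF sps(1,3) t] linear_on_tens_right bilinear_on_comp2[OF bil_H] lon) simp_all
  qed
  then show ?thesis by (simp add: bilinear_on_def)
qed

lemma free_coact_bilinear:
  "bilinear_on (Sub V) H (tensor_space (tensor_space (Sub V) H) H)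
    (\<lambda>v x. sw (DH x) (\<lambda>x1 x2. tens (tensor_space (Sub V) H) H (tens (Sub V) H v x1) x2))"
  by (intro lon linear_on_sw_rep_body[OF spH(1)] linear_on_sw_rep_comp linear_on_comp[OF lin_bcomult]
      is_space_tensor_space spH(1) tens_in tensor_in) (simp_all add: spH)

lemma free_coact_linear:
  "linear_on (tensor_space (Sub V) H) (tensor_space (tensor_space (Sub V) H) H) (free_coact (Sub V) H)"
  unfolding free_coact_def tensor_lift_sw
  by (rule linear_on_sw_rep[OF spV spH(1) is_space_tensor_space free_coact_bilinear])

lemma \<Psi>_in: "m \<in> R \<Longrightarrow> \<Psi> m \<in> carrier (tensor_space (Sub V) H)"
  using linear_onD(1)[OF \<Psi>_linear, of m] by simp

text \<open>The two sides are compared after \<Phi>, where right multiplication on the free factor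
  turns into the action by \<open>hit_mult\<close>.\<close>

lemma \<Psi>_act_free:
  assumes m: "m \<in> R" shows "free_act (Sub V) H (\<Psi> m) h = \<Psi> (dual_rat_act B H m h)"
proof -
  note t = \<Psi>_in[OF m]
  let ?t = "free_act (Sub V) H (\<Psi> m) h"
  have tin: "?t \<in> carrier (tensor_space (Sub V) H)"
    using bilinear_on_in[OF free_act_bilinear, of "\<Psi> m" h] t by (simp add: spH)
  have "\<Phi> ?t = sw (rep (Sub V) H (\<Psi> m)) (\<lambda>v x. \<Phi> (tens HD H v (x * h)))"
    unfolding free_act_def tensor_lift_sw tens_Sub
    by (rule linear_on_sw_rep_out[OF \<Phi>_linear spV is_space_tensor_space t]) (simp add: tens_V_in)
  also have "\<dots> = sw (rep (Sub V) H (\<Psi> m)) (\<lambda>v x. hit (hit v x) h)"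
    by (rule sw_rep_cong[OF spV t]) (use V_subset_R R_lform in \<open>auto simp: \<Phi>_tens hit_mult subset_iff\<close>)
  also have "\<dots> = hit (\<Phi> (\<Psi> m)) h"
    by (simp add: hit_sw \<Phi>_def)
  finally have "\<Phi> ?t = hit m h" by (simp add: \<Phi>_\<Psi> m)
  then show ?thesis using \<Psi>_\<Phi>[OF tin] by (simp add: dual_rat_act_eq m)
qed

text \<open>Writing m as \<Phi>(\<Psi>(m)) reduces the claim to elements v \<leftharpoonup> x with v
  an integral, where \<open>rep_\<rho>_hit_V\<close> gives the coaction explicitly.\<close>

lemma \<Psi>_coact_free:
  assumes m: "m \<in> R"
  shows "free_coact (Sub V) H (\<Psi> m) = sw (PR m) (\<lambda>m0 m1. tens (tensor_space (Sub V) H) H (\<Psi> m0) m1)"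
proof -
  note t = \<Psi>_in[OF m]
  let ?TV = "tensor_space (Sub V) H"
  have bJ: "bilinear_on (Sub R) H (tensor_space ?TV H) (\<lambda>m0 m1. tens ?TV H (\<Psi> m0) m1)"
    by (intro lon linear_on_comp[OF _ \<Psi>_linear] linear_onD(1)[OF \<Psi>_linear])
  let ?J = "\<lambda>s. sw (rep (Sub R) H s) (\<lambda>m0 m1. tens ?TV H (\<Psi> m0) m1)"
  have lJ: "linear_on T (tensor_space ?TV H) ?J"
    by (rule linear_on_sw_rep[OF spR spH(1) is_space_tensor_space bJ])
  have vR: "v \<in> V \<Longrightarrow> v \<in> R" for v using V_subset_R by blast
  have "?J (\<rho> m) = ?J (\<rho> (\<Phi> (\<Psi> m)))" by (simp add: \<Phi>_\<Psi> m)
  also have "\<dots> = sw (rep (Sub V) H (\<Psi> m)) (\<lambda>v x. ?J (\<rho> (hit v x)))"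
    unfolding \<Phi>_def
    by (rule linear_on_sw_rep_out[OF linear_on_comp[OF lJ \<rho>_linear] spV spR t]) (simp add: hit_in_R vR)
  also have "\<dots> = sw (rep (Sub V) H (\<Psi> m)) (\<lambda>v x. sw (DH x) (\<lambda>x1 x2. tens ?TV H (\<Psi> (hit v x1)) x2))"
    by (rule sw_rep_cong[OF spV t], rule rep_\<rho>_hit_V[OF is_space_tensor_space bJ]) simp
  also have "\<dots> = sw (rep (Sub V) H (\<Psi> m)) (\<lambda>v x. sw (DH x) (\<lambda>x1 x2. tens ?TV H (tens HD H v x1) x2))"
    by (rule sw_rep_cong[OF spV t]) (simp add: \<Psi>_hit)
  also have "\<dots> = free_coact (Sub V) H (\<Psi> m)"
    by (simp add: free_coact_def tensor_lift_sw)
  finally show ?thesis ..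
qed

theorem dual_rat_isomorphic_free:
  "hopf_module_isomorphic B H (Sub R) (dual_rat_act B H) \<rho> M' (free_act (Sub V) H) (free_coact (Sub V) H)"
proof -
  have surj: "\<Psi> ` carrier (Sub R) = carrier M'"
  proof
    show "\<Psi> ` carrier (Sub R) \<subseteq> carrier M'" using \<Psi>_in by auto
    show "carrier M' \<subseteq> \<Psi> ` carrier (Sub R)"
      using \<Psi>_\<Phi> linear_onD(1)[OF \<Phi>_linear] by (auto intro!: image_eqI[where x = "\<Phi> _"] simp: \<Psi>_\<Phi>[symmetric])
  qed
  have inj: "inj_on \<Psi> (carrier (Sub R))"
    by (rule inj_on_inverseI[where g = \<Phi>]) (simp add: \<Phi>_\<Psi>)
  have "hopf_transport B (Sub R) M' \<Psi> H (dual_rat_act B H) \<rho> (free_act (Sub V) H) (free_coact (Sub V) H)"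
    by unfold_locales
      (use hopf_B sub_yd_module[OF sub_R] dat_M' \<Psi>_hom surj hopf_H hopf_module_dual_rat free_act_bilinear
        free_coact_linear \<Psi>_act_free \<Psi>_coact_free in simp_all)
  then have "hopf_module B H M' (free_act (Sub V) H) (free_coact (Sub V) H)"
    by (rule hopf_transport.hopf_module')
  then show ?thesis
    unfolding hopf_module_isomorphic_def
    using hopf_module_dual_rat \<Psi>_hom surj inj \<Psi>_act_free \<Psi>_coact_free
    by (intro conjI exI[of _ \<Psi>]) (auto simp: bij_betw_def tensor_lift_sw)
qed

end


text \<open>The first two conjuncts certify that the \<open>GREATEST\<close> in
  \<open>dual_rat_carrier\<close> exists, and rationality contains the existence of a coaction. The
  isomorphism is stated for every such coaction, so it does not depend on a choice.\<close>

theorem mainTheorem7: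
  fixes B :: "('k::field, 'b::ring_1) hopf"
    and H :: "('k, 'b, 'h::ring_1) braided_hopf"
  assumes "hopf_algebra B"
    and "\<exists>E. finite_dimensional_vector_space (scale B) E"
    and "bij (antipode B)" and "antipode B = inv (antipode B)"
    and "braided_hopf_algebra B H"
    and "\<forall>t \<in> carrier (tensor_space H H). braid B H H (braid B H H t) = t"
  shows "rational_submodule B H (dual_rat_carrier B H) \<and>
    (\<forall>N. rational_submodule B H N \<longrightarrow> N \<subseteq> dual_rat_carrier B H) \<and>
    yd_module B (left_integrals B H) \<and>
    (\<forall>\<rho>. rational_coaction B H (dual_rat B H) (dual_mult B H) \<rho> \<longrightarrow>
      hopf_module_isomorphic B H
        (dual_rat B H) (dual_rat_act B H) \<rho>
        (yd_tensor B (left_integrals B H) H)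
        (free_act (left_integrals B H) H) (free_coact (left_integrals B H) H))"
proof -
  interpret hopf_setup B H
    by unfold_locales (fact assms)+
  have "hopf_module_isomorphic B H (dual_rat B H) (dual_rat_act B H) \<rho>
      (yd_tensor B (left_integrals B H) H) (free_act (left_integrals B H) H)
      (free_coact (left_integrals B H) H)"
    if "rational_coaction B H (dual_rat B H) (dual_mult B H) \<rho>" for \<rho>
  proof -
    interpret rational_setup B H \<rho>
      by unfold_locales (use that in \<open>simp add: dual_rat_Sub\<close>)
    show ?thesis
      using dual_rat_isomorphic_free by (simp add: dual_rat_Sub left_integrals_Sub[symmetric])
  qed
  moreover have "yd_module B (left_integrals B H)"
    using sub_yd_module[OF sub_V] by (simp add: left_integrals_Sub[symmetric])
  ultimately show ?thesis
    using rational_dual_rat rational_le_dual_rat by blast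
qed

end
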